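(* Let $K\in\mathbb R$, $N\in[1,\infty)$, and let $(X,d,\mu)$ be a metric measure space satisfying $RCD^*(K,N)$. Let $\Omega\subset X$ be a bounded domain. Let $f\in H^{1}(\Omega)\cap L^\infty_{\rm loc}(\Omega)$ be such that $\mathscr L f$ is a signed Radon measure on $\Omega$ with $\mathscr L^{\rm sing}f\geq 0$. Suppose that $f$ achieves one of its strict maxima in $\Omega$ in the sense that there exists a neighborhood $U\subset\subset\Omega$ such that $$\sup_{U}f>\sup_{\Omega\setminus U}f .$$ Then, given any $w\in H^{1}(\Omega)\cap L^\infty(\Omega)$, there exists a sequence of points $\{x_j\}_{j\in\mathbb N}\subset U$ such that each $x_j$ is an approximate continuity point of $\mathscr L^{\rm ac}f$ and of $\langle\nabla f,\nabla w\rangle$, and $$f(x_j)\geq \sup_\Omega f-\frac1j\qquad\text{and}\qquad \mathscr L^{\rm ac}f(x_j)+\langle\nabla f,\nabla w\rangle(x_j)\leq \frac1j .$$ Here $\sup$ of a function over a set always means the essential supremum.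
   Context: **Metric measure spaces.** $(X,d)$ is a complete metric space which is proper (closed balls of finite radius are compact), and $\mu$ is a Radon measure on $X$ with $\operatorname{supp}\mu=X$. $L^p(\Omega):=L^p(\Omega,\mu)$. **$CD^*(K,N)$.** Let $\mathscr P_2(X,d)$ be the $L^2$-Wasserstein space (Borel probability measures with finite second moment, with the $L^2$-Wasserstein distance) and $\mathscr P_\infty(X,d,\mu)$ its subset of measures absolutely continuous w.r.t. $\mu$ with bounded support. For $K\in\mathbb R$, $N\in[1,\infty)$, $(X,d,\mu)$ satisfies $CD^*(K,N)$ if for each pair $\nu_0=\rho_0\mu,\nu_1=\rho_1\mu\in\mathscr P_\infty(X,d,\mu)$ there exist an optimal coupling $q$ of them and a (Wasserstein) geodesic $(\nu_t=\rho_t\mu)_{t\in[0,1]}$ in $\mathscr P_\infty(X,d,\mu)$ connecting them such that for all $t\in[0,1]$ and all $N'\ge N$ $$\int_X\rho_t^{-1/N'}d\nu_t\ge\int_{X\times X}\Big[\sigma^{(1-t)}_{K/N'}(d(x_0,x_1))\rho_0^{-1/N'}(x_0)+\sigma^{(t)}_{K/N'}(d(x_0,x_1))\rho_1^{-1/N'}(x_1)\Big]dq(x_0,x_1),$$ where $\sigma^{(t)}_k(\theta)=\frac{\sin(\sqrt k t\theta)}{\sin(\sqrt k\theta)}$ if $0<k\theta^2<\pi^2$, $=t$ if $k\theta^2=0$, $=\frac{\sinh(\sqrt{-k}t\theta)}{\sinh(\sqrt{-k}\theta)}$ if $k\theta^2<0$, $=\infty$ if $k\theta^2\ge\pi^2$.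 **$RCD^*(K,N)$.** For $f\in C(X)$, ${\rm Lip}f(x):=\limsup_{y\to x}\frac{|f(y)-f(x)|}{d(x,y)}$ (and $0$ at isolated points). The Cheeger energy of $f\in L^2(X)$ is ${\rm Ch}(f):=\inf\{\liminf_j\frac12\int_X({\rm Lip}f_j)^2d\mu\}$, the infimum being over sequences of Lipschitz $f_j\to f$ in $L^2(X)$. $(X,d,\mu)$ satisfies $RCD^*(K,N)$ if it satisfies $CD^*(K,N)$ and ${\rm Ch}$ is a quadratic form. If ${\rm Ch}(f)<\infty$, then ${\rm Ch}(f)=\frac12\int_X|\nabla f|^2d\mu$, with $|\nabla f|$ the minimal relaxed gradient (the element of least $L^2$-norm among all weak $L^2$-limits of ${\rm Lip}f_j$ with $f_j$ Lipschitz, $f_j\to f$ in $L^2$). The bilinear inner product is $\langle\nabla f,\nabla g\rangle:=\lim_{\epsilon\to0}\frac{|\nabla(f+\epsilon g)|^2-|\nabla f|^2}{2\epsilon}$ (limit in $L^1$); these notions are local and hence make sense for Sobolev functions on open sets. **Sobolev spaces.** For $\Omega\subset X$ open, $W^{1,p}(\Omega)$ is the closure of $\{f\in Lip_{\rm loc}(\Omega):\|f\|_{W^{1,p}}<\infty\}$ under $\|f\|_{W^{1,p}(\Omega)}:=\|f\|_{L^p(\Omega)}+\|{\rm Lip}f\|_{L^p(\Omega)}$, and $W^{1,p}_0(\Omega)$ is the closure of $Lip_0(\Omega)$ (Lipschitz functions with compact support in $\Omega$). $H^1(\Omega):=W^{1,2}(\Omega)$, $H^1_0(\Omega):=W^{1,2}_0(\Omega)$.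 **Weak Laplacian.** For $f\in H^1(\Omega)$, $\mathscr Lf$ is the functional on $H^1_0(\Omega)\cap L^\infty(\Omega)$ given by $\mathscr Lf(\phi):=-\int_\Omega\langle\nabla f,\nabla\phi\rangle d\mu$. When $\mathscr Lf$ extends to a signed Radon measure on $\Omega$, its Radon–Nikodym decomposition w.r.t. $\mu$ is written $\mathscr Lf=\mathscr L^{\rm ac}f\cdot\mu+\mathscr L^{\rm sing}f$, where $\mathscr L^{\rm ac}f$ is the density of the absolutely continuous part and $\mathscr L^{\rm sing}f$ is the singular part. **Approximate continuity.** $x$ is an approximate continuity point of a measurable $g$ if for every $\epsilon>0$, $\mu(B_r(x)\cap\{|g-g(x)|>\epsilon\})/\mu(B_r(x))\to0$ as $r\to0$. *)

theory Defs
  imports "HOL-Analysis.Analysis" "HOL-Probability.Probability" "HOL-Probability.Essential_Supremum"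
begin

text \<open>
  The metric space \<open>(X, d)\<close> is the type \<open>'a\<close> with \<open>dist\<close>.  The class \<^class>\<open>heine_borel\<close> says exactly
  that the space is proper (and it entails completeness).  The main theorem also carries the sort
  \<^class>\<open>second_countable_topology\<close>; the following lemma shows that it is no restriction, since a
  proper metric space always has a countable basis.
\<close>

lemma heine_borel_countable_basis:
  "\<exists>B :: 'a::heine_borel set set. countable B \<and> topological_basis B"
proof -
  fix a :: 'a
  have "\<exists>k. finite k \<and> cball a (real n) \<subseteq> (\<Union>x\<in>k. ball x (1 / real (Suc m)))" for n m
  proof -
    have "seq_compact (cball a (real n))"
      using compact_cball compact_imp_seq_compact by blast
    then show ?thesis
      using seq_compact_imp_totally_bounded[of "cball a (real n)"] by (metis of_nat_0_less_iff zero_less_Suc zero_less_divide_1_iff)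
  qed
  then obtain k where k: "\<And>n m. finite (k n m)"
    "\<And>n m. cball a (real n) \<subseteq> (\<Union>x\<in>k n m. ball x (1 / real (Suc m)))"
    by metis
  define B where "B = (\<Union>n. \<Union>m. (\<lambda>x. ball x (1 / real (Suc m))) ` k n m)"
  have "countable B"
    unfolding B_def using k(1) by (intro countable_UN countable_image) (auto intro: countable_finite)
  moreover have "topological_basis B"
  proof (rule topological_basisI)
    fix b assume "b \<in> B" then show "open b" by (auto simp: B_def)
  next
    fix U :: "'a set" and x assume U: "open U" "x \<in> U"
    then obtain e where e: "e > 0" "ball x e \<subseteq> U"
      using open_contains_ball by blast
    obtain m where m: "1 / real (Suc m) < e / 2"
      using e(1) by (metis half_gt_zero inverse_eq_divide reals_Archimedean)
    obtain n where "dist a x \<le> real n" using real_arch_simple by blast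
    then have "x \<in> cball a (real n)" by simp
    then obtain y where y: "y \<in> k n m" "x \<in> ball y (1 / real (Suc m))"
      using k(2) by blast
    have "ball y (1 / real (Suc m)) \<subseteq> ball x e"
    proof
      fix z assume z: "z \<in> ball y (1 / real (Suc m))"
      have "dist x z \<le> dist y x + dist y z" by (metis dist_commute dist_triangle2 dist_triangle)
      then show "z \<in> ball x e" using y(2) z m unfolding mem_ball by linarith
    qed
    then show "\<exists>B'\<in>B. x \<in> B' \<and> B' \<subseteq> U"
      using y e(2) by (intro bexI[of _ "ball y (1 / real (Suc m))"]) (auto simp: B_def)
  qed
  ultimately show ?thesis by blast
qed


section \<open>Metric measure spaces\<close>

definition compactly_inside :: "'a::topological_space set \<Rightarrow> 'a set \<Rightarrow> bool"
    (infix \<open>\<subset>\<subset>\<close> 50) where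
  "A \<subset>\<subset> \<Omega> \<longleftrightarrow> compact (closure A) \<and> closure A \<subseteq> \<Omega>"

text \<open>A (positive) Radon measure on an open set \<open>\<Omega>\<close>.\<close>

definition radon_on :: "'a::topological_space set \<Rightarrow> 'a measure \<Rightarrow> bool" where
  "radon_on \<Omega> \<nu> \<longleftrightarrow>
     sets \<nu> = sets (restrict_space borel \<Omega>) \<and>
     (\<forall>C. compact C \<and> C \<subseteq> \<Omega> \<longrightarrow> emeasure \<nu> C < \<infinity>) \<and>
     (\<forall>A\<in>sets \<nu>. emeasure \<nu> A = (SUP C\<in>{C. compact C \<and> C \<in> sets \<nu> \<and> C \<subseteq> A}. emeasure \<nu> C))"

definition msupport :: "'a::topological_space measure \<Rightarrow> 'a set" where
  "msupport \<nu> = {x. \<forall>V. open V \<and> x \<in> V \<longrightarrow> emeasure \<nu> V > 0}"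

definition metric_measure_space :: "'a::metric_space measure \<Rightarrow> bool" where
  "metric_measure_space \<mu> \<longleftrightarrow> radon_on UNIV \<mu> \<and> msupport \<mu> = UNIV"


section \<open>The curvature-dimension condition \<open>CD*(K,N)\<close>\<close>

definition P2 :: "'a::metric_space measure set" where
  "P2 = {\<nu>. sets \<nu> = sets borel \<and> prob_space \<nu> \<and>
            (\<exists>x0. (\<integral>\<^sup>+x. ennreal ((dist x x0)\<^sup>2) \<partial>\<nu>) < \<infinity>)}"

definition P_infty :: "'a::metric_space measure \<Rightarrow> 'a measure set" where
  "P_infty \<mu> = {\<nu> \<in> P2. absolutely_continuous \<mu> \<nu> \<and> bounded (msupport \<nu>)}"

definition couplings :: "'a::metric_space measure \<Rightarrow> 'a measure \<Rightarrow> ('a \<times> 'a) measure set" where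
  "couplings \<nu>0 \<nu>1 = {q. sets q = sets borel \<and> distr q borel fst = \<nu>0 \<and> distr q borel snd = \<nu>1}"

definition transport_cost :: "('a::metric_space \<times> 'a) measure \<Rightarrow> ennreal" where
  "transport_cost q = (\<integral>\<^sup>+z. ennreal ((dist (fst z) (snd z))\<^sup>2) \<partial>q)"

definition optimal_coupling ::
    "'a::metric_space measure \<Rightarrow> 'a measure \<Rightarrow> ('a \<times> 'a) measure \<Rightarrow> bool" where
  "optimal_coupling \<nu>0 \<nu>1 q \<longleftrightarrow>
     q \<in> couplings \<nu>0 \<nu>1 \<and> (\<forall>q'\<in>couplings \<nu>0 \<nu>1. transport_cost q \<le> transport_cost q')"

definition W2 :: "'a::metric_space measure \<Rightarrow> 'a measure \<Rightarrow> real" where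
  "W2 \<nu>0 \<nu>1 = sqrt (enn2real (INF q\<in>couplings \<nu>0 \<nu>1. transport_cost q))"

definition wasserstein_geodesic :: "(real \<Rightarrow> 'a::metric_space measure) \<Rightarrow> bool" where
  "wasserstein_geodesic \<nu> \<longleftrightarrow>
     (\<forall>s\<in>{0..1}. \<nu> s \<in> P2) \<and>
     (\<forall>s\<in>{0..1}. \<forall>t\<in>{0..1}. W2 (\<nu> s) (\<nu> t) = \<bar>s - t\<bar> * W2 (\<nu> 0) (\<nu> 1))"

definition sigma_coeff :: "real \<Rightarrow> real \<Rightarrow> real \<Rightarrow> ennreal" where
  "sigma_coeff k t \<theta> =
     (if k * \<theta>\<^sup>2 \<ge> pi\<^sup>2 then \<infinity>
      else if k * \<theta>\<^sup>2 = 0 then ennreal t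
      else if k * \<theta>\<^sup>2 > 0 then ennreal (sin (sqrt k * t * \<theta>) / sin (sqrt k * \<theta>))
      else ennreal (sinh (sqrt (- k) * t * \<theta>) / sinh (sqrt (- k) * \<theta>)))"

text \<open>
  Densities are taken real-valued and nonnegative; \<open>\<rho>\<^sub>0\<close>, \<open>\<rho>\<^sub>1\<close> and \<open>\<rho>\<^sub>t\<close> are positive almost everywhere
  for the measures against which their negative powers are integrated.  All integrals are taken in
  \<open>[0,\<infinity>]\<close>, because the coefficients may be infinite.
\<close>

definition nonneg_density :: "'a measure \<Rightarrow> ('a \<Rightarrow> real) \<Rightarrow> bool" where
  "nonneg_density \<mu> \<rho> \<longleftrightarrow> \<rho> \<in> borel_measurable \<mu> \<and> (\<forall>x. 0 \<le> \<rho> x)"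

definition CD_star :: "real \<Rightarrow> real \<Rightarrow> 'a::metric_space measure \<Rightarrow> bool" where
  "CD_star K N \<mu> \<longleftrightarrow>
    (\<forall>\<rho>0 \<rho>1.
       nonneg_density \<mu> \<rho>0 \<and> nonneg_density \<mu> \<rho>1 \<and>
       density \<mu> (ennreal \<circ> \<rho>0) \<in> P_infty \<mu> \<and>
       density \<mu> (ennreal \<circ> \<rho>1) \<in> P_infty \<mu> \<longrightarrow>
       (\<exists>q \<rho>.
          optimal_coupling (density \<mu> (ennreal \<circ> \<rho>0)) (density \<mu> (ennreal \<circ> \<rho>1)) q \<and>
          (\<forall>t\<in>{0..1}. nonneg_density \<mu> (\<rho> t) \<and> density \<mu> (ennreal \<circ> \<rho> t) \<in> P_infty \<mu>) \<and>
          wasserstein_geodesic (\<lambda>t. density \<mu> (ennreal \<circ> \<rho> t)) \<and>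
          density \<mu> (ennreal \<circ> \<rho> 0) = density \<mu> (ennreal \<circ> \<rho>0) \<and>
          density \<mu> (ennreal \<circ> \<rho> 1) = density \<mu> (ennreal \<circ> \<rho>1) \<and>
          (\<forall>t\<in>{0..1}. \<forall>N'\<ge>N.
             (\<integral>\<^sup>+x. ennreal (\<rho> t x powr (- 1 / N')) \<partial>density \<mu> (ennreal \<circ> \<rho> t)) \<ge>
             (\<integral>\<^sup>+z. sigma_coeff (K / N') (1 - t) (dist (fst z) (snd z)) * ennreal (\<rho>0 (fst z) powr (- 1 / N'))
                  + sigma_coeff (K / N') t (dist (fst z) (snd z)) * ennreal (\<rho>1 (snd z) powr (- 1 / N')) \<partial>q))))"


section \<open>Lebesgue spaces and Lipschitz functions\<close>

text \<open>
  Elements of \<open>L\<^sup>p(\<Omega>)\<close> are represented by functions on the whole type whose values outside \<open>\<Omega>\<close> are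
  irrelevant: \<open>L\<^sup>p(\<Omega>)\<close> is \<open>Lp (restrict_space \<mu> \<Omega>) p\<close>.
\<close>

definition Lp :: "'a measure \<Rightarrow> real \<Rightarrow> ('a \<Rightarrow> real) set" where
  "Lp M p = {f. f \<in> borel_measurable M \<and> integrable M (\<lambda>x. \<bar>f x\<bar> powr p)}"

definition Lp_norm :: "'a measure \<Rightarrow> real \<Rightarrow> ('a \<Rightarrow> real) \<Rightarrow> real" where
  "Lp_norm M p f = (\<integral>x. \<bar>f x\<bar> powr p \<partial>M) powr (1 / p)"

definition Lp_tendsto ::
    "'a measure \<Rightarrow> real \<Rightarrow> (nat \<Rightarrow> 'a \<Rightarrow> real) \<Rightarrow> ('a \<Rightarrow> real) \<Rightarrow> bool" where
  "Lp_tendsto M p F f \<longleftrightarrow>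
     (\<forall>j. F j \<in> Lp M p) \<and> f \<in> Lp M p \<and> (\<lambda>j. Lp_norm M p (\<lambda>x. F j x - f x)) \<longlonglongrightarrow> 0"

definition L2_weakly_tendsto ::
    "'a measure \<Rightarrow> (nat \<Rightarrow> 'a \<Rightarrow> real) \<Rightarrow> ('a \<Rightarrow> real) \<Rightarrow> bool" where
  "L2_weakly_tendsto M F f \<longleftrightarrow>
     (\<forall>j. F j \<in> Lp M 2) \<and> f \<in> Lp M 2 \<and>
     (\<forall>h\<in>Lp M 2. (\<lambda>j. \<integral>x. F j x * h x \<partial>M) \<longlonglongrightarrow> (\<integral>x. f x * h x \<partial>M))"

definition Linfty :: "'a measure \<Rightarrow> 'a set \<Rightarrow> ('a \<Rightarrow> real) set" where
  "Linfty \<mu> \<Omega> = {f. f \<in> borel_measurable (restrict_space \<mu> \<Omega>) \<and>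
                    (\<exists>C. AE x in \<mu>. x \<in> \<Omega> \<longrightarrow> \<bar>f x\<bar> \<le> C)}"

definition Linfty_loc :: "'a::topological_space measure \<Rightarrow> 'a set \<Rightarrow> ('a \<Rightarrow> real) set" where
  "Linfty_loc \<mu> \<Omega> = {f. f \<in> borel_measurable (restrict_space \<mu> \<Omega>) \<and>
     (\<forall>C. compact C \<and> C \<subseteq> \<Omega> \<longrightarrow> f \<in> Linfty \<mu> C)}"

definition pt_Lip_ereal :: "('a::metric_space \<Rightarrow> real) \<Rightarrow> 'a \<Rightarrow> ereal" where
  "pt_Lip_ereal f x =
     (if x islimpt UNIV then Limsup (at x) (\<lambda>y. ereal (\<bar>f y - f x\<bar> / dist x y)) else 0)"

text \<open>
  The real-valued pointwise Lipschitz constant is only applied to functions that are locally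
  Lipschitz around the point, where the upper limit is finite.
\<close>

definition pt_Lip :: "('a::metric_space \<Rightarrow> real) \<Rightarrow> 'a \<Rightarrow> real" where
  "pt_Lip f x = real_of_ereal (pt_Lip_ereal f x)"

definition Lip_fun :: "('a::metric_space \<Rightarrow> real) set" where
  "Lip_fun = {f. \<exists>C. C-lipschitz_on UNIV f}"

definition Lip_loc :: "'a::metric_space set \<Rightarrow> ('a \<Rightarrow> real) set" where
  "Lip_loc \<Omega> = {f. \<forall>x\<in>\<Omega>. \<exists>r>0. \<exists>C. C-lipschitz_on (ball x r \<inter> \<Omega>) f}"

definition Cc :: "'a::topological_space set \<Rightarrow> ('a \<Rightarrow> real) set" where
  "Cc \<Omega> = {f. continuous_on UNIV f \<and> {x. f x \<noteq> 0} \<subset>\<subset> \<Omega>}"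

text \<open>For open \<open>\<Omega>\<close>, elements of \<open>Lip\<^sub>0(\<Omega>)\<close> are identified with their extensions by zero.\<close>

definition Lip0 :: "'a::metric_space set \<Rightarrow> ('a \<Rightarrow> real) set" where
  "Lip0 \<Omega> = {f \<in> Lip_fun. {x. f x \<noteq> 0} \<subset>\<subset> \<Omega>}"


section \<open>Cheeger energy and \<open>RCD*(K,N)\<close>\<close>

definition Cheeger :: "'a::metric_space measure \<Rightarrow> ('a \<Rightarrow> real) \<Rightarrow> ennreal" where
  "Cheeger \<mu> f =
     Inf {liminf (\<lambda>j. ennreal (1/2) * (\<integral>\<^sup>+x. ennreal ((pt_Lip (F j) x)\<^sup>2) \<partial>\<mu>)) | F.
            (\<forall>j. F j \<in> Lip_fun) \<and> Lp_tendsto \<mu> 2 F f}"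

definition Cheeger_dom :: "'a::metric_space measure \<Rightarrow> ('a \<Rightarrow> real) set" where
  "Cheeger_dom \<mu> = {f \<in> Lp \<mu> 2. Cheeger \<mu> f < \<infinity>}"

definition quadratic_form_on ::
    "('a \<Rightarrow> real) set \<Rightarrow> (('a \<Rightarrow> real) \<Rightarrow> real) \<Rightarrow> bool" where
  "quadratic_form_on D Q \<longleftrightarrow>
     (\<lambda>x. 0) \<in> D \<and>
     (\<forall>f\<in>D. \<forall>g\<in>D. \<forall>a b. (\<lambda>x. a * f x + b * g x) \<in> D) \<and>
     (\<exists>B. (\<forall>f\<in>D. \<forall>g\<in>D. B f g = B g f) \<and>
          (\<forall>f\<in>D. \<forall>g\<in>D. \<forall>h\<in>D. \<forall>a b. B (\<lambda>x. a * f x + b * g x) h = a * B f h + b * B g h) \<and>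
          (\<forall>f\<in>D. Q f = B f f))"

definition RCD_star :: "real \<Rightarrow> real \<Rightarrow> 'a::metric_space measure \<Rightarrow> bool" where
  "RCD_star K N \<mu> \<longleftrightarrow>
     CD_star K N \<mu> \<and> quadratic_form_on (Cheeger_dom \<mu>) (\<lambda>f. enn2real (Cheeger \<mu> f))"


section \<open>Gradients and Sobolev spaces\<close>

text \<open>
  Gradients, their inner products and measure densities are only determined almost everywhere, so
  they are described by predicates that hold for all representatives.
\<close>

definition relaxed_gradient ::
    "'a::metric_space measure \<Rightarrow> ('a \<Rightarrow> real) \<Rightarrow> ('a \<Rightarrow> real) \<Rightarrow> bool" where
  "relaxed_gradient \<mu> f G \<longleftrightarrow>
     (\<exists>F. (\<forall>j. F j \<in> Lip_fun) \<and> Lp_tendsto \<mu> 2 F f \<and> L2_weakly_tendsto \<mu> (\<lambda>j. pt_Lip (F j)) G)"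

definition min_relaxed_gradient ::
    "'a::metric_space measure \<Rightarrow> ('a \<Rightarrow> real) \<Rightarrow> ('a \<Rightarrow> real) \<Rightarrow> bool" where
  "min_relaxed_gradient \<mu> f G \<longleftrightarrow>
     relaxed_gradient \<mu> f G \<and>
     (\<forall>G'. relaxed_gradient \<mu> f G' \<longrightarrow> Lp_norm \<mu> 2 G \<le> Lp_norm \<mu> 2 G')"

text \<open>
  \<open>G = |\<nabla>f|\<close> almost everywhere in the open set \<open>\<Omega>\<close>.  By locality, \<open>|\<nabla>f|\<close> is determined on
  \<open>{\<eta> = 1}\<close> by the globally defined function \<open>\<eta> f\<close>, for every cut-off function \<open>\<eta>\<close>.
\<close>

definition min_gradient_on ::
    "'a::metric_space measure \<Rightarrow> 'a set \<Rightarrow> ('a \<Rightarrow> real) \<Rightarrow> ('a \<Rightarrow> real) \<Rightarrow> bool" where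
  "min_gradient_on \<mu> \<Omega> f G \<longleftrightarrow>
     G \<in> borel_measurable (restrict_space \<mu> \<Omega>) \<and>
     (\<forall>\<eta>\<in>Lip0 \<Omega>. \<exists>G'. min_relaxed_gradient \<mu> (\<lambda>x. \<eta> x * f x) G' \<and>
                         (AE x in \<mu>. x \<in> \<Omega> \<and> \<eta> x = 1 \<longrightarrow> G x = G' x))"

text \<open>\<open>h = \<langle>\<nabla>f, \<nabla>g\<rangle>\<close> almost everywhere in \<open>\<Omega>\<close>; the limit is taken in \<open>L\<^sup>1(\<Omega>)\<close>.\<close>

definition grad_inner_on ::
    "'a::metric_space measure \<Rightarrow> 'a set \<Rightarrow> ('a \<Rightarrow> real) \<Rightarrow> ('a \<Rightarrow> real) \<Rightarrow> ('a \<Rightarrow> real) \<Rightarrow> bool" where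
  "grad_inner_on \<mu> \<Omega> f g h \<longleftrightarrow>
     integrable (restrict_space \<mu> \<Omega>) h \<and>
     (\<exists>G. (\<forall>\<epsilon>. min_gradient_on \<mu> \<Omega> (\<lambda>x. f x + \<epsilon> * g x) (G \<epsilon>) \<and> G \<epsilon> \<in> Lp (restrict_space \<mu> \<Omega>) 2) \<and>
          ((\<lambda>\<epsilon>. \<integral>x. \<bar>((G \<epsilon> x)\<^sup>2 - (G 0 x)\<^sup>2) / (2 * \<epsilon>) - h x\<bar> \<partial>restrict_space \<mu> \<Omega>) \<longlongrightarrow> 0) (at 0))"

text \<open>
  The norm of \<open>W\<^sup>1\<^sup>,\<^sup>p(\<Omega>)\<close> is given on locally Lipschitz functions only, so closures are completions:
  an element is the \<open>L\<^sup>p\<close>-limit of a sequence that is Cauchy for that norm.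
\<close>

definition W1p_norm :: "'a::metric_space measure \<Rightarrow> 'a set \<Rightarrow> real \<Rightarrow> ('a \<Rightarrow> real) \<Rightarrow> real" where
  "W1p_norm \<mu> \<Omega> p f =
     Lp_norm (restrict_space \<mu> \<Omega>) p f + Lp_norm (restrict_space \<mu> \<Omega>) p (pt_Lip f)"

definition W1p_closure ::
    "'a::metric_space measure \<Rightarrow> 'a set \<Rightarrow> real \<Rightarrow> ('a \<Rightarrow> real) set \<Rightarrow> ('a \<Rightarrow> real) set" where
  "W1p_closure \<mu> \<Omega> p S = {f. \<exists>F.
     (\<forall>j. F j \<in> S \<and> pt_Lip (F j) \<in> Lp (restrict_space \<mu> \<Omega>) p) \<and>
     Lp_tendsto (restrict_space \<mu> \<Omega>) p F f \<and>
     (\<forall>e>0. \<exists>n0. \<forall>m\<ge>n0. \<forall>n\<ge>n0. W1p_norm \<mu> \<Omega> p (\<lambda>x. F m x - F n x) < e)}"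

definition W1p :: "'a::metric_space measure \<Rightarrow> 'a set \<Rightarrow> real \<Rightarrow> ('a \<Rightarrow> real) set" where
  "W1p \<mu> \<Omega> p = W1p_closure \<mu> \<Omega> p (Lip_loc \<Omega>)"

definition W1p_0 :: "'a::metric_space measure \<Rightarrow> 'a set \<Rightarrow> real \<Rightarrow> ('a \<Rightarrow> real) set" where
  "W1p_0 \<mu> \<Omega> p = W1p_closure \<mu> \<Omega> p (Lip0 \<Omega>)"

abbreviation H1 :: "'a::metric_space measure \<Rightarrow> 'a set \<Rightarrow> ('a \<Rightarrow> real) set" where
  "H1 \<mu> \<Omega> \<equiv> W1p \<mu> \<Omega> 2"

abbreviation H1_0 :: "'a::metric_space measure \<Rightarrow> 'a set \<Rightarrow> ('a \<Rightarrow> real) set" where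
  "H1_0 \<mu> \<Omega> \<equiv> W1p_0 \<mu> \<Omega> 2"


section \<open>The weak Laplacian\<close>

text \<open>The integral does not depend on the chosen representative of \<open>\<langle>\<nabla>f, \<nabla>\<phi>\<rangle>\<close>.\<close>

definition weak_laplacian ::
    "'a::metric_space measure \<Rightarrow> 'a set \<Rightarrow> ('a \<Rightarrow> real) \<Rightarrow> ('a \<Rightarrow> real) \<Rightarrow> real" where
  "weak_laplacian \<mu> \<Omega> f \<phi> = - (\<integral>x. (SOME h. grad_inner_on \<mu> \<Omega> f \<phi> h) x \<partial>restrict_space \<mu> \<Omega>)"

text \<open>
  A signed Radon measure on \<open>\<Omega>\<close> is a difference \<open>P - N\<close> of positive ones and is represented by the
  pair \<open>(P, N)\<close>.  Both terms may be infinite on \<open>\<Omega>\<close>, so the difference has a value only on Borel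
  sets that are relatively compact in \<open>\<Omega>\<close>, and an integral only for compactly supported functions.
\<close>

type_synonym 'a signed_measure = "'a measure \<times> 'a measure"

definition signed_radon_on :: "'a::topological_space set \<Rightarrow> 'a signed_measure \<Rightarrow> bool" where
  "signed_radon_on \<Omega> \<nu> \<longleftrightarrow> radon_on \<Omega> (fst \<nu>) \<and> radon_on \<Omega> (snd \<nu>)"

definition rc_borel :: "'a::topological_space set \<Rightarrow> 'a set set" where
  "rc_borel \<Omega> = {A \<in> sets borel. A \<subset>\<subset> \<Omega>}"

definition signed_value :: "'a signed_measure \<Rightarrow> 'a set \<Rightarrow> real" where
  "signed_value \<nu> A = measure (fst \<nu>) A - measure (snd \<nu>) A"

definition signed_integral :: "'a signed_measure \<Rightarrow> ('a \<Rightarrow> real) \<Rightarrow> real" where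
  "signed_integral \<nu> \<phi> = (\<integral>x. \<phi> x \<partial>fst \<nu>) - (\<integral>x. \<phi> x \<partial>snd \<nu>)"

definition signed_nonneg_on :: "'a::topological_space set \<Rightarrow> 'a signed_measure \<Rightarrow> bool" where
  "signed_nonneg_on \<Omega> \<nu> \<longleftrightarrow> (\<forall>A\<in>rc_borel \<Omega>. 0 \<le> signed_value \<nu> A)"

definition signed_singular_on ::
    "'a::topological_space measure \<Rightarrow> 'a set \<Rightarrow> 'a signed_measure \<Rightarrow> bool" where
  "signed_singular_on \<mu> \<Omega> \<nu> \<longleftrightarrow>
     (\<exists>S\<in>null_sets \<mu>. S \<subseteq> \<Omega> \<and> (\<forall>A\<in>rc_borel \<Omega>. A \<inter> S = {} \<longrightarrow> signed_value \<nu> A = 0))"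

text \<open>
  The Laplacian of \<open>f\<close> is the signed Radon measure \<open>\<nu>\<close>: the two functionals agree on the
  intersection of their domains.
\<close>

definition measure_laplacian ::
    "'a::metric_space measure \<Rightarrow> 'a set \<Rightarrow> ('a \<Rightarrow> real) \<Rightarrow> 'a signed_measure \<Rightarrow> bool" where
  "measure_laplacian \<mu> \<Omega> f \<nu> \<longleftrightarrow>
     signed_radon_on \<Omega> \<nu> \<and>
     (\<forall>\<phi> \<in> H1_0 \<mu> \<Omega> \<inter> Linfty \<mu> \<Omega> \<inter> Cc \<Omega>. weak_laplacian \<mu> \<Omega> f \<phi> = signed_integral \<nu> \<phi>)"

text \<open>\<open>\<nu> = g \<mu> + \<sigma>\<close> on \<open>\<Omega>\<close>, with \<open>\<sigma>\<close> singular with respect to \<open>\<mu>\<close>.\<close>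

definition radon_nikodym_decomposition ::
    "'a::topological_space measure \<Rightarrow> 'a set \<Rightarrow> 'a signed_measure \<Rightarrow> ('a \<Rightarrow> real) \<Rightarrow>
     'a signed_measure \<Rightarrow> bool" where
  "radon_nikodym_decomposition \<mu> \<Omega> \<nu> g \<sigma> \<longleftrightarrow>
     g \<in> borel_measurable (restrict_space \<mu> \<Omega>) \<and>
     signed_radon_on \<Omega> \<sigma> \<and> signed_singular_on \<mu> \<Omega> \<sigma> \<and>
     (\<forall>A\<in>rc_borel \<Omega>. set_integrable \<mu> A g \<and>
        signed_value \<nu> A = (LINT x:A|\<mu>. g x) + signed_value \<sigma> A)"


section \<open>Pointwise notions\<close>

definition ess_sup_on :: "'a measure \<Rightarrow> 'a set \<Rightarrow> ('a \<Rightarrow> real) \<Rightarrow> ereal" where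
  "ess_sup_on \<mu> A f = esssup (restrict_space \<mu> A) (\<lambda>x. ereal (f x))"

definition approx_continuity_point ::
    "'a::metric_space measure \<Rightarrow> ('a \<Rightarrow> real) \<Rightarrow> 'a \<Rightarrow> bool" where
  "approx_continuity_point \<mu> g x \<longleftrightarrow>
     (\<forall>\<epsilon>>0. ((\<lambda>r. measure \<mu> (ball x r \<inter> {y. \<bar>g y - g x\<bar> > \<epsilon>}) / measure \<mu> (ball x r)) \<longlongrightarrow> 0)
               (at_right 0))"

end

theory Submission imports Defs
begin

text \<open>
  Up to approximation the proof is a test function argument.  Suppose that \<open>\<L>\<^sup>a\<^sup>c f + \<langle>\<nabla>f, \<nabla>w\<rangle>\<close> were larger than
  \<open>1 / j\<close> almost everywhere on the set where \<open>f > c\<close>, for a level \<open>c\<close> between \<open>sup f - 1 / j\<close> and \<open>sup f\<close> that also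
  exceeds the supremum of \<open>f\<close> outside \<open>U\<close>.  Let \<open>\<psi>\<close> be a bounded increasing \<open>C\<^sup>1\<close> function that is positive exactly
  above \<open>c\<close>, and \<open>\<eta>\<close> a cut-off function that is one near \<open>U\<close>.  Testing \<open>\<L> f\<close> with \<open>\<phi> = \<eta> \<psi>(f) e\<^sup>w \<ge> 0\<close>, and using
  that the singular part is nonnegative, gives
  \<open>- \<integral> \<langle>\<nabla>f, \<nabla>\<phi>\<rangle> \<ge> \<integral> \<phi> \<L>\<^sup>a\<^sup>c f\<close>.  The chain rule turns this into \<open>\<integral> \<phi> (\<L>\<^sup>a\<^sup>c f + \<langle>\<nabla>f, \<nabla>w\<rangle>) \<le> - \<integral> \<eta> \<psi>'(f) e\<^sup>w \<bar>\<nabla>f\<bar>\<^sup>2 \<le> 0\<close>, a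
  contradiction, since the left-hand side is positive.  So the good points have positive measure, and
  almost all of them are approximate continuity points.  The steps are \<open>weak_laplacian_test\<close>,
  \<open>weak_maximum_inequality\<close> and \<open>AE_approx_continuity_point\<close>.
  
  Two bodies of theory stand behind this.  The first is the calculus of \<open>\<langle>\<nabla>f, \<nabla>\<phi>\<rangle>\<close>.  Since gradients are defined
  by relaxation, everything is reduced to functions that dominate a gradient (\<open>upper_grad\<close>), a class closed
  under sums, limits and mixing by cut-offs.  Uniform convexity of \<open>L\<^sup>2\<close> makes the minimal gradient a strong limit
  of Lipschitz constants, mixing makes it minimal pointwise, and truncation makes it local.  The inner
  product exists in every direction of compact support because the Cheeger energy is quadratic
  (\<open>grad_inner_on_exists\<close>), and a single inequality, its subadditivity in the direction with a gradient bound
  on the error (\<open>grad_inner_subadditive\<close>), gives linearity, the chain rule and continuity under approximation.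
  
  The second is Lebesgue's density theorem, for which the measure has to be doubling on small balls.
  Transporting the uniform distribution of a ball halfway to its centre, the curvature-dimension condition
  bounds the measure of the ball by that of a smaller one (\<open>ball_shrink\<close>).  That the transport really moves
  mass towards the centre is \<open>midpoint_concentration\<close>, proved by gluing nearly optimal plans.
\<close>

section \<open>The Hilbert space of square integrable functions\<close>

lemma Lp2_iff: "f \<in> Lp M 2 \<longleftrightarrow> f \<in> borel_measurable M \<and> integrable M (\<lambda>x. (f x)\<^sup>2)"
  by (simp add: Lp_def)

lemma Lp2_measurable[measurable_dest]: "f \<in> Lp M 2 \<Longrightarrow> f \<in> borel_measurable M"
  by (simp add: Lp_def)

lemma Lp2_integrable_square: "f \<in> Lp M 2 \<Longrightarrow> integrable M (\<lambda>x. (f x)\<^sup>2)"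
  by (simp add: Lp2_iff)

lemma Lp2_norm: "Lp_norm M 2 f = sqrt (\<integral>x. (f x)\<^sup>2 \<partial>M)"
  by (simp add: Lp_norm_def powr_half_sqrt)

lemma Lp2_norm_nonneg[simp]: "0 \<le> Lp_norm M 2 f"
  by (simp add: Lp2_norm)

lemma Lp2_norm_square: "(Lp_norm M 2 f)\<^sup>2 = (\<integral>x. (f x)\<^sup>2 \<partial>M)"
  by (simp add: Lp2_norm)

lemma Lp2_dominated:
  assumes "g \<in> Lp M 2" "f \<in> borel_measurable M" "AE x in M. \<bar>f x\<bar> \<le> \<bar>g x\<bar>"
  shows "f \<in> Lp M 2"
proof -
  have [measurable]: "f \<in> borel_measurable M" by fact
  have "integrable M (\<lambda>x. (f x)\<^sup>2)"
  proof (rule Bochner_Integration.integrable_bound[OF Lp2_integrable_square[OF assms(1)]])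
    show "AE x in M. norm ((f x)\<^sup>2) \<le> norm ((g x)\<^sup>2)"
      using assms(3) by eventually_elim (simp add: power2_le_iff_abs_le abs_le_square_iff)
  qed measurable
  then show ?thesis using assms(2) by (simp add: Lp2_iff)
qed

lemma Lp2_norm_mono:
  assumes "g \<in> Lp M 2" "f \<in> borel_measurable M" "AE x in M. \<bar>f x\<bar> \<le> \<bar>g x\<bar>"
  shows "Lp_norm M 2 f \<le> Lp_norm M 2 g"
proof -
  have "(\<integral>x. (f x)\<^sup>2 \<partial>M) \<le> (\<integral>x. (g x)\<^sup>2 \<partial>M)"
    using assms(3) Lp2_integrable_square[OF assms(1)] Lp2_integrable_square[OF Lp2_dominated[OF assms]]
    by (intro integral_mono_AE) (auto elim!: eventually_mono simp: abs_le_square_iff)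
  then show ?thesis by (simp add: Lp2_norm)
qed

lemma Lp2_integrable_mult:
  assumes "f \<in> Lp M 2" "g \<in> Lp M 2"
  shows "integrable M (\<lambda>x. f x * g x)"
proof -
  have [measurable]: "f \<in> borel_measurable M" "g \<in> borel_measurable M"
    using assms by (auto simp: Lp2_iff)
  show ?thesis
  proof (rule Bochner_Integration.integrable_bound[OF Bochner_Integration.integrable_add[OF Lp2_integrable_square[OF assms(1)]
          Lp2_integrable_square[OF assms(2)]]])
    have "\<bar>a * b\<bar> \<le> a\<^sup>2 + b\<^sup>2" for a b :: real
      using sum_squares_bound[of "\<bar>a\<bar>" "\<bar>b\<bar>"] mult_nonneg_nonneg[OF abs_ge_zero[of a] abs_ge_zero[of b]]
      unfolding abs_mult power2_abs by linarith
    then show "AE x in M. norm (f x * g x) \<le> norm ((f x)\<^sup>2 + (g x)\<^sup>2)"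
      by (auto intro!: AE_I2 order_trans[OF _ abs_ge_self])
  qed measurable
qed

lemma Lp2_zero[simp]: "(\<lambda>x. 0) \<in> Lp M 2"
  by (simp add: Lp2_iff)

lemma Lp2_cmult: "f \<in> Lp M 2 \<Longrightarrow> (\<lambda>x. c * f x) \<in> Lp M 2"
  by (auto simp: Lp2_iff power_mult_distrib)

lemma Lp2_add:
  assumes "f \<in> Lp M 2" "g \<in> Lp M 2"
  shows "(\<lambda>x. f x + g x) \<in> Lp M 2"
  using assms Lp2_integrable_mult[OF assms] by (auto simp: Lp2_iff power2_sum mult.assoc)

lemma Lp2_diff: "f \<in> Lp M 2 \<Longrightarrow> g \<in> Lp M 2 \<Longrightarrow> (\<lambda>x. f x - g x) \<in> Lp M 2"
  using Lp2_add[of f M "\<lambda>x. -1 * g x"] Lp2_cmult[of g M "-1"] by simp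

lemma Lp2_abs: "f \<in> Lp M 2 \<Longrightarrow> (\<lambda>x. \<bar>f x\<bar>) \<in> Lp M 2"
  by (auto simp: Lp2_iff)

lemma Lp2_bounded_mult:
  assumes "f \<in> Lp M 2" and [measurable]: "\<theta> \<in> borel_measurable M" and "\<And>x. x \<in> space M \<Longrightarrow> \<bar>\<theta> x\<bar> \<le> C"
  shows "(\<lambda>x. \<theta> x * f x) \<in> Lp M 2"
proof (rule Lp2_dominated[OF Lp2_cmult[OF assms(1), of C]])
  show "AE x in M. \<bar>\<theta> x * f x\<bar> \<le> \<bar>C * f x\<bar>"
    using assms(3) by (intro AE_I2) (fastforce simp: abs_mult intro!: mult_right_mono)
  show "(\<lambda>x. \<theta> x * f x) \<in> borel_measurable M" using assms(1) by measurable
qed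

lemma Lp2_norm_cmult: "Lp_norm M 2 (\<lambda>x. c * f x) = \<bar>c\<bar> * Lp_norm M 2 f"
  by (simp add: Lp2_norm power_mult_distrib real_sqrt_mult)

lemma Lp2_norm_minus_commute: "Lp_norm M 2 (\<lambda>x. f x - g x) = Lp_norm M 2 (\<lambda>x. g x - f x)"
  by (simp add: Lp2_norm power2_commute)

lemma Lp2_Cauchy_Schwarz_abs:
  assumes "f \<in> Lp M 2" "g \<in> Lp M 2"
  shows "(\<integral>x. \<bar>f x * g x\<bar> \<partial>M) \<le> Lp_norm M 2 f * Lp_norm M 2 g"
proof -
  define A B c where "A = (\<integral>x. (f x)\<^sup>2 \<partial>M)" and "B = (\<integral>x. (g x)\<^sup>2 \<partial>M)" and "c = (\<integral>x. \<bar>f x * g x\<bar> \<partial>M)"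
  have nn: "A \<ge> 0" "B \<ge> 0" "c \<ge> 0" by (auto simp: A_def B_def c_def)
  have quad: "0 \<le> t\<^sup>2 * A - 2 * t * c + B" for t
  proof -
    have "0 \<le> (\<integral>x. (t * \<bar>f x\<bar> - \<bar>g x\<bar>)\<^sup>2 \<partial>M)" by simp
    also have "\<dots> = (\<integral>x. t\<^sup>2 * (f x)\<^sup>2 - (2 * t) * \<bar>f x * g x\<bar> + (g x)\<^sup>2 \<partial>M)"
      by (intro Bochner_Integration.integral_cong) (auto simp: power2_diff power_mult_distrib abs_mult)
    also have "\<dots> = t\<^sup>2 * A - 2 * t * c + B"
      using Lp2_integrable_square[OF assms(1)] Lp2_integrable_square[OF assms(2)] Lp2_integrable_mult[OF assms]
      by (simp add: A_def B_def c_def)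
    finally show ?thesis .
  qed
  have "c\<^sup>2 \<le> A * B"
  proof (cases "A = 0")
    case True
    have "c = 0"
    proof (rule ccontr)
      assume "c \<noteq> 0"
      then show False using quad[of "(B + 1) / (2 * c)"] nn True by (simp add: field_simps)
    qed
    then show ?thesis using nn by simp
  next
    case False
    then have "A > 0" using nn by simp
    then show ?thesis using quad[of "c / A"] by (simp add: field_simps power2_eq_square)
  qed
  then have "c \<le> sqrt (A * B)" using nn real_le_rsqrt by blast
  then show ?thesis by (simp add: c_def A_def B_def Lp2_norm real_sqrt_mult)
qed

lemma Lp2_Cauchy_Schwarz:
  assumes "f \<in> Lp M 2" "g \<in> Lp M 2"
  shows "\<bar>\<integral>x. f x * g x \<partial>M\<bar> \<le> Lp_norm M 2 f * Lp_norm M 2 g"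
  using integral_abs_bound[of M "\<lambda>x. f x * g x"] Lp2_Cauchy_Schwarz_abs[OF assms] by linarith

lemma Lp2_triangle:
  assumes "f \<in> Lp M 2" "g \<in> Lp M 2"
  shows "Lp_norm M 2 (\<lambda>x. f x + g x) \<le> Lp_norm M 2 f + Lp_norm M 2 g"
proof -
  have "(Lp_norm M 2 (\<lambda>x. f x + g x))\<^sup>2 = (\<integral>x. (f x)\<^sup>2 + (g x)\<^sup>2 + 2 * (f x * g x) \<partial>M)"
    unfolding Lp2_norm_square by (intro Bochner_Integration.integral_cong) (auto simp: power2_sum)
  also have "\<dots> = (Lp_norm M 2 f)\<^sup>2 + (Lp_norm M 2 g)\<^sup>2 + 2 * (\<integral>x. f x * g x \<partial>M)"
    using Lp2_integrable_square[OF assms(1)] Lp2_integrable_square[OF assms(2)] Lp2_integrable_mult[OF assms]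
    by (simp add: Lp2_norm_square)
  also have "\<dots> \<le> (Lp_norm M 2 f + Lp_norm M 2 g)\<^sup>2"
    using Lp2_Cauchy_Schwarz[OF assms] by (simp add: power2_sum)
  finally show ?thesis by (rule power2_le_imp_le) simp
qed

lemma Lp2_triangle_diff:
  assumes "f \<in> Lp M 2" "g \<in> Lp M 2" "h \<in> Lp M 2"
  shows "Lp_norm M 2 (\<lambda>x. f x - h x) \<le> Lp_norm M 2 (\<lambda>x. f x - g x) + Lp_norm M 2 (\<lambda>x. g x - h x)"
  using Lp2_triangle[OF Lp2_diff[OF assms(1,2)] Lp2_diff[OF assms(2,3)]] by simp

lemma Lp2_norm_diff_le:
  assumes "f \<in> Lp M 2" "g \<in> Lp M 2"
  shows "\<bar>Lp_norm M 2 f - Lp_norm M 2 g\<bar> \<le> Lp_norm M 2 (\<lambda>x. f x - g x)"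
  using Lp2_triangle_diff[OF assms(1,2) Lp2_zero] Lp2_triangle_diff[OF assms(2,1) Lp2_zero]
    Lp2_norm_minus_commute[of M f g] by simp

lemma Lp_norm_cong_AE:
  assumes "f \<in> borel_measurable M" "g \<in> borel_measurable M" "AE x in M. f x = g x"
  shows "Lp_norm M 2 f = Lp_norm M 2 g"
proof -
  have "(\<integral>x. (f x)\<^sup>2 \<partial>M) = (\<integral>x. (g x)\<^sup>2 \<partial>M)"
    using assms by (intro integral_cong_AE) auto
  then show ?thesis by (simp add: Lp2_norm)
qed

lemma Lp2_tendstoD:
  assumes "Lp_tendsto M 2 F f"
  shows "F j \<in> Lp M 2" "f \<in> Lp M 2" "(\<lambda>j. Lp_norm M 2 (\<lambda>x. F j x - f x)) \<longlonglongrightarrow> 0"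
  using assms by (auto simp: Lp_tendsto_def)

lemma Lp2_tendsto_const: "f \<in> Lp M 2 \<Longrightarrow> Lp_tendsto M 2 (\<lambda>j. f) f"
  by (simp add: Lp_tendsto_def Lp2_norm)

lemma Lp2_tendstoI:
  assumes "\<And>j. F j \<in> Lp M 2" "f \<in> Lp M 2" "e \<longlonglongrightarrow> 0" "\<And>j. Lp_norm M 2 (\<lambda>x. F j x - f x) \<le> e j"
  shows "Lp_tendsto M 2 F f"
  unfolding Lp_tendsto_def
  using assms by (auto intro!: tendsto_sandwich[OF _ _ tendsto_const assms(3)] always_eventually)

lemma Lp2_tendsto_subseq: "Lp_tendsto M 2 F f \<Longrightarrow> strict_mono r \<Longrightarrow> Lp_tendsto M 2 (\<lambda>j. F (r j)) f"
  unfolding Lp_tendsto_def by (auto dest: LIMSEQ_subseq_LIMSEQ simp: o_def)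

lemma Lp2_tendsto_add:
  assumes "Lp_tendsto M 2 F f" "Lp_tendsto M 2 G g"
  shows "Lp_tendsto M 2 (\<lambda>j x. F j x + G j x) (\<lambda>x. f x + g x)"
proof (rule Lp2_tendstoI)
  show "Lp_norm M 2 (\<lambda>x. F j x + G j x - (f x + g x))
      \<le> Lp_norm M 2 (\<lambda>x. F j x - f x) + Lp_norm M 2 (\<lambda>x. G j x - g x)" for j
    using Lp2_triangle[OF Lp2_diff[OF Lp2_tendstoD(1,2)[OF assms(1)]] Lp2_diff[OF Lp2_tendstoD(1,2)[OF assms(2)]]]
    by (simp add: algebra_simps)
  show "(\<lambda>j. Lp_norm M 2 (\<lambda>x. F j x - f x) + Lp_norm M 2 (\<lambda>x. G j x - g x)) \<longlonglongrightarrow> 0"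
    using tendsto_add[OF Lp2_tendstoD(3)[OF assms(1)] Lp2_tendstoD(3)[OF assms(2)]] by simp
qed (use assms in \<open>auto intro!: Lp2_add dest: Lp2_tendstoD\<close>)

lemma Lp2_tendsto_cmult:
  assumes "Lp_tendsto M 2 F f"
  shows "Lp_tendsto M 2 (\<lambda>j x. c * F j x) (\<lambda>x. c * f x)"
proof (rule Lp2_tendstoI)
  show "Lp_norm M 2 (\<lambda>x. c * F j x - c * f x) \<le> \<bar>c\<bar> * Lp_norm M 2 (\<lambda>x. F j x - f x)" for j
    using Lp2_norm_cmult[of M c "\<lambda>x. F j x - f x"] by (simp add: right_diff_distrib)
  show "(\<lambda>j. \<bar>c\<bar> * Lp_norm M 2 (\<lambda>x. F j x - f x)) \<longlonglongrightarrow> 0"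
    using tendsto_mult_right_zero[OF Lp2_tendstoD(3)[OF assms]] .
qed (use assms in \<open>auto intro!: Lp2_cmult dest: Lp2_tendstoD\<close>)

lemma Lp2_tendsto_diff:
  assumes "Lp_tendsto M 2 F f" "Lp_tendsto M 2 G g"
  shows "Lp_tendsto M 2 (\<lambda>j x. F j x - G j x) (\<lambda>x. f x - g x)"
  using Lp2_tendsto_add[OF assms(1) Lp2_tendsto_cmult[OF assms(2), of "-1"]] by simp

lemma Lp2_tendsto_norm:
  assumes "Lp_tendsto M 2 F f"
  shows "(\<lambda>j. Lp_norm M 2 (F j)) \<longlonglongrightarrow> Lp_norm M 2 f"
proof -
  have "(\<lambda>j. Lp_norm M 2 (F j) - Lp_norm M 2 f) \<longlonglongrightarrow> 0"
    by (rule Lim_null_comparison[OF always_eventually Lp2_tendstoD(3)[OF assms]])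
      (use Lp2_norm_diff_le Lp2_tendstoD[OF assms] in auto)
  then show ?thesis by (simp add: LIM_zero_iff)
qed

lemma Lp2_tendsto_inner:
  assumes "Lp_tendsto M 2 F f" "g \<in> Lp M 2"
  shows "(\<lambda>j. \<integral>x. F j x * g x \<partial>M) \<longlonglongrightarrow> (\<integral>x. f x * g x \<partial>M)"
proof -
  have "(\<lambda>j. (\<integral>x. F j x * g x \<partial>M) - (\<integral>x. f x * g x \<partial>M)) \<longlonglongrightarrow> 0"
  proof (rule Lim_null_comparison[OF always_eventually])
    show "\<forall>j. norm ((\<integral>x. F j x * g x \<partial>M) - (\<integral>x. f x * g x \<partial>M)) \<le> Lp_norm M 2 (\<lambda>x. F j x - f x) * Lp_norm M 2 g"
    proof
      fix j
      have "(\<integral>x. F j x * g x \<partial>M) - (\<integral>x. f x * g x \<partial>M) = (\<integral>x. (F j x - f x) * g x \<partial>M)"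
        using Lp2_integrable_mult[OF Lp2_tendstoD(1)[OF assms(1)] assms(2)]
          Lp2_integrable_mult[OF Lp2_tendstoD(2)[OF assms(1)] assms(2)]
        by (simp add: left_diff_distrib)
      then show "norm ((\<integral>x. F j x * g x \<partial>M) - (\<integral>x. f x * g x \<partial>M)) \<le> Lp_norm M 2 (\<lambda>x. F j x - f x) * Lp_norm M 2 g"
        using Lp2_Cauchy_Schwarz[OF Lp2_diff[OF Lp2_tendstoD(1,2)[OF assms(1)]] assms(2), of j] by simp
    qed
    show "(\<lambda>j. Lp_norm M 2 (\<lambda>x. F j x - f x) * Lp_norm M 2 g) \<longlonglongrightarrow> 0"
      using tendsto_mult_left_zero[OF Lp2_tendstoD(3)[OF assms(1)]] .
  qed
  then show ?thesis by (simp add: LIM_zero_iff)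
qed

lemma Lp2_tendsto_AE_subseq:
  assumes "Lp_tendsto M 2 F f"
  shows "\<exists>r. strict_mono r \<and> (AE x in M. (\<lambda>j. F (r j) x) \<longlonglongrightarrow> f x)"
proof -
  have "(\<lambda>j. (Lp_norm M 2 (\<lambda>x. F j x - f x))\<^sup>2) \<longlonglongrightarrow> 0"
    using tendsto_power[OF Lp2_tendstoD(3)[OF assms], of 2] by simp
  then have "(\<lambda>j. \<integral>x. norm ((F j x - f x)\<^sup>2) \<partial>M) \<longlonglongrightarrow> 0"
    by (simp add: Lp2_norm_square)
  then obtain r where r: "strict_mono r" "AE x in M. (\<lambda>j. (F (r j) x - f x)\<^sup>2) \<longlonglongrightarrow> 0"
    using tendsto_L1_AE_subseq[of M "\<lambda>j x. (F j x - f x)\<^sup>2"]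
      Lp2_integrable_square[OF Lp2_diff[OF Lp2_tendstoD(1,2)[OF assms]]] by blast
  have "AE x in M. (\<lambda>j. F (r j) x) \<longlonglongrightarrow> f x"
    using r(2)
  proof eventually_elim
    case (elim x)
    have "(\<lambda>j. sqrt ((F (r j) x - f x)\<^sup>2)) \<longlonglongrightarrow> sqrt 0" by (rule tendsto_real_sqrt[OF elim])
    then show ?case by (simp add: tendsto_rabs_zero_iff LIM_zero_iff)
  qed
  with r(1) show ?thesis by blast
qed

text \<open>
  Completeness: a rapidly converging subsequence converges almost everywhere, and Fatou's lemma turns
  this into convergence in norm.
\<close>

lemma Lp2_complete:
  fixes F :: "nat \<Rightarrow> 'a \<Rightarrow> real"
  assumes F: "\<And>j. F j \<in> Lp M 2"
    and Cauchy: "\<And>e. e > 0 \<Longrightarrow> \<exists>n0. \<forall>m\<ge>n0. \<forall>n\<ge>n0. Lp_norm M 2 (\<lambda>x. F m x - F n x) < e"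
  shows "\<exists>f. Lp_tendsto M 2 F f"
proof -
  have [measurable]: "F j \<in> borel_measurable M" for j using F Lp2_measurable by blast
  have "\<exists>r. \<forall>k. (\<forall>m\<ge>r k. \<forall>n\<ge>r k. Lp_norm M 2 (\<lambda>x. F m x - F n x) < (1/2)^k) \<and> r (Suc k) > r k"
  proof (intro dependent_nat_choice, goal_cases)
    case 1
    then show ?case using Cauchy[of "(1/2)^0"] by simp
  next
    case (2 n k)
    obtain n0 where n0: "\<forall>m\<ge>n0. \<forall>n\<ge>n0. Lp_norm M 2 (\<lambda>x. F m x - F n x) < (1/2)^Suc k"
      using Cauchy[of "(1/2)^Suc k"] by auto
    then show ?case by (intro exI[of _ "max n0 (Suc n)"]) auto
  qed
  then obtain r where r: "\<And>k m n. m \<ge> r k \<Longrightarrow> n \<ge> r k \<Longrightarrow> Lp_norm M 2 (\<lambda>x. F m x - F n x) < (1/2)^k"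
    and rs: "\<And>k. r (Suc k) > r k" by blast
  have sm: "strict_mono r" by (simp add: rs strict_mono_Suc_iff)
  define D where "D k x = F (r (Suc k)) x - F (r k) x" for k x
  have D: "D k \<in> Lp M 2" for k unfolding D_def by (intro Lp2_diff F)
  have [measurable]: "D k \<in> borel_measurable M" for k using D Lp2_measurable by blast
  have Dn: "Lp_norm M 2 (D k) < (1/2)^k" for k
    unfolding D_def using r[of k "r (Suc k)" "r k"] rs[of k] by simp
  \<comment> \<open>Weights \<open>(3/2)^k\<close> keep the series of squares summable, which forces \<open>\<bar>D k x\<bar>\<close> to decay geometrically.\<close>
  have fin: "(\<integral>\<^sup>+x. (\<Sum>k. ennreal ((3/2)^k * (D k x)\<^sup>2)) \<partial>M) < \<infinity>"
  proof -
    have "(\<integral>\<^sup>+x. (\<Sum>k. ennreal ((3/2)^k * (D k x)\<^sup>2)) \<partial>M) = (\<Sum>k. \<integral>\<^sup>+x. ennreal ((3/2)^k * (D k x)\<^sup>2) \<partial>M)"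
      by (intro nn_integral_suminf) measurable
    also have "\<dots> \<le> (\<Sum>k. ennreal ((3/8)^k))"
    proof (intro suminf_le)
      fix k
      have "(\<integral>\<^sup>+x. ennreal ((3/2)^k * (D k x)\<^sup>2) \<partial>M) = ennreal ((3/2)^k * (Lp_norm M 2 (D k))\<^sup>2)"
        using Lp2_integrable_square[OF D[of k]]
        by (subst nn_integral_eq_integral) (auto simp: Lp2_norm_square)
      also have "\<dots> \<le> ennreal ((3/8)^k)"
      proof (rule ennreal_leI)
        have "(Lp_norm M 2 (D k))\<^sup>2 \<le> ((1/2)^k)\<^sup>2" using Dn[of k] by (intro power_mono) auto
        then have "(3/2)^k * (Lp_norm M 2 (D k))\<^sup>2 \<le> (3/2)^k * ((1/2)^k)\<^sup>2" by (intro mult_left_mono) auto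
        also have "\<dots> = ((3/2) * ((1/2) * (1/2)))^k"
          by (simp only: power_mult_distrib power2_eq_square)
        finally show "(3/2)^k * (Lp_norm M 2 (D k))\<^sup>2 \<le> (3/8)^k" by simp
      qed
      finally show "(\<integral>\<^sup>+x. ennreal ((3/2)^k * (D k x)\<^sup>2) \<partial>M) \<le> ennreal ((3/8)^k)" .
    qed auto
    also have "\<dots> = ennreal (\<Sum>k. (3/8)^k)"
      by (rule suminf_ennreal2) (auto intro!: summable_geometric)
    finally show ?thesis by (rule le_less_trans) simp
  qed
  have "AE x in M. (\<Sum>k. ennreal ((3/2)^k * (D k x)\<^sup>2)) \<noteq> \<infinity>"
    by (rule nn_integral_noteq_infinite) (use fin in auto)
  then have conv: "AE x in M. convergent (\<lambda>k. F (r k) x)"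
  proof eventually_elim
    case (elim x)
    have s1: "summable (\<lambda>k. (3/2)^k * (D k x)\<^sup>2)"
      using elim by (intro summable_suminf_not_top) auto
    have "summable (\<lambda>k. \<bar>D k x\<bar>)"
    proof (rule summable_comparison_test'[where N = 0])
      show "summable (\<lambda>k. (3/2)^k * (D k x)\<^sup>2 + (2/3)^k)"
        by (intro summable_add s1 summable_geometric) simp
      fix k
      define p :: real where "p = sqrt ((3/2)^k)"
      define q :: real where "q = sqrt ((2/3)^k)"
      have pq: "p * q = 1"
      proof -
        have "p * q = sqrt ((3/2)^k * (2/3)^k)" unfolding p_def q_def by (rule real_sqrt_mult[symmetric])
        also have "(3/2)^k * (2/3)^k = ((3/2) * (2/3) :: real)^k" by (rule power_mult_distrib[symmetric])
        finally show ?thesis by simp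
      qed
      have "2 * (p * \<bar>D k x\<bar>) * q \<le> (p * \<bar>D k x\<bar>)\<^sup>2 + q\<^sup>2"
        by (rule sum_squares_bound)
      also have "2 * (p * \<bar>D k x\<bar>) * q = 2 * \<bar>D k x\<bar> * (p * q)"
        by (simp only: ac_simps)
      also have "(p * \<bar>D k x\<bar>)\<^sup>2 + q\<^sup>2 = (3/2)^k * (D k x)\<^sup>2 + (2/3)^k"
        by (simp add: p_def q_def power_mult_distrib)
      finally have "2 * \<bar>D k x\<bar> \<le> (3/2)^k * (D k x)\<^sup>2 + (2/3)^k"
        unfolding pq by simp
      then show "norm \<bar>D k x\<bar> \<le> (3/2)^k * (D k x)\<^sup>2 + (2/3)^k" by simp
    qed
    then have "summable (\<lambda>k. D k x)" by (rule summable_rabs_cancel)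
    then have "convergent (\<lambda>n. \<Sum>k<n. D k x)" by (simp add: summable_iff_convergent)
    moreover have "(\<Sum>k<n. D k x) = F (r n) x - F (r 0) x" for n
      using sum_lessThan_telescope[of "\<lambda>k. F (r k) x" n] by (simp add: D_def)
    ultimately show ?case by (simp add: convergent_diff_const_right_iff)
  qed
  define f where "f x = lim (\<lambda>k. F (r k) x)" for x
  have [measurable]: "f \<in> borel_measurable M" unfolding f_def by measurable
  have lim: "AE x in M. (\<lambda>k. F (r k) x) \<longlonglongrightarrow> f x"
    using conv by eventually_elim (simp add: f_def convergent_LIMSEQ_iff)
  have Fatou: "(\<integral>\<^sup>+x. ennreal ((F m x - f x)\<^sup>2) \<partial>M) \<le> ennreal (((1/2)^k)\<^sup>2)" if "m \<ge> r k" for m k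
  proof -
    have "(\<integral>\<^sup>+x. ennreal ((F m x - f x)\<^sup>2) \<partial>M) = (\<integral>\<^sup>+x. liminf (\<lambda>l. ennreal ((F m x - F (r l) x)\<^sup>2)) \<partial>M)"
    proof (rule nn_integral_cong_AE, use lim in eventually_elim)
      case (elim x)
      have "(\<lambda>l. ennreal ((F m x - F (r l) x)\<^sup>2)) \<longlonglongrightarrow> ennreal ((F m x - f x)\<^sup>2)"
        by (intro tendsto_intros elim)
      then show ?case by (intro lim_imp_Liminf[symmetric]) auto
    qed
    also have "\<dots> \<le> liminf (\<lambda>l. \<integral>\<^sup>+x. ennreal ((F m x - F (r l) x)\<^sup>2) \<partial>M)"
      by (rule nn_integral_liminf) measurable
    also have "\<dots> \<le> ennreal (((1/2)^k)\<^sup>2)"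
    proof (rule Liminf_le)
      show "\<forall>\<^sub>F l in sequentially. (\<integral>\<^sup>+x. ennreal ((F m x - F (r l) x)\<^sup>2) \<partial>M) \<le> ennreal (((1/2)^k)\<^sup>2)"
        using eventually_ge_at_top[of k]
      proof eventually_elim
        case (elim l)
        have "r l \<ge> r k" using sm elim by (simp add: strict_mono_less_eq)
        then have "(Lp_norm M 2 (\<lambda>x. F m x - F (r l) x))\<^sup>2 \<le> ((1/2)^k)\<^sup>2"
          using r[OF that] by (intro power_mono) (auto intro: less_imp_le)
        then show ?case
          using Lp2_integrable_square[OF Lp2_diff[OF F F]]
          by (subst nn_integral_eq_integral) (auto simp: Lp2_norm_square ennreal_leI)
      qed
    qed simp
    finally show ?thesis .
  qed
  have diff: "(\<lambda>x. F m x - f x) \<in> Lp M 2" if "m \<ge> r 0" for m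
    using le_less_trans[OF Fatou[OF that] ennreal_less_top] by (auto simp: Lp2_iff integrable_iff_bounded)
  have f: "f \<in> Lp M 2"
    using Lp2_diff[OF F[of "r 0"] diff[of "r 0"]] by simp
  have norm: "Lp_norm M 2 (\<lambda>x. F m x - f x) \<le> (1/2)^k" if "m \<ge> r k" for m k
  proof -
    have "ennreal ((Lp_norm M 2 (\<lambda>x. F m x - f x))\<^sup>2) \<le> ennreal (((1/2)^k)\<^sup>2)"
      using Fatou[OF that] Lp2_integrable_square[OF Lp2_diff[OF F f]]
      by (subst (asm) nn_integral_eq_integral) (auto simp: Lp2_norm_square)
    then have "(Lp_norm M 2 (\<lambda>x. F m x - f x))\<^sup>2 \<le> ((1/2)^k)\<^sup>2" by simp
    then show ?thesis by (rule power2_le_imp_le) simp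
  qed
  have "(\<lambda>j. Lp_norm M 2 (\<lambda>x. F j x - f x)) \<longlonglongrightarrow> 0"
  proof (rule LIMSEQ_I)
    fix e :: real assume "e > 0"
    then obtain k where k: "(1/2)^k < e" using real_arch_pow_inv[of e "1/2"] by auto
    show "\<exists>no. \<forall>n\<ge>no. norm (Lp_norm M 2 (\<lambda>x. F n x - f x) - 0) < e"
      using norm[of k] k by (intro exI[of _ "r k"]) (auto intro: le_less_trans)
  qed
  then show ?thesis using F f by (auto simp: Lp_tendsto_def)
qed

text \<open>
  In \<open>\<theta> j G j - \<theta>' g = \<theta> j (G j - g) + (\<theta> j - \<theta>') g\<close> the first term is small because the \<open>\<theta> j\<close> are bounded, the
  second one by dominated convergence.
\<close>

lemma Lp2_tendsto_mult_bounded: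
  assumes g: "Lp_tendsto M 2 G g"
    and [measurable]: "\<And>j. \<theta> j \<in> borel_measurable M" "\<theta>' \<in> borel_measurable M"
    and bound: "\<And>j x. x \<in> space M \<Longrightarrow> \<bar>\<theta> j x\<bar> \<le> C" "\<And>x. x \<in> space M \<Longrightarrow> \<bar>\<theta>' x\<bar> \<le> C"
    and lim: "AE x in M. (\<lambda>j. \<theta> j x) \<longlonglongrightarrow> \<theta>' x"
  shows "Lp_tendsto M 2 (\<lambda>j x. \<theta> j x * G j x) (\<lambda>x. \<theta>' x * g x)"
proof -
  have G2: "G j \<in> Lp M 2" "g \<in> Lp M 2" for j using Lp2_tendstoD[OF g] by auto
  have [measurable]: "g \<in> borel_measurable M" using G2 Lp2_measurable by blast
  have "(\<lambda>j. \<integral>x. ((\<theta> j x - \<theta>' x) * g x)\<^sup>2 \<partial>M) \<longlonglongrightarrow> (\<integral>x. 0 \<partial>M)"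
  proof (rule integral_dominated_convergence)
    show "integrable M (\<lambda>x. (2 * C)\<^sup>2 * (g x)\<^sup>2)" using Lp2_integrable_square[OF G2(2)] by simp
    show "AE x in M. (\<lambda>j. ((\<theta> j x - \<theta>' x) * g x)\<^sup>2) \<longlonglongrightarrow> 0"
      using lim
    proof eventually_elim
      case (elim x)
      then have "(\<lambda>j. ((\<theta> j x - \<theta>' x) * g x)\<^sup>2) \<longlonglongrightarrow> ((\<theta>' x - \<theta>' x) * g x)\<^sup>2" by (intro tendsto_intros)
      then show ?case by simp
    qed
    show "AE x in M. norm (((\<theta> j x - \<theta>' x) * g x)\<^sup>2) \<le> (2 * C)\<^sup>2 * (g x)\<^sup>2" for j
    proof (rule AE_I2)
      fix x assume x: "x \<in> space M"
      have "(\<theta> j x - \<theta>' x)\<^sup>2 \<le> (2 * C)\<^sup>2"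
        using bound(1)[OF x, of j] bound(2)[OF x] by (intro abs_le_square_iff[THEN iffD1]) linarith
      then show "norm (((\<theta> j x - \<theta>' x) * g x)\<^sup>2) \<le> (2 * C)\<^sup>2 * (g x)\<^sup>2"
        by (auto simp: power_mult_distrib intro!: mult_right_mono)
    qed
  qed measurable
  then have "(\<lambda>j. sqrt (\<integral>x. ((\<theta> j x - \<theta>' x) * g x)\<^sup>2 \<partial>M)) \<longlonglongrightarrow> sqrt 0"
    by (intro tendsto_real_sqrt) simp
  then have lim2: "(\<lambda>j. Lp_norm M 2 (\<lambda>x. (\<theta> j x - \<theta>' x) * g x)) \<longlonglongrightarrow> 0" by (simp add: Lp2_norm)
  show ?thesis
  proof (rule Lp2_tendstoI)
    show "(\<lambda>x. \<theta> j x * G j x) \<in> Lp M 2" for j using G2 bound by (intro Lp2_bounded_mult[where C = C]) auto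
    show "(\<lambda>x. \<theta>' x * g x) \<in> Lp M 2" using G2 bound by (intro Lp2_bounded_mult[where C = C]) auto
    show "(\<lambda>j. \<bar>C\<bar> * Lp_norm M 2 (\<lambda>x. G j x - g x) + Lp_norm M 2 (\<lambda>x. (\<theta> j x - \<theta>' x) * g x)) \<longlonglongrightarrow> 0"
      using tendsto_add[OF tendsto_mult_right_zero[OF Lp2_tendstoD(3)[OF g], of "\<bar>C\<bar>"] lim2] by simp
    fix j
    have a: "(\<lambda>x. \<theta> j x * (G j x - g x)) \<in> Lp M 2"
      using G2 bound by (intro Lp2_bounded_mult[where C = C] Lp2_diff) auto
    have b: "(\<lambda>x. (\<theta> j x - \<theta>' x) * g x) \<in> Lp M 2"
    proof (rule Lp2_bounded_mult[where C = "C + C"])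
      show "\<bar>\<theta> j x - \<theta>' x\<bar> \<le> C + C" if "x \<in> space M" for x
        using bound(1)[OF that, of j] bound(2)[OF that] by linarith
    qed (use G2 in auto)
    have "Lp_norm M 2 (\<lambda>x. \<theta> j x * G j x - \<theta>' x * g x)
        = Lp_norm M 2 (\<lambda>x. \<theta> j x * (G j x - g x) + (\<theta> j x - \<theta>' x) * g x)"
      by (simp add: algebra_simps)
    also have "\<dots> \<le> Lp_norm M 2 (\<lambda>x. \<theta> j x * (G j x - g x)) + Lp_norm M 2 (\<lambda>x. (\<theta> j x - \<theta>' x) * g x)"
      by (rule Lp2_triangle[OF a b])
    also have "Lp_norm M 2 (\<lambda>x. \<theta> j x * (G j x - g x)) \<le> Lp_norm M 2 (\<lambda>x. C * (G j x - g x))"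
    proof (rule Lp2_norm_mono[OF Lp2_cmult[OF Lp2_diff[OF G2]] Lp2_measurable[OF a]], rule AE_I2)
      show "\<bar>\<theta> j x * (G j x - g x)\<bar> \<le> \<bar>C * (G j x - g x)\<bar>" if "x \<in> space M" for x
        unfolding abs_mult using bound(1)[OF that, of j] by (intro mult_right_mono) auto
    qed
    also have "\<dots> = \<bar>C\<bar> * Lp_norm M 2 (\<lambda>x. G j x - g x)" by (rule Lp2_norm_cmult)
    finally show "Lp_norm M 2 (\<lambda>x. \<theta> j x * G j x - \<theta>' x * g x)
        \<le> \<bar>C\<bar> * Lp_norm M 2 (\<lambda>x. G j x - g x) + Lp_norm M 2 (\<lambda>x. (\<theta> j x - \<theta>' x) * g x)" by simp
  qed
qed

lemma Lp2_parallelogram: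
  assumes "f \<in> Lp M 2" "g \<in> Lp M 2"
  shows "(Lp_norm M 2 (\<lambda>x. (f x + g x) / 2))\<^sup>2 + (Lp_norm M 2 (\<lambda>x. (f x - g x) / 2))\<^sup>2
    = ((Lp_norm M 2 f)\<^sup>2 + (Lp_norm M 2 g)\<^sup>2) / 2"
proof -
  note i = Lp2_integrable_square[OF assms(1)] Lp2_integrable_square[OF assms(2)]
    Lp2_integrable_square[OF Lp2_add[OF assms]] Lp2_integrable_square[OF Lp2_diff[OF assms]]
  have "(Lp_norm M 2 (\<lambda>x. (f x + g x) / 2))\<^sup>2 + (Lp_norm M 2 (\<lambda>x. (f x - g x) / 2))\<^sup>2
      = (\<integral>x. ((f x + g x) / 2)\<^sup>2 + ((f x - g x) / 2)\<^sup>2 \<partial>M)"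
    using i(3,4) by (simp add: Lp2_norm_square power_divide)
  also have "\<dots> = (\<integral>x. ((f x)\<^sup>2 + (g x)\<^sup>2) / 2 \<partial>M)"
    by (intro Bochner_Integration.integral_cong) (auto simp: power_divide power2_sum power2_diff field_simps)
  also have "\<dots> = ((Lp_norm M 2 f)\<^sup>2 + (Lp_norm M 2 g)\<^sup>2) / 2"
    using i(1,2) by (simp add: Lp2_norm_square)
  finally show ?thesis .
qed

text \<open>
  The projection onto the closure of a convex set, with its variational inequality: the distances of
  a minimising sequence and of its midpoints are controlled by the parallelogram law.
\<close>

lemma Lp2_nearest_point:
  assumes A: "A \<subseteq> Lp M 2" "A \<noteq> {}" and z: "z \<in> Lp M 2"
    and convex: "\<And>a b t. a \<in> A \<Longrightarrow> b \<in> A \<Longrightarrow> 0 \<le> t \<Longrightarrow> t \<le> 1 \<Longrightarrow> (\<lambda>x. (1 - t) * a x + t * b x) \<in> A"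
  shows "\<exists>p y. (\<forall>k. y k \<in> A) \<and> Lp_tendsto M 2 y p \<and> (\<forall>a\<in>A. (\<integral>x. (z x - p x) * (a x - p x) \<partial>M) \<le> 0)"
proof -
  define D where "D a = (Lp_norm M 2 (\<lambda>x. z x - a x))\<^sup>2" for a
  define d where "d = (INF a\<in>A. D a)"
  have bdd: "bdd_below (D ` A)" by (auto simp: D_def intro!: bdd_belowI[of _ 0])
  have dle: "d \<le> D a" if "a \<in> A" for a unfolding d_def by (rule cINF_lower[OF bdd that])
  have "\<exists>a\<in>A. D a < d + e" if "e > 0" for e
    using cINF_less_iff[OF A(2) bdd, of "d + e"] that unfolding d_def by auto
  then have "\<forall>k. \<exists>a\<in>A. D a < d + 1 / real (Suc k)" by simp
  then obtain y where yA: "\<And>k. y k \<in> A" and yD: "\<And>k. D (y k) < d + 1 / real (Suc k)" by metis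
  have y2: "y k \<in> Lp M 2" for k using yA A by blast
  have close: "(Lp_norm M 2 (\<lambda>x. y m x - y n x))\<^sup>2 \<le> 4 / real (Suc k)" if "m \<ge> k" "n \<ge> k" for m n k
  proof -
    have mid: "(\<lambda>x. (1 - 1/2) * y m x + (1/2) * y n x) \<in> A" by (rule convex[OF yA yA]) auto
    have "D (\<lambda>x. (1 - 1/2) * y m x + (1/2) * y n x) + (Lp_norm M 2 (\<lambda>x. (1/2) * (y n x - y m x)))\<^sup>2
      = (D (y m) + D (y n)) / 2"
      using Lp2_parallelogram[OF Lp2_diff[OF z y2[of m]] Lp2_diff[OF z y2[of n]]]
      unfolding D_def by (simp add: diff_divide_distrib add_divide_distrib algebra_simps)
    moreover have "(Lp_norm M 2 (\<lambda>x. (1/2) * (y n x - y m x)))\<^sup>2 = (Lp_norm M 2 (\<lambda>x. y m x - y n x))\<^sup>2 / 4"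
      unfolding Lp2_norm_cmult Lp2_norm_minus_commute[of M "y n" "y m"] by (simp add: power_mult_distrib power_divide)
    moreover have "D (y m) < d + 1 / real (Suc k)" "D (y n) < d + 1 / real (Suc k)"
      using yD[of m] yD[of n] that
      by (auto intro!: less_le_trans[OF yD] add_left_mono divide_left_mono)
    ultimately have "(Lp_norm M 2 (\<lambda>x. y m x - y n x))\<^sup>2 \<le> 4 * (1 / real (Suc k))"
      using dle[OF mid] by argo
    then show ?thesis by simp
  qed
  have "\<exists>p. Lp_tendsto M 2 y p"
  proof (rule Lp2_complete[OF y2])
    fix e :: real assume e: "e > 0"
    obtain k where k: "1 / real (Suc k) < e\<^sup>2 / 4"
      using e by (metis divide_pos_pos inverse_eq_divide reals_Archimedean zero_less_numeral zero_less_power)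
    have "Lp_norm M 2 (\<lambda>x. y m x - y n x) < e" if "m \<ge> k" "n \<ge> k" for m n
    proof -
      have "(Lp_norm M 2 (\<lambda>x. y m x - y n x))\<^sup>2 \<le> 4 * (1 / real (Suc k))" using close[OF that] by simp
      also have "\<dots> < e\<^sup>2" using k by argo
      finally show ?thesis using e by (intro power2_less_imp_less[of _ e]) auto
    qed
    then show "\<exists>n0. \<forall>m\<ge>n0. \<forall>n\<ge>n0. Lp_norm M 2 (\<lambda>x. y m x - y n x) < e" by blast
  qed
  then obtain p where p: "Lp_tendsto M 2 y p" by blast
  have p2: "p \<in> Lp M 2" using Lp2_tendstoD[OF p] by blast
  have Dlim: "(\<lambda>k. D (\<lambda>x. (1 - t) * y k x + t * a x)) \<longlonglongrightarrow> D (\<lambda>x. (1 - t) * p x + t * a x)" if "a \<in> Lp M 2" for a t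
    unfolding D_def
    by (intro tendsto_power Lp2_tendsto_norm Lp2_tendsto_diff Lp2_tendsto_add Lp2_tendsto_cmult Lp2_tendsto_const p z that)
  have "D p \<le> d"
  proof (rule LIMSEQ_le)
    show "(\<lambda>k. D (y k)) \<longlonglongrightarrow> D p" using Dlim[of p 0] p2 by simp
    show "(\<lambda>k. d + 1 / real (Suc k)) \<longlonglongrightarrow> d"
      using tendsto_add[OF tendsto_const LIMSEQ_Suc[OF lim_1_over_n], of d] by simp
    show "\<exists>N. \<forall>n\<ge>N. D (y n) \<le> d + 1 / real (Suc n)" using yD less_imp_le by blast
  qed
  have "(\<integral>x. (z x - p x) * (a x - p x) \<partial>M) \<le> 0" if a: "a \<in> A" for a
  proof (rule ccontr)
    define I where "I = (\<integral>x. (z x - p x) * (a x - p x) \<partial>M)"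
    define J where "J = (\<integral>x. (a x - p x)\<^sup>2 \<partial>M)"
    assume "\<not> (\<integral>x. (z x - p x) * (a x - p x) \<partial>M) \<le> 0"
    then have I: "I > 0" by (simp add: I_def)
    have a2: "a \<in> Lp M 2" using a A by blast
    have J: "J \<ge> 0" by (simp add: J_def)
    have key: "2 * I \<le> t * J" if t: "0 < t" "t \<le> 1" for t
    proof -
      have "d \<le> D (\<lambda>x. (1 - t) * p x + t * a x)"
        by (rule LIMSEQ_le_const[OF Dlim[OF a2]]) (use dle convex[OF yA a] t in auto)
      also have "D (\<lambda>x. (1 - t) * p x + t * a x)
        = (\<integral>x. (z x - p x)\<^sup>2 - (2 * t) * ((z x - p x) * (a x - p x)) + t\<^sup>2 * (a x - p x)\<^sup>2 \<partial>M)"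
        unfolding D_def Lp2_norm_square
        by (intro Bochner_Integration.integral_cong) (auto simp: power2_eq_square algebra_simps)
      also have "\<dots> = D p - 2 * t * I + t\<^sup>2 * J"
        using Lp2_integrable_square[OF Lp2_diff[OF z p2]] Lp2_integrable_square[OF Lp2_diff[OF a2 p2]]
          Lp2_integrable_mult[OF Lp2_diff[OF z p2] Lp2_diff[OF a2 p2]]
        by (simp add: I_def J_def D_def Lp2_norm_square)
      finally have "t * (2 * I) \<le> t * (t * J)" using \<open>D p \<le> d\<close> by (simp add: power2_eq_square algebra_simps)
      then show ?thesis using t by simp
    qed
    have "2 * I \<le> min 1 (I / (J + 1)) * J" using I J by (intro key) auto
    also have "\<dots> \<le> I / (J + 1) * J" using J by (intro mult_right_mono) auto
    also have "\<dots> \<le> I" using I J by (simp add: field_simps)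
    finally show False using I by simp
  qed
  then show ?thesis using yA p by blast
qed

section \<open>Pointwise Lipschitz constants\<close>

text \<open>
  \<open>lip_le F x L\<close> says that \<open>F\<close> is Lipschitz at \<open>x\<close> up to first order with constant \<open>L\<close>.  It is the
  form of \<open>pt_Lip F x \<le> L\<close> that can be computed with, and \<open>L = 0\<close> means that \<open>F\<close> is constant
  to first order at \<open>x\<close>.
\<close>

definition lip_le :: "('a::metric_space \<Rightarrow> real) \<Rightarrow> 'a \<Rightarrow> real \<Rightarrow> bool" where
  "lip_le F x L \<longleftrightarrow> 0 \<le> L \<and> (\<forall>e>0. \<forall>\<^sub>F y in nhds x. \<bar>F y - F x\<bar> \<le> (L + e) * dist x y)"

lemma lip_leD: "lip_le F x L \<Longrightarrow> e > 0 \<Longrightarrow> \<forall>\<^sub>F y in nhds x. \<bar>F y - F x\<bar> \<le> (L + e) * dist x y"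
  and lip_le_nonneg: "lip_le F x L \<Longrightarrow> 0 \<le> L"
  by (auto simp: lip_le_def)

lemma lip_le_0: "lip_le (\<lambda>x. c) x 0"
  by (auto simp: lip_le_def)

lemma lip_le_add:
  assumes "lip_le F x a" "lip_le G x b"
  shows "lip_le (\<lambda>x. F x + G x) x (a + b)"
  unfolding lip_le_def
proof (intro conjI allI impI)
  show "0 \<le> a + b" using assms by (simp add: lip_le_nonneg)
  fix e :: real assume "e > 0"
  then have "\<forall>\<^sub>F y in nhds x. \<bar>F y - F x\<bar> \<le> (a + e/2) * dist x y" "\<forall>\<^sub>F y in nhds x. \<bar>G y - G x\<bar> \<le> (b + e/2) * dist x y"
    using assms by (auto intro!: lip_leD)
  then show "\<forall>\<^sub>F y in nhds x. \<bar>F y + G y - (F x + G x)\<bar> \<le> (a + b + e) * dist x y"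
  proof eventually_elim
    case (elim y)
    have "\<bar>F y + G y - (F x + G x)\<bar> \<le> (a + e/2) * dist x y + (b + e/2) * dist x y" using elim by linarith
    then show ?case by (simp add: algebra_simps)
  qed
qed

lemma lip_le_cmult:
  assumes "lip_le F x a"
  shows "lip_le (\<lambda>x. c * F x) x (\<bar>c\<bar> * a)"
  unfolding lip_le_def
proof (intro conjI allI impI)
  show "0 \<le> \<bar>c\<bar> * a" using assms by (simp add: lip_le_nonneg)
  fix e :: real assume e: "e > 0"
  have "\<forall>\<^sub>F y in nhds x. \<bar>F y - F x\<bar> \<le> (a + e/(\<bar>c\<bar>+1)) * dist x y"
    using e by (intro lip_leD[OF assms]) auto
  then show "\<forall>\<^sub>F y in nhds x. \<bar>c * F y - c * F x\<bar> \<le> (\<bar>c\<bar> * a + e) * dist x y"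
  proof eventually_elim
    case (elim y)
    have "\<bar>c * F y - c * F x\<bar> = \<bar>c\<bar> * \<bar>F y - F x\<bar>" by (simp add: abs_mult flip: right_diff_distrib)
    also have "\<dots> \<le> \<bar>c\<bar> * ((a + e/(\<bar>c\<bar>+1)) * dist x y)" using elim by (intro mult_left_mono) auto
    also have "\<dots> = (\<bar>c\<bar> * a + \<bar>c\<bar> * (e/(\<bar>c\<bar>+1))) * dist x y" by (simp add: algebra_simps)
    also have "\<dots> \<le> (\<bar>c\<bar> * a + e) * dist x y"
    proof (intro mult_right_mono add_left_mono)
      show "\<bar>c\<bar> * (e / (\<bar>c\<bar> + 1)) \<le> e" using e by (simp add: field_simps)
    qed auto
    finally show ?case .
  qed
qed

lemma lip_le_diff: "lip_le F x a \<Longrightarrow> lip_le G x b \<Longrightarrow> lip_le (\<lambda>x. F x - G x) x (a + b)"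
  using lip_le_add[of F x a "\<lambda>x. -1 * G x" b] lip_le_cmult[of G x b "-1"] by simp

lemma lip_le_tendsto:
  assumes "lip_le F x a"
  shows "(F \<longlongrightarrow> F x) (nhds x)"
proof -
  have "((\<lambda>y. F y - F x) \<longlongrightarrow> 0) (nhds x)"
  proof (rule Lim_null_comparison)
    show "\<forall>\<^sub>F y in nhds x. norm (F y - F x) \<le> (a + 1) * dist x y" using lip_leD[OF assms, of 1] by simp
    have "((\<lambda>y. (a + 1) * dist x y) \<longlongrightarrow> (a + 1) * dist x x) (nhds x)"
      by (intro tendsto_intros tendsto_dist filterlim_ident)
    then show "((\<lambda>y. (a + 1) * dist x y) \<longlongrightarrow> 0) (nhds x)" by simp
  qed
  then show ?thesis by (simp add: LIM_zero_iff)
qed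

text \<open>
  Up to a constant the function is the product of the two increments \<open>F y - F x\<close> and \<open>G y - G x\<close>, which is
  of second order.
\<close>

lemma lip_le_mult_error:
  assumes "lip_le F x a" "lip_le G x b"
  shows "lip_le (\<lambda>y. F y * G y - F x * G y - G x * F y) x 0"
  unfolding lip_le_def
proof (intro conjI allI impI)
  fix e :: real assume e: "e > 0"
  have b: "b \<ge> 0" using assms(2) by (rule lip_le_nonneg)
  have "\<forall>\<^sub>F y in nhds x. \<bar>F y - F x\<bar> < e / (b + 1)"
    using tendstoD[OF lip_le_tendsto[OF assms(1)], of "e / (b + 1)"] e b by (simp add: dist_real_def)
  moreover have "\<forall>\<^sub>F y in nhds x. \<bar>G y - G x\<bar> \<le> (b + 1) * dist x y" by (rule lip_leD[OF assms(2)]) simp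
  ultimately show "\<forall>\<^sub>F y in nhds x. \<bar>F y * G y - F x * G y - G x * F y - (F x * G x - F x * G x - G x * F x)\<bar>
      \<le> (0 + e) * dist x y"
  proof eventually_elim
    case (elim y)
    have "\<bar>F y * G y - F x * G y - G x * F y - (F x * G x - F x * G x - G x * F x)\<bar> = \<bar>F y - F x\<bar> * \<bar>G y - G x\<bar>"
      by (simp add: algebra_simps flip: abs_mult)
    also have "\<dots> \<le> (e / (b + 1)) * ((b + 1) * dist x y)" using elim e b by (intro mult_mono) auto
    also have "\<dots> = (0 + e) * dist x y" using b by simp
    finally show ?case .
  qed
qed simp

lemma lip_le_eq:
  assumes "lip_le F x L" "\<forall>\<^sub>F y in nhds x. G y = F y"
  shows "lip_le G x L"
  unfolding lip_le_def
proof (intro conjI allI impI)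
  show "0 \<le> L" using assms by (simp add: lip_le_nonneg)
  fix e :: real assume "e > 0"
  from lip_leD[OF assms(1) this] assms(2) show "\<forall>\<^sub>F y in nhds x. \<bar>G y - G x\<bar> \<le> (L + e) * dist x y"
    by eventually_elim (simp add: eventually_nhds_x_imp_x[OF assms(2)])
qed

lemma lip_le_mult:
  assumes "lip_le F x a" "lip_le G x b"
  shows "lip_le (\<lambda>y. F y * G y) x (\<bar>F x\<bar> * b + \<bar>G x\<bar> * a)"
  using lip_le_add[OF lip_le_mult_error[OF assms] lip_le_add[OF lip_le_cmult[OF assms(2)] lip_le_cmult[OF assms(1)]], of "F x" "G x"]
  by (simp add: algebra_simps)

text \<open>
  Together with \<open>lip_le_mult_error\<close> this is the differential calculus needed later: equality up to a
  function of pointwise Lipschitz constant zero replaces equality of differentials.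
\<close>

lemma lip_le_compose_error:
  assumes "lip_le v x L" "(\<psi> has_real_derivative d) (at (v x))"
  shows "lip_le (\<lambda>y. \<psi> (v y) - d * v y) x 0"
  unfolding lip_le_def
proof (intro conjI allI impI)
  fix e :: real assume e: "e > 0"
  have L: "L \<ge> 0" using assms(1) by (rule lip_le_nonneg)
  define e' where "e' = e / (L + 1)"
  have e': "e' > 0" using e L by (simp add: e'_def)
  have "(\<psi> has_derivative (\<lambda>h. d * h)) (at (v x))"
    using assms(2) by (simp add: has_field_derivative_def)
  then obtain \<delta> where \<delta>: "\<delta> > 0" "\<And>s. norm (s - v x) < \<delta> \<Longrightarrow> norm (\<psi> s - \<psi> (v x) - d * (s - v x)) \<le> e' * norm (s - v x)"
    using e' unfolding has_derivative_at_alt by blast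
  have "\<forall>\<^sub>F y in nhds x. \<bar>v y - v x\<bar> < \<delta>"
    using tendstoD[OF lip_le_tendsto[OF assms(1)] \<delta>(1)] by (simp add: dist_real_def)
  moreover have "\<forall>\<^sub>F y in nhds x. \<bar>v y - v x\<bar> \<le> (L + 1) * dist x y" by (rule lip_leD[OF assms(1)]) simp
  ultimately show "\<forall>\<^sub>F y in nhds x. \<bar>\<psi> (v y) - d * v y - (\<psi> (v x) - d * v x)\<bar> \<le> (0 + e) * dist x y"
  proof eventually_elim
    case (elim y)
    have "\<bar>\<psi> (v y) - d * v y - (\<psi> (v x) - d * v x)\<bar> = norm (\<psi> (v y) - \<psi> (v x) - d * (v y - v x))"
      by (simp add: algebra_simps)
    also have "\<dots> \<le> e' * norm (v y - v x)" using elim(1) by (intro \<delta>) simp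
    also have "\<dots> \<le> e' * ((L + 1) * dist x y)" using elim(2) e' by (intro mult_left_mono) auto
    also have "\<dots> = (0 + e) * dist x y" using L by (simp add: e'_def)
    finally show ?case .
  qed
qed simp

lemma lip_le_lipschitz:
  assumes "C-lipschitz_on S F" "open S" "x \<in> S"
  shows "lip_le F x C"
  unfolding lip_le_def
proof (intro conjI allI impI)
  show "0 \<le> C" using assms(1) by (rule lipschitz_on_nonneg)
  fix e :: real assume "e > 0"
  have "\<forall>\<^sub>F y in nhds x. y \<in> S" using assms by (auto simp: eventually_nhds)
  then show "\<forall>\<^sub>F y in nhds x. \<bar>F y - F x\<bar> \<le> (C + e) * dist x y"
  proof eventually_elim
    case (elim y)
    have "\<bar>F y - F x\<bar> \<le> C * dist x y"
      using lipschitz_onD[OF assms(1,3) elim] by (simp add: dist_real_def abs_minus_commute)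
    also have "\<dots> \<le> (C + e) * dist x y" using \<open>e > 0\<close> by (intro mult_right_mono) auto
    finally show ?case .
  qed
qed

lemma Limsup_quotient_le:
  fixes F :: "'a::metric_space \<Rightarrow> real"
  assumes "\<forall>\<^sub>F y in at x. \<bar>F y - F x\<bar> \<le> c * dist x y"
  shows "Limsup (at x) (\<lambda>y. ereal (\<bar>F y - F x\<bar> / dist x y)) \<le> ereal c"
proof (rule Limsup_bounded)
  show "\<forall>\<^sub>F y in at x. ereal (\<bar>F y - F x\<bar> / dist x y) \<le> ereal c"
    using assms eventually_neq_at_within[of x x UNIV] by eventually_elim (simp add: divide_le_eq)
qed

lemma pt_Lip_le:
  assumes "lip_le F x L"
  shows "0 \<le> pt_Lip F x" "pt_Lip F x \<le> L"
proof -
  have "0 \<le> pt_Lip F x \<and> pt_Lip F x \<le> L"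
  proof (cases "x islimpt UNIV")
    case True
    then have nt: "\<not> trivial_limit (at x)" by (simp add: trivial_limit_within)
    define Q where "Q = Limsup (at x) (\<lambda>y. ereal (\<bar>F y - F x\<bar> / dist x y))"
    have "0 \<le> Q" unfolding Q_def
      by (rule order_trans[OF _ Liminf_le_Limsup[OF nt]]) (auto intro!: Liminf_bounded)
    have "Q \<le> ereal L + ereal e" if "e > 0" for e
      unfolding Q_def plus_ereal.simps using lip_leD[OF assms that]
      by (intro Limsup_quotient_le) (simp add: eventually_nhds_conv_at)
    then have "Q \<le> ereal L"
      by (rule ereal_le_epsilon2)
    then show ?thesis using True \<open>0 \<le> Q\<close>
      by (cases Q) (auto simp: pt_Lip_def pt_Lip_ereal_def Q_def[symmetric])
  next
    case False
    then show ?thesis using lip_le_nonneg[OF assms] by (simp add: pt_Lip_def pt_Lip_ereal_def)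
  qed
  then show "0 \<le> pt_Lip F x" "pt_Lip F x \<le> L" by auto
qed

lemma lip_le_pt_Lip:
  assumes "lip_le F x L"
  shows "lip_le F x (pt_Lip F x)"
  unfolding lip_le_def
proof (intro conjI allI impI)
  show "0 \<le> pt_Lip F x" by (rule pt_Lip_le[OF assms])
  fix e :: real assume e: "e > 0"
  show "\<forall>\<^sub>F y in nhds x. \<bar>F y - F x\<bar> \<le> (pt_Lip F x + e) * dist x y"
  proof (cases "x islimpt UNIV")
    case True
    then have nt: "\<not> trivial_limit (at x)" by (simp add: trivial_limit_within)
    define Q where "Q = Limsup (at x) (\<lambda>y. ereal (\<bar>F y - F x\<bar> / dist x y))"
    have "0 \<le> Q" unfolding Q_def
      by (rule order_trans[OF _ Liminf_le_Limsup[OF nt]]) (auto intro!: Liminf_bounded)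
    have "\<forall>\<^sub>F y in at x. \<bar>F y - F x\<bar> \<le> (L + 1) * dist x y"
      using lip_leD[OF assms, of 1] by (simp add: eventually_nhds_conv_at)
    then have "Q \<le> ereal (L + 1)" unfolding Q_def by (rule Limsup_quotient_le)
    then have Q: "Q = ereal (pt_Lip F x)" using True \<open>0 \<le> Q\<close>
      by (cases Q) (auto simp: pt_Lip_def pt_Lip_ereal_def Q_def[symmetric])
    have "Q < ereal (pt_Lip F x + e)" using e by (simp add: Q)
    then have "\<forall>\<^sub>F y in at x. ereal (\<bar>F y - F x\<bar> / dist x y) < ereal (pt_Lip F x + e)"
      unfolding Q_def by (rule Limsup_lessD)
    then have "\<forall>\<^sub>F y in at x. \<bar>F y - F x\<bar> \<le> (pt_Lip F x + e) * dist x y"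
      using eventually_neq_at_within[of x x UNIV]
    proof eventually_elim
      case (elim y)
      then have "\<bar>F y - F x\<bar> < (pt_Lip F x + e) * dist x y" by (simp add: divide_less_eq)
      then show ?case by (rule less_imp_le)
    qed
    then show ?thesis by (simp add: eventually_nhds_conv_at)
  next
    case False
    then have "open {x}" by (auto simp: islimpt_UNIV_iff)
    then show ?thesis unfolding eventually_nhds by (intro exI[of _ "{x}"]) auto
  qed
qed

lemma Lip_fun_lip_le: "F \<in> Lip_fun \<Longrightarrow> \<exists>L. lip_le F x L"
  unfolding Lip_fun_def using lip_le_lipschitz[OF _ open_UNIV UNIV_I] by blast

lemma Lip_loc_lip_le:
  assumes "F \<in> Lip_loc \<Omega>" "open \<Omega>" "x \<in> \<Omega>"
  shows "\<exists>L. lip_le F x L"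
proof -
  obtain r C where "r > 0" "C-lipschitz_on (ball x r \<inter> \<Omega>) F" using assms unfolding Lip_loc_def by blast
  then have "lip_le F x C" using assms by (intro lip_le_lipschitz[of C "ball x r \<inter> \<Omega>"]) (auto intro: open_Int)
  then show ?thesis ..
qed

lemma pt_Lip_add:
  assumes "lip_le F x a" "lip_le G x b"
  shows "pt_Lip (\<lambda>x. F x + G x) x \<le> pt_Lip F x + pt_Lip G x"
  by (rule pt_Lip_le(2)[OF lip_le_add[OF lip_le_pt_Lip[OF assms(1)] lip_le_pt_Lip[OF assms(2)]]])

lemma pt_Lip_cmult:
  assumes "lip_le F x a"
  shows "pt_Lip (\<lambda>x. c * F x) x \<le> \<bar>c\<bar> * pt_Lip F x"
  by (rule pt_Lip_le(2)[OF lip_le_cmult[OF lip_le_pt_Lip[OF assms(1)]]])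

lemma pt_Lip_minus_commute: "pt_Lip (\<lambda>x. F x - G x) x = pt_Lip (\<lambda>x. G x - F x) x"
proof -
  have "\<bar>F y - G y - (F x - G x)\<bar> = \<bar>G y - F y - (G x - F x)\<bar>" for y by linarith
  then show ?thesis by (simp add: pt_Lip_def pt_Lip_ereal_def)
qed

lemma pt_Lip_diff_le:
  assumes "lip_le F x a" "lip_le G x b"
  shows "\<bar>pt_Lip F x - pt_Lip G x\<bar> \<le> pt_Lip (\<lambda>x. F x - G x) x"
  using pt_Lip_add[OF lip_le_diff[OF assms] assms(2)] pt_Lip_add[OF lip_le_diff[OF assms(2,1)] assms(1)]
    pt_Lip_minus_commute[of F G x] by simp

lemma pt_Lip_mult:
  assumes "lip_le F x a" "lip_le G x b"
  shows "pt_Lip (\<lambda>y. F y * G y) x \<le> \<bar>F x\<bar> * pt_Lip G x + \<bar>G x\<bar> * pt_Lip F x"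
  by (rule pt_Lip_le(2)[OF lip_le_mult[OF lip_le_pt_Lip[OF assms(1)] lip_le_pt_Lip[OF assms(2)]]])

lemma pt_Lip_const[simp]: "pt_Lip (\<lambda>x. c) x = 0"
  using pt_Lip_le[OF lip_le_0[of c x]] by simp

text \<open>
  Measurability: the suprema of the difference quotients over punctured balls of a fixed radius are
  lower semicontinuous.
\<close>

lemma pt_Lip_measurable:
  fixes F :: "'a::metric_space \<Rightarrow> real"
  assumes F: "continuous_on UNIV F"
  shows "pt_Lip F \<in> borel_measurable borel"
proof -
  define S where "S k x = (SUP y\<in>{y. 0 < dist x y \<and> dist x y < 1 / real (Suc k)}. ereal (\<bar>F y - F x\<bar> / dist x y))" for k x
  have [measurable]: "S k \<in> borel_measurable borel" for k
  proof (rule borel_measurableI_greater)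
    fix a :: ereal
    have "open {x. S k x > a}"
    proof -
      have "{x. S k x > a} = (\<Union>y. {x. 0 < dist x y \<and> dist x y < 1 / real (Suc k) \<and> a < ereal (\<bar>F y - F x\<bar> / dist x y)})"
        by (auto simp: S_def less_SUP_iff)
      also have "open \<dots>"
      proof (intro open_UN ballI)
        fix y :: 'a
        have "open {x::'a. x \<noteq> y}" using open_Compl[OF closed_singleton[of y]] by (simp add: Compl_eq)
        moreover have "continuous_on {x. x \<noteq> y} (\<lambda>x. ereal (\<bar>F y - F x\<bar> / dist x y))"
          by (intro continuous_on_ereal continuous_intros continuous_on_subset[OF F]) auto
        ultimately have "open ({x. x \<noteq> y} \<inter> (\<lambda>x. ereal (\<bar>F y - F x\<bar> / dist x y)) -` {a<..})"
          by (intro continuous_open_preimage) auto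
        moreover have "open {x. dist x y < 1 / real (Suc k)}" by (intro open_Collect_less continuous_intros)
        ultimately have "open ({x. x \<noteq> y} \<inter> (\<lambda>x. ereal (\<bar>F y - F x\<bar> / dist x y)) -` {a<..} \<inter> {x. dist x y < 1 / real (Suc k)})"
          by (rule open_Int)
        also have "\<dots> = {x. 0 < dist x y \<and> dist x y < 1 / real (Suc k) \<and> a < ereal (\<bar>F y - F x\<bar> / dist x y)}" by auto
        finally show "open {x. 0 < dist x y \<and> dist x y < 1 / real (Suc k) \<and> a < ereal (\<bar>F y - F x\<bar> / dist x y)}" .
      qed
      finally show ?thesis .
    qed
    then show "{x \<in> space borel. S k x > a} \<in> sets borel" by simp
  qed
  have lim: "Limsup (at x) (\<lambda>y. ereal (\<bar>F y - F x\<bar> / dist x y)) = (INF k. S k x)" for x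
  proof (rule antisym)
    show "Limsup (at x) (\<lambda>y. ereal (\<bar>F y - F x\<bar> / dist x y)) \<le> (INF k. S k x)"
    proof (rule INF_greatest)
      fix k
      have "\<forall>\<^sub>F y in at x. y \<noteq> x \<and> dist y x < 1 / real (Suc k)"
        unfolding eventually_at by (intro exI[of _ "1 / real (Suc k)"]) auto
      then have "\<forall>\<^sub>F y in at x. ereal (\<bar>F y - F x\<bar> / dist x y) \<le> S k x"
        unfolding S_def by eventually_elim (rule SUP_upper, simp add: dist_commute)
      then show "Limsup (at x) (\<lambda>y. ereal (\<bar>F y - F x\<bar> / dist x y)) \<le> S k x" by (rule Limsup_bounded)
    qed
    show "(INF k. S k x) \<le> Limsup (at x) (\<lambda>y. ereal (\<bar>F y - F x\<bar> / dist x y))"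
    proof (rule dense_ge)
      fix b assume "Limsup (at x) (\<lambda>y. ereal (\<bar>F y - F x\<bar> / dist x y)) < b"
      then have "\<forall>\<^sub>F y in at x. ereal (\<bar>F y - F x\<bar> / dist x y) < b" by (rule Limsup_lessD)
      then obtain d where d: "d > 0" "\<And>y. y \<noteq> x \<Longrightarrow> dist y x < d \<Longrightarrow> ereal (\<bar>F y - F x\<bar> / dist x y) < b"
        unfolding eventually_at by auto
      obtain k where k: "1 / real (Suc k) < d" using d(1) by (metis inverse_eq_divide reals_Archimedean)
      have "S k x \<le> b" unfolding S_def
        using d(2) k by (intro SUP_least less_imp_le) (auto simp: dist_commute)
      then show "(INF k. S k x) \<le> b" by (rule INF_lower2[OF UNIV_I])
    qed
  qed
  have "{x::'a. \<not> x islimpt UNIV} \<in> sets borel"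
  proof (rule borel_open)
    have "{x::'a. \<not> x islimpt UNIV} = \<Union>{{x} |x. open {x}}" by (auto simp: islimpt_UNIV_iff)
    then show "open {x::'a. \<not> x islimpt UNIV}" by (simp only:) (rule open_Union, auto)
  qed
  then have "space borel - {x::'a. \<not> x islimpt UNIV} \<in> sets borel" by (rule sets.compl_sets)
  then have "{x::'a. x islimpt UNIV} \<in> sets borel" by (simp add: Diff_eq Compl_eq)
  then have [measurable]: "Measurable.pred borel (\<lambda>x::'a. x islimpt UNIV)"
    by (simp add: Measurable.pred_def)
  have "pt_Lip F = (\<lambda>x. real_of_ereal (if x islimpt UNIV then INF k. S k x else 0))"
    by (auto simp: pt_Lip_def pt_Lip_ereal_def lim)
  also have "\<dots> \<in> borel_measurable borel" by measurable
  finally show ?thesis .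
qed

section \<open>Lipschitz functions\<close>

lemma Lip_fun_continuous: "F \<in> Lip_fun \<Longrightarrow> continuous_on UNIV F"
  by (auto simp: Lip_fun_def intro: lipschitz_on_continuous_on)

lemma Lip_fun_cmult: "F \<in> Lip_fun \<Longrightarrow> (\<lambda>x. c * F x) \<in> Lip_fun"
  using lipschitz_on_cmult_real[of _ UNIV F c] by (auto simp: Lip_fun_def)

lemma Lip_fun_add: "F \<in> Lip_fun \<Longrightarrow> G \<in> Lip_fun \<Longrightarrow> (\<lambda>x. F x + G x) \<in> Lip_fun"
  using lipschitz_on_add[of _ UNIV F _ G] by (fastforce simp: Lip_fun_def)

lemma Lip_fun_diff: "F \<in> Lip_fun \<Longrightarrow> G \<in> Lip_fun \<Longrightarrow> (\<lambda>x. F x - G x) \<in> Lip_fun"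
  using Lip_fun_add[of F "\<lambda>x. -1 * G x"] Lip_fun_cmult[of G "-1"] by simp

lemma Lip0_Lip_fun: "\<phi> \<in> Lip0 \<Omega> \<Longrightarrow> \<phi> \<in> Lip_fun"
  and Lip0_support: "\<phi> \<in> Lip0 \<Omega> \<Longrightarrow> {x. \<phi> x \<noteq> 0} \<subset>\<subset> \<Omega>"
  by (auto simp: Lip0_def)

lemma Lip0_outside: "\<phi> \<in> Lip0 \<Omega> \<Longrightarrow> x \<notin> \<Omega> \<Longrightarrow> \<phi> x = 0"
  using Lip0_support[of \<phi> \<Omega>] closure_subset[of "{x. \<phi> x \<noteq> 0}"] by (auto simp: compactly_inside_def)

lemma Lip0_mono: "\<Omega> \<subseteq> \<Omega>' \<Longrightarrow> \<phi> \<in> Lip0 \<Omega> \<Longrightarrow> \<phi> \<in> Lip0 \<Omega>'"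
  by (auto simp: Lip0_def compactly_inside_def)

lemma compactly_inside_subset: "A \<subseteq> B \<Longrightarrow> B \<subset>\<subset> \<Omega> \<Longrightarrow> A \<subset>\<subset> \<Omega>"
  unfolding compactly_inside_def
proof
  assume sub: "A \<subseteq> B" and B: "compact (closure B) \<and> closure B \<subseteq> \<Omega>"
  have cl: "closure A \<subseteq> closure B" by (rule closure_mono[OF sub])
  then show "closure A \<subseteq> \<Omega>" using B by blast
  have "compact (closure B \<inter> closure A)" using B by (intro compact_Int_closed) auto
  then show "compact (closure A)" using cl by (simp add: Int_absorb1)
qed

text \<open>
  For a function with compact support, Lipschitz continuity is a local property: otherwise there are
  points violating it with larger and larger constants, which accumulate at a point of the support.
\<close>

lemma Lip_fun_if_locally:
  fixes u :: "'a::metric_space \<Rightarrow> real"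
  assumes loc: "\<And>x. \<exists>r>0. \<exists>C. C-lipschitz_on (ball x r) u"
    and cpt: "compact (closure {x. u x \<noteq> 0})"
  shows "u \<in> Lip_fun"
proof (rule ccontr)
  define S where "S = closure {x. u x \<noteq> 0}"
  have S: "compact S" "\<And>x. u x \<noteq> 0 \<Longrightarrow> x \<in> S"
    using cpt closure_subset[of "{x. u x \<noteq> 0}"] by (auto simp: S_def)
  have cont: "continuous_on UNIV u"
  proof (rule continuous_at_imp_continuous_on, rule ballI)
    fix x
    obtain r C where "r > 0" "C-lipschitz_on (ball x r) u" using loc by blast
    then show "isCont u x"
      using lipschitz_on_continuous_on continuous_on_interior[of "ball x r" u x] by (auto simp: interior_open)
  qed
  assume "u \<notin> Lip_fun"
  have "\<exists>x y. x \<in> S \<and> \<bar>u x - u y\<bar> > real n * dist x y" for n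
  proof -
    have "\<not> (real n)-lipschitz_on UNIV u" using \<open>u \<notin> Lip_fun\<close> by (auto simp: Lip_fun_def)
    then obtain x y where xy: "\<bar>u x - u y\<bar> > real n * dist x y"
      by (auto simp: lipschitz_on_def dist_real_def not_le)
    then have "u x \<noteq> 0 \<or> u y \<noteq> 0" using mult_nonneg_nonneg[of "real n" "dist x y"] by fastforce
    then show ?thesis using S(2) xy by (metis abs_minus_commute dist_commute)
  qed
  then obtain x y where x: "\<And>n. x n \<in> S" and xy: "\<And>n. \<bar>u (x n) - u (y n)\<bar> > real n * dist (x n) (y n)" by metis
  obtain l r where l: "l \<in> S" "strict_mono r" "(x \<circ> r) \<longlonglongrightarrow> l"
    using S(1) x unfolding compact_def by blast
  obtain B where B: "\<And>z. \<bar>u z\<bar> \<le> B"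
  proof -
    have "bounded (u ` S)" using compact_continuous_image[OF continuous_on_subset[OF cont] S(1)] compact_imp_bounded by blast
    then obtain B where "\<And>z. z \<in> S \<Longrightarrow> \<bar>u z\<bar> \<le> B" by (auto simp: bounded_real)
    then have "\<bar>u z\<bar> \<le> max B 0" for z using S(2)[of z] by fastforce
    then show ?thesis using that by blast
  qed
  have dle: "dist (x n) (y n) \<le> 2 * B / real n" if "n > 0" for n
  proof -
    have "real n * dist (x n) (y n) < 2 * B" using xy[of n] B[of "x n"] B[of "y n"] by linarith
    then show ?thesis using that by (simp add: field_simps)
  qed
  have "(\<lambda>n. dist (x n) (y n)) \<longlonglongrightarrow> 0"
  proof (rule Lim_null_comparison)
    show "\<forall>\<^sub>F n in sequentially. norm (dist (x n) (y n)) \<le> 2 * B / real n"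
      using eventually_gt_at_top[of 0] by eventually_elim (use dle in auto)
    show "(\<lambda>n. 2 * B / real n) \<longlonglongrightarrow> 0" by (rule lim_const_over_n)
  qed
  then have d0: "(\<lambda>n. dist (x (r n)) (y (r n))) \<longlonglongrightarrow> 0"
    using LIMSEQ_subseq_LIMSEQ[OF _ l(2)] by (force simp: o_def)
  have y: "(\<lambda>n. y (r n)) \<longlonglongrightarrow> l"
  proof (subst tendsto_dist_iff, rule Lim_null_comparison[OF always_eventually])
    have "(\<lambda>n. dist (x (r n)) l) \<longlonglongrightarrow> 0" using l(3) by (simp add: tendsto_dist_iff[of _ l] o_def)
    from tendsto_add[OF d0 this] show "(\<lambda>n. dist (x (r n)) (y (r n)) + dist (x (r n)) l) \<longlonglongrightarrow> 0" by simp
    show "\<forall>n. norm (dist (y (r n)) l) \<le> dist (x (r n)) (y (r n)) + dist (x (r n)) l"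
      by (simp add: dist_triangle3)
  qed
  obtain \<rho> C where \<rho>: "\<rho> > 0" "C-lipschitz_on (ball l \<rho>) u" using loc by blast
  have "\<forall>\<^sub>F n in sequentially. x (r n) \<in> ball l \<rho>" "\<forall>\<^sub>F n in sequentially. y (r n) \<in> ball l \<rho>"
    using tendstoD[OF l(3) \<rho>(1)] tendstoD[OF y \<rho>(1)] by (auto simp: o_def dist_commute)
  moreover have "\<forall>\<^sub>F n in sequentially. real (r n) > C"
    using filterlim_compose[OF filterlim_real_sequentially filterlim_subseq[OF l(2)]]
    by (simp add: filterlim_at_top_dense)
  ultimately have "\<forall>\<^sub>F n in sequentially. False"
  proof eventually_elim
    case (elim n)
    have "\<bar>u (x (r n)) - u (y (r n))\<bar> \<le> C * dist (x (r n)) (y (r n))"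
      using lipschitz_onD[OF \<rho>(2) elim(1,2)] by (simp add: dist_real_def)
    also have "\<dots> \<le> real (r n) * dist (x (r n)) (y (r n))" using elim(3) by (intro mult_right_mono) auto
    finally show False using xy[of "r n"] by simp
  qed
  then show False by simp
qed

text \<open>
  Locally both factors are bounded and Lipschitz, or the product vanishes; compactness of the support does
  the rest.
\<close>

lemma Lip0_mult_Lip_loc:
  assumes "open \<Omega>" "\<eta> \<in> Lip0 \<Omega>" "p \<in> Lip_loc \<Omega>"
  shows "(\<lambda>x. \<eta> x * p x) \<in> Lip0 \<Omega>"
proof -
  have sub: "{x. \<eta> x * p x \<noteq> 0} \<subseteq> {x. \<eta> x \<noteq> 0}" by auto
  have supp: "{x. \<eta> x * p x \<noteq> 0} \<subset>\<subset> \<Omega>"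
    by (rule compactly_inside_subset[OF sub Lip0_support[OF assms(2)]])
  obtain K where K: "K-lipschitz_on UNIV \<eta>" using assms(2) by (auto simp: Lip0_def Lip_fun_def)
  have "(\<lambda>x. \<eta> x * p x) \<in> Lip_fun"
  proof (rule Lip_fun_if_locally)
    show "compact (closure {x. \<eta> x * p x \<noteq> 0})" using supp by (simp add: compactly_inside_def)
    fix x
    show "\<exists>r>0. \<exists>C. C-lipschitz_on (ball x r) (\<lambda>x. \<eta> x * p x)"
    proof (cases "x \<in> \<Omega>")
      case False
      then have "x \<in> - closure {x. \<eta> x \<noteq> 0}" using Lip0_support[OF assms(2)] by (auto simp: compactly_inside_def)
      then obtain r where r: "r > 0" "ball x r \<subseteq> - closure {x. \<eta> x \<noteq> 0}"
        using open_contains_ball[of "- closure {x. \<eta> x \<noteq> 0}"] by auto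
      then have "\<eta> z = 0" if "z \<in> ball x r" for z
        using that closure_subset[of "{x. \<eta> x \<noteq> 0}"] by blast
      then have "0-lipschitz_on (ball x r) (\<lambda>x. \<eta> x * p x)" by (intro lipschitz_onI) auto
      then show ?thesis using r(1) by blast
    next
      case True
      obtain r C where r: "r > 0" "C-lipschitz_on (ball x r \<inter> \<Omega>) p" using assms(3) True unfolding Lip_loc_def by blast
      obtain r' where r': "r' > 0" "ball x r' \<subseteq> \<Omega>" using assms(1) True open_contains_ball by blast
      define \<rho> where "\<rho> = min r (min r' 1)"
      have \<rho>: "\<rho> > 0" "\<rho> \<le> 1" "ball x \<rho> \<subseteq> ball x r \<inter> \<Omega>" using r r' by (auto simp: \<rho>_def)
      have C: "C-lipschitz_on (ball x \<rho>) p" by (rule lipschitz_on_subset[OF r(2) \<rho>(3)])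
      have C0: "C \<ge> 0" "K \<ge> 0" using C K by (auto dest: lipschitz_on_nonneg)
      have pb: "\<bar>p z\<bar> \<le> \<bar>p x\<bar> + C" if "z \<in> ball x \<rho>" for z
      proof -
        have "\<bar>p z - p x\<bar> \<le> C * dist z x"
          using lipschitz_onD[OF C that, of x] \<rho> by (simp add: dist_real_def)
        also have "\<dots> \<le> C * 1" using that \<rho> C0 by (intro mult_left_mono) (auto simp: dist_commute)
        finally show ?thesis by linarith
      qed
      have \<eta>b: "\<bar>\<eta> z\<bar> \<le> \<bar>\<eta> x\<bar> + K" if "z \<in> ball x \<rho>" for z
      proof -
        have "\<bar>\<eta> z - \<eta> x\<bar> \<le> K * dist z x"
          using lipschitz_onD[OF K, of z x] by (simp add: dist_real_def)
        also have "\<dots> \<le> K * 1" using that \<rho> C0 by (intro mult_left_mono) (auto simp: dist_commute)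
        finally show ?thesis by linarith
      qed
      have "((\<bar>\<eta> x\<bar> + K) * C + (\<bar>p x\<bar> + C) * K)-lipschitz_on (ball x \<rho>) (\<lambda>x. \<eta> x * p x)"
      proof (rule lipschitz_onI)
        fix y z assume yz: "y \<in> ball x \<rho>" "z \<in> ball x \<rho>"
        have "\<bar>\<eta> y * p y - \<eta> z * p z\<bar> = \<bar>\<eta> y * (p y - p z) + p z * (\<eta> y - \<eta> z)\<bar>" by (simp add: algebra_simps)
        also have "\<dots> \<le> \<bar>\<eta> y\<bar> * \<bar>p y - p z\<bar> + \<bar>p z\<bar> * \<bar>\<eta> y - \<eta> z\<bar>"
          by (simp add: abs_triangle_ineq flip: abs_mult)
        also have "\<dots> \<le> (\<bar>\<eta> x\<bar> + K) * (C * dist y z) + (\<bar>p x\<bar> + C) * (K * dist y z)"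
          using lipschitz_onD[OF C yz] lipschitz_onD[OF K UNIV_I UNIV_I, of y z] C0 \<eta>b[OF yz(1)] pb[OF yz(2)]
          by (intro add_mono mult_mono) (auto simp: dist_real_def)
        finally show "dist (\<eta> y * p y) (\<eta> z * p z) \<le> ((\<bar>\<eta> x\<bar> + K) * C + (\<bar>p x\<bar> + C) * K) * dist y z"
          by (simp add: dist_real_def algebra_simps)
      qed (use C0 in auto)
      then show ?thesis using \<rho>(1) by blast
    qed
  qed
  then show ?thesis using supp by (simp add: Lip0_def)
qed

lemma Lip_fun_Lip_loc: "F \<in> Lip_fun \<Longrightarrow> F \<in> Lip_loc \<Omega>"
  unfolding Lip_fun_def Lip_loc_def
proof safe
  fix C x assume "C-lipschitz_on UNIV F"
  then have "C-lipschitz_on (ball x 1 \<inter> \<Omega>) F" by (rule lipschitz_on_subset) auto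
  then show "\<exists>r>0. \<exists>C. C-lipschitz_on (ball x r \<inter> \<Omega>) F" by (intro exI[of _ 1]) auto
qed

lemma Lip0_mult: "open \<Omega> \<Longrightarrow> \<eta> \<in> Lip0 \<Omega> \<Longrightarrow> F \<in> Lip_fun \<Longrightarrow> (\<lambda>x. \<eta> x * F x) \<in> Lip0 \<Omega>"
  by (intro Lip0_mult_Lip_loc Lip_fun_Lip_loc)

lemma Lip0_add:
  assumes "\<phi> \<in> Lip0 \<Omega>" "\<psi> \<in> Lip0 \<Omega>"
  shows "(\<lambda>x. \<phi> x + \<psi> x) \<in> Lip0 \<Omega>"
proof -
  have "{x. \<phi> x \<noteq> 0} \<union> {x. \<psi> x \<noteq> 0} \<subset>\<subset> \<Omega>"
    using assms[THEN Lip0_support] by (auto simp: compactly_inside_def closure_Un)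
  then have "{x. \<phi> x + \<psi> x \<noteq> 0} \<subset>\<subset> \<Omega>" by (rule compactly_inside_subset[rotated]) auto
  then show ?thesis using assms[THEN Lip0_Lip_fun] by (auto simp: Lip0_def Lip_fun_add)
qed

lemma Lip0_cmult:
  assumes "\<phi> \<in> Lip0 \<Omega>"
  shows "(\<lambda>x. c * \<phi> x) \<in> Lip0 \<Omega>"
proof -
  have "{x. c * \<phi> x \<noteq> 0} \<subset>\<subset> \<Omega>" by (rule compactly_inside_subset[OF _ Lip0_support[OF assms]]) auto
  then show ?thesis using assms[THEN Lip0_Lip_fun] by (auto simp: Lip0_def Lip_fun_cmult)
qed

lemma Lip0_zero: "(\<lambda>x. 0) \<in> Lip0 \<Omega>"
  by (auto simp: Lip0_def compactly_inside_def Lip_fun_def intro: lipschitz_on_constant)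

lemma Lip0_bounded:
  assumes "\<phi> \<in> Lip0 \<Omega>"
  shows "\<exists>B\<ge>0. \<forall>x. \<bar>\<phi> x\<bar> \<le> B"
proof -
  have "compact (\<phi> ` closure {x. \<phi> x \<noteq> 0})"
    using assms Lip_fun_continuous[OF Lip0_Lip_fun[OF assms]] Lip0_support[OF assms]
    by (intro compact_continuous_image) (auto simp: compactly_inside_def intro: continuous_on_subset)
  then obtain B where "\<And>x. x \<in> closure {x. \<phi> x \<noteq> 0} \<Longrightarrow> \<bar>\<phi> x\<bar> \<le> B"
    using compact_imp_bounded by (force simp: bounded_real)
  then have "\<bar>\<phi> x\<bar> \<le> max B 0" for x
  proof (cases "\<phi> x = 0")
    case False
    then have "x \<in> closure {x. \<phi> x \<noteq> 0}" using closure_subset[of "{x. \<phi> x \<noteq> 0}"] by blast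
    then show ?thesis using \<open>\<And>x. x \<in> closure {x. \<phi> x \<noteq> 0} \<Longrightarrow> \<bar>\<phi> x\<bar> \<le> B\<close> by fastforce
  qed simp
  then show ?thesis by (intro exI[of _ "max B 0"]) auto
qed

text \<open>
  The cut-off is a truncated affine function of the distance to \<open>C\<close>; closed bounded sets are compact,
  so its support is.
\<close>

lemma Lip0_cutoff:
  fixes C :: "'a::heine_borel set"
  assumes "compact C" "open \<Omega>" "C \<subseteq> \<Omega>"
  shows "\<exists>\<eta>\<in>Lip0 \<Omega>. (\<forall>x. 0 \<le> \<eta> x \<and> \<eta> x \<le> 1) \<and> (\<exists>V. open V \<and> C \<subseteq> V \<and> V \<subseteq> \<Omega> \<and> (\<forall>x\<in>V. \<eta> x = 1))"
proof (cases "C = {}")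
  case True
  then show ?thesis by (intro bexI[of _ "\<lambda>x. 0"]) (auto intro: Lip0_zero)
next
  case False
  obtain e where e: "e > 0" "{x. infdist x C \<le> e} \<subseteq> \<Omega>"
    using compact_in_open_separated[OF False assms] by auto
  define \<eta> where "\<eta> x = max 0 (min 1 (2 - (2 / e) * infdist x C))" for x
  have lip: "(2 / e)-lipschitz_on UNIV \<eta>"
  proof (rule lipschitz_onI)
    fix x y
    have "\<bar>\<eta> x - \<eta> y\<bar> \<le> \<bar>(2 / e) * infdist x C - (2 / e) * infdist y C\<bar>" unfolding \<eta>_def by linarith
    also have "\<dots> = (2 / e) * \<bar>infdist x C - infdist y C\<bar>"
      using e(1) abs_mult[of "2 / e" "infdist x C - infdist y C"] by (simp add: right_diff_distrib)
    also have "\<dots> \<le> (2 / e) * dist x y"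
      using e(1) infdist_triangle_abs[of x C y] by (intro mult_left_mono) auto
    finally show "dist (\<eta> x) (\<eta> y) \<le> (2 / e) * dist x y" by (simp add: dist_real_def)
  qed (use e in simp)
  have sub: "{x. \<eta> x \<noteq> 0} \<subseteq> {x. infdist x C \<le> e}"
    using e(1) by (auto simp: \<eta>_def max_def min_def field_simps split: if_splits)
  have cl: "closed {x. infdist x C \<le> e}" by (intro closed_Collect_le continuous_intros)
  have "bounded {x. infdist x C \<le> e}"
  proof -
    obtain a B where B: "\<And>c. c \<in> C \<Longrightarrow> dist a c \<le> B" using compact_imp_bounded[OF assms(1)] by (auto simp: bounded_def)
    have "dist a x \<le> B + e" if "infdist x C \<le> e" for x
    proof -
      obtain c where c: "c \<in> C" "infdist x C = dist x c"
        using infdist_attains_inf[OF compact_imp_closed[OF assms(1)] False] by blast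
      then show ?thesis using B[OF c(1)] that dist_triangle[of a x c] by (simp add: dist_commute)
    qed
    then show ?thesis by (auto simp: bounded_def)
  qed
  then have cpt: "compact {x. infdist x C \<le> e}" using cl by (simp add: compact_eq_bounded_closed)
  have "{x. infdist x C \<le> e} \<subset>\<subset> \<Omega>"
    using e(2) cpt cl by (simp add: compactly_inside_def)
  then have "{x. \<eta> x \<noteq> 0} \<subset>\<subset> \<Omega>" by (rule compactly_inside_subset[OF sub])
  then have 1: "\<eta> \<in> Lip0 \<Omega>" using lip by (auto simp: Lip0_def Lip_fun_def)
  have 2: "open {x. infdist x C < e / 2}" by (intro open_Collect_less continuous_intros)
  have 3: "C \<subseteq> {x. infdist x C < e / 2}" using e(1) by auto
  have 4: "{x. infdist x C < e / 2} \<subseteq> \<Omega>" using e by auto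
  have 5: "\<eta> x = 1" if "infdist x C < e / 2" for x
    using that e(1) by (simp add: \<eta>_def field_simps)
  show ?thesis
    using 1 2 3 4 5 by (intro bexI[of _ \<eta>] conjI allI exI[of _ "{x. infdist x C < e / 2}"]) (auto simp: \<eta>_def)
qed

section \<open>Metric measure spaces\<close>

locale mm_space =
  fixes \<mu> :: "'a::{heine_borel, second_countable_topology} measure"
  assumes mms: "metric_measure_space \<mu>"
begin

lemma sets_mu[simp, measurable_cong]: "sets \<mu> = sets borel"
  using mms by (auto simp: metric_measure_space_def radon_on_def)

lemma space_mu[simp]: "space \<mu> = UNIV"
  using sets_eq_imp_space_eq[OF sets_mu] by simp

lemma emeasure_compact_finite: "compact C \<Longrightarrow> emeasure \<mu> C < \<infinity>"
  using mms by (auto simp: metric_measure_space_def radon_on_def)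

lemma emeasure_bounded_finite: "bounded A \<Longrightarrow> emeasure \<mu> A < \<infinity>"
proof -
  assume "bounded A"
  then have "compact (closure A)" by (simp add: compact_closure)
  then show ?thesis
    using emeasure_mono[OF closure_subset[of A], of \<mu>] emeasure_compact_finite[of "closure A"]
    by (auto intro: le_less_trans)
qed

lemma emeasure_open_pos: "open V \<Longrightarrow> x \<in> V \<Longrightarrow> 0 < emeasure \<mu> V"
proof -
  assume V: "open V" "x \<in> V"
  have "x \<in> msupport \<mu>" using mms by (auto simp: metric_measure_space_def)
  then show ?thesis using V by (auto simp: msupport_def)
qed

lemma inner_regular_mu:
  "A \<in> sets borel \<Longrightarrow> emeasure \<mu> A = (SUP C\<in>{C. compact C \<and> C \<subseteq> A}. emeasure \<mu> C)"
proof -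
  assume "A \<in> sets borel"
  then have "emeasure \<mu> A = (SUP C\<in>{C. compact C \<and> C \<in> sets \<mu> \<and> C \<subseteq> A}. emeasure \<mu> C)"
    using mms by (auto simp: metric_measure_space_def radon_on_def)
  also have "{C. compact C \<and> C \<in> sets \<mu> \<and> C \<subseteq> A} = {C. compact C \<and> C \<subseteq> A}"
    by (auto simp: borel_compact)
  finally show ?thesis .
qed

lemma compact_subset_pos:
  assumes "A \<in> sets borel" "emeasure \<mu> A > a"
  shows "\<exists>C. compact C \<and> C \<subseteq> A \<and> emeasure \<mu> C > a"
  using assms(2) unfolding inner_regular_mu[OF assms(1)] less_SUP_iff by blast

lemma pt_Lip_measurable_mu: "F \<in> Lip_fun \<Longrightarrow> pt_Lip F \<in> borel_measurable \<mu>"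
  using pt_Lip_measurable[OF Lip_fun_continuous] by (simp add: measurable_cong_sets[OF sets_mu refl])

lemma Lip_fun_measurable: "F \<in> Lip_fun \<Longrightarrow> F \<in> borel_measurable \<mu>"
  using borel_measurable_continuous_onI[OF Lip_fun_continuous] by (simp add: measurable_cong_sets[OF sets_mu refl])

lemma pt_Lip_Lip_fun_nonneg: "F \<in> Lip_fun \<Longrightarrow> 0 \<le> pt_Lip F x"
  using Lip_fun_lip_le[of F x] pt_Lip_le(1) by blast

section \<open>Functions dominating a gradient\<close>

text \<open>
  \<open>G\<close> dominates a gradient of \<open>u\<close>: it is the strong limit of functions that dominate the pointwise
  Lipschitz constants of approximating Lipschitz functions.  Unlike weak limits of Lipschitz constants
  themselves, this class is visibly closed under all the operations below.
\<close>

definition upper_grad :: "('a \<Rightarrow> real) \<Rightarrow> ('a \<Rightarrow> real) \<Rightarrow> bool" where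
  "upper_grad u G \<longleftrightarrow> (\<exists>F g. (\<forall>j. F j \<in> Lip_fun) \<and> Lp_tendsto \<mu> 2 F u \<and> Lp_tendsto \<mu> 2 g G \<and>
     (\<forall>j. AE x in \<mu>. pt_Lip (F j) x \<le> g j x))"

lemma upper_gradI:
  assumes "\<And>j. F j \<in> Lip_fun" "Lp_tendsto \<mu> 2 F u" "Lp_tendsto \<mu> 2 g G"
    "\<And>j. AE x in \<mu>. pt_Lip (F j) x \<le> g j x"
  shows "upper_grad u G"
  unfolding upper_grad_def using assms by blast

lemma upper_grad_L2: "upper_grad u G \<Longrightarrow> u \<in> Lp \<mu> 2" "upper_grad u G \<Longrightarrow> G \<in> Lp \<mu> 2"
  unfolding upper_grad_def by (blast dest: Lp2_tendstoD)+

lemma upper_grad_add: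
  assumes "upper_grad u G" "upper_grad v H"
  shows "upper_grad (\<lambda>x. u x + v x) (\<lambda>x. G x + H x)"
proof -
  obtain F g where 1: "\<And>j. F j \<in> Lip_fun" "Lp_tendsto \<mu> 2 F u" "Lp_tendsto \<mu> 2 g G"
    "\<And>j. AE x in \<mu>. pt_Lip (F j) x \<le> g j x" using assms(1) unfolding upper_grad_def by blast
  obtain F' g' where 2: "\<And>j. F' j \<in> Lip_fun" "Lp_tendsto \<mu> 2 F' v" "Lp_tendsto \<mu> 2 g' H"
    "\<And>j. AE x in \<mu>. pt_Lip (F' j) x \<le> g' j x" using assms(2) unfolding upper_grad_def by blast
  have "AE x in \<mu>. pt_Lip (\<lambda>x. F j x + F' j x) x \<le> g j x + g' j x" for j
    using 1(4)[of j] 2(4)[of j]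
  proof eventually_elim
    case (elim x)
    obtain a b where "lip_le (F j) x a" "lip_le (F' j) x b" using Lip_fun_lip_le 1(1) 2(1) by blast
    then show ?case using pt_Lip_add[of "F j" x a "F' j" b] elim by linarith
  qed
  then show ?thesis
    by (rule upper_gradI[OF Lip_fun_add[OF 1(1) 2(1)] Lp2_tendsto_add[OF 1(2) 2(2)] Lp2_tendsto_add[OF 1(3) 2(3)]])
qed

lemma upper_grad_cmult:
  assumes "upper_grad u G"
  shows "upper_grad (\<lambda>x. c * u x) (\<lambda>x. \<bar>c\<bar> * G x)"
proof -
  obtain F g where 1: "\<And>j. F j \<in> Lip_fun" "Lp_tendsto \<mu> 2 F u" "Lp_tendsto \<mu> 2 g G"
    "\<And>j. AE x in \<mu>. pt_Lip (F j) x \<le> g j x" using assms(1) unfolding upper_grad_def by blast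
  have "AE x in \<mu>. pt_Lip (\<lambda>x. c * F j x) x \<le> \<bar>c\<bar> * g j x" for j
    using 1(4)[of j]
  proof eventually_elim
    case (elim x)
    obtain a where "lip_le (F j) x a" using Lip_fun_lip_le 1(1) by blast
    then show ?case using pt_Lip_cmult[of "F j" x a c] mult_left_mono[OF elim, of "\<bar>c\<bar>"] by simp
  qed
  then show ?thesis
    by (rule upper_gradI[OF Lip_fun_cmult[OF 1(1)] Lp2_tendsto_cmult[OF 1(2)] Lp2_tendsto_cmult[OF 1(3)]])
qed

lemma upper_grad_diff:
  assumes "upper_grad u G" "upper_grad v H"
  shows "upper_grad (\<lambda>x. u x - v x) (\<lambda>x. G x + H x)"
  using upper_grad_add[OF assms(1) upper_grad_cmult[OF assms(2), of "-1"]] by simp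

text \<open>
  A diagonal sequence.
\<close>

lemma upper_grad_closed:
  assumes U: "Lp_tendsto \<mu> 2 U u" and H: "Lp_tendsto \<mu> 2 H G" and ug: "\<And>k::nat. upper_grad (U k) (H k)"
  shows "upper_grad u G"
proof -
  define P where "P k F g \<longleftrightarrow> F \<in> Lip_fun \<and> F \<in> Lp \<mu> 2 \<and> g \<in> Lp \<mu> 2 \<and> Lp_norm \<mu> 2 (\<lambda>x. F x - U k x) < 1 / real (Suc k) \<and>
     Lp_norm \<mu> 2 (\<lambda>x. g x - H k x) < 1 / real (Suc k) \<and> (AE x in \<mu>. pt_Lip F x \<le> g x)" for k F g
  have "\<exists>F g. P k F g" for k
  proof -
    obtain F g where 1: "\<And>j. F j \<in> Lip_fun" "Lp_tendsto \<mu> 2 F (U k)" "Lp_tendsto \<mu> 2 g (H k)"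
      "\<And>j. AE x in \<mu>. pt_Lip (F j) x \<le> g j x" using ug[of k] unfolding upper_grad_def by blast
    have "\<forall>\<^sub>F j in sequentially. Lp_norm \<mu> 2 (\<lambda>x. F j x - U k x) < 1 / real (Suc k)"
      "\<forall>\<^sub>F j in sequentially. Lp_norm \<mu> 2 (\<lambda>x. g j x - H k x) < 1 / real (Suc k)"
      using order_tendstoD(2)[OF Lp2_tendstoD(3)[OF 1(2)], of "1 / real (Suc k)"]
        order_tendstoD(2)[OF Lp2_tendstoD(3)[OF 1(3)], of "1 / real (Suc k)"] by auto
    then have "\<forall>\<^sub>F j in sequentially. Lp_norm \<mu> 2 (\<lambda>x. F j x - U k x) < 1 / real (Suc k) \<and>
        Lp_norm \<mu> 2 (\<lambda>x. g j x - H k x) < 1 / real (Suc k)" by (rule eventually_conj)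
    then obtain j where "Lp_norm \<mu> 2 (\<lambda>x. F j x - U k x) < 1 / real (Suc k)" "Lp_norm \<mu> 2 (\<lambda>x. g j x - H k x) < 1 / real (Suc k)"
      by (auto simp: eventually_sequentially)
    then show ?thesis using 1(1,4) Lp2_tendstoD(1)[OF 1(2), of j] Lp2_tendstoD(1)[OF 1(3), of j] unfolding P_def by blast
  qed
  then obtain F g where FP: "\<And>k. P k (F k) (g k)" by metis
  have F: "F k \<in> Lip_fun" "F k \<in> Lp \<mu> 2" "g k \<in> Lp \<mu> 2" "Lp_norm \<mu> 2 (\<lambda>x. F k x - U k x) < 1 / real (Suc k)"
    "Lp_norm \<mu> 2 (\<lambda>x. g k x - H k x) < 1 / real (Suc k)" "AE x in \<mu>. pt_Lip (F k) x \<le> g k x" for k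
    using FP[of k] unfolding P_def by blast+
  have tend: "Lp_tendsto \<mu> 2 A a"
    if "\<And>k. A k \<in> Lp \<mu> 2" "Lp_tendsto \<mu> 2 B a" "\<And>k. Lp_norm \<mu> 2 (\<lambda>x. A k x - B k x) < 1 / real (Suc k)" for A B a
  proof (rule Lp2_tendstoI)
    show "(\<lambda>k. 1 / real (Suc k) + Lp_norm \<mu> 2 (\<lambda>x. B k x - a x)) \<longlonglongrightarrow> 0"
      using tendsto_add[OF LIMSEQ_Suc[OF lim_1_over_n] Lp2_tendstoD(3)[OF that(2)]] by simp
    show "Lp_norm \<mu> 2 (\<lambda>x. A k x - a x) \<le> 1 / real (Suc k) + Lp_norm \<mu> 2 (\<lambda>x. B k x - a x)" for k
      using Lp2_triangle_diff[OF that(1)[of k] Lp2_tendstoD(1)[OF that(2), of k] Lp2_tendstoD(2)[OF that(2)]] that(3)[of k]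
      by linarith
  qed (use that Lp2_tendstoD(2) in auto)
  show ?thesis
    by (rule upper_gradI[OF F(1) tend[OF F(2) U F(4)] tend[OF F(3) H F(5)] F(6)])
qed

lemma upper_grad_mono:
  assumes "upper_grad u G" "G' \<in> Lp \<mu> 2" "AE x in \<mu>. G x \<le> G' x"
  shows "upper_grad u G'"
proof -
  obtain F g where 1: "\<And>j. F j \<in> Lip_fun" "Lp_tendsto \<mu> 2 F u" "Lp_tendsto \<mu> 2 g G"
    "\<And>j. AE x in \<mu>. pt_Lip (F j) x \<le> g j x" using assms(1) unfolding upper_grad_def by blast
  have "Lp_tendsto \<mu> 2 (\<lambda>j x. g j x + (G' x - G x)) (\<lambda>x. G x + (G' x - G x))"
    by (intro Lp2_tendsto_add Lp2_tendsto_const Lp2_diff 1(3) assms(2) upper_grad_L2(2)[OF assms(1)])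
  then have "Lp_tendsto \<mu> 2 (\<lambda>j x. g j x + (G' x - G x)) G'" by simp
  moreover have "AE x in \<mu>. pt_Lip (F j) x \<le> g j x + (G' x - G x)" for j
    using 1(4)[of j] assms(3) by eventually_elim simp
  ultimately show ?thesis by (rule upper_gradI[OF 1(1,2)])
qed

lemma upper_grad_Lip_fun:
  assumes "\<phi> \<in> Lip_fun" "\<phi> \<in> Lp \<mu> 2" "g \<in> Lp \<mu> 2" "AE x in \<mu>. pt_Lip \<phi> x \<le> g x"
  shows "upper_grad \<phi> g"
  unfolding upper_grad_def using assms
  by (intro exI[of _ "\<lambda>j. \<phi>"] exI[of _ "\<lambda>j. g"]) (auto intro: Lp2_tendsto_const)

lemma upper_grad_nonneg:
  assumes "upper_grad u G"
  shows "AE x in \<mu>. 0 \<le> G x"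
proof -
  obtain F g where 1: "\<And>j. F j \<in> Lip_fun" "Lp_tendsto \<mu> 2 g G"
    "\<And>j. AE x in \<mu>. pt_Lip (F j) x \<le> g j x" using assms(1) unfolding upper_grad_def by blast
  obtain r where r: "strict_mono r" "AE x in \<mu>. (\<lambda>j. g (r j) x) \<longlonglongrightarrow> G x"
    using Lp2_tendsto_AE_subseq[OF 1(2)] by blast
  have "AE x in \<mu>. \<forall>j. pt_Lip (F j) x \<le> g j x" using 1(3) by (simp add: AE_all_countable)
  with r(2) show ?thesis
  proof eventually_elim
    case (elim x)
    have "0 \<le> g (r j) x" for j using elim(2) pt_Lip_Lip_fun_nonneg[OF 1(1)] order_trans by blast
    then show ?case using LIMSEQ_le_const[OF elim(1)] by blast
  qed
qed

lemma bounded_support_L2: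
  assumes [measurable]: "f \<in> borel_measurable \<mu>" and "\<And>x. \<bar>f x\<bar> \<le> B" and "\<And>x. x \<notin> S \<Longrightarrow> f x = 0" and "compact S"
  shows "f \<in> Lp \<mu> 2"
proof -
  have "integrable \<mu> (\<lambda>x. indicator S x * B\<^sup>2)"
    using assms(4) emeasure_compact_finite[of S] borel_compact[of S]
    by (intro integrable_mult_left integrable_real_indicator) auto
  then have "integrable \<mu> (\<lambda>x. (f x)\<^sup>2)"
  proof (rule Bochner_Integration.integrable_bound)
    show "AE x in \<mu>. norm ((f x)\<^sup>2) \<le> norm (indicator S x * B\<^sup>2)"
    proof (rule AE_I2)
      fix x
      have "(f x)\<^sup>2 \<le> B\<^sup>2" using assms(2)[of x] by (intro abs_le_square_iff[THEN iffD1]) linarith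
      then show "norm ((f x)\<^sup>2) \<le> norm (indicator S x * B\<^sup>2)" using assms(3)[of x] by (cases "x \<in> S") auto
    qed
  qed measurable
  then show ?thesis by (simp add: Lp2_iff)
qed

lemma Lip0_L2:
  assumes "\<phi> \<in> Lip0 \<Omega>"
  shows "\<phi> \<in> Lp \<mu> 2"
proof -
  obtain B where "\<And>x. \<bar>\<phi> x\<bar> \<le> B" using Lip0_bounded[OF assms] by blast
  then show ?thesis
    using Lip0_support[OF assms] closure_subset[of "{x. \<phi> x \<noteq> 0}"]
    by (intro bounded_support_L2[where S = "closure {x. \<phi> x \<noteq> 0}" and B = B] Lip_fun_measurable Lip0_Lip_fun[OF assms])
      (auto simp: compactly_inside_def)
qed

lemma pt_Lip_outside:
  assumes "x \<notin> closure {x. \<phi> x \<noteq> 0}"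
  shows "pt_Lip \<phi> x = (0::real)"
proof -
  have "\<forall>\<^sub>F y in nhds x. \<phi> y = 0"
    unfolding eventually_nhds
    using assms closure_subset[of "{x. \<phi> x \<noteq> 0}"] by (intro exI[of _ "- closure {x. \<phi> x \<noteq> 0}"]) auto
  from pt_Lip_le[OF lip_le_eq[OF lip_le_0[of 0 x] this]] show ?thesis by simp
qed

lemma pt_Lip_Lip0_bounded:
  assumes "\<phi> \<in> Lip0 \<Omega>"
  shows "\<exists>B. \<forall>x. \<bar>pt_Lip \<phi> x\<bar> \<le> B"
proof -
  obtain C where "C-lipschitz_on UNIV \<phi>" using assms by (auto simp: Lip0_def Lip_fun_def)
  then have "\<bar>pt_Lip \<phi> x\<bar> \<le> C" for x using pt_Lip_le[OF lip_le_lipschitz[OF _ open_UNIV UNIV_I, of C \<phi> x]] by simp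
  then show ?thesis by blast
qed

lemma Lip0_pt_Lip_L2:
  assumes "\<phi> \<in> Lip0 \<Omega>"
  shows "pt_Lip \<phi> \<in> Lp \<mu> 2"
proof -
  obtain B where "\<And>x. \<bar>pt_Lip \<phi> x\<bar> \<le> B" using pt_Lip_Lip0_bounded[OF assms] by blast
  then show ?thesis
    using Lip0_support[OF assms]
    by (intro bounded_support_L2[where S = "closure {x. \<phi> x \<noteq> 0}" and B = B] pt_Lip_measurable_mu Lip0_Lip_fun[OF assms] pt_Lip_outside)
      (auto simp: compactly_inside_def)
qed

lemma upper_grad_Lip0: "\<phi> \<in> Lip0 \<Omega> \<Longrightarrow> upper_grad \<phi> (pt_Lip \<phi>)"
  by (rule upper_grad_Lip_fun) (auto intro: Lip0_Lip_fun Lip0_L2 Lip0_pt_Lip_L2)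

lemma Cheeger_le_upper_grad:
  assumes "upper_grad u G"
  shows "Cheeger \<mu> u \<le> ennreal (1/2 * (\<integral>x. (G x)\<^sup>2 \<partial>\<mu>))"
proof -
  obtain F g where 1: "\<And>j. F j \<in> Lip_fun" "Lp_tendsto \<mu> 2 F u" "Lp_tendsto \<mu> 2 g G"
    "\<And>j. AE x in \<mu>. pt_Lip (F j) x \<le> g j x" using assms(1) unfolding upper_grad_def by blast
  have le: "ennreal (1/2) * (\<integral>\<^sup>+x. ennreal ((pt_Lip (F j) x)\<^sup>2) \<partial>\<mu>) \<le> ennreal (1/2 * (Lp_norm \<mu> 2 (g j))\<^sup>2)" for j
  proof -
    have "(\<integral>\<^sup>+x. ennreal ((pt_Lip (F j) x)\<^sup>2) \<partial>\<mu>) \<le> (\<integral>\<^sup>+x. ennreal ((g j x)\<^sup>2) \<partial>\<mu>)"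
    proof (rule nn_integral_mono_AE, use 1(4)[of j] in eventually_elim)
      case (elim x)
      then show ?case using pt_Lip_Lip_fun_nonneg[OF 1(1)[of j], of x] by (intro ennreal_leI power_mono)
    qed
    also have "\<dots> = ennreal ((Lp_norm \<mu> 2 (g j))\<^sup>2)"
      using Lp2_integrable_square[OF Lp2_tendstoD(1)[OF 1(3)]]
      by (subst nn_integral_eq_integral) (auto simp: Lp2_norm_square)
    finally show ?thesis by (subst ennreal_mult') (auto intro: mult_left_mono)
  qed
  have "Cheeger \<mu> u \<le> liminf (\<lambda>j. ennreal (1/2) * (\<integral>\<^sup>+x. ennreal ((pt_Lip (F j) x)\<^sup>2) \<partial>\<mu>))"
    unfolding Cheeger_def using 1(1,2) by (intro Inf_lower) blast
  also have "\<dots> \<le> liminf (\<lambda>j. ennreal (1/2 * (Lp_norm \<mu> 2 (g j))\<^sup>2))"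
    using le by (intro Liminf_mono always_eventually) blast
  also have "\<dots> = ennreal (1/2 * (Lp_norm \<mu> 2 G)\<^sup>2)"
    by (rule lim_imp_Liminf) (auto intro!: tendsto_intros Lp2_tendsto_norm 1(3))
  finally show ?thesis by (simp add: Lp2_norm_square)
qed

section \<open>The Cheeger energy and minimal gradients\<close>

text \<open>
  Described by its energy, \<open>\<bar>\<nabla>u\<bar>\<close> can be compared with every member of \<open>upper_grad\<close>.  That this is the
  minimal relaxed gradient is the content of \<open>min_relaxed_gradient_iff\<close>.
\<close>

definition minimal_grad :: "('a \<Rightarrow> real) \<Rightarrow> ('a \<Rightarrow> real) \<Rightarrow> bool" where
  "minimal_grad u G \<longleftrightarrow> upper_grad u G \<and> ennreal (1/2 * (\<integral>x. (G x)\<^sup>2 \<partial>\<mu>)) = Cheeger \<mu> u"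

text \<open>
  A sequence violating the bound with \<open>e\<close> tending to zero would compete in the infimum that defines the
  Cheeger energy.
\<close>

lemma Cheeger_lower_semicontinuous:
  assumes u: "u \<in> Lp \<mu> 2" and C: "Cheeger \<mu> u = ennreal C" "C \<ge> 0" and \<delta>: "\<delta> > 0"
  shows "\<exists>e>0. \<forall>H a. H \<in> Lip_fun \<and> H \<in> Lp \<mu> 2 \<and> Lp_norm \<mu> 2 (\<lambda>x. H x - u x) < e \<and> a \<in> Lp \<mu> 2 \<and>
    (AE x in \<mu>. pt_Lip H x \<le> a x) \<longrightarrow> 2 * (C - \<delta>) \<le> (Lp_norm \<mu> 2 a)\<^sup>2"
proof (rule ccontr)
  assume neg: "\<not> ?thesis"
  define P where "P e H a \<longleftrightarrow> H \<in> Lip_fun \<and> H \<in> Lp \<mu> 2 \<and> Lp_norm \<mu> 2 (\<lambda>x. H x - u x) < e \<and> a \<in> Lp \<mu> 2 \<and>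
    (AE x in \<mu>. pt_Lip H x \<le> a x)" for e H a
  have "\<not> (\<exists>e>0. \<forall>H a. P e H a \<longrightarrow> 2 * (C - \<delta>) \<le> (Lp_norm \<mu> 2 a)\<^sup>2)"
    using neg unfolding P_def .
  then have "\<forall>e>0. \<exists>H a. P e H a \<and> (Lp_norm \<mu> 2 a)\<^sup>2 < 2 * (C - \<delta>)" by (meson not_le)
  then have "\<exists>H a. P (1 / real (Suc k)) H a \<and> (Lp_norm \<mu> 2 a)\<^sup>2 < 2 * (C - \<delta>)" for k by simp
  then obtain H a where HP: "\<And>k. P (1 / real (Suc k)) (H k) (a k) \<and> (Lp_norm \<mu> 2 (a k))\<^sup>2 < 2 * (C - \<delta>)" by metis
  have H: "H k \<in> Lip_fun" "H k \<in> Lp \<mu> 2" "Lp_norm \<mu> 2 (\<lambda>x. H k x - u x) < 1 / real (Suc k)"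
    "a k \<in> Lp \<mu> 2" "AE x in \<mu>. pt_Lip (H k) x \<le> a k x" "(Lp_norm \<mu> 2 (a k))\<^sup>2 < 2 * (C - \<delta>)" for k
    using HP[of k] unfolding P_def by blast+
  have tend: "Lp_tendsto \<mu> 2 H u"
    by (rule Lp2_tendstoI[OF H(2) u LIMSEQ_Suc[OF lim_1_over_n] less_imp_le[OF H(3)]])
  have "ennreal C \<le> liminf (\<lambda>j. ennreal (1/2) * (\<integral>\<^sup>+x. ennreal ((pt_Lip (H j) x)\<^sup>2) \<partial>\<mu>))"
    unfolding C(1)[symmetric] Cheeger_def using H(1) tend by (intro Inf_lower) blast
  also have "\<dots> \<le> liminf (\<lambda>j. ennreal (C - \<delta>))"
  proof (intro Liminf_mono always_eventually allI)
    fix j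
    have "(\<integral>\<^sup>+x. ennreal ((pt_Lip (H j) x)\<^sup>2) \<partial>\<mu>) \<le> (\<integral>\<^sup>+x. ennreal ((a j x)\<^sup>2) \<partial>\<mu>)"
    proof (rule nn_integral_mono_AE, use H(5)[of j] in eventually_elim)
      case (elim x)
      then show ?case using pt_Lip_Lip_fun_nonneg[OF H(1)[of j], of x] by (intro ennreal_leI power_mono)
    qed
    also have "\<dots> = ennreal ((Lp_norm \<mu> 2 (a j))\<^sup>2)"
      using Lp2_integrable_square[OF H(4)]
      by (subst nn_integral_eq_integral) (auto simp: Lp2_norm_square)
    also have "\<dots> \<le> ennreal (2 * (C - \<delta>))" using H(6)[of j] by (intro ennreal_leI) simp
    finally have "ennreal (1/2) * (\<integral>\<^sup>+x. ennreal ((pt_Lip (H j) x)\<^sup>2) \<partial>\<mu>) \<le> ennreal (1/2) * ennreal (2 * (C - \<delta>))"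
      by (rule mult_left_mono) simp
    also have "\<dots> = ennreal (1/2 * (2 * (C - \<delta>)))" by (rule ennreal_mult'[symmetric]) simp
    also have "1/2 * (2 * (C - \<delta>)) = C - \<delta>" by simp
    finally show "ennreal (1/2) * (\<integral>\<^sup>+x. ennreal ((pt_Lip (H j) x)\<^sup>2) \<partial>\<mu>) \<le> ennreal (C - \<delta>)" .
  qed
  also have "\<dots> = ennreal (C - \<delta>)" by (simp add: Liminf_const)
  finally have "C \<le> C - \<delta> \<or> C \<le> 0"
    using C(2) by (cases "C - \<delta> \<ge> 0") (auto simp: ennreal_neg)
  moreover have "0 < C - \<delta>" using le_less_trans[OF zero_le_power2 H(6)[of 0]] by simp
  ultimately show False using \<delta> by linarith
qed

text \<open>
  The Cheeger energy is attained, with strong convergence of the Lipschitz constants: averages of two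
  almost minimising approximations are again approximations, so the parallelogram law makes their
  Lipschitz constants a Cauchy sequence.
\<close>

lemma minimal_grad_strong_approximation:
  assumes u: "u \<in> Cheeger_dom \<mu>"
  shows "\<exists>F G. (\<forall>j. F j \<in> Lip_fun) \<and> Lp_tendsto \<mu> 2 F u \<and> Lp_tendsto \<mu> 2 (\<lambda>j. pt_Lip (F j)) G \<and> minimal_grad u G"
proof -
  have u2: "u \<in> Lp \<mu> 2" and fin: "Cheeger \<mu> u < \<infinity>" using u by (auto simp: Cheeger_dom_def)
  obtain C where C: "Cheeger \<mu> u = ennreal C" "C \<ge> 0" using fin by (cases "Cheeger \<mu> u") auto
  define P where "P k H \<longleftrightarrow> H \<in> Lip_fun \<and> H \<in> Lp \<mu> 2 \<and> Lp_norm \<mu> 2 (\<lambda>x. H x - u x) < 1 / real (Suc k) \<and>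
     pt_Lip H \<in> Lp \<mu> 2 \<and> (Lp_norm \<mu> 2 (pt_Lip H))\<^sup>2 < 2 * C + 2 / real (Suc k)" for k H
  have "\<exists>H. P k H" for k
  proof -
    define c where "c = C + 1 / real (Suc k)"
    have "C < c" by (simp add: c_def)
    then have c: "c > 0" using C(2) by linarith
    have "Cheeger \<mu> u < ennreal c" using C \<open>C < c\<close> by (simp add: ennreal_less_iff)
    then obtain F where F: "\<And>j. F j \<in> Lip_fun" "Lp_tendsto \<mu> 2 F u"
      "liminf (\<lambda>j. ennreal (1/2) * (\<integral>\<^sup>+x. ennreal ((pt_Lip (F j) x)\<^sup>2) \<partial>\<mu>)) < ennreal c"
      unfolding Cheeger_def Inf_less_iff by blast
    have "\<not> (\<forall>\<^sub>F j in sequentially. ennreal c \<le> ennreal (1/2) * (\<integral>\<^sup>+x. ennreal ((pt_Lip (F j) x)\<^sup>2) \<partial>\<mu>))"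
      using F(3) Liminf_bounded[of "ennreal c" _ sequentially] by (meson not_le)
    then have "\<exists>\<^sub>F j in sequentially. ennreal (1/2) * (\<integral>\<^sup>+x. ennreal ((pt_Lip (F j) x)\<^sup>2) \<partial>\<mu>) < ennreal c"
      by (simp add: not_eventually not_le)
    moreover have "\<forall>\<^sub>F j in sequentially. Lp_norm \<mu> 2 (\<lambda>x. F j x - u x) < 1 / real (Suc k)"
      using order_tendstoD(2)[OF Lp2_tendstoD(3)[OF F(2)], of "1 / real (Suc k)"] by simp
    ultimately have "\<exists>\<^sub>F j in sequentially. ennreal (1/2) * (\<integral>\<^sup>+x. ennreal ((pt_Lip (F j) x)\<^sup>2) \<partial>\<mu>) < ennreal c \<and>
        Lp_norm \<mu> 2 (\<lambda>x. F j x - u x) < 1 / real (Suc k)" by (rule frequently_eventually_frequently)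
    then obtain j where j: "ennreal (1/2) * (\<integral>\<^sup>+x. ennreal ((pt_Lip (F j) x)\<^sup>2) \<partial>\<mu>) < ennreal c"
        "Lp_norm \<mu> 2 (\<lambda>x. F j x - u x) < 1 / real (Suc k)" by (auto dest: frequently_ex)
    have [measurable]: "pt_Lip (F j) \<in> borel_measurable \<mu>" by (rule pt_Lip_measurable_mu[OF F(1)])
    have "ennreal 2 * (ennreal (1/2) * (\<integral>\<^sup>+x. ennreal ((pt_Lip (F j) x)\<^sup>2) \<partial>\<mu>)) < ennreal 2 * ennreal c"
      using j(1) by (intro ennreal_mult_strict_left_mono) auto
    moreover have "ennreal 2 * (ennreal (1/2) * X) = X" for X :: ennreal
      by (simp only: mult.assoc[symmetric] ennreal_mult'[symmetric]) simp
    ultimately have nn: "(\<integral>\<^sup>+x. ennreal ((pt_Lip (F j) x)\<^sup>2) \<partial>\<mu>) < ennreal (2 * c)"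
      using c by (simp add: ennreal_mult')
    then have L2: "pt_Lip (F j) \<in> Lp \<mu> 2"
      using less_trans[OF nn ennreal_less_top] by (auto simp: Lp2_iff integrable_iff_bounded)
    have "ennreal ((Lp_norm \<mu> 2 (pt_Lip (F j)))\<^sup>2) < ennreal (2 * c)"
      using nn Lp2_integrable_square[OF L2] by (subst (asm) nn_integral_eq_integral) (auto simp: Lp2_norm_square)
    then have "(Lp_norm \<mu> 2 (pt_Lip (F j)))\<^sup>2 < 2 * c" by (simp add: ennreal_less_iff)
    then show ?thesis using F(1) j(2) L2 Lp2_tendstoD(1)[OF F(2)] by (intro exI[of _ "F j"]) (auto simp: c_def P_def)
  qed
  then obtain H where HP: "\<And>k. P k (H k)" by metis
  have H: "H k \<in> Lip_fun" "H k \<in> Lp \<mu> 2" "Lp_norm \<mu> 2 (\<lambda>x. H k x - u x) < 1 / real (Suc k)"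
     "pt_Lip (H k) \<in> Lp \<mu> 2" "(Lp_norm \<mu> 2 (pt_Lip (H k)))\<^sup>2 < 2 * C + 2 / real (Suc k)" for k
    using HP[of k] unfolding P_def by blast+
  have Hu: "Lp_tendsto \<mu> 2 H u"
    by (rule Lp2_tendstoI[OF H(2) u2 LIMSEQ_Suc[OF lim_1_over_n] less_imp_le[OF H(3)]])
  have "\<exists>G. Lp_tendsto \<mu> 2 (\<lambda>k. pt_Lip (H k)) G"
  proof (rule Lp2_complete[OF H(4)])
    fix e :: real assume e: "e > 0"
    define \<delta> where "\<delta> = e\<^sup>2 / 16"
    have \<delta>: "\<delta> > 0" using e by (simp add: \<delta>_def)
    obtain e' where e': "e' > 0" "\<And>H a. H \<in> Lip_fun \<Longrightarrow> H \<in> Lp \<mu> 2 \<Longrightarrow> Lp_norm \<mu> 2 (\<lambda>x. H x - u x) < e' \<Longrightarrow> a \<in> Lp \<mu> 2 \<Longrightarrow>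
      (AE x in \<mu>. pt_Lip H x \<le> a x) \<Longrightarrow> 2 * (C - \<delta>) \<le> (Lp_norm \<mu> 2 a)\<^sup>2"
      using Cheeger_lower_semicontinuous[OF u2 C \<delta>] by blast
    obtain k where k: "1 / real (Suc k) < min e' \<delta>"
      using e'(1) \<delta> by (metis inverse_eq_divide min_less_iff_conj reals_Archimedean)
    have "Lp_norm \<mu> 2 (\<lambda>x. pt_Lip (H m) x - pt_Lip (H n) x) < e" if "m \<ge> k" "n \<ge> k" for m n
    proof -
      have small: "1 / real (Suc m) \<le> 1 / real (Suc k)" "1 / real (Suc n) \<le> 1 / real (Suc k)"
        using that by (auto intro!: divide_left_mono)
      have L1: "(\<lambda>x. 1/2 * H m x + 1/2 * H n x) \<in> Lip_fun" by (intro Lip_fun_add Lip_fun_cmult H)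
      have L2: "(\<lambda>x. 1/2 * H m x + 1/2 * H n x) \<in> Lp \<mu> 2" by (intro Lp2_add Lp2_cmult H)
      have "Lp_norm \<mu> 2 (\<lambda>x. 1/2 * H m x + 1/2 * H n x - u x)
         = Lp_norm \<mu> 2 (\<lambda>x. 1/2 * (H m x - u x) + 1/2 * (H n x - u x))" by (simp add: algebra_simps)
      also have "\<dots> \<le> Lp_norm \<mu> 2 (\<lambda>x. 1/2 * (H m x - u x)) + Lp_norm \<mu> 2 (\<lambda>x. 1/2 * (H n x - u x))"
        by (intro Lp2_triangle Lp2_cmult Lp2_diff H u2)
      also have "\<dots> < e'" using H(3)[of m] H(3)[of n] small k unfolding Lp2_norm_cmult by simp
      finally have L3: "Lp_norm \<mu> 2 (\<lambda>x. 1/2 * H m x + 1/2 * H n x - u x) < e'" .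
      have L4: "AE x in \<mu>. pt_Lip (\<lambda>x. 1/2 * H m x + 1/2 * H n x) x \<le> 1/2 * pt_Lip (H m) x + 1/2 * pt_Lip (H n) x"
      proof (rule AE_I2)
        fix x
        obtain a b where "lip_le (H m) x a" "lip_le (H n) x b" using Lip_fun_lip_le H(1) by metis
        then show "pt_Lip (\<lambda>x. 1/2 * H m x + 1/2 * H n x) x \<le> 1/2 * pt_Lip (H m) x + 1/2 * pt_Lip (H n) x"
          using pt_Lip_add[OF lip_le_cmult lip_le_cmult, of "H m" x a "H n" b "1/2" "1/2"]
            pt_Lip_cmult[of "H m" x a "1/2"] pt_Lip_cmult[of "H n" x b "1/2"] by simp
      qed
      have "2 * (C - \<delta>) \<le> (Lp_norm \<mu> 2 (\<lambda>x. 1/2 * pt_Lip (H m) x + 1/2 * pt_Lip (H n) x))\<^sup>2"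
        by (rule e'(2)[OF L1 L2 L3 _ L4]) (intro Lp2_add Lp2_cmult H)
      moreover have "(Lp_norm \<mu> 2 (\<lambda>x. 1/2 * pt_Lip (H m) x + 1/2 * pt_Lip (H n) x))\<^sup>2 +
          (Lp_norm \<mu> 2 (\<lambda>x. 1/2 * (pt_Lip (H m) x - pt_Lip (H n) x)))\<^sup>2
        = ((Lp_norm \<mu> 2 (pt_Lip (H m)))\<^sup>2 + (Lp_norm \<mu> 2 (pt_Lip (H n)))\<^sup>2) / 2"
        using Lp2_parallelogram[OF H(4)[of m] H(4)[of n]] by (simp add: add_divide_distrib)
      moreover have "(Lp_norm \<mu> 2 (\<lambda>x. 1/2 * (pt_Lip (H m) x - pt_Lip (H n) x)))\<^sup>2
        = (Lp_norm \<mu> 2 (\<lambda>x. pt_Lip (H m) x - pt_Lip (H n) x))\<^sup>2 / 4"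
        unfolding Lp2_norm_cmult by (simp add: power_mult_distrib power_divide)
      moreover have "(Lp_norm \<mu> 2 (pt_Lip (H m)))\<^sup>2 < 2 * C + 2 * \<delta>" "(Lp_norm \<mu> 2 (pt_Lip (H n)))\<^sup>2 < 2 * C + 2 * \<delta>"
        using H(5)[of m] H(5)[of n] small k by (simp_all only: min_less_iff_conj) linarith+
      ultimately have "(Lp_norm \<mu> 2 (\<lambda>x. pt_Lip (H m) x - pt_Lip (H n) x))\<^sup>2 < 16 * \<delta>" by argo
      then show ?thesis using e by (intro power2_less_imp_less[of _ e]) (auto simp: \<delta>_def)
    qed
    then show "\<exists>n0. \<forall>m\<ge>n0. \<forall>n\<ge>n0. Lp_norm \<mu> 2 (\<lambda>x. pt_Lip (H m) x - pt_Lip (H n) x) < e" by blast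
  qed
  then obtain G where G: "Lp_tendsto \<mu> 2 (\<lambda>k. pt_Lip (H k)) G" by blast
  have ug: "upper_grad u G" by (rule upper_gradI[OF H(1) Hu G]) simp
  have "(Lp_norm \<mu> 2 G)\<^sup>2 \<le> 2 * C"
  proof (rule LIMSEQ_le)
    show "(\<lambda>k. (Lp_norm \<mu> 2 (pt_Lip (H k)))\<^sup>2) \<longlonglongrightarrow> (Lp_norm \<mu> 2 G)\<^sup>2"
      by (intro tendsto_power Lp2_tendsto_norm[OF G])
    show "(\<lambda>k. 2 * C + 2 / real (Suc k)) \<longlonglongrightarrow> 2 * C"
      using tendsto_add[OF tendsto_const LIMSEQ_Suc[OF lim_const_over_n], of "2 * C" 2] by simp
    show "\<exists>N. \<forall>k\<ge>N. (Lp_norm \<mu> 2 (pt_Lip (H k)))\<^sup>2 \<le> 2 * C + 2 / real (Suc k)" using H(5) less_imp_le by blast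
  qed
  then have "ennreal (1/2 * (\<integral>x. (G x)\<^sup>2 \<partial>\<mu>)) \<le> ennreal C"
    by (intro ennreal_leI) (simp add: Lp2_norm_square)
  then have "minimal_grad u G"
    unfolding minimal_grad_def using Cheeger_le_upper_grad[OF ug] ug unfolding C(1) by (intro conjI antisym) 
  then show ?thesis using H(1) Hu G by blast
qed

lemma upper_grad_Cheeger_dom: "upper_grad u G \<Longrightarrow> u \<in> Cheeger_dom \<mu>"
  using Cheeger_le_upper_grad[of u G] upper_grad_L2[of u G] by (auto simp: Cheeger_dom_def intro: le_less_trans)

lemma minimal_grad_exists: "u \<in> Cheeger_dom \<mu> \<Longrightarrow> \<exists>G. minimal_grad u G"
  using minimal_grad_strong_approximation by blast

lemma minimal_gradD: "minimal_grad u G \<Longrightarrow> upper_grad u G"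
  by (simp add: minimal_grad_def)

section \<open>Pointwise minimality and locality\<close>

text \<open>
  Mixing two approximations of the same function by a cut-off \<open>\<eta>\<close> costs only the term
  \<open>\<bar>F1 - F2\<bar>\<close> times the Lipschitz constant of \<open>\<eta>\<close>, which disappears in the limit.
\<close>

lemma upper_grad_mix:
  assumes \<eta>: "\<eta> \<in> Lip0 UNIV" "\<And>x. 0 \<le> \<eta> x \<and> \<eta> x \<le> 1"
    and "upper_grad u G" "upper_grad u G'"
  shows "upper_grad u (\<lambda>x. (1 - \<eta> x) * G x + \<eta> x * G' x)"
proof -
  obtain F g where 1: "\<And>j. F j \<in> Lip_fun" "Lp_tendsto \<mu> 2 F u" "Lp_tendsto \<mu> 2 g G"
    "\<And>j. AE x in \<mu>. pt_Lip (F j) x \<le> g j x" using assms(3) unfolding upper_grad_def by blast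
  obtain F' g' where 2: "\<And>j. F' j \<in> Lip_fun" "Lp_tendsto \<mu> 2 F' u" "Lp_tendsto \<mu> 2 g' G'"
    "\<And>j. AE x in \<mu>. pt_Lip (F' j) x \<le> g' j x" using assms(4) unfolding upper_grad_def by blast
  obtain K where K: "K-lipschitz_on UNIV \<eta>" using \<eta>(1) by (auto simp: Lip0_def Lip_fun_def)
  have K0: "K \<ge> 0" using K by (rule lipschitz_on_nonneg)
  have \<eta>m: "\<eta> \<in> borel_measurable \<mu>" by (rule Lip_fun_measurable[OF Lip0_Lip_fun[OF \<eta>(1)]])
  have \<eta>1: "\<bar>\<eta> x\<bar> \<le> 1" "\<bar>1 - \<eta> x\<bar> \<le> 1" for x using \<eta>(2)[of x] by auto
  have mult: "Lp_tendsto \<mu> 2 (\<lambda>j x. \<eta> x * A j x) (\<lambda>x. \<eta> x * a x)"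
    "Lp_tendsto \<mu> 2 (\<lambda>j x. (1 - \<eta> x) * A j x) (\<lambda>x. (1 - \<eta> x) * a x)" if "Lp_tendsto \<mu> 2 A a" for A a
    using \<eta>m \<eta>1 that by (intro Lp2_tendsto_mult_bounded[where C = 1]; simp)+
  define H where "H j x = F j x + \<eta> x * (F' j x - F j x)" for j x
  have d0: "Lp_tendsto \<mu> 2 (\<lambda>j x. F' j x - F j x) (\<lambda>x. u x - u x)" by (rule Lp2_tendsto_diff[OF 2(2) 1(2)])
  have "Lp_tendsto \<mu> 2 H (\<lambda>x. u x + \<eta> x * (u x - u x))"
    unfolding H_def by (intro Lp2_tendsto_add 1(2) mult d0)
  then have Hu: "Lp_tendsto \<mu> 2 H u" by simp
  have HL: "H j \<in> Lip_fun" for j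
    unfolding H_def by (intro Lip_fun_add 1(1) Lip0_Lip_fun[OF Lip0_mult[OF open_UNIV \<eta>(1)]] Lip_fun_diff 2(1))
  have d0': "Lp_tendsto \<mu> 2 (\<lambda>j x. \<bar>F' j x - F j x\<bar>) (\<lambda>x. 0)"
  proof (rule Lp2_tendstoI)
    show "(\<lambda>j. Lp_norm \<mu> 2 (\<lambda>x. F' j x - F j x)) \<longlonglongrightarrow> 0" using Lp2_tendstoD(3)[OF d0] by simp
    show "Lp_norm \<mu> 2 (\<lambda>x. \<bar>F' j x - F j x\<bar> - 0) \<le> Lp_norm \<mu> 2 (\<lambda>x. F' j x - F j x)" for j by (simp add: Lp2_norm)
    show "(\<lambda>x. \<bar>F' j x - F j x\<bar>) \<in> Lp \<mu> 2" for j
      using Lp2_abs[OF Lp2_tendstoD(1)[OF d0, of j]] by simp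
  qed simp
  have "Lp_tendsto \<mu> 2 (\<lambda>j x. (1 - \<eta> x) * g j x + \<eta> x * g' j x + K * \<bar>F' j x - F j x\<bar>)
      (\<lambda>x. (1 - \<eta> x) * G x + \<eta> x * G' x + K * 0)"
    by (intro Lp2_tendsto_add Lp2_tendsto_cmult d0' mult 1(3) 2(3))
  then have lim: "Lp_tendsto \<mu> 2 (\<lambda>j x. (1 - \<eta> x) * g j x + \<eta> x * g' j x + K * \<bar>F' j x - F j x\<bar>)
      (\<lambda>x. (1 - \<eta> x) * G x + \<eta> x * G' x)" by simp
  have "AE x in \<mu>. pt_Lip (H j) x \<le> (1 - \<eta> x) * g j x + \<eta> x * g' j x + K * \<bar>F' j x - F j x\<bar>" for j
    using 1(4)[of j] 2(4)[of j]
  proof eventually_elim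
    case (elim x)
    obtain a where a: "lip_le (F j) x a" using Lip_fun_lip_le 1(1) by blast
    obtain b where b: "lip_le (F' j) x b" using Lip_fun_lip_le 2(1) by blast
    note L = lip_le_pt_Lip[OF a] lip_le_pt_Lip[OF b]
    have e: "lip_le \<eta> x K" by (rule lip_le_lipschitz[OF K open_UNIV UNIV_I])
    have "lip_le (\<lambda>y. (\<eta> y * (F' j y - F j y) - \<eta> x * (F' j y - F j y) - (F' j x - F j x) * \<eta> y)
        + ((1 - \<eta> x) * F j y + \<eta> x * F' j y + (F' j x - F j x) * \<eta> y)) x
        (0 + (\<bar>1 - \<eta> x\<bar> * pt_Lip (F j) x + \<bar>\<eta> x\<bar> * pt_Lip (F' j) x + \<bar>F' j x - F j x\<bar> * K))"
      by (intro lip_le_add lip_le_cmult L e lip_le_mult_error[OF e lip_le_diff[OF L(2,1)]])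
    moreover have "(\<lambda>y. (\<eta> y * (F' j y - F j y) - \<eta> x * (F' j y - F j y) - (F' j x - F j x) * \<eta> y)
        + ((1 - \<eta> x) * F j y + \<eta> x * F' j y + (F' j x - F j x) * \<eta> y)) = H j"
      by (auto simp: H_def algebra_simps)
    ultimately have "pt_Lip (H j) x \<le> (1 - \<eta> x) * pt_Lip (F j) x + \<eta> x * pt_Lip (F' j) x + K * \<bar>F' j x - F j x\<bar>"
      using pt_Lip_le(2) \<eta>(2)[of x] by (fastforce simp: mult.commute)
    also have "\<dots> \<le> (1 - \<eta> x) * g j x + \<eta> x * g' j x + K * \<bar>F' j x - F j x\<bar>"
      using elim \<eta>(2)[of x] K0 by (intro add_mono mult_left_mono) auto
    finally show ?case .
  qed
  from upper_gradI[OF HL Hu lim this] show ?thesis .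
qed

text \<open>
  By inner regularity, a set \<open>{p < 0}\<close> of positive measure would contain a compact set of positive measure.
\<close>

lemma AE_nonneg_if_compact_integrals_nonneg:
  fixes p :: "'a \<Rightarrow> real"
  assumes p: "integrable \<mu> p" and nn: "\<And>C. compact C \<Longrightarrow> 0 \<le> (\<integral>x. indicator C x * p x \<partial>\<mu>)"
  shows "AE x in \<mu>. 0 \<le> p x"
proof (rule ccontr)
  have [measurable]: "p \<in> borel_measurable \<mu>" using p by simp
  assume "\<not> (AE x in \<mu>. 0 \<le> p x)"
  have "{x \<in> space \<mu>. p x < 0} \<in> sets \<mu>" by measurable
  then have B: "{x. p x < 0} \<in> sets \<mu>" by simp
  have "emeasure \<mu> {x. p x < 0} \<noteq> 0"
    using \<open>\<not> (AE x in \<mu>. 0 \<le> p x)\<close> B by (subst (asm) AE_iff_measurable[OF B]) (auto simp: not_le)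
  then obtain C where C: "compact C" "C \<subseteq> {x. p x < 0}" "emeasure \<mu> C > 0"
    using compact_subset_pos[of "{x. p x < 0}" 0] B by (auto simp: zero_less_iff_neq_zero)
  have [measurable]: "C \<in> sets \<mu>" using C(1) by (simp add: borel_compact)
  have int: "integrable \<mu> (\<lambda>x. indicator C x * - p x)"
    using integrable_mult_indicator[OF \<open>C \<in> sets \<mu>\<close>, of "\<lambda>x. - p x"] p by simp
  have nonneg: "0 \<le> indicator C x * - p x" for x using C(2) by (auto simp: indicator_def)
  have "0 \<le> (\<integral>x. indicator C x * - p x \<partial>\<mu>)"
    by (rule integral_nonneg_AE) (use nonneg in auto)
  then have "(\<integral>x. indicator C x * - p x \<partial>\<mu>) = 0" using nn[OF C(1)] by simp
  then have "AE x in \<mu>. indicator C x * - p x = 0"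
    using integral_nonneg_eq_0_iff_AE[OF int] nonneg by simp
  then have "AE x in \<mu>. x \<notin> C" by eventually_elim (use C(2) in \<open>auto simp: indicator_def split: if_splits\<close>)
  then have "emeasure \<mu> C = 0" using AE_iff_measurable[OF \<open>C \<in> sets \<mu>\<close>, of "\<lambda>x. x \<notin> C"] by simp
  then show False using C(3) by simp
qed

text \<open>
  Minimality in norm implies minimality almost everywhere: mixing with a cut-off \<open>t \<eta>\<close> and letting
  \<open>t\<close> tend to zero, the first variation \<open>\<integral> \<eta> G (G' - G)\<close> is nonnegative for every cut-off.
\<close>

lemma minimal_grad_le:
  assumes min: "minimal_grad u G" and ug': "upper_grad u G'"
  shows "AE x in \<mu>. G x \<le> G' x"
proof -
  have ug: "upper_grad u G" using min by (rule minimal_gradD)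
  note L2 = upper_grad_L2(2)[OF ug] upper_grad_L2(2)[OF ug']
  define p where "p x = G x * (G' x - G x)" for x
  have p: "integrable \<mu> p" unfolding p_def by (intro Lp2_integrable_mult L2 Lp2_diff)
  have var: "0 \<le> (\<integral>x. \<eta> x * p x \<partial>\<mu>)" if \<eta>: "\<eta> \<in> Lip0 UNIV" "\<And>x. 0 \<le> \<eta> x \<and> \<eta> x \<le> 1" for \<eta>
  proof (rule ccontr)
    define D where "D x = \<eta> x * (G' x - G x)" for x
    have D: "D \<in> Lp \<mu> 2"
      unfolding D_def using \<eta>(2)
      by (intro Lp2_bounded_mult[where C = 1] Lp2_diff L2 Lip_fun_measurable[OF Lip0_Lip_fun[OF \<eta>(1)]]) auto
    define I J where "I = (\<integral>x. G x * D x \<partial>\<mu>)" and "J = (\<integral>x. (D x)\<^sup>2 \<partial>\<mu>)"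
    have J: "J \<ge> 0" by (simp add: J_def)
    assume "\<not> 0 \<le> (\<integral>x. \<eta> x * p x \<partial>\<mu>)"
    moreover have "I = (\<integral>x. \<eta> x * p x \<partial>\<mu>)"
      unfolding I_def D_def p_def by (intro Bochner_Integration.integral_cong) (auto simp: mult_ac)
    ultimately have I: "I < 0" by simp
    have key: "0 \<le> 2 * I + t * J" if t: "0 < t" "t \<le> 1" for t
    proof -
      have t01: "0 \<le> t * \<eta> x \<and> t * \<eta> x \<le> 1" for x
        using \<eta>(2)[of x] t mult_mono[of t 1 "\<eta> x" 1] by auto
      have "upper_grad u (\<lambda>x. (1 - t * \<eta> x) * G x + t * \<eta> x * G' x)"
        by (rule upper_grad_mix[OF Lip0_cmult[OF \<eta>(1)] t01 ug ug'])
      from Cheeger_le_upper_grad[OF this]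
      have "ennreal (1/2 * (\<integral>x. (G x)\<^sup>2 \<partial>\<mu>)) \<le> ennreal (1/2 * (\<integral>x. ((1 - t * \<eta> x) * G x + t * \<eta> x * G' x)\<^sup>2 \<partial>\<mu>))"
        using min by (simp add: minimal_grad_def)
      then have "(\<integral>x. (G x)\<^sup>2 \<partial>\<mu>) \<le> (\<integral>x. ((1 - t * \<eta> x) * G x + t * \<eta> x * G' x)\<^sup>2 \<partial>\<mu>)"
        by (subst (asm) ennreal_le_iff) auto
      also have "\<dots> = (\<integral>x. (G x)\<^sup>2 + (2 * t) * (G x * D x) + t\<^sup>2 * (D x)\<^sup>2 \<partial>\<mu>)"
        by (intro Bochner_Integration.integral_cong) (auto simp: D_def power2_eq_square algebra_simps)
      also have "\<dots> = (\<integral>x. (G x)\<^sup>2 \<partial>\<mu>) + 2 * t * I + t\<^sup>2 * J"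
        using Lp2_integrable_square[OF L2(1)] Lp2_integrable_mult[OF L2(1) D] Lp2_integrable_square[OF D]
        by (simp add: I_def J_def)
      finally have "0 \<le> t * (2 * I + t * J)" by (simp add: power2_eq_square algebra_simps)
      then show ?thesis using t by (simp add: zero_le_mult_iff)
    qed
    have "0 \<le> 2 * I + min 1 (- I / (J + 1)) * J" using I J by (intro key) (auto intro: divide_neg_pos)
    also have "\<dots> \<le> 2 * I + (- I / (J + 1)) * J" using J by (intro add_left_mono mult_right_mono) auto
    also have "\<dots> \<le> 2 * I + (- I)" using I J by (simp add: field_simps)
    finally show False using I by simp
  qed
  have "AE x in \<mu>. 0 \<le> p x"
  proof (rule AE_nonneg_if_compact_integrals_nonneg[OF p])
    fix C :: "'a set" assume C: "compact C"
    show "0 \<le> (\<integral>x. indicator C x * p x \<partial>\<mu>)"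
    proof (cases "C = {}")
      case False
      define V where "V k = {x. infdist x C < 1 / real (Suc k)}" for k
      have Vo: "open (V k)" for k unfolding V_def by (intro open_Collect_less continuous_intros)
      have "\<exists>\<eta>\<in>Lip0 (V k). (\<forall>x. 0 \<le> \<eta> x \<and> \<eta> x \<le> 1) \<and> (\<exists>W. open W \<and> C \<subseteq> W \<and> W \<subseteq> V k \<and> (\<forall>x\<in>W. \<eta> x = 1))" for k
        by (rule Lip0_cutoff[OF C Vo]) (auto simp: V_def)
      then have "\<exists>\<eta>\<in>Lip0 (V k). (\<forall>x. 0 \<le> \<eta> x \<and> \<eta> x \<le> 1) \<and> (\<forall>x\<in>C. \<eta> x = 1)" for k by blast
      then obtain \<eta> where \<eta>: "\<And>k. \<eta> k \<in> Lip0 (V k)" "\<And>k x. 0 \<le> \<eta> k x \<and> \<eta> k x \<le> 1" "\<And>k x. x \<in> C \<Longrightarrow> \<eta> k x = 1"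
        by metis
      have [measurable]: "\<eta> k \<in> borel_measurable \<mu>" for k by (rule Lip_fun_measurable[OF Lip0_Lip_fun[OF \<eta>(1)]])
      have [measurable]: "C \<in> sets \<mu>" using C by (simp add: borel_compact)
      have [measurable]: "p \<in> borel_measurable \<mu>" using p by simp
      have "(\<lambda>k. \<integral>x. \<eta> k x * p x \<partial>\<mu>) \<longlonglongrightarrow> (\<integral>x. indicator C x * p x \<partial>\<mu>)"
      proof (rule integral_dominated_convergence)
        show "integrable \<mu> (\<lambda>x. \<bar>p x\<bar>)" using p by simp
        show "AE x in \<mu>. norm (\<eta> k x * p x) \<le> \<bar>p x\<bar>" for k
          using \<eta>(2)[of k] by (auto simp: abs_mult intro!: AE_I2 mult_left_le_one_le)
        show "AE x in \<mu>. (\<lambda>k. \<eta> k x * p x) \<longlonglongrightarrow> indicator C x * p x"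
        proof (rule AE_I2)
          fix x
          have "(\<lambda>k. \<eta> k x) \<longlonglongrightarrow> indicator C x"
          proof (cases "x \<in> C")
            case True then show ?thesis using \<eta>(3) by simp
          next
            case False
            then have "infdist x C > 0"
              using infdist_pos_not_in_closed[OF compact_imp_closed[OF C] \<open>C \<noteq> {}\<close>] by blast
            then obtain n where n: "1 / real (Suc n) < infdist x C" by (metis inverse_eq_divide reals_Archimedean)
            have "\<eta> k x = 0" if "k \<ge> n" for k
            proof (rule Lip0_outside[OF \<eta>(1)])
              have "1 / real (Suc k) \<le> 1 / real (Suc n)" using that by (intro divide_left_mono) auto
              then show "x \<notin> V k" using n by (simp add: V_def)
            qed
            then have "\<forall>\<^sub>F k in sequentially. \<eta> k x = 0" by (auto simp: eventually_sequentially)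
            then show ?thesis using False by (simp add: tendsto_eventually)
          qed
          then show "(\<lambda>k. \<eta> k x * p x) \<longlonglongrightarrow> indicator C x * p x" by (intro tendsto_mult tendsto_const)
        qed
      qed measurable
      then show ?thesis
        by (rule LIMSEQ_le_const) (use var[OF Lip0_mono[OF subset_UNIV \<eta>(1)] \<eta>(2)] in auto)
    qed simp
  qed
  with upper_grad_nonneg[OF ug] upper_grad_nonneg[OF ug'] show ?thesis
  proof eventually_elim
    case (elim x)
    then show ?case unfolding p_def by (cases "G x = 0") (auto simp: zero_le_mult_iff)
  qed
qed

lemma minimal_grad_unique: "minimal_grad u G \<Longrightarrow> minimal_grad u G' \<Longrightarrow> AE x in \<mu>. G x = G' x"
  using minimal_grad_le[of u G G'] minimal_grad_le[of u G' G] minimal_gradD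
  by (auto elim: eventually_elim2)

lemma minimal_grad_cong:
  assumes "minimal_grad u G" "AE x in \<mu>. G x = G' x" "G' \<in> borel_measurable \<mu>"
  shows "minimal_grad u G'"
proof -
  have G: "G \<in> Lp \<mu> 2" by (rule upper_grad_L2[OF minimal_gradD[OF assms(1)]])
  have G': "G' \<in> Lp \<mu> 2" by (rule Lp2_dominated[OF G assms(3)]) (use assms(2) in eventually_elim, simp)
  have "upper_grad u G'"
    by (rule upper_grad_mono[OF minimal_gradD[OF assms(1)] G']) (use assms(2) in eventually_elim, simp)
  moreover have "(\<integral>x. (G x)\<^sup>2 \<partial>\<mu>) = (\<integral>x. (G' x)\<^sup>2 \<partial>\<mu>)"
    using assms(2) G G' by (intro integral_cong_AE) (auto dest: Lp2_measurable)
  ultimately show ?thesis using assms(1) by (simp add: minimal_grad_def)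
qed

text \<open>
  Truncating \<open>u\<close> around the value zero gives functions whose gradients are supported on \<open>{u \<noteq> 0}\<close> and
  which converge to \<open>u\<close>.
\<close>

lemma upper_grad_truncate:
  assumes "upper_grad u G" and \<epsilon>: "\<epsilon> > 0"
  shows "upper_grad (\<lambda>x. u x - max (-\<epsilon>) (min (u x) \<epsilon>)) (\<lambda>x. min 1 (\<bar>u x\<bar> / \<epsilon>) * G x)"
proof -
  define \<psi> where "\<psi> s = s - max (-\<epsilon>) (min s \<epsilon>)" for s :: real
  define \<theta> where "\<theta> s = min 1 (\<bar>s\<bar> / \<epsilon>)" for s :: real
  have \<psi>lip: "\<bar>\<psi> s - \<psi> t\<bar> \<le> \<bar>s - t\<bar>" for s t unfolding \<psi>_def by linarith
  have \<psi>0: "\<psi> s = 0" if "\<bar>s\<bar> < \<epsilon>" for s using that unfolding \<psi>_def by linarith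
  have \<theta>01: "0 \<le> \<theta> s" "\<bar>\<theta> s\<bar> \<le> 1" for s using \<epsilon> by (auto simp: \<theta>_def)
  have [measurable]: "\<psi> \<in> borel_measurable borel" "\<theta> \<in> borel_measurable borel"
    unfolding \<psi>_def \<theta>_def by measurable
  obtain F0 g0 where 0: "\<And>j. F0 j \<in> Lip_fun" "Lp_tendsto \<mu> 2 F0 u" "Lp_tendsto \<mu> 2 g0 G"
    "\<And>j. AE x in \<mu>. pt_Lip (F0 j) x \<le> g0 j x" using assms(1) unfolding upper_grad_def by blast
  obtain r where r: "strict_mono r" "AE x in \<mu>. (\<lambda>j. F0 (r j) x) \<longlonglongrightarrow> u x" using Lp2_tendsto_AE_subseq[OF 0(2)] by blast
  define F g where "F j = F0 (r j)" and "g j = g0 (r j)" for j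
  have 1: "\<And>j. F j \<in> Lip_fun" "Lp_tendsto \<mu> 2 F u" "Lp_tendsto \<mu> 2 g G" "\<And>j. AE x in \<mu>. pt_Lip (F j) x \<le> g j x"
    unfolding F_def g_def using 0 r by (auto intro: Lp2_tendsto_subseq)
  have lim: "AE x in \<mu>. (\<lambda>j. F j x) \<longlonglongrightarrow> u x" using r(2) by (simp add: F_def)
  have [measurable]: "F j \<in> borel_measurable \<mu>" for j by (rule Lip_fun_measurable[OF 1(1)])
  have u2: "u \<in> Lp \<mu> 2" by (rule Lp2_tendstoD(2)[OF 1(2)])
  then have [measurable]: "u \<in> borel_measurable \<mu>" by (rule Lp2_measurable)
  have \<psi>L2: "(\<lambda>x. \<psi> (v x)) \<in> Lp \<mu> 2" if "v \<in> Lp \<mu> 2" for v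
  proof (rule Lp2_dominated[OF that])
    show "AE x in \<mu>. \<bar>\<psi> (v x)\<bar> \<le> \<bar>v x\<bar>" using \<psi>lip[of _ 0] \<psi>0[of 0] \<epsilon> by simp
  qed (use Lp2_measurable[OF that] in measurable)
  have a: "(\<lambda>x. \<psi> (F j x)) \<in> Lip_fun" for j
  proof -
    obtain C where C: "C-lipschitz_on UNIV (F j)" using 1(1)[of j] by (auto simp: Lip_fun_def)
    then have "C-lipschitz_on UNIV (\<lambda>x. \<psi> (F j x))"
      by (auto simp: lipschitz_on_def dist_real_def intro: order_trans[OF \<psi>lip])
    then show ?thesis by (auto simp: Lip_fun_def)
  qed
  have b: "Lp_tendsto \<mu> 2 (\<lambda>j x. \<psi> (F j x)) (\<lambda>x. \<psi> (u x))"
  proof (rule Lp2_tendstoI[OF \<psi>L2[OF Lp2_tendstoD(1)[OF 1(2)]] \<psi>L2[OF u2] Lp2_tendstoD(3)[OF 1(2)]])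
    show "Lp_norm \<mu> 2 (\<lambda>x. \<psi> (F j x) - \<psi> (u x)) \<le> Lp_norm \<mu> 2 (\<lambda>x. F j x - u x)" for j
      using \<psi>lip by (intro Lp2_norm_mono Lp2_diff u2 Lp2_tendstoD(1)[OF 1(2)]) auto
  qed
  have c: "Lp_tendsto \<mu> 2 (\<lambda>j x. \<theta> (F j x) * g j x) (\<lambda>x. \<theta> (u x) * G x)"
  proof (rule Lp2_tendsto_mult_bounded[OF 1(3), where C = 1])
    show "AE x in \<mu>. (\<lambda>j. \<theta> (F j x)) \<longlonglongrightarrow> \<theta> (u x)"
      using lim by eventually_elim (use \<epsilon> in \<open>auto simp: \<theta>_def intro!: tendsto_intros\<close>)
  qed (use \<theta>01 in auto)
  have d: "AE x in \<mu>. pt_Lip (\<lambda>x. \<psi> (F j x)) x \<le> \<theta> (F j x) * g j x" for j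
    using 1(4)[of j]
  proof eventually_elim
    case (elim x)
    obtain L where "lip_le (F j) x L" using Lip_fun_lip_le 1(1) by blast
    then have L: "lip_le (F j) x (pt_Lip (F j) x)" by (rule lip_le_pt_Lip)
    show ?case
    proof (cases "\<bar>F j x\<bar> < \<epsilon>")
      case True
      have "((\<lambda>y. \<bar>F j y\<bar>) \<longlongrightarrow> \<bar>F j x\<bar>) (nhds x)" by (intro tendsto_intros lip_le_tendsto[OF L])
      then have "\<forall>\<^sub>F y in nhds x. \<bar>F j y\<bar> < \<epsilon>" using True order_tendstoD(2) by blast
      then have "\<forall>\<^sub>F y in nhds x. \<psi> (F j y) = 0" by eventually_elim (rule \<psi>0)
      from pt_Lip_le(2)[OF lip_le_eq[OF lip_le_0[of 0 x] this]]
      have "pt_Lip (\<lambda>x. \<psi> (F j x)) x \<le> 0" .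
      also have "0 \<le> \<theta> (F j x) * g j x"
        using \<theta>01(1) pt_Lip_Lip_fun_nonneg[OF 1(1)[of j], of x] elim by (intro mult_nonneg_nonneg) auto
      finally show ?thesis .
    next
      case False
      have "lip_le (\<lambda>x. \<psi> (F j x)) x (pt_Lip (F j) x)"
        using L \<psi>lip unfolding lip_le_def by (blast intro: order_trans eventually_mono)
      then have "pt_Lip (\<lambda>x. \<psi> (F j x)) x \<le> pt_Lip (F j) x" by (rule pt_Lip_le(2))
      moreover have "\<theta> (F j x) = 1" using False \<epsilon> by (simp add: \<theta>_def field_simps)
      ultimately show ?thesis using elim by simp
    qed
  qed
  show ?thesis using upper_gradI[OF a b c d] by (simp add: \<psi>_def \<theta>_def)
qed

text \<open>
  In the limit \<open>\<epsilon> \<rightarrow> 0\<close> the truncations show that \<open>G\<close>, set to zero on \<open>{u = 0}\<close>, still dominates a gradient of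
  \<open>u\<close>, so minimality applies.
\<close>

lemma minimal_grad_zero_on_level:
  assumes "minimal_grad u G"
  shows "AE x in \<mu>. u x = 0 \<longrightarrow> G x = 0"
proof -
  have ug: "upper_grad u G" by (rule minimal_gradD[OF assms])
  note u2 = upper_grad_L2(1)[OF ug] and G2 = upper_grad_L2(2)[OF ug]
  have [measurable]: "u \<in> borel_measurable \<mu>" "G \<in> borel_measurable \<mu>" using u2 G2 by (auto dest: Lp2_measurable)
  define \<epsilon> where "\<epsilon> k = 1 / real (Suc k)" for k
  have \<epsilon>: "\<epsilon> k > 0" for k by (simp add: \<epsilon>_def)
  have \<epsilon>0: "\<epsilon> \<longlonglongrightarrow> 0" unfolding \<epsilon>_def by (rule LIMSEQ_Suc[OF lim_1_over_n])
  have U: "Lp_tendsto \<mu> 2 (\<lambda>k x. u x - max (-\<epsilon> k) (min (u x) (\<epsilon> k))) u"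
  proof -
    define \<theta> where "\<theta> k x = (if u x = 0 then 0 else (u x - max (-\<epsilon> k) (min (u x) (\<epsilon> k))) / u x)" for k x
    have "Lp_tendsto \<mu> 2 (\<lambda>k x. \<theta> k x * u x) (\<lambda>x. indicator {x. u x \<noteq> 0} x * u x)"
    proof (rule Lp2_tendsto_mult_bounded[OF Lp2_tendsto_const[OF u2], where C = 1])
      show "\<theta> k \<in> borel_measurable \<mu>" for k unfolding \<theta>_def by measurable
      show "\<bar>\<theta> k x\<bar> \<le> 1" for k x
      proof (cases "u x = 0")
        case False
        have "\<bar>u x - max (-\<epsilon> k) (min (u x) (\<epsilon> k))\<bar> \<le> \<bar>u x\<bar>" using \<epsilon>[of k] by linarith
        then show ?thesis using False by (simp add: \<theta>_def)
      qed (simp add: \<theta>_def)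
      show "AE x in \<mu>. (\<lambda>k. \<theta> k x) \<longlonglongrightarrow> indicator {x. u x \<noteq> 0} x"
      proof (rule AE_I2)
        fix x
        show "(\<lambda>k. \<theta> k x) \<longlonglongrightarrow> indicator {x. u x \<noteq> 0} x"
        proof (cases "u x = 0")
          case False
          have "(\<lambda>k. (u x - max (-\<epsilon> k) (min (u x) (\<epsilon> k))) / u x) \<longlonglongrightarrow> (u x - max (-0) (min (u x) 0)) / u x"
            using False by (intro tendsto_intros \<epsilon>0) auto
          moreover have "max (-0) (min (u x) 0) = (0::real)" by linarith
          ultimately show ?thesis using False by (simp add: \<theta>_def)
        qed (simp add: \<theta>_def)
      qed
    qed (auto simp: indicator_def)
    moreover have "(\<lambda>k x. \<theta> k x * u x) = (\<lambda>k x. u x - max (-\<epsilon> k) (min (u x) (\<epsilon> k)))"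
    proof (intro ext)
      fix k x
      show "\<theta> k x * u x = u x - max (-\<epsilon> k) (min (u x) (\<epsilon> k))" using \<epsilon>[of k] by (auto simp: \<theta>_def)
    qed
    moreover have "(\<lambda>x. indicator {x. u x \<noteq> 0} x * u x) = u" by (auto simp: indicator_def)
    ultimately show ?thesis by simp
  qed
  have H: "Lp_tendsto \<mu> 2 (\<lambda>k x. min 1 (\<bar>u x\<bar> / \<epsilon> k) * G x) (\<lambda>x. indicator {x. u x \<noteq> 0} x * G x)"
  proof (rule Lp2_tendsto_mult_bounded[OF Lp2_tendsto_const[OF G2], where C = 1])
    show "\<bar>min 1 (\<bar>u x\<bar> / \<epsilon> k)\<bar> \<le> 1" for k x using \<epsilon>[of k] by (auto simp: min_def)
    show "AE x in \<mu>. (\<lambda>k. min 1 (\<bar>u x\<bar> / \<epsilon> k)) \<longlonglongrightarrow> indicator {x. u x \<noteq> 0} x"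
    proof (rule AE_I2)
      fix x
      show "(\<lambda>k. min 1 (\<bar>u x\<bar> / \<epsilon> k)) \<longlonglongrightarrow> indicator {x. u x \<noteq> 0} x"
      proof (cases "u x = 0")
        case False
        have "\<forall>\<^sub>F k in sequentially. \<epsilon> k < \<bar>u x\<bar>" using order_tendstoD(2)[OF \<epsilon>0] False by simp
        then have "\<forall>\<^sub>F k in sequentially. min 1 (\<bar>u x\<bar> / \<epsilon> k) = 1"
          by eventually_elim (use \<epsilon> in \<open>auto simp: min_def field_simps\<close>)
        then show ?thesis using False by (simp add: tendsto_eventually)
      qed simp
    qed
  qed (auto simp: indicator_def)
  have "upper_grad u (\<lambda>x. indicator {x. u x \<noteq> 0} x * G x)"
    by (rule upper_grad_closed[OF U H upper_grad_truncate[OF ug \<epsilon>]])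
  from minimal_grad_le[OF assms this] upper_grad_nonneg[OF ug] show ?thesis
    by eventually_elim (auto simp: indicator_def split: if_splits)
qed

lemma minimal_grad_triangle:
  assumes "minimal_grad u G" "minimal_grad v H" "upper_grad (\<lambda>x. u x - v x) D"
  shows "AE x in \<mu>. \<bar>G x - H x\<bar> \<le> D x"
proof -
  have "upper_grad (\<lambda>x. (u x - v x) + v x) (\<lambda>x. D x + H x)"
    by (rule upper_grad_add[OF assms(3) minimal_gradD[OF assms(2)]])
  then have 1: "AE x in \<mu>. G x \<le> D x + H x" using minimal_grad_le[OF assms(1)] by simp
  have "upper_grad (\<lambda>x. u x - (u x - v x)) (\<lambda>x. G x + D x)"
    by (rule upper_grad_diff[OF minimal_gradD[OF assms(1)] assms(3)])
  then have 2: "AE x in \<mu>. H x \<le> G x + D x" using minimal_grad_le[OF assms(2)] by simp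
  from 1 2 show ?thesis by eventually_elim linarith
qed

text \<open>
  On \<open>{u - v = 0}\<close> the minimal gradient of \<open>u - v\<close> vanishes, and it bounds the difference of the gradients.
\<close>

lemma minimal_grad_local:
  assumes "minimal_grad u G" "minimal_grad v H"
  shows "AE x in \<mu>. u x = v x \<longrightarrow> G x = H x"
proof -
  have "upper_grad (\<lambda>x. u x - v x) (\<lambda>x. G x + H x)"
    by (rule upper_grad_diff[OF minimal_gradD[OF assms(1)] minimal_gradD[OF assms(2)]])
  then obtain D where D: "minimal_grad (\<lambda>x. u x - v x) D"
    using minimal_grad_exists[OF upper_grad_Cheeger_dom] by blast
  from minimal_grad_zero_on_level[OF D] minimal_grad_triangle[OF assms minimal_gradD[OF D]]
  show ?thesis by eventually_elim auto
qed

section \<open>Relaxed gradients\<close>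

text \<open>
  Mazur's lemma for relaxed gradients.  The functions dominating the Lipschitz constants of
  Lipschitz functions close to \<open>u\<close> form a convex set, and the projection of a weak limit onto its
  closure is the weak limit itself.
\<close>

lemma relaxed_gradient_upper_grad:
  assumes "relaxed_gradient \<mu> u G"
  shows "upper_grad u G"
proof -
  obtain F where F: "\<And>j. F j \<in> Lip_fun" "Lp_tendsto \<mu> 2 F u" "L2_weakly_tendsto \<mu> (\<lambda>j. pt_Lip (F j)) G"
    using assms unfolding relaxed_gradient_def by blast
  have u2: "u \<in> Lp \<mu> 2" by (rule Lp2_tendstoD(2)[OF F(2)])
  have G2: "G \<in> Lp \<mu> 2" and P2: "pt_Lip (F j) \<in> Lp \<mu> 2" for j using F(3) by (auto simp: L2_weakly_tendsto_def)
  have weak: "(\<lambda>j. \<integral>x. pt_Lip (F j) x * h x \<partial>\<mu>) \<longlonglongrightarrow> (\<integral>x. G x * h x \<partial>\<mu>)" if "h \<in> Lp \<mu> 2" for h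
    using F(3) that by (auto simp: L2_weakly_tendsto_def)
  define A where "A \<delta> = {y \<in> Lp \<mu> 2. \<exists>H\<in>Lip_fun. H \<in> Lp \<mu> 2 \<and> Lp_norm \<mu> 2 (\<lambda>x. H x - u x) \<le> \<delta> \<and> (\<forall>x. pt_Lip H x \<le> y x)}" for \<delta>
  have FA: "\<forall>\<^sub>F j in sequentially. pt_Lip (F j) \<in> A \<delta>" if "\<delta> > 0" for \<delta>
    using order_tendstoD(2)[OF Lp2_tendstoD(3)[OF F(2)] that]
  proof eventually_elim
    case (elim j)
    then show ?case unfolding A_def using P2 F(1) Lp2_tendstoD(1)[OF F(2)]
      by (intro CollectI conjI bexI[of _ "F j"]) (auto intro: less_imp_le)
  qed
  have convex: "(\<lambda>x. (1 - t) * a x + t * b x) \<in> A \<delta>" if ab: "a \<in> A \<delta>" "b \<in> A \<delta>" and t: "0 \<le> t" "t \<le> 1" for a b t \<delta>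
  proof -
    obtain H where H: "H \<in> Lip_fun" "H \<in> Lp \<mu> 2" "Lp_norm \<mu> 2 (\<lambda>x. H x - u x) \<le> \<delta>" "\<And>x. pt_Lip H x \<le> a x" and a: "a \<in> Lp \<mu> 2"
      using ab(1) unfolding A_def by blast
    obtain H' where H': "H' \<in> Lip_fun" "H' \<in> Lp \<mu> 2" "Lp_norm \<mu> 2 (\<lambda>x. H' x - u x) \<le> \<delta>" "\<And>x. pt_Lip H' x \<le> b x" and b: "b \<in> Lp \<mu> 2"
      using ab(2) unfolding A_def by blast
    define M where "M x = (1 - t) * H x + t * H' x" for x
    have "M \<in> Lip_fun" unfolding M_def by (intro Lip_fun_add Lip_fun_cmult H H')
    moreover have "M \<in> Lp \<mu> 2" unfolding M_def by (intro Lp2_add Lp2_cmult H H')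
    moreover have "Lp_norm \<mu> 2 (\<lambda>x. M x - u x) \<le> \<delta>"
    proof -
      have "Lp_norm \<mu> 2 (\<lambda>x. M x - u x) = Lp_norm \<mu> 2 (\<lambda>x. (1 - t) * (H x - u x) + t * (H' x - u x))"
        by (simp add: M_def algebra_simps)
      also have "\<dots> \<le> Lp_norm \<mu> 2 (\<lambda>x. (1 - t) * (H x - u x)) + Lp_norm \<mu> 2 (\<lambda>x. t * (H' x - u x))"
        by (intro Lp2_triangle Lp2_cmult Lp2_diff H H' u2)
      also have "\<dots> \<le> (1 - t) * \<delta> + t * \<delta>"
        unfolding Lp2_norm_cmult using t H(3) H'(3) by (intro add_mono mult_mono) auto
      finally show ?thesis by (simp add: algebra_simps)
    qed
    moreover have "pt_Lip M x \<le> (1 - t) * a x + t * b x" for x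
    proof -
      obtain c d where cd: "lip_le H x c" "lip_le H' x d" using Lip_fun_lip_le H(1) H'(1) by metis
      have "lip_le M x (\<bar>1 - t\<bar> * pt_Lip H x + \<bar>t\<bar> * pt_Lip H' x)"
        unfolding M_def by (intro lip_le_add lip_le_cmult lip_le_pt_Lip[OF cd(1)] lip_le_pt_Lip[OF cd(2)])
      then have "pt_Lip M x \<le> (1 - t) * pt_Lip H x + t * pt_Lip H' x" using pt_Lip_le(2) t by fastforce
      also have "\<dots> \<le> (1 - t) * a x + t * b x" using H(4) H'(4) t by (intro add_mono mult_left_mono) auto
      finally show ?thesis .
    qed
    ultimately show ?thesis unfolding A_def using a b Lp2_add[OF Lp2_cmult Lp2_cmult] by blast
  qed
  have near: "\<exists>y\<in>A \<delta>. Lp_norm \<mu> 2 (\<lambda>x. y x - G x) < \<delta>" if \<delta>: "\<delta> > 0" for \<delta>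
  proof -
    have "A \<delta> \<noteq> {}" using FA[OF \<delta>] by (force simp: eventually_sequentially)
    then have "\<exists>p y. (\<forall>k::nat. y k \<in> A \<delta>) \<and> Lp_tendsto \<mu> 2 y p \<and>
        (\<forall>a\<in>A \<delta>. (\<integral>x. (G x - p x) * (a x - p x) \<partial>\<mu>) \<le> 0)"
      by (intro Lp2_nearest_point G2 convex) (auto simp: A_def)
    then obtain p y where p: "\<And>k::nat. y k \<in> A \<delta>" "Lp_tendsto \<mu> 2 y p" "\<And>a. a \<in> A \<delta> \<Longrightarrow> (\<integral>x. (G x - p x) * (a x - p x) \<partial>\<mu>) \<le> 0"
      by blast
    have p2: "p \<in> Lp \<mu> 2" by (rule Lp2_tendstoD(2)[OF p(2)])
    have d2: "(\<lambda>x. G x - p x) \<in> Lp \<mu> 2" by (rule Lp2_diff[OF G2 p2])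
    have "(\<lambda>j. (\<integral>x. pt_Lip (F j) x * (G x - p x) \<partial>\<mu>) - (\<integral>x. p x * (G x - p x) \<partial>\<mu>)) \<longlonglongrightarrow>
        (\<integral>x. G x * (G x - p x) \<partial>\<mu>) - (\<integral>x. p x * (G x - p x) \<partial>\<mu>)" by (intro tendsto_intros weak d2)
    moreover have "\<forall>\<^sub>F j in sequentially. (\<integral>x. pt_Lip (F j) x * (G x - p x) \<partial>\<mu>) - (\<integral>x. p x * (G x - p x) \<partial>\<mu>) \<le> 0"
      using FA[OF \<delta>]
    proof eventually_elim
      case (elim j)
      have "(\<integral>x. (G x - p x) * (pt_Lip (F j) x - p x) \<partial>\<mu>) = (\<integral>x. pt_Lip (F j) x * (G x - p x) - p x * (G x - p x) \<partial>\<mu>)"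
        by (intro Bochner_Integration.integral_cong) (auto simp: algebra_simps)
      also have "\<dots> = (\<integral>x. pt_Lip (F j) x * (G x - p x) \<partial>\<mu>) - (\<integral>x. p x * (G x - p x) \<partial>\<mu>)"
        by (intro Bochner_Integration.integral_diff Lp2_integrable_mult P2 d2 p2)
      finally show ?case using p(3)[OF elim] by simp
    qed
    ultimately have "(\<integral>x. G x * (G x - p x) \<partial>\<mu>) - (\<integral>x. p x * (G x - p x) \<partial>\<mu>) \<le> 0"
      by (rule tendsto_upperbound) simp
    also have "(\<integral>x. G x * (G x - p x) \<partial>\<mu>) - (\<integral>x. p x * (G x - p x) \<partial>\<mu>) = (\<integral>x. G x * (G x - p x) - p x * (G x - p x) \<partial>\<mu>)"
      by (intro Bochner_Integration.integral_diff[symmetric] Lp2_integrable_mult G2 d2 p2)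
    also have "\<dots> = (Lp_norm \<mu> 2 (\<lambda>x. p x - G x))\<^sup>2"
      unfolding Lp2_norm_square by (intro Bochner_Integration.integral_cong) (auto simp: power2_eq_square algebra_simps)
    finally have n0: "Lp_norm \<mu> 2 (\<lambda>x. p x - G x) = 0" by simp
    have "(\<lambda>k. Lp_norm \<mu> 2 (\<lambda>x. y k x - p x) + Lp_norm \<mu> 2 (\<lambda>x. p x - G x)) \<longlonglongrightarrow> 0"
      using Lp2_tendstoD(3)[OF p(2)] n0 by simp
    then have "\<forall>\<^sub>F k in sequentially. Lp_norm \<mu> 2 (\<lambda>x. y k x - p x) + Lp_norm \<mu> 2 (\<lambda>x. p x - G x) < \<delta>"
      using \<delta> by (rule order_tendstoD(2))
    then obtain k where "Lp_norm \<mu> 2 (\<lambda>x. y k x - p x) + Lp_norm \<mu> 2 (\<lambda>x. p x - G x) < \<delta>" by (auto simp: eventually_sequentially)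
    then show ?thesis using p(1)[of k] Lp2_triangle_diff[OF Lp2_tendstoD(1)[OF p(2), of k] p2 G2]
      by (intro bexI[of _ "y k"]) auto
  qed
  then have "\<exists>y. y \<in> A (1 / real (Suc k)) \<and> Lp_norm \<mu> 2 (\<lambda>x. y x - G x) < 1 / real (Suc k)" for k
    by (meson of_nat_0_less_iff zero_less_Suc zero_less_divide_1_iff)
  then obtain y where y: "\<And>k. y k \<in> A (1 / real (Suc k))" "\<And>k. Lp_norm \<mu> 2 (\<lambda>x. y k x - G x) < 1 / real (Suc k)" by metis
  have "\<exists>H. H \<in> Lip_fun \<and> H \<in> Lp \<mu> 2 \<and> Lp_norm \<mu> 2 (\<lambda>x. H x - u x) \<le> 1 / real (Suc k) \<and> (\<forall>x. pt_Lip H x \<le> y k x)" for k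
    using y(1)[of k] unfolding A_def by blast
  then obtain H where H: "\<And>k. H k \<in> Lip_fun \<and> H k \<in> Lp \<mu> 2 \<and> Lp_norm \<mu> 2 (\<lambda>x. H k x - u x) \<le> 1 / real (Suc k) \<and> (\<forall>x. pt_Lip (H k) x \<le> y k x)"
    by metis
  have z: "(\<lambda>k. 1 / real (Suc k)) \<longlonglongrightarrow> 0" by (rule LIMSEQ_Suc[OF lim_1_over_n])
  have y2: "y k \<in> Lp \<mu> 2" for k using y(1)[of k] by (simp add: A_def)
  show ?thesis
  proof (rule upper_gradI)
    show "Lp_tendsto \<mu> 2 H u" using H by (intro Lp2_tendstoI[OF _ u2 z]) auto
    show "Lp_tendsto \<mu> 2 y G" by (rule Lp2_tendstoI[OF y2 G2 z less_imp_le[OF y(2)]])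
  qed (use H in auto)
qed

lemma Lp2_strong_imp_weak: "Lp_tendsto M 2 F f \<Longrightarrow> L2_weakly_tendsto M F f"
  by (auto simp: L2_weakly_tendsto_def dest: Lp2_tendstoD intro: Lp2_tendsto_inner)

text \<open>
  Relaxed gradients are limits of convex combinations of Lipschitz constants, hence have at least the
  energy of the minimal gradient, which is itself a strong and thus a weak limit of Lipschitz constants.
\<close>

lemma min_relaxed_gradient_iff: "min_relaxed_gradient \<mu> u G \<longleftrightarrow> minimal_grad u G"
proof -
  have relaxed: "relaxed_gradient \<mu> u G" if G: "minimal_grad u G" for G
  proof -
    obtain F G1 where F: "\<And>j. F j \<in> Lip_fun" "Lp_tendsto \<mu> 2 F u" "Lp_tendsto \<mu> 2 (\<lambda>j. pt_Lip (F j)) G1" "minimal_grad u G1"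
      using minimal_grad_strong_approximation[OF upper_grad_Cheeger_dom[OF minimal_gradD[OF G]]] by blast
    have G2: "G \<in> Lp \<mu> 2" "G1 \<in> Lp \<mu> 2" using G F(4) by (auto dest!: minimal_gradD intro: upper_grad_L2)
    have "Lp_norm \<mu> 2 (\<lambda>x. pt_Lip (F j) x - G x) = Lp_norm \<mu> 2 (\<lambda>x. pt_Lip (F j) x - G1 x)" for j
      using Lp2_diff[OF Lp2_tendstoD(1)[OF F(3), of j] G2(1)] Lp2_diff[OF Lp2_tendstoD(1)[OF F(3), of j] G2(2)]
      by (intro Lp_norm_cong_AE Lp2_measurable) (use minimal_grad_unique[OF G F(4)] in \<open>auto elim: eventually_mono\<close>)
    then have "Lp_tendsto \<mu> 2 (\<lambda>j. pt_Lip (F j)) G" using F(3) G2(1) by (simp add: Lp_tendsto_def)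
    then show ?thesis unfolding relaxed_gradient_def using F(1,2) Lp2_strong_imp_weak by blast
  qed
  have le: "Lp_norm \<mu> 2 G1 \<le> Lp_norm \<mu> 2 G'" if "minimal_grad u G1" "relaxed_gradient \<mu> u G'" for G1 G'
  proof -
    have "ennreal (1/2 * (\<integral>x. (G1 x)\<^sup>2 \<partial>\<mu>)) \<le> ennreal (1/2 * (\<integral>x. (G' x)\<^sup>2 \<partial>\<mu>))"
      using Cheeger_le_upper_grad[OF relaxed_gradient_upper_grad[OF that(2)]] that(1) by (simp add: minimal_grad_def)
    then have "(\<integral>x. (G1 x)\<^sup>2 \<partial>\<mu>) \<le> (\<integral>x. (G' x)\<^sup>2 \<partial>\<mu>)" by (subst (asm) ennreal_le_iff) auto
    then show ?thesis by (simp add: Lp2_norm)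
  qed
  show ?thesis
  proof
    assume min: "min_relaxed_gradient \<mu> u G"
    then have ug: "upper_grad u G" by (intro relaxed_gradient_upper_grad) (simp add: min_relaxed_gradient_def)
    then obtain G1 where G1: "minimal_grad u G1" using minimal_grad_exists[OF upper_grad_Cheeger_dom] by blast
    have "Lp_norm \<mu> 2 G = Lp_norm \<mu> 2 G1"
      using min relaxed[OF G1] le[OF G1] by (auto simp: min_relaxed_gradient_def intro: antisym)
    then have "(Lp_norm \<mu> 2 G)\<^sup>2 = (Lp_norm \<mu> 2 G1)\<^sup>2" by simp
    then show "minimal_grad u G" using G1 ug by (simp add: minimal_grad_def Lp2_norm_square)
  next
    assume "minimal_grad u G"
    then show "min_relaxed_gradient \<mu> u G" using relaxed le by (auto simp: min_relaxed_gradient_def)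
  qed
qed

section \<open>Restricting measures to open sets\<close>

lemma rs_integrable:
  fixes f :: "'a \<Rightarrow> real"
  assumes "A \<in> sets borel"
  shows "integrable (restrict_space \<mu> A) f \<longleftrightarrow> integrable \<mu> (\<lambda>x. indicator A x * f x)"
  using integrable_restrict_space[of A \<mu> f] assms by simp

lemma rs_integral:
  fixes f :: "'a \<Rightarrow> real"
  assumes "A \<in> sets borel"
  shows "integral\<^sup>L (restrict_space \<mu> A) f = (\<integral>x. indicator A x * f x \<partial>\<mu>)"
  using integral_restrict_space[of A \<mu> f] assms by simp

lemma rs_measurable:
  fixes f :: "'a \<Rightarrow> real"
  assumes "A \<in> sets borel"
  shows "f \<in> borel_measurable (restrict_space \<mu> A) \<longleftrightarrow> (\<lambda>x. indicator A x * f x) \<in> borel_measurable \<mu>"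
  using borel_measurable_restrict_space_iff[of A \<mu> f] assms by (simp add: mult.commute)

lemma rs_AE: "A \<in> sets borel \<Longrightarrow> (AE x in restrict_space \<mu> A. P x) \<longleftrightarrow> (AE x in \<mu>. x \<in> A \<longrightarrow> P x)"
  using AE_restrict_space_iff[of A \<mu> P] by simp

lemma rs_integrable_subset:
  fixes f :: "'a \<Rightarrow> real"
  assumes "A \<in> sets borel" "B \<in> sets borel" "B \<subseteq> A" "integrable (restrict_space \<mu> A) f"
  shows "integrable (restrict_space \<mu> B) f"
proof -
  have "integrable \<mu> (\<lambda>x. indicator B x *\<^sub>R (indicator A x * f x))"
    using assms by (intro integrable_mult_indicator) (auto simp: rs_integrable)
  moreover have "(\<lambda>x. indicator B x *\<^sub>R (indicator A x * f x)) = (\<lambda>x. indicator B x * f x)"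
    using assms(3) by (auto simp: indicator_def fun_eq_iff)
  ultimately show ?thesis using assms(2) by (simp add: rs_integrable)
qed

lemma rs_integral_subset:
  fixes f :: "'a \<Rightarrow> real"
  assumes "A \<in> sets borel" "B \<in> sets borel" "B \<subseteq> A" "integrable (restrict_space \<mu> A) f" "\<And>x. 0 \<le> f x"
  shows "integral\<^sup>L (restrict_space \<mu> B) f \<le> integral\<^sup>L (restrict_space \<mu> A) f"
  unfolding rs_integral[OF assms(1)] rs_integral[OF assms(2)]
  using assms rs_integrable_subset[OF assms(1-4)]
  by (intro integral_mono) (auto simp: rs_integrable indicator_def)

lemma rs_L2_iff:
  assumes "A \<in> sets borel"
  shows "f \<in> Lp (restrict_space \<mu> A) 2 \<longleftrightarrow> (\<lambda>x. indicator A x * f x) \<in> Lp \<mu> 2"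
proof -
  have "(\<lambda>x. (indicator A x * f x)\<^sup>2) = (\<lambda>x. indicator A x * (f x)\<^sup>2)" by (auto simp: indicator_def)
  then show ?thesis using assms by (simp add: Lp2_iff rs_measurable rs_integrable)
qed

lemma rs_L2_norm:
  assumes "A \<in> sets borel"
  shows "Lp_norm (restrict_space \<mu> A) 2 f = Lp_norm \<mu> 2 (\<lambda>x. indicator A x * f x)"
proof -
  have "(\<lambda>x. (indicator A x * f x)\<^sup>2) = (\<lambda>x. indicator A x * (f x)\<^sup>2)" by (auto simp: indicator_def)
  then show ?thesis using assms by (simp add: Lp2_norm rs_integral)
qed

lemma rs_L2_tendsto:
  assumes A: "A \<in> sets borel" and F: "Lp_tendsto (restrict_space \<mu> A) 2 F f"
  shows "Lp_tendsto \<mu> 2 (\<lambda>j x. indicator A x * F j x) (\<lambda>x. indicator A x * f x)"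
proof -
  have "(\<lambda>j. Lp_norm \<mu> 2 (\<lambda>x. indicator A x * (F j x - f x))) \<longlonglongrightarrow> 0"
    using Lp2_tendstoD(3)[OF F] unfolding rs_L2_norm[OF A] .
  then show ?thesis using Lp2_tendstoD(1,2)[OF F] unfolding rs_L2_iff[OF A] Lp_tendsto_def
    by (simp add: right_diff_distrib)
qed

lemma rs_L2_subset:
  assumes "A \<in> sets borel" "B \<in> sets borel" "B \<subseteq> A" "f \<in> Lp (restrict_space \<mu> A) 2"
  shows "f \<in> Lp (restrict_space \<mu> B) 2"
proof -
  have "f \<in> borel_measurable (restrict_space \<mu> B)"
  proof -
    have "(\<lambda>x. indicator B x * (indicator A x * f x)) \<in> borel_measurable \<mu>"
      using assms(2) Lp2_measurable[OF assms(4)] by (auto simp: rs_measurable[OF assms(1)])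
    also have "(\<lambda>x. indicator B x * (indicator A x * f x)) = (\<lambda>x. indicator B x * f x)"
      using assms(3) by (auto simp: indicator_def fun_eq_iff)
    finally show ?thesis by (simp add: rs_measurable[OF assms(2)])
  qed
  then show ?thesis using rs_integrable_subset[OF assms(1-3) Lp2_integrable_square[OF assms(4)]] by (simp add: Lp2_iff)
qed

section \<open>Gradients on open sets\<close>

lemma countable_cutoff_cover:
  fixes \<Omega> :: "'a set"
  assumes "open \<Omega>"
  shows "\<exists>C. countable C \<and> \<Union>C = \<Omega> \<and> (\<forall>W\<in>C. open W \<and> W \<subseteq> \<Omega> \<and> (\<exists>\<eta>\<in>Lip0 \<Omega>. (\<forall>x. 0 \<le> \<eta> x \<and> \<eta> x \<le> 1) \<and> (\<forall>x\<in>W. \<eta> x = 1)))"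
proof -
  define F where "F = {W. open W \<and> W \<subseteq> \<Omega> \<and> (\<exists>\<eta>\<in>Lip0 \<Omega>. (\<forall>x. 0 \<le> \<eta> x \<and> \<eta> x \<le> 1) \<and> (\<forall>x\<in>W. \<eta> x = 1))}"
  have "\<Union>F = \<Omega>"
  proof (rule antisym)
    show "\<Omega> \<subseteq> \<Union>F"
    proof
      fix x assume "x \<in> \<Omega>"
      then obtain \<eta> V where "\<eta> \<in> Lip0 \<Omega>" "\<forall>x. 0 \<le> \<eta> x \<and> \<eta> x \<le> 1" "open V" "{x} \<subseteq> V" "V \<subseteq> \<Omega>" "\<forall>x\<in>V. \<eta> x = 1"
        using Lip0_cutoff[of "{x}" \<Omega>] assms by auto
      then show "x \<in> \<Union>F" by (intro UnionI[of V]) (auto simp: F_def)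
    qed
  qed (auto simp: F_def)
  have F: "open W \<and> W \<subseteq> \<Omega> \<and> (\<exists>\<eta>\<in>Lip0 \<Omega>. (\<forall>x. 0 \<le> \<eta> x \<and> \<eta> x \<le> 1) \<and> (\<forall>x\<in>W. \<eta> x = 1))" if "W \<in> F" for W
    using that unfolding F_def by (rule CollectD)
  obtain C where C: "C \<subseteq> F" "countable C" "\<Union>C = \<Union>F" by (rule Lindelof[OF F[THEN conjunct1]])
  show ?thesis
  proof (intro exI[of _ C] conjI C(2) ballI)
    show "\<Union>C = \<Omega>" using C(3) \<open>\<Union>F = \<Omega>\<close> by simp
    fix W assume "W \<in> C"
    then have "W \<in> F" using C(1) by blast
    from F[OF this] show "open W" "W \<subseteq> \<Omega>" "\<exists>\<eta>\<in>Lip0 \<Omega>. (\<forall>x. 0 \<le> \<eta> x \<and> \<eta> x \<le> 1) \<and> (\<forall>x\<in>W. \<eta> x = 1)"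
      by simp_all
  qed
qed

text \<open>
  Second countability reduces a local almost everywhere statement to countably many sets on which a cut-off
  function is one.
\<close>

lemma AE_local:
  assumes "open \<Omega>"
    and P: "\<And>\<eta> W. \<eta> \<in> Lip0 \<Omega> \<Longrightarrow> (\<And>x. 0 \<le> \<eta> x \<and> \<eta> x \<le> 1) \<Longrightarrow> open W \<Longrightarrow> W \<subseteq> \<Omega> \<Longrightarrow> (\<And>x. x \<in> W \<Longrightarrow> \<eta> x = 1) \<Longrightarrow>
      AE x in \<mu>. x \<in> W \<longrightarrow> P x"
  shows "AE x in \<mu>. x \<in> \<Omega> \<longrightarrow> P x"
proof -
  obtain C where C: "countable C \<and> \<Union>C = \<Omega> \<and> (\<forall>W\<in>C. open W \<and> W \<subseteq> \<Omega> \<and>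
      (\<exists>\<eta>\<in>Lip0 \<Omega>. (\<forall>x. 0 \<le> \<eta> x \<and> \<eta> x \<le> 1) \<and> (\<forall>x\<in>W. \<eta> x = 1)))"
    using countable_cutoff_cover[OF assms(1)] ..
  have "AE x in \<mu>. \<forall>W\<in>C. x \<in> W \<longrightarrow> P x"
    unfolding AE_ball_countable[OF C[THEN conjunct1]]
  proof
    fix W assume "W \<in> C"
    with C have W: "open W" "W \<subseteq> \<Omega>" "\<exists>\<eta>\<in>Lip0 \<Omega>. (\<forall>x. 0 \<le> \<eta> x \<and> \<eta> x \<le> 1) \<and> (\<forall>x\<in>W. \<eta> x = 1)" by simp_all
    from W(3) obtain \<eta> where "\<eta> \<in> Lip0 \<Omega>" "\<forall>x. 0 \<le> \<eta> x \<and> \<eta> x \<le> 1" "\<forall>x\<in>W. \<eta> x = 1" by (elim bexE conjE)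
    then show "AE x in \<mu>. x \<in> W \<longrightarrow> P x" by (intro P[of \<eta> W]) (auto intro: W(1,2) subsetD[OF W(2)])
  qed
  then show ?thesis
  proof eventually_elim
    case (elim x)
    show ?case
    proof
      assume "x \<in> \<Omega>"
      then obtain W where "W \<in> C" "x \<in> W" using C[THEN conjunct2, THEN conjunct1] by blast
      with elim show "P x" by blast
    qed
  qed
qed

lemma pt_Lip_local:
  assumes "open W" "x \<in> W" "\<And>y. y \<in> W \<Longrightarrow> u y = (v y :: real)" "lip_le v x a"
  shows "pt_Lip u x = pt_Lip v x"
proof (rule antisym)
  have ev: "\<forall>\<^sub>F y in nhds x. u y = v y" unfolding eventually_nhds using assms(1-3) by blast
  then have ev': "\<forall>\<^sub>F y in nhds x. v y = u y" by eventually_elim simp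
  have u: "lip_le u x a" by (rule lip_le_eq[OF assms(4) ev])
  have "lip_le u x (pt_Lip v x)" by (rule lip_le_eq[OF lip_le_pt_Lip[OF assms(4)] ev])
  then show "pt_Lip u x \<le> pt_Lip v x" by (rule pt_Lip_le(2))
  have "lip_le v x (pt_Lip u x)" by (rule lip_le_eq[OF lip_le_pt_Lip[OF u] ev'])
  then show "pt_Lip v x \<le> pt_Lip u x" by (rule pt_Lip_le(2))
qed

text \<open>
  The local form of the relation \<open>upper_grad\<close>.  The bound is only required where the cut-off is
  one on a neighbourhood, so that the Lipschitz constant of the cut-off does not enter.
\<close>

definition upper_grad_on :: "'a set \<Rightarrow> ('a \<Rightarrow> real) \<Rightarrow> ('a \<Rightarrow> real) \<Rightarrow> bool" where
  "upper_grad_on V v g \<longleftrightarrow> (\<forall>\<eta>\<in>Lip0 V. \<exists>g'. upper_grad (\<lambda>x. \<eta> x * v x) g' \<and>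
     (\<forall>W. open W \<and> (\<forall>x\<in>W. \<eta> x = 1) \<longrightarrow> (AE x in \<mu>. x \<in> W \<longrightarrow> g' x \<le> g x)))"

lemma upper_grad_onD:
  assumes "upper_grad_on V v g" "\<eta> \<in> Lip0 V"
  shows "\<exists>g'. upper_grad (\<lambda>x. \<eta> x * v x) g' \<and>
     (\<forall>W. open W \<and> (\<forall>x\<in>W. \<eta> x = 1) \<longrightarrow> (AE x in \<mu>. x \<in> W \<longrightarrow> g' x \<le> g x))"
  using assms unfolding upper_grad_on_def by (rule bspec)

lemma upper_grad_on_add:
  assumes "upper_grad_on V u g" "upper_grad_on V v h"
  shows "upper_grad_on V (\<lambda>x. u x + v x) (\<lambda>x. g x + h x)"
  unfolding upper_grad_on_def
proof
  fix \<eta> assume \<eta>: "\<eta> \<in> Lip0 V"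
  obtain g' where g'0: "upper_grad (\<lambda>x. \<eta> x * u x) g' \<and>
     (\<forall>W. open W \<and> (\<forall>x\<in>W. \<eta> x = 1) \<longrightarrow> (AE x in \<mu>. x \<in> W \<longrightarrow> g' x \<le> g x))"
    using upper_grad_onD[OF assms(1) \<eta>] ..
  note g' = g'0[THEN conjunct1] g'0[THEN conjunct2, rule_format]
  obtain h' where h'0: "upper_grad (\<lambda>x. \<eta> x * v x) h' \<and>
     (\<forall>W. open W \<and> (\<forall>x\<in>W. \<eta> x = 1) \<longrightarrow> (AE x in \<mu>. x \<in> W \<longrightarrow> h' x \<le> h x))"
    using upper_grad_onD[OF assms(2) \<eta>] ..
  note h' = h'0[THEN conjunct1] h'0[THEN conjunct2, rule_format]
  show "\<exists>g'. upper_grad (\<lambda>x. \<eta> x * (u x + v x)) g' \<and>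
     (\<forall>W. open W \<and> (\<forall>x\<in>W. \<eta> x = 1) \<longrightarrow> (AE x in \<mu>. x \<in> W \<longrightarrow> g' x \<le> g x + h x))"
  proof (intro exI[of _ "\<lambda>x. g' x + h' x"] conjI allI impI)
    show "upper_grad (\<lambda>x. \<eta> x * (u x + v x)) (\<lambda>x. g' x + h' x)"
      using upper_grad_add[OF g'(1) h'(1)] by (simp add: distrib_left)
    fix W assume "open W \<and> (\<forall>x\<in>W. \<eta> x = 1)"
    from g'(2)[OF this] h'(2)[OF this] show "AE x in \<mu>. x \<in> W \<longrightarrow> g' x + h' x \<le> g x + h x" by eventually_elim auto
  qed
qed

lemma upper_grad_on_cmult:
  assumes "upper_grad_on V u g"
  shows "upper_grad_on V (\<lambda>x. c * u x) (\<lambda>x. \<bar>c\<bar> * g x)"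
  unfolding upper_grad_on_def
proof
  fix \<eta> assume \<eta>: "\<eta> \<in> Lip0 V"
  obtain g' where g'0: "upper_grad (\<lambda>x. \<eta> x * u x) g' \<and>
     (\<forall>W. open W \<and> (\<forall>x\<in>W. \<eta> x = 1) \<longrightarrow> (AE x in \<mu>. x \<in> W \<longrightarrow> g' x \<le> g x))"
    using upper_grad_onD[OF assms(1) \<eta>] ..
  note g' = g'0[THEN conjunct1] g'0[THEN conjunct2, rule_format]
  show "\<exists>g'. upper_grad (\<lambda>x. \<eta> x * (c * u x)) g' \<and>
     (\<forall>W. open W \<and> (\<forall>x\<in>W. \<eta> x = 1) \<longrightarrow> (AE x in \<mu>. x \<in> W \<longrightarrow> g' x \<le> \<bar>c\<bar> * g x))"
  proof (intro exI[of _ "\<lambda>x. \<bar>c\<bar> * g' x"] conjI allI impI)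
    show "upper_grad (\<lambda>x. \<eta> x * (c * u x)) (\<lambda>x. \<bar>c\<bar> * g' x)"
      using upper_grad_cmult[OF g'(1), of c] by (simp add: mult.left_commute)
    fix W assume "open W \<and> (\<forall>x\<in>W. \<eta> x = 1)"
    from g'(2)[OF this] show "AE x in \<mu>. x \<in> W \<longrightarrow> \<bar>c\<bar> * g' x \<le> \<bar>c\<bar> * g x" by eventually_elim (auto intro: mult_left_mono)
  qed
qed

lemma upper_grad_on_Lip0:
  assumes "open V" "\<phi> \<in> Lip_fun"
  shows "upper_grad_on V \<phi> (pt_Lip \<phi>)"
  unfolding upper_grad_on_def
proof
  fix \<eta> assume \<eta>: "\<eta> \<in> Lip0 V"
  have "(\<lambda>x. \<eta> x * \<phi> x) \<in> Lip0 V" by (rule Lip0_mult[OF assms(1) \<eta> assms(2)])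
  then have "upper_grad (\<lambda>x. \<eta> x * \<phi> x) (pt_Lip (\<lambda>x. \<eta> x * \<phi> x))" by (rule upper_grad_Lip0)
  moreover have "pt_Lip (\<lambda>x. \<eta> x * \<phi> x) x = pt_Lip \<phi> x" if W: "open W" "\<forall>x\<in>W. \<eta> x = 1" "x \<in> W" for W x
  proof -
    obtain L where "lip_le \<phi> x L" using Lip_fun_lip_le[OF assms(2)] by blast
    then show ?thesis using W by (intro pt_Lip_local[of W x "\<lambda>x. \<eta> x * \<phi> x" \<phi> L]) auto
  qed
  ultimately show "\<exists>g'. upper_grad (\<lambda>x. \<eta> x * \<phi> x) g' \<and>
     (\<forall>W. open W \<and> (\<forall>x\<in>W. \<eta> x = 1) \<longrightarrow> (AE x in \<mu>. x \<in> W \<longrightarrow> g' x \<le> pt_Lip \<phi> x))"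
    by (intro exI[of _ "pt_Lip (\<lambda>x. \<eta> x * \<phi> x)"]) auto
qed

lemma upper_grad_on_zero: "open V \<Longrightarrow> upper_grad_on V (\<lambda>x. 0) (\<lambda>x. 0)"
proof -
  assume "open V"
  have "pt_Lip (\<lambda>x::'a. 0) = (\<lambda>x. 0)" by (rule ext) (rule pt_Lip_const)
  then show ?thesis using upper_grad_on_Lip0[OF \<open>open V\<close> Lip0_Lip_fun[OF Lip0_zero[of UNIV]]] by simp
qed

lemma upper_grad_on_sum:
  assumes "open V" "finite I" "\<And>i. i \<in> I \<Longrightarrow> upper_grad_on V (u i) (g i)"
  shows "upper_grad_on V (\<lambda>x. \<Sum>i\<in>I. u i x) (\<lambda>x. \<Sum>i\<in>I. g i x)"
  using assms(2,3)
proof (induction I rule: finite_induct)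
  case empty
  then show ?case using upper_grad_on_zero[OF assms(1)] by simp
next
  case (insert i I)
  then show ?case using upper_grad_on_add[of V "u i" "g i" "\<lambda>x. \<Sum>i\<in>I. u i x"] by simp
qed

lemma upper_grad_on_cong:
  assumes "upper_grad_on V u g" "\<And>x. x \<in> V \<Longrightarrow> u x = v x"
  shows "upper_grad_on V v g"
proof -
  have "(\<lambda>x. \<eta> x * u x) = (\<lambda>x. \<eta> x * v x)" if "\<eta> \<in> Lip0 V" for \<eta>
    using assms(2) Lip0_outside[OF that] by (metis mult_zero_left)
  then show ?thesis using assms(1) unfolding upper_grad_on_def by auto
qed

lemma min_gradient_onD:
  assumes "min_gradient_on \<mu> \<Omega> u G" "\<eta> \<in> Lip0 \<Omega>"
  shows "\<exists>G'. minimal_grad (\<lambda>x. \<eta> x * u x) G' \<and> (AE x in \<mu>. x \<in> \<Omega> \<and> \<eta> x = 1 \<longrightarrow> G x = G' x)"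
  using assms(1)[unfolded min_gradient_on_def min_relaxed_gradient_iff, THEN conjunct2] assms(2) by (rule bspec)

lemma min_gradient_on_upper:
  assumes "V \<subseteq> \<Omega>" "min_gradient_on \<mu> \<Omega> u G"
  shows "upper_grad_on V u G"
  unfolding upper_grad_on_def
proof
  fix \<eta> assume "\<eta> \<in> Lip0 V"
  then have \<eta>: "\<eta> \<in> Lip0 \<Omega>" by (rule Lip0_mono[OF assms(1)])
  obtain G' where G': "minimal_grad (\<lambda>x. \<eta> x * u x) G'" "AE x in \<mu>. x \<in> \<Omega> \<and> \<eta> x = 1 \<longrightarrow> G x = G' x"
    using min_gradient_onD[OF assms(2) \<eta>] by blast
  have "AE x in \<mu>. x \<in> W \<longrightarrow> G' x \<le> G x" if "\<forall>x\<in>W. \<eta> x = 1" for W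
    using G'(2)
  proof eventually_elim
    case (elim x)
    show ?case
    proof
      assume "x \<in> W"
      then have "\<eta> x = 1" using that by simp
      then have "x \<in> \<Omega>" using Lip0_outside[OF \<eta>] by force
      then show "G' x \<le> G x" using elim \<open>\<eta> x = 1\<close> by simp
    qed
  qed
  then show "\<exists>g'. upper_grad (\<lambda>x. \<eta> x * u x) g' \<and>
     (\<forall>W. open W \<and> (\<forall>x\<in>W. \<eta> x = 1) \<longrightarrow> (AE x in \<mu>. x \<in> W \<longrightarrow> g' x \<le> G x))"
    using minimal_gradD[OF G'(1)] by blast
qed

lemma min_gradient_on_le:
  assumes "open V" "V \<subseteq> \<Omega>" "min_gradient_on \<mu> \<Omega> u G" "upper_grad_on V u g"
  shows "AE x in \<mu>. x \<in> V \<longrightarrow> G x \<le> g x"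
proof (rule AE_local[OF assms(1)])
  fix \<eta> W assume \<eta>V: "\<eta> \<in> Lip0 V" and W: "open W" "W \<subseteq> V" "\<And>x. x \<in> W \<Longrightarrow> \<eta> x = 1"
  have \<eta>: "\<eta> \<in> Lip0 \<Omega>" by (rule Lip0_mono[OF assms(2) \<eta>V])
  obtain G' where G': "minimal_grad (\<lambda>x. \<eta> x * u x) G'" "AE x in \<mu>. x \<in> \<Omega> \<and> \<eta> x = 1 \<longrightarrow> G x = G' x"
    using min_gradient_onD[OF assms(3) \<eta>] by blast
  obtain g' where g'0: "upper_grad (\<lambda>x. \<eta> x * u x) g' \<and>
     (\<forall>W. open W \<and> (\<forall>x\<in>W. \<eta> x = 1) \<longrightarrow> (AE x in \<mu>. x \<in> W \<longrightarrow> g' x \<le> g x))"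
    using upper_grad_onD[OF assms(4) \<eta>V] ..
  have "open W \<and> (\<forall>x\<in>W. \<eta> x = 1)" using W by simp
  note g' = g'0[THEN conjunct1] g'0[THEN conjunct2, rule_format, OF this]
  from G'(2) g'(2) minimal_grad_le[OF G'(1) g'(1)]
  show "AE x in \<mu>. x \<in> W \<longrightarrow> G x \<le> g x"
    by eventually_elim (use W assms(2) in fastforce)
qed

lemma min_gradient_on_unique:
  assumes "open \<Omega>" "min_gradient_on \<mu> \<Omega> u G" "min_gradient_on \<mu> \<Omega> u G'"
  shows "AE x in \<mu>. x \<in> \<Omega> \<longrightarrow> G x = G' x"
  using min_gradient_on_le[OF assms(1) order_refl assms(2) min_gradient_on_upper[OF order_refl assms(3)]]
    min_gradient_on_le[OF assms(1) order_refl assms(3) min_gradient_on_upper[OF order_refl assms(2)]]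
  by eventually_elim auto

lemma min_gradient_on_nonneg:
  assumes "open \<Omega>" "min_gradient_on \<mu> \<Omega> u G"
  shows "AE x in \<mu>. x \<in> \<Omega> \<longrightarrow> 0 \<le> G x"
proof (rule AE_local[OF assms(1)])
  fix \<eta> W assume \<eta>: "\<eta> \<in> Lip0 \<Omega>" and W: "W \<subseteq> \<Omega>" "\<And>x. x \<in> W \<Longrightarrow> \<eta> x = 1"
  obtain G' where G': "minimal_grad (\<lambda>x. \<eta> x * u x) G'" "AE x in \<mu>. x \<in> \<Omega> \<and> \<eta> x = 1 \<longrightarrow> G x = G' x"
    using min_gradient_onD[OF assms(2) \<eta>] by blast
  from G'(2) upper_grad_nonneg[OF minimal_gradD[OF G'(1)]] show "AE x in \<mu>. x \<in> W \<longrightarrow> 0 \<le> G x"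
    by eventually_elim (use W in fastforce)
qed

lemma minimal_grad_cmult:
  assumes "minimal_grad u G"
  shows "minimal_grad (\<lambda>x. c * u x) (\<lambda>x. \<bar>c\<bar> * G x)"
proof -
  have ug: "upper_grad (\<lambda>x. c * u x) (\<lambda>x. \<bar>c\<bar> * G x)" by (rule upper_grad_cmult[OF minimal_gradD[OF assms]])
  then obtain H where H: "minimal_grad (\<lambda>x. c * u x) H" using minimal_grad_exists[OF upper_grad_Cheeger_dom] by blast
  have "AE x in \<mu>. H x = \<bar>c\<bar> * G x"
  proof (cases "c = 0")
    case True
    then show ?thesis using minimal_grad_zero_on_level[OF H] by simp
  next
    case False
    have "upper_grad (\<lambda>x. (1/c) * (c * u x)) (\<lambda>x. \<bar>1/c\<bar> * H x)" by (rule upper_grad_cmult[OF minimal_gradD[OF H]])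
    then have "AE x in \<mu>. G x \<le> \<bar>1/c\<bar> * H x" using minimal_grad_le[OF assms] False by simp
    with minimal_grad_le[OF H ug] show ?thesis
      by eventually_elim (use False in \<open>auto simp: field_simps\<close>)
  qed
  then show ?thesis
    by (rule minimal_grad_cong[OF H]) (rule Lp2_measurable[OF upper_grad_L2(2)[OF ug]])
qed

lemma min_gradient_on_cmult:
  assumes "open \<Omega>" "min_gradient_on \<mu> \<Omega> u G"
  shows "min_gradient_on \<mu> \<Omega> (\<lambda>x. c * u x) (\<lambda>x. \<bar>c\<bar> * G x)"
  unfolding min_gradient_on_def min_relaxed_gradient_iff
proof (intro conjI ballI)
  show "(\<lambda>x. \<bar>c\<bar> * G x) \<in> borel_measurable (restrict_space \<mu> \<Omega>)" using assms(2) by (auto simp: min_gradient_on_def)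
  fix \<eta> assume \<eta>: "\<eta> \<in> Lip0 \<Omega>"
  obtain G' where G': "minimal_grad (\<lambda>x. \<eta> x * u x) G'" "AE x in \<mu>. x \<in> \<Omega> \<and> \<eta> x = 1 \<longrightarrow> G x = G' x"
    using min_gradient_onD[OF assms(2) \<eta>] by blast
  have "minimal_grad (\<lambda>x. \<eta> x * (c * u x)) (\<lambda>x. \<bar>c\<bar> * G' x)"
    using minimal_grad_cmult[OF G'(1), of c] by (simp add: mult.left_commute)
  moreover have "AE x in \<mu>. x \<in> \<Omega> \<and> \<eta> x = 1 \<longrightarrow> \<bar>c\<bar> * G x = \<bar>c\<bar> * G' x" using G'(2) by eventually_elim auto
  ultimately show "\<exists>G'. minimal_grad (\<lambda>x. \<eta> x * (c * u x)) G' \<and> (AE x in \<mu>. x \<in> \<Omega> \<and> \<eta> x = 1 \<longrightarrow> \<bar>c\<bar> * G x = G' x)"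
    by blast
qed

section \<open>The inner product of gradients\<close>

lemma L1_limit_mono_AE:
  fixes A B :: "nat \<Rightarrow> 'b \<Rightarrow> real"
  assumes int: "\<And>k. integrable M (A k)" "\<And>k. integrable M (B k)" "integrable M a" "integrable M b"
    and lim: "(\<lambda>k. \<integral>x. \<bar>A k x - a x\<bar> \<partial>M) \<longlonglongrightarrow> 0" "(\<lambda>k. \<integral>x. \<bar>B k x - b x\<bar> \<partial>M) \<longlonglongrightarrow> 0"
    and le: "\<And>k. AE x in M. A k x \<le> B k x"
  shows "AE x in M. a x \<le> b x"
proof -
  define p where "p x = max 0 (a x - b x)" for x
  have p: "integrable M p" unfolding p_def using int by (intro integrable_max) auto
  have "(\<integral>x. p x \<partial>M) \<le> (\<integral>x. \<bar>A k x - a x\<bar> \<partial>M) + (\<integral>x. \<bar>B k x - b x\<bar> \<partial>M)" for k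
  proof -
    have "(\<integral>x. p x \<partial>M) \<le> (\<integral>x. \<bar>A k x - a x\<bar> + \<bar>B k x - b x\<bar> \<partial>M)"
    proof (rule integral_mono_AE[OF p])
      show "AE x in M. p x \<le> \<bar>A k x - a x\<bar> + \<bar>B k x - b x\<bar>"
        using le[of k] by eventually_elim (auto simp: p_def)
    qed (use int in auto)
    also have "\<dots> = (\<integral>x. \<bar>A k x - a x\<bar> \<partial>M) + (\<integral>x. \<bar>B k x - b x\<bar> \<partial>M)" using int by simp
    finally show ?thesis .
  qed
  moreover have "(\<lambda>k. (\<integral>x. \<bar>A k x - a x\<bar> \<partial>M) + (\<integral>x. \<bar>B k x - b x\<bar> \<partial>M)) \<longlonglongrightarrow> 0"
    using tendsto_add[OF lim] by simp
  ultimately have "(\<integral>x. p x \<partial>M) \<le> 0" by (intro LIMSEQ_le_const) auto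
  moreover have "0 \<le> (\<integral>x. p x \<partial>M)" by (intro integral_nonneg_AE) (simp add: p_def)
  ultimately have "(\<integral>x. p x \<partial>M) = 0" by simp
  moreover have "AE x in M. 0 \<le> p x" by (simp add: p_def)
  ultimately have "AE x in M. p x = 0" using integral_nonneg_eq_0_iff_AE[OF p] by blast
  then show ?thesis by eventually_elim (simp add: p_def max_def split: if_splits)
qed

lemma grad_inner_onD:
  assumes "grad_inner_on \<mu> \<Omega> f \<phi> h"
  shows "\<exists>G. (\<forall>\<epsilon>. min_gradient_on \<mu> \<Omega> (\<lambda>x. f x + \<epsilon> * \<phi> x) (G \<epsilon>) \<and> G \<epsilon> \<in> Lp (restrict_space \<mu> \<Omega>) 2) \<and>
    ((\<lambda>\<epsilon>. \<integral>x. \<bar>((G \<epsilon> x)\<^sup>2 - (G 0 x)\<^sup>2) / (2 * \<epsilon>) - h x\<bar> \<partial>restrict_space \<mu> \<Omega>) \<longlongrightarrow> 0) (at 0)"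
  and "integrable (restrict_space \<mu> \<Omega>) h"
  using assms by (simp_all add: grad_inner_on_def)

lemma grad_inner_on_scale:
  assumes "grad_inner_on \<mu> \<Omega> f \<phi> h"
  shows "grad_inner_on \<mu> \<Omega> f (\<lambda>x. a * \<phi> x) (\<lambda>x. a * h x)"
proof -
  obtain G where Gall: "(\<forall>\<epsilon>. min_gradient_on \<mu> \<Omega> (\<lambda>x. f x + \<epsilon> * \<phi> x) (G \<epsilon>) \<and> G \<epsilon> \<in> Lp (restrict_space \<mu> \<Omega>) 2) \<and>
    ((\<lambda>\<epsilon>. \<integral>x. \<bar>((G \<epsilon> x)\<^sup>2 - (G 0 x)\<^sup>2) / (2 * \<epsilon>) - h x\<bar> \<partial>restrict_space \<mu> \<Omega>) \<longlongrightarrow> 0) (at 0)"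
    using grad_inner_onD(1)[OF assms] ..
  note G = Gall[THEN conjunct1, rule_format, THEN conjunct1] Gall[THEN conjunct1, rule_format, THEN conjunct2]
    Gall[THEN conjunct2] grad_inner_onD(2)[OF assms]
  show ?thesis unfolding grad_inner_on_def
  proof (intro conjI exI[of _ "\<lambda>\<epsilon>. G (a * \<epsilon>)"] allI)
    show "integrable (restrict_space \<mu> \<Omega>) (\<lambda>x. a * h x)" using G(4) by simp
    show "min_gradient_on \<mu> \<Omega> (\<lambda>x. f x + \<epsilon> * (a * \<phi> x)) (G (a * \<epsilon>))" for \<epsilon>
      using G(1)[of "a * \<epsilon>"] by (simp add: ac_simps)
    show "G (a * \<epsilon>) \<in> Lp (restrict_space \<mu> \<Omega>) 2" for \<epsilon> by (rule G(2))
    show "((\<lambda>\<epsilon>. \<integral>x. \<bar>((G (a * \<epsilon>) x)\<^sup>2 - (G (a * 0) x)\<^sup>2) / (2 * \<epsilon>) - a * h x\<bar> \<partial>restrict_space \<mu> \<Omega>) \<longlongrightarrow> 0) (at 0)"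
    proof (cases "a = 0")
      case False
      have f: "filterlim (\<lambda>\<epsilon>. a * \<epsilon>) (at 0) (at 0)"
      proof (rule filterlim_atI)
        have "((\<lambda>\<epsilon>. a * \<epsilon>) \<longlongrightarrow> a * 0) (at 0)" by (intro tendsto_intros)
        then show "((\<lambda>\<epsilon>. a * \<epsilon>) \<longlongrightarrow> 0) (at 0)" by simp
        show "\<forall>\<^sub>F \<epsilon> in at 0. a * \<epsilon> \<noteq> 0" using eventually_neq_at_within[of 0 0 UNIV] by eventually_elim (use False in simp)
      qed
      have "((\<lambda>\<epsilon>. \<bar>a\<bar> * (\<integral>x. \<bar>((G (a * \<epsilon>) x)\<^sup>2 - (G 0 x)\<^sup>2) / (2 * (a * \<epsilon>)) - h x\<bar> \<partial>restrict_space \<mu> \<Omega>)) \<longlongrightarrow> 0) (at 0)"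
        using tendsto_mult_right_zero[OF filterlim_compose[OF G(3) f]] .
      then show ?thesis
      proof (rule Lim_transform_eventually, use eventually_neq_at_within[of 0 0 UNIV] in eventually_elim)
        case (elim \<epsilon>)
        have "\<bar>a\<bar> * \<bar>((G (a * \<epsilon>) x)\<^sup>2 - (G 0 x)\<^sup>2) / (2 * (a * \<epsilon>)) - h x\<bar> =
           \<bar>((G (a * \<epsilon>) x)\<^sup>2 - (G (a * 0) x)\<^sup>2) / (2 * \<epsilon>) - a * h x\<bar>" for x
        proof -
          have "a * (((G (a * \<epsilon>) x)\<^sup>2 - (G 0 x)\<^sup>2) / (2 * (a * \<epsilon>)) - h x) = ((G (a * \<epsilon>) x)\<^sup>2 - (G (a * 0) x)\<^sup>2) / (2 * \<epsilon>) - a * h x"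
            using False elim by (simp add: field_simps)
          then show ?thesis by (simp only: abs_mult[symmetric])
        qed
        then show ?case by (simp flip: integral_mult_right_zero)
      qed
    qed simp
  qed
qed

lemma grad_inner_on_zero:
  assumes "grad_inner_on \<mu> \<Omega> f \<phi> h"
  shows "grad_inner_on \<mu> \<Omega> f (\<lambda>x. 0) (\<lambda>x. 0)"
  using grad_inner_on_scale[OF assms, of 0] by simp

text \<open>
  The gradient of \<open>(1 + \<epsilon>) f\<close> is \<open>\<bar>1 + \<epsilon>\<bar> \<bar>\<nabla>f\<bar>\<close>, so the difference quotient is explicit.
\<close>

lemma grad_inner_on_self:
  assumes \<Omega>: "open \<Omega>" and G0: "min_gradient_on \<mu> \<Omega> f G0" "G0 \<in> Lp (restrict_space \<mu> \<Omega>) 2"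
  shows "grad_inner_on \<mu> \<Omega> f f (\<lambda>x. (G0 x)\<^sup>2)"
  unfolding grad_inner_on_def
proof (intro conjI exI[of _ "\<lambda>\<epsilon> x. \<bar>1 + \<epsilon>\<bar> * G0 x"] allI)
  show "integrable (restrict_space \<mu> \<Omega>) (\<lambda>x. (G0 x)\<^sup>2)" by (rule Lp2_integrable_square[OF G0(2)])
  show "min_gradient_on \<mu> \<Omega> (\<lambda>x. f x + \<epsilon> * f x) (\<lambda>x. \<bar>1 + \<epsilon>\<bar> * G0 x)" for \<epsilon>
    using min_gradient_on_cmult[OF \<Omega> G0(1), of "1 + \<epsilon>"] by (simp add: distrib_right)
  show "(\<lambda>x. \<bar>1 + \<epsilon>\<bar> * G0 x) \<in> Lp (restrict_space \<mu> \<Omega>) 2" for \<epsilon> by (rule Lp2_cmult[OF G0(2)])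
  define J where "J = (\<integral>x. \<bar>(G0 x)\<^sup>2\<bar> \<partial>restrict_space \<mu> \<Omega>)"
  have "((\<lambda>\<epsilon>. \<bar>\<epsilon> / 2\<bar> * J) \<longlongrightarrow> \<bar>0 / 2\<bar> * J) (at 0)" by (intro tendsto_intros) auto
  then have "((\<lambda>\<epsilon>. \<bar>\<epsilon> / 2\<bar> * J) \<longlongrightarrow> 0) (at 0)" by simp
  then show "((\<lambda>\<epsilon>. \<integral>x. \<bar>((\<bar>1 + \<epsilon>\<bar> * G0 x)\<^sup>2 - (\<bar>1 + 0\<bar> * G0 x)\<^sup>2) / (2 * \<epsilon>) - (G0 x)\<^sup>2\<bar> \<partial>restrict_space \<mu> \<Omega>) \<longlongrightarrow> 0) (at 0)"
  proof (rule Lim_transform_eventually, use eventually_neq_at_within[of 0 0 UNIV] in eventually_elim)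
    case (elim \<epsilon>)
    have "((\<bar>1 + \<epsilon>\<bar> * G0 x)\<^sup>2 - (\<bar>1 + 0\<bar> * G0 x)\<^sup>2) / (2 * \<epsilon>) - (G0 x)\<^sup>2 = (\<epsilon> / 2) * (G0 x)\<^sup>2" for x
      using elim by (simp add: power_mult_distrib field_simps power2_eq_square)
    then have "(\<integral>x. \<bar>((\<bar>1 + \<epsilon>\<bar> * G0 x)\<^sup>2 - (\<bar>1 + 0\<bar> * G0 x)\<^sup>2) / (2 * \<epsilon>) - (G0 x)\<^sup>2\<bar> \<partial>restrict_space \<mu> \<Omega>)
        = (\<integral>x. \<bar>\<epsilon> / 2\<bar> * \<bar>(G0 x)\<^sup>2\<bar> \<partial>restrict_space \<mu> \<Omega>)" by (simp only: abs_mult)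
    also have "\<dots> = \<bar>\<epsilon> / 2\<bar> * J" unfolding J_def by (rule integral_mult_right_zero)
    finally show ?case by (rule sym)
  qed
qed

lemma sum_plus_square_le:
  fixes b :: real
  assumes "finite I"
  shows "((\<Sum>i\<in>I. x i) + b)\<^sup>2 \<le> (real (card I) + 1) * ((\<Sum>i\<in>I. (x i)\<^sup>2) + b\<^sup>2)"
proof -
  have "2 * (\<Sum>i\<in>I. x i) * b = (\<Sum>i\<in>I. 2 * x i * b)" by (simp add: sum_distrib_left sum_distrib_right)
  also have "\<dots> \<le> (\<Sum>i\<in>I. (x i)\<^sup>2 + b\<^sup>2)" by (intro sum_mono sum_squares_bound)
  also have "\<dots> = (\<Sum>i\<in>I. (x i)\<^sup>2) + real (card I) * b\<^sup>2" by (simp add: sum.distrib)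
  finally have "2 * (\<Sum>i\<in>I. x i) * b \<le> (\<Sum>i\<in>I. (x i)\<^sup>2) + real (card I) * b\<^sup>2" .
  moreover have "(\<Sum>i\<in>I. x i)\<^sup>2 \<le> (\<Sum>i\<in>I. (x i)\<^sup>2) * real (card I)" by (rule sum_squared_le_sum_of_squares)
  ultimately show ?thesis by (simp add: power2_sum algebra_simps)
qed

text \<open>
  The convexity of \<open>u \<mapsto> \<bar>\<nabla>u\<bar>\<^sup>2\<close> makes its directional derivative at \<open>f\<close> subadditive, and \<open>\<bar>\<nabla>f\<bar> g\<close>
  bounds it in a direction with gradient at most \<open>g\<close>.  Applied to the positive and to the negative of
  a direction, this single inequality contains linearity, locality and uniqueness of \<open>\<langle>\<nabla>f, \<nabla>\<phi>\<rangle>\<close> in \<open>\<phi>\<close>.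
\<close>

lemma grad_inner_subadditive:
  assumes \<Omega>: "open \<Omega>" and V: "open V" "V \<subseteq> \<Omega>" and I: "finite I"
    and h: "grad_inner_on \<mu> \<Omega> f \<phi> h" and hI: "\<And>i. i \<in> I \<Longrightarrow> grad_inner_on \<mu> \<Omega> f (\<phi>' i) (h' i)"
    and G0: "min_gradient_on \<mu> \<Omega> f G0"
    and g: "upper_grad_on V (\<lambda>x. \<phi> x - (\<Sum>i\<in>I. \<phi>' i x)) g" "g \<in> Lp (restrict_space \<mu> V) 2"
  shows "AE x in \<mu>. x \<in> V \<longrightarrow> h x \<le> (\<Sum>i\<in>I. h' i x) + G0 x * g x"
proof -
  have bo: "\<Omega> \<in> sets borel" "V \<in> sets borel" using \<Omega> V by auto
  obtain G where Gall: "(\<forall>\<epsilon>. min_gradient_on \<mu> \<Omega> (\<lambda>x. f x + \<epsilon> * \<phi> x) (G \<epsilon>) \<and> G \<epsilon> \<in> Lp (restrict_space \<mu> \<Omega>) 2) \<and>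
    ((\<lambda>\<epsilon>. \<integral>x. \<bar>((G \<epsilon> x)\<^sup>2 - (G 0 x)\<^sup>2) / (2 * \<epsilon>) - h x\<bar> \<partial>restrict_space \<mu> \<Omega>) \<longlongrightarrow> 0) (at 0)"
    using grad_inner_onD(1)[OF h] ..
  note G = Gall[THEN conjunct1, rule_format, THEN conjunct1] Gall[THEN conjunct1, rule_format, THEN conjunct2]
    Gall[THEN conjunct2] grad_inner_onD(2)[OF h]
  have "\<exists>H. \<forall>i\<in>I. (\<forall>\<epsilon>. min_gradient_on \<mu> \<Omega> (\<lambda>x. f x + \<epsilon> * \<phi>' i x) (H i \<epsilon>) \<and> H i \<epsilon> \<in> Lp (restrict_space \<mu> \<Omega>) 2) \<and>
    ((\<lambda>\<epsilon>. \<integral>x. \<bar>((H i \<epsilon> x)\<^sup>2 - (H i 0 x)\<^sup>2) / (2 * \<epsilon>) - h' i x\<bar> \<partial>restrict_space \<mu> \<Omega>) \<longlongrightarrow> 0) (at 0)"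
    by (rule bchoice) (intro ballI grad_inner_onD(1) hI)
  then obtain H where Hall: "\<forall>i\<in>I. (\<forall>\<epsilon>. min_gradient_on \<mu> \<Omega> (\<lambda>x. f x + \<epsilon> * \<phi>' i x) (H i \<epsilon>) \<and> H i \<epsilon> \<in> Lp (restrict_space \<mu> \<Omega>) 2) \<and>
    ((\<lambda>\<epsilon>. \<integral>x. \<bar>((H i \<epsilon> x)\<^sup>2 - (H i 0 x)\<^sup>2) / (2 * \<epsilon>) - h' i x\<bar> \<partial>restrict_space \<mu> \<Omega>) \<longlongrightarrow> 0) (at 0)" ..
  note H = Hall[THEN bspec, THEN conjunct1, rule_format, THEN conjunct1] Hall[THEN bspec, THEN conjunct1, rule_format, THEN conjunct2]
    Hall[THEN bspec, THEN conjunct2]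
  have h'int: "integrable (restrict_space \<mu> \<Omega>) (h' i)" if "i \<in> I" for i using hI[OF that] by (simp add: grad_inner_on_def)
  \<comment> \<open>With \<open>n = \<bar>I\<bar> + 1\<close> the function \<open>f + e \<phi>\<close> is the mean of the \<open>f + n e \<phi>' i\<close> and of \<open>f + n e (\<phi> - \<Sum> \<phi>' i)\<close>,
    and the square of the norm of a mean is at most the mean of the squares.\<close>
  define n where "n = real (card I) + 1"
  have n: "n > 0" by (simp add: n_def)
  define \<epsilon> where "\<epsilon> k = 1 / real (Suc k)" for k
  have \<epsilon>: "\<epsilon> k > 0" for k by (simp add: \<epsilon>_def)
  have \<epsilon>0: "\<epsilon> \<longlonglongrightarrow> 0" unfolding \<epsilon>_def by (rule LIMSEQ_Suc[OF lim_1_over_n])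
  have \<epsilon>at: "filterlim (\<lambda>k. c * \<epsilon> k) (at 0) sequentially" if "c > 0" for c
  proof (rule filterlim_atI)
    show "(\<lambda>k. c * \<epsilon> k) \<longlonglongrightarrow> 0" by (rule tendsto_mult_right_zero[OF \<epsilon>0])
    show "\<forall>\<^sub>F k in sequentially. c * \<epsilon> k \<noteq> 0" using that \<epsilon> by (intro always_eventually allI) (simp add: less_imp_neq[THEN not_sym])
  qed
  let ?M = "restrict_space \<mu> V"
  define q where "q = (\<lambda>e x. ((G e x)\<^sup>2 - (G 0 x)\<^sup>2) / (2 * e))"
  define p where "p = (\<lambda>i e x. ((H i e x)\<^sup>2 - (H i 0 x)\<^sup>2) / (2 * e))"
  have sq: "integrable ?M (\<lambda>x. (F x)\<^sup>2)" if "F \<in> Lp (restrict_space \<mu> \<Omega>) 2" for F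
    by (rule rs_integrable_subset[OF bo V(2) Lp2_integrable_square[OF that]])
  have qint: "integrable ?M (q e)" "integrable (restrict_space \<mu> \<Omega>) (q e)" for e
    unfolding q_def using sq[OF G(2)] Lp2_integrable_square[OF G(2)] by auto
  have pint: "integrable ?M (p i e)" "integrable (restrict_space \<mu> \<Omega>) (p i e)" if "i \<in> I" for i e
    unfolding p_def using sq[OF H(2)[OF that]] Lp2_integrable_square[OF H(2)[OF that]] by auto
  have hV: "integrable ?M h" by (rule rs_integrable_subset[OF bo V(2) G(4)])
  have h'V: "integrable ?M (h' i)" if "i \<in> I" for i by (rule rs_integrable_subset[OF bo V(2) h'int[OF that]])
  have limV: "(\<lambda>k. \<integral>x. \<bar>Q (c * \<epsilon> k) x - a x\<bar> \<partial>?M) \<longlonglongrightarrow> 0"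
    if "c > 0" "((\<lambda>e. \<integral>x. \<bar>Q e x - a x\<bar> \<partial>restrict_space \<mu> \<Omega>) \<longlongrightarrow> 0) (at 0)"
      "\<And>e. integrable (restrict_space \<mu> \<Omega>) (Q e)" "integrable (restrict_space \<mu> \<Omega>) a"
    for Q :: "real \<Rightarrow> 'a \<Rightarrow> real" and a c
  proof (rule tendsto_sandwich[OF _ _ tendsto_const])
    show "(\<lambda>k. \<integral>x. \<bar>Q (c * \<epsilon> k) x - a x\<bar> \<partial>restrict_space \<mu> \<Omega>) \<longlonglongrightarrow> 0"
      by (rule filterlim_compose[OF that(2) \<epsilon>at[OF that(1)]])
    show "\<forall>\<^sub>F k in sequentially. (\<integral>x. \<bar>Q (c * \<epsilon> k) x - a x\<bar> \<partial>?M) \<le> (\<integral>x. \<bar>Q (c * \<epsilon> k) x - a x\<bar> \<partial>restrict_space \<mu> \<Omega>)"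
      using that(3,4) by (intro always_eventually allI rs_integral_subset[OF bo V(2)]) auto
  qed simp
  have limq: "(\<lambda>k. \<integral>x. \<bar>q (\<epsilon> k) x - h x\<bar> \<partial>?M) \<longlonglongrightarrow> 0"
    using limV[of 1 q h] G(3,4) qint(2) by (simp add: q_def)
  have limp: "(\<lambda>k. \<integral>x. \<bar>p i (n * \<epsilon> k) x - h' i x\<bar> \<partial>?M) \<longlonglongrightarrow> 0" if "i \<in> I" for i
    using limV[OF n, of "p i" "h' i"] H(3)[OF that] h'int[OF that] pint(2)[OF that] by (simp add: p_def)
  have G00: "min_gradient_on \<mu> \<Omega> f (G 0)" using G(1)[of 0] by simp
  have H00: "min_gradient_on \<mu> \<Omega> f (H i 0)" if "i \<in> I" for i using H(1)[OF that, of 0] by simp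
  have G0L: "G 0 \<in> Lp ?M 2" by (rule rs_L2_subset[OF bo V(2) G(2)])
  have Ggint: "integrable ?M (\<lambda>x. G 0 x * g x)" by (rule Lp2_integrable_mult[OF G0L g(2)])
  have g2: "integrable ?M (\<lambda>x. (g x)\<^sup>2)" by (rule Lp2_integrable_square[OF g(2)])
  define B where "B k x = (\<Sum>i\<in>I. p i (n * \<epsilon> k) x) + (G 0 x * g x + n * \<epsilon> k / 2 * (g x)\<^sup>2)" for k x
  define b where "b x = (\<Sum>i\<in>I. h' i x) + G 0 x * g x" for x
  have Bint: "integrable ?M (B k)" for k unfolding B_def using pint(1) Ggint g2 by (intro Bochner_Integration.integrable_add Bochner_Integration.integrable_sum integrable_mult_right) auto
  have bint: "integrable ?M b" unfolding b_def using h'V Ggint by (intro Bochner_Integration.integrable_add Bochner_Integration.integrable_sum) auto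
  have limB: "(\<lambda>k. \<integral>x. \<bar>B k x - b x\<bar> \<partial>?M) \<longlonglongrightarrow> 0"
  proof (rule tendsto_sandwich[OF _ _ tendsto_const])
    show "\<forall>\<^sub>F k in sequentially. 0 \<le> (\<integral>x. \<bar>B k x - b x\<bar> \<partial>?M)" by simp
    show "\<forall>\<^sub>F k in sequentially. (\<integral>x. \<bar>B k x - b x\<bar> \<partial>?M) \<le>
        (\<Sum>i\<in>I. \<integral>x. \<bar>p i (n * \<epsilon> k) x - h' i x\<bar> \<partial>?M) + n * \<epsilon> k / 2 * (\<integral>x. (g x)\<^sup>2 \<partial>?M)"
    proof (intro always_eventually allI)
      fix k
      have "(\<integral>x. \<bar>B k x - b x\<bar> \<partial>?M) \<le> (\<integral>x. (\<Sum>i\<in>I. \<bar>p i (n * \<epsilon> k) x - h' i x\<bar>) + n * \<epsilon> k / 2 * (g x)\<^sup>2 \<partial>?M)"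
      proof (rule integral_mono)
        fix x
        have "B k x - b x = (\<Sum>i\<in>I. p i (n * \<epsilon> k) x - h' i x) + n * \<epsilon> k / 2 * (g x)\<^sup>2"
          by (simp add: B_def b_def sum_subtractf)
        also have "\<bar>\<dots>\<bar> \<le> \<bar>\<Sum>i\<in>I. p i (n * \<epsilon> k) x - h' i x\<bar> + \<bar>n * \<epsilon> k / 2 * (g x)\<^sup>2\<bar>" by (rule abs_triangle_ineq)
        also have "\<dots> \<le> (\<Sum>i\<in>I. \<bar>p i (n * \<epsilon> k) x - h' i x\<bar>) + n * \<epsilon> k / 2 * (g x)\<^sup>2"
          using n \<epsilon>[of k] by (intro add_mono sum_abs) (simp add: abs_mult)
        finally show "\<bar>B k x - b x\<bar> \<le> (\<Sum>i\<in>I. \<bar>p i (n * \<epsilon> k) x - h' i x\<bar>) + n * \<epsilon> k / 2 * (g x)\<^sup>2" .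
      next
        show "integrable ?M (\<lambda>x. \<bar>B k x - b x\<bar>)"
          by (intro integrable_abs Bochner_Integration.integrable_diff Bint bint)
        show "integrable ?M (\<lambda>x. (\<Sum>i\<in>I. \<bar>p i (n * \<epsilon> k) x - h' i x\<bar>) + n * \<epsilon> k / 2 * (g x)\<^sup>2)"
          by (intro Bochner_Integration.integrable_add Bochner_Integration.integrable_sum integrable_abs
              Bochner_Integration.integrable_diff integrable_mult_right pint(1) h'V g2)
      qed
      also have "\<dots> = (\<integral>x. (\<Sum>i\<in>I. \<bar>p i (n * \<epsilon> k) x - h' i x\<bar>) \<partial>?M) + (\<integral>x. n * \<epsilon> k / 2 * (g x)\<^sup>2 \<partial>?M)"
        by (intro Bochner_Integration.integral_add Bochner_Integration.integrable_sum integrable_abs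
              Bochner_Integration.integrable_diff integrable_mult_right pint(1) h'V g2)
      also have "(\<integral>x. (\<Sum>i\<in>I. \<bar>p i (n * \<epsilon> k) x - h' i x\<bar>) \<partial>?M) = (\<Sum>i\<in>I. \<integral>x. \<bar>p i (n * \<epsilon> k) x - h' i x\<bar> \<partial>?M)"
        by (intro Bochner_Integration.integral_sum integrable_abs Bochner_Integration.integrable_diff pint(1) h'V)
      also have "(\<integral>x. n * \<epsilon> k / 2 * (g x)\<^sup>2 \<partial>?M) = n * \<epsilon> k / 2 * (\<integral>x. (g x)\<^sup>2 \<partial>?M)" by simp
      finally show "(\<integral>x. \<bar>B k x - b x\<bar> \<partial>?M) \<le>
        (\<Sum>i\<in>I. \<integral>x. \<bar>p i (n * \<epsilon> k) x - h' i x\<bar> \<partial>?M) + n * \<epsilon> k / 2 * (\<integral>x. (g x)\<^sup>2 \<partial>?M)" .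
    qed
    have "(\<lambda>k. (\<Sum>i\<in>I. \<integral>x. \<bar>p i (n * \<epsilon> k) x - h' i x\<bar> \<partial>?M) + n * \<epsilon> k / 2 * (\<integral>x. (g x)\<^sup>2 \<partial>?M)) \<longlonglongrightarrow>
        (\<Sum>i\<in>I. 0) + n * 0 / 2 * (\<integral>x. (g x)\<^sup>2 \<partial>?M)" by (intro tendsto_intros limp \<epsilon>0) auto
    then show "(\<lambda>k. (\<Sum>i\<in>I. \<integral>x. \<bar>p i (n * \<epsilon> k) x - h' i x\<bar> \<partial>?M) + n * \<epsilon> k / 2 * (\<integral>x. (g x)\<^sup>2 \<partial>?M)) \<longlonglongrightarrow> 0" by simp
  qed
  have le: "AE x in ?M. q (\<epsilon> k) x \<le> B k x" for k
  proof -
    define e where "e = \<epsilon> k"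
    have e: "e > 0" using \<epsilon> by (simp add: e_def)
    have up: "upper_grad_on V (\<lambda>x. (\<Sum>i\<in>I. 1/n * (f x + n * e * \<phi>' i x)) + (1/n * f x + e * (\<phi> x - (\<Sum>i\<in>I. \<phi>' i x))))
       (\<lambda>x. (\<Sum>i\<in>I. \<bar>1/n\<bar> * H i (n * e) x) + (\<bar>1/n\<bar> * G 0 x + \<bar>e\<bar> * g x))"
      by (intro upper_grad_on_add upper_grad_on_sum[OF V(1) I] upper_grad_on_cmult min_gradient_on_upper[OF V(2)] H(1) G00 g(1))
    have eq: "(\<lambda>x. (\<Sum>i\<in>I. 1/n * (f x + n * e * \<phi>' i x)) + (1/n * f x + e * (\<phi> x - (\<Sum>i\<in>I. \<phi>' i x)))) = (\<lambda>x. f x + e * \<phi> x)"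
    proof
      fix x
      have "(\<Sum>i\<in>I. 1/n * (f x + n * e * \<phi>' i x)) = (\<Sum>i\<in>I. f x / n + e * \<phi>' i x)"
        using n by (intro sum.cong) (auto simp: field_simps)
      also have "\<dots> = real (card I) * (f x / n) + e * (\<Sum>i\<in>I. \<phi>' i x)"
        by (simp add: sum.distrib sum_distrib_left)
      finally have "(\<Sum>i\<in>I. 1/n * (f x + n * e * \<phi>' i x)) = real (card I) * (f x / n) + e * (\<Sum>i\<in>I. \<phi>' i x)" .
      moreover have "real (card I) * (f x / n) + 1/n * f x = n * (f x / n)" by (simp add: n_def distrib_right add_divide_distrib)
      moreover have "n * (f x / n) = f x" using n by simp
      ultimately show "(\<Sum>i\<in>I. 1/n * (f x + n * e * \<phi>' i x)) + (1/n * f x + e * (\<phi> x - (\<Sum>i\<in>I. \<phi>' i x))) = f x + e * \<phi> x"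
        by (simp add: right_diff_distrib)
    qed
    have 1: "AE x in \<mu>. x \<in> V \<longrightarrow> G e x \<le> (\<Sum>i\<in>I. \<bar>1/n\<bar> * H i (n * e) x) + (\<bar>1/n\<bar> * G 0 x + \<bar>e\<bar> * g x)"
      using min_gradient_on_le[OF V G(1)[of e]] up unfolding eq by blast
    have 2: "AE x in \<mu>. x \<in> \<Omega> \<longrightarrow> 0 \<le> G e x" by (rule min_gradient_on_nonneg[OF \<Omega> G(1)])
    have 3: "AE x in \<mu>. \<forall>i\<in>I. x \<in> \<Omega> \<longrightarrow> H i 0 x = G 0 x"
      unfolding AE_ball_countable[OF countable_finite[OF I]]
      using min_gradient_on_unique[OF \<Omega> H00 G00] by blast
    have "AE x in \<mu>. x \<in> V \<longrightarrow> q e x \<le> B k x"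
      using 1 2 3
    proof eventually_elim
      case (elim x)
      show ?case
      proof
        assume x: "x \<in> V"
        then have x\<Omega>: "x \<in> \<Omega>" using V by blast
        define S where "S = (\<Sum>i\<in>I. H i (n * e) x)"
        define c where "c = G 0 x + n * e * g x"
        have "(\<Sum>i\<in>I. \<bar>1/n\<bar> * H i (n * e) x) + (\<bar>1/n\<bar> * G 0 x + \<bar>e\<bar> * g x) = (S + c) / n"
          using n e by (simp add: S_def c_def add_divide_distrib sum_divide_distrib)
        then have a: "0 \<le> G e x" "G e x \<le> (S + c) / n" using elim x x\<Omega> by auto
        then have "(G e x)\<^sup>2 \<le> ((S + c) / n)\<^sup>2" by (intro power_mono)
        also have "\<dots> = (S + c)\<^sup>2 / n\<^sup>2" by (rule power_divide)
        also have "\<dots> \<le> (n * ((\<Sum>i\<in>I. (H i (n * e) x)\<^sup>2) + c\<^sup>2)) / n\<^sup>2"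
          unfolding S_def n_def by (intro divide_right_mono sum_plus_square_le[OF I]) simp
        also have "\<dots> = ((\<Sum>i\<in>I. (H i (n * e) x)\<^sup>2) + c\<^sup>2) / n" using n by (simp add: power2_eq_square)
        finally have "(G e x)\<^sup>2 \<le> ((\<Sum>i\<in>I. (H i (n * e) x)\<^sup>2) + c\<^sup>2) / n" .
        then have "q e x \<le> (((\<Sum>i\<in>I. (H i (n * e) x)\<^sup>2) + c\<^sup>2) / n - (G 0 x)\<^sup>2) / (2 * e)"
          unfolding q_def using e by (intro divide_right_mono) auto
        also have "\<dots> = ((\<Sum>i\<in>I. (H i (n * e) x)\<^sup>2) + c\<^sup>2 - n * (G 0 x)\<^sup>2) / (2 * (n * e))"
          using n e by (simp add: field_simps)
        also have "(\<Sum>i\<in>I. (H i (n * e) x)\<^sup>2) + c\<^sup>2 - n * (G 0 x)\<^sup>2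
            = (\<Sum>i\<in>I. (H i (n * e) x)\<^sup>2 - (H i 0 x)\<^sup>2) + (c\<^sup>2 - (G 0 x)\<^sup>2)"
          using elim(3) x\<Omega> by (simp add: sum_subtractf n_def algebra_simps)
        also have "\<dots> / (2 * (n * e)) = (\<Sum>i\<in>I. p i (n * e) x) + (c\<^sup>2 - (G 0 x)\<^sup>2) / (2 * (n * e))"
          unfolding p_def by (simp add: add_divide_distrib sum_divide_distrib)
        also have "(c\<^sup>2 - (G 0 x)\<^sup>2) / (2 * (n * e)) = G 0 x * g x + n * e / 2 * (g x)\<^sup>2"
          using n e by (simp add: c_def field_simps power2_eq_square)
        finally show "q e x \<le> B k x" by (simp add: B_def e_def)
      qed
    qed
    then show ?thesis using bo by (simp add: rs_AE e_def)
  qed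
  have "AE x in ?M. h x \<le> b x"
    by (rule L1_limit_mono_AE[OF qint(1) Bint hV bint limq limB le])
  then have "AE x in \<mu>. x \<in> V \<longrightarrow> h x \<le> b x" using bo by (simp add: rs_AE)
  with min_gradient_on_unique[OF \<Omega> G00 G0] show ?thesis
    by eventually_elim (use V in \<open>auto simp: b_def\<close>)
qed

section \<open>Existence of directional derivatives\<close>

lemma minimal_grad_square_convex:
  assumes "minimal_grad (\<lambda>x. u x + a * \<phi> x) A" "minimal_grad (\<lambda>x. u x + c * \<phi> x) C"
    and "minimal_grad (\<lambda>x. u x + ((1 - t) * a + t * c) * \<phi> x) B" and t: "0 \<le> t" "t \<le> 1"
  shows "AE x in \<mu>. (B x)\<^sup>2 \<le> (1 - t) * (A x)\<^sup>2 + t * (C x)\<^sup>2"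
proof -
  have "upper_grad (\<lambda>x. (1 - t) * (u x + a * \<phi> x) + t * (u x + c * \<phi> x)) (\<lambda>x. \<bar>1 - t\<bar> * A x + \<bar>t\<bar> * C x)"
    by (intro upper_grad_add upper_grad_cmult minimal_gradD assms(1,2))
  moreover have "(\<lambda>x. (1 - t) * (u x + a * \<phi> x) + t * (u x + c * \<phi> x)) = (\<lambda>x. u x + ((1 - t) * a + t * c) * \<phi> x)"
    by (auto simp: algebra_simps)
  ultimately have "upper_grad (\<lambda>x. u x + ((1 - t) * a + t * c) * \<phi> x) (\<lambda>x. (1 - t) * A x + t * C x)" using t by simp
  from minimal_grad_le[OF assms(3) this] upper_grad_nonneg[OF minimal_gradD[OF assms(3)]]
  show ?thesis
  proof eventually_elim
    case (elim x)
    then have "(B x)\<^sup>2 \<le> ((1 - t) * A x + t * C x)\<^sup>2" by (intro power_mono)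
    also have "\<dots> = (1 - t) * (A x)\<^sup>2 + t * (C x)\<^sup>2 - t * (1 - t) * (A x - C x)\<^sup>2"
      by (simp add: power2_eq_square algebra_simps)
    also have "\<dots> \<le> (1 - t) * (A x)\<^sup>2 + t * (C x)\<^sup>2" using t by simp
    finally show ?case .
  qed
qed

text \<open>
  Along a line a quadratic form is a quadratic polynomial, whose second symmetric difference is \<open>\<gamma> s\<^sup>2\<close>.
\<close>

lemma minimal_grad_energy_quadratic:
  assumes quad: "quadratic_form_on (Cheeger_dom \<mu>) (\<lambda>f. enn2real (Cheeger \<mu> f))"
    and u: "u \<in> Cheeger_dom \<mu>" and \<phi>: "\<phi> \<in> Cheeger_dom \<mu>"
    and g: "\<And>\<epsilon>. minimal_grad (\<lambda>x. u x + \<epsilon> * \<phi> x) (g \<epsilon>)"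
  shows "\<exists>\<gamma>. \<forall>s. (\<integral>x. (g s x)\<^sup>2 \<partial>\<mu>) + (\<integral>x. (g (- s) x)\<^sup>2 \<partial>\<mu>) - 2 * (\<integral>x. (g 0 x)\<^sup>2 \<partial>\<mu>) = \<gamma> * s\<^sup>2"
proof -
  obtain B where B: "(\<forall>f\<in>Cheeger_dom \<mu>. \<forall>g\<in>Cheeger_dom \<mu>. B f g = B g f) \<and>
      (\<forall>f\<in>Cheeger_dom \<mu>. \<forall>g\<in>Cheeger_dom \<mu>. \<forall>h\<in>Cheeger_dom \<mu>. \<forall>a b.
        B (\<lambda>x. a * f x + b * g x) h = a * B f h + b * B g h) \<and>
      (\<forall>f\<in>Cheeger_dom \<mu>. enn2real (Cheeger \<mu> f) = B f f)"
    using quad[unfolded quadratic_form_on_def, THEN conjunct2, THEN conjunct2] ..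
  note B_sym = B[THEN conjunct1, rule_format]
    and lin = B[THEN conjunct2, THEN conjunct1, rule_format]
    and Q = B[THEN conjunct2, THEN conjunct2, rule_format]
  have dom: "(\<lambda>x. a * f x + b * g x) \<in> Cheeger_dom \<mu>" if "f \<in> Cheeger_dom \<mu>" "g \<in> Cheeger_dom \<mu>" for f g a b
    using quad that unfolding quadratic_form_on_def by (elim conjE) simp
  have E: "(\<integral>x. (g s x)\<^sup>2 \<partial>\<mu>) = 2 * (B u u + 2 * s * B \<phi> u + s\<^sup>2 * B \<phi> \<phi>)" for s
  proof -
    let ?w = "\<lambda>x. 1 * u x + s * \<phi> x"
    have w: "?w \<in> Cheeger_dom \<mu>" by (rule dom[OF u \<phi>])
    have "ennreal (1/2 * (\<integral>x. (g s x)\<^sup>2 \<partial>\<mu>)) = Cheeger \<mu> ?w" using g[of s] by (simp add: minimal_grad_def)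
    then have "enn2real (ennreal (1/2 * (\<integral>x. (g s x)\<^sup>2 \<partial>\<mu>))) = B ?w ?w" using Q[OF w] by (simp only:)
    moreover have "enn2real (ennreal (1/2 * (\<integral>x. (g s x)\<^sup>2 \<partial>\<mu>))) = 1/2 * (\<integral>x. (g s x)\<^sup>2 \<partial>\<mu>)" by (rule enn2real_ennreal) simp
    ultimately have "1/2 * (\<integral>x. (g s x)\<^sup>2 \<partial>\<mu>) = B ?w ?w" by (simp only:)
    also have "\<dots> = 1 * B u ?w + s * B \<phi> ?w" by (rule lin[OF u \<phi> w])
    also have "B u ?w = 1 * B u u + s * B \<phi> u" using B_sym[OF u w] lin[OF u \<phi> u, of 1 s] by simp
    also have "B \<phi> ?w = 1 * B u \<phi> + s * B \<phi> \<phi>" using B_sym[OF \<phi> w] lin[OF u \<phi> \<phi>, of 1 s] by simp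
    also have "B u \<phi> = B \<phi> u" by (rule B_sym[OF u \<phi>])
    finally show ?thesis by (simp add: power2_eq_square algebra_simps)
  qed
  show ?thesis unfolding E by (intro exI[of _ "4 * B \<phi> \<phi>"]) (simp add: algebra_simps)
qed

text \<open>
  The directional derivative exists for compactly supported Lipschitz directions: by convexity the
  difference quotients are monotone in \<open>\<epsilon>\<close>, and since the energy is a quadratic form the right and
  left quotients at \<open>\<epsilon>\<close> and \<open>-\<epsilon>\<close> differ in \<open>L\<^sup>1\<close> only by a multiple of \<open>\<epsilon>\<close>.
\<close>

lemma grad_inner_on_exists:
  assumes \<Omega>: "open \<Omega>" and quad: "quadratic_form_on (Cheeger_dom \<mu>) (\<lambda>f. enn2real (Cheeger \<mu> f))"
    and G0: "min_gradient_on \<mu> \<Omega> f G0" "G0 \<in> Lp (restrict_space \<mu> \<Omega>) 2" and \<phi>: "\<phi> \<in> Lip0 \<Omega>"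
  shows "\<exists>h. grad_inner_on \<mu> \<Omega> f \<phi> h"
proof -
  have bo: "\<Omega> \<in> sets borel" using \<Omega> by auto
  have [measurable]: "\<phi> \<in> borel_measurable \<mu>" by (rule Lip_fun_measurable[OF Lip0_Lip_fun[OF \<phi>]])
  obtain \<eta> where \<eta>: "\<eta> \<in> Lip0 \<Omega>" "\<And>x. \<phi> x \<noteq> 0 \<Longrightarrow> \<eta> x = 1"
  proof -
    have S: "compact (closure {x. \<phi> x \<noteq> 0})" "closure {x. \<phi> x \<noteq> 0} \<subseteq> \<Omega>"
      using Lip0_support[OF \<phi>] by (auto simp: compactly_inside_def)
    obtain \<eta> V where "\<eta> \<in> Lip0 \<Omega>" "closure {x. \<phi> x \<noteq> 0} \<subseteq> V" "\<forall>x\<in>V. \<eta> x = 1"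
      using Lip0_cutoff[OF S(1) \<Omega> S(2)] by blast
    then show ?thesis using closure_subset[of "{x. \<phi> x \<noteq> 0}"] by (intro that[of \<eta>]) auto
  qed
  define u where "u x = \<eta> x * f x" for x
  obtain U where "minimal_grad u U" using min_gradient_onD[OF G0(1) \<eta>(1)] unfolding u_def by blast
  then have u_ug: "upper_grad u U" by (rule minimal_gradD)
  have \<phi>_ug: "upper_grad \<phi> (pt_Lip \<phi>)" by (rule upper_grad_Lip0[OF \<phi>])
  have "\<exists>g. \<forall>\<epsilon>. minimal_grad (\<lambda>x. u x + \<epsilon> * \<phi> x) (g \<epsilon>)"
    by (intro choice allI minimal_grad_exists upper_grad_Cheeger_dom[OF upper_grad_add[OF u_ug upper_grad_cmult[OF \<phi>_ug]]])
  then obtain g where g: "\<And>\<epsilon>. minimal_grad (\<lambda>x. u x + \<epsilon> * \<phi> x) (g \<epsilon>)" by blast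
  have g2: "g \<epsilon> \<in> Lp \<mu> 2" for \<epsilon> by (rule upper_grad_L2(2)[OF minimal_gradD[OF g]])
  have [measurable]: "g \<epsilon> \<in> borel_measurable \<mu>" for \<epsilon> by (rule Lp2_measurable[OF g2])
  define q where "q \<epsilon> x = ((g \<epsilon> x)\<^sup>2 - (g 0 x)\<^sup>2) / (2 * \<epsilon>)" for \<epsilon> x
  have [measurable]: "q \<epsilon> \<in> borel_measurable \<mu>" for \<epsilon> unfolding q_def by measurable
  have qint: "integrable \<mu> (q \<epsilon>)" for \<epsilon> unfolding q_def using Lp2_integrable_square[OF g2] by auto
  have mono: "AE x in \<mu>. q s x \<le> q s' x \<and> q (- s') x \<le> q (- s) x" if s: "0 < s" "s \<le> s'" for s s'
  proof -
    have "minimal_grad (\<lambda>x. u x + ((1 - s / s') * 0 + (s / s') * s') * \<phi> x) (g s)" using g[of s] s by simp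
    from minimal_grad_square_convex[OF g g this]
    have 1: "AE x in \<mu>. (g s x)\<^sup>2 \<le> (1 - s / s') * (g 0 x)\<^sup>2 + (s / s') * (g s' x)\<^sup>2" using s by simp
    have "minimal_grad (\<lambda>x. u x + ((1 - s / s') * 0 + (s / s') * (- s')) * \<phi> x) (g (- s))" using g[of "- s"] s by simp
    from minimal_grad_square_convex[OF g g this]
    have 2: "AE x in \<mu>. (g (- s) x)\<^sup>2 \<le> (1 - s / s') * (g 0 x)\<^sup>2 + (s / s') * (g (- s') x)\<^sup>2" using s by simp
    from 1 2 show ?thesis
    proof eventually_elim
      case (elim x)
      have "(g s x)\<^sup>2 - (g 0 x)\<^sup>2 \<le> (s / s') * ((g s' x)\<^sup>2 - (g 0 x)\<^sup>2)"
        "(g (- s) x)\<^sup>2 - (g 0 x)\<^sup>2 \<le> (s / s') * ((g (- s') x)\<^sup>2 - (g 0 x)\<^sup>2)"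
        using elim by (simp_all add: algebra_simps)
      then show ?case unfolding q_def using s by (auto simp: field_simps)
    qed
  qed
  have cross: "AE x in \<mu>. q (- s) x \<le> q s x" if s: "0 < s" for s
  proof -
    have "minimal_grad (\<lambda>x. u x + ((1 - 1/2) * (- s) + (1/2) * s) * \<phi> x) (g 0)" using g[of 0] by simp
    from minimal_grad_square_convex[OF g g this]
    have "AE x in \<mu>. (g 0 x)\<^sup>2 \<le> (1 - 1/2) * (g (- s) x)\<^sup>2 + (1/2) * (g s x)\<^sup>2" by simp
    then show ?thesis
    proof eventually_elim
      case (elim x)
      have "q (- s) x = ((g 0 x)\<^sup>2 - (g (- s) x)\<^sup>2) / (2 * s)"
        using s by (simp add: q_def divide_simps)
      also have "\<dots> \<le> ((g s x)\<^sup>2 - (g 0 x)\<^sup>2) / (2 * s)" using s elim by (intro divide_right_mono) auto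
      finally show ?case by (simp add: q_def)
    qed
  qed
  define s where "s n = 1 / real (Suc n)" for n
  have s: "s n > 0" for n by (simp add: s_def)
  have s_mono: "s m \<le> s n" if "n \<le> m" for n m using that by (auto simp: s_def intro!: divide_left_mono)
  have s0: "s \<longlonglongrightarrow> 0" unfolding s_def by (rule LIMSEQ_Suc[OF lim_1_over_n])
  define h0 where "h0 x = lim (\<lambda>n. q (s n) x)" for x
  have [measurable]: "h0 \<in> borel_measurable \<mu>" unfolding h0_def by measurable
  have "AE x in \<mu>. \<forall>n m. n \<le> m \<longrightarrow> q (s m) x \<le> q (s n) x \<and> q (- s n) x \<le> q (- s m) x"
    unfolding AE_all_countable by (intro allI AE_impI mono[OF s s_mono])
  moreover have "AE x in \<mu>. \<forall>n. q (- s n) x \<le> q (s n) x" unfolding AE_all_countable using cross[OF s] by blast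
  ultimately have h0: "AE x in \<mu>. \<forall>n. q (- s n) x \<le> h0 x \<and> h0 x \<le> q (s n) x"
  proof eventually_elim
    case (elim x)
    have dec: "decseq (\<lambda>n. q (s n) x)" unfolding decseq_def using elim(1) by blast
    have lower: "q (- s n) x \<le> q (s m) x" for n m
    proof (cases "n \<le> m")
      case True
      then have "q (- s n) x \<le> q (- s m) x" using elim(1) by blast
      then show ?thesis using elim(2) order_trans by blast
    next
      case False
      then have "q (s n) x \<le> q (s m) x" using elim(1) by simp
      then show ?thesis using elim(2) order_trans by blast
    qed
    obtain l where "(\<lambda>n. q (s n) x) \<longlonglongrightarrow> l"
      by (rule decseq_convergent[OF dec allI[OF lower[of 0]]]) (rule that)
    then have "convergent (\<lambda>n. q (s n) x)" by (rule convergentI)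
    then have l: "(\<lambda>n. q (s n) x) \<longlonglongrightarrow> h0 x" unfolding h0_def by (simp add: convergent_LIMSEQ_iff)
    show ?case
    proof (intro allI conjI)
      fix n
      show "q (- s n) x \<le> h0 x" by (rule LIMSEQ_le_const[OF l]) (use lower in blast)
      show "h0 x \<le> q (s n) x" by (rule decseq_ge[OF dec l])
    qed
  qed
  have h0int: "integrable \<mu> h0"
  proof (rule Bochner_Integration.integrable_bound[of _ "\<lambda>x. \<bar>q (s 0) x\<bar> + \<bar>q (- s 0) x\<bar>"])
    show "integrable \<mu> (\<lambda>x. \<bar>q (s 0) x\<bar> + \<bar>q (- s 0) x\<bar>)" using qint by auto
    show "AE x in \<mu>. norm (h0 x) \<le> norm (\<bar>q (s 0) x\<bar> + \<bar>q (- s 0) x\<bar>)"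
      using h0
    proof eventually_elim
      case (elim x)
      then have "q (- s 0) x \<le> h0 x" "h0 x \<le> q (s 0) x" by blast+
      then show ?case by simp
    qed
  qed measurable
  obtain \<gamma> where \<gamma>: "\<And>s. (\<integral>x. (g s x)\<^sup>2 \<partial>\<mu>) + (\<integral>x. (g (- s) x)\<^sup>2 \<partial>\<mu>) - 2 * (\<integral>x. (g 0 x)\<^sup>2 \<partial>\<mu>) = \<gamma> * s\<^sup>2"
    using minimal_grad_energy_quadratic[OF quad upper_grad_Cheeger_dom[OF u_ug] upper_grad_Cheeger_dom[OF \<phi>_ug] g] by blast
  have gap: "(\<integral>x. q (s n) x - q (- s n) x \<partial>\<mu>) = \<gamma> / 2 * s n" for n
  proof -
    have "(\<integral>x. q (s n) x - q (- s n) x \<partial>\<mu>) = (\<integral>x. ((g (s n) x)\<^sup>2 + (g (- s n) x)\<^sup>2 - 2 * (g 0 x)\<^sup>2) / (2 * s n) \<partial>\<mu>)"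
      using s[of n] by (intro Bochner_Integration.integral_cong) (auto simp: q_def field_simps)
    also have "\<dots> = (\<gamma> * (s n)\<^sup>2) / (2 * s n)"
      using Lp2_integrable_square[OF g2] by (simp add: \<gamma>[symmetric])
    also have "\<dots> = \<gamma> / 2 * s n" using s[of n] by (simp add: power2_eq_square)
    finally show ?thesis .
  qed
  have squeeze: "(\<integral>x. \<bar>q \<epsilon> x - h0 x\<bar> \<partial>\<mu>) \<le> \<gamma> / 2 * s n" if \<epsilon>: "\<epsilon> \<noteq> 0" "\<bar>\<epsilon>\<bar> \<le> s n" for \<epsilon> n
  proof -
    have "(\<integral>x. \<bar>q \<epsilon> x - h0 x\<bar> \<partial>\<mu>) \<le> (\<integral>x. q (s n) x - q (- s n) x \<partial>\<mu>)"
    proof (rule integral_mono_AE)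
      have "0 < \<bar>\<epsilon>\<bar>" using \<epsilon> by simp
      from h0 mono[OF this \<epsilon>(2)] cross[OF this]
      show "AE x in \<mu>. \<bar>q \<epsilon> x - h0 x\<bar> \<le> q (s n) x - q (- s n) x"
      proof eventually_elim
        case (elim x)
        have "q (- s n) x \<le> h0 x" "h0 x \<le> q (s n) x" using elim(1) by blast+
        moreover have "q (- s n) x \<le> q \<epsilon> x \<and> q \<epsilon> x \<le> q (s n) x" using elim(2,3) by (cases "\<epsilon> > 0") auto
        ultimately show ?case by linarith
      qed
    qed (use qint h0int in auto)
    then show ?thesis by (simp add: gap)
  qed
  \<comment> \<open>Off \<open>{\<phi> \<noteq> 0}\<close> the direction does not change the gradient, by locality.\<close>
  define G where "G \<epsilon> x = (if \<phi> x = 0 then G0 x else g \<epsilon> x)" for \<epsilon> x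
  define h where "h x = (if \<phi> x = 0 then 0 else h0 x)" for x
  have ind: "indicator \<Omega> x * G \<epsilon> x = indicator {x. \<phi> x = 0} x * (indicator \<Omega> x * G0 x) + indicator (\<Omega> \<inter> {x. \<phi> x \<noteq> 0}) x * g \<epsilon> x" for x \<epsilon>
    by (auto simp: G_def indicator_def)
  have [measurable]: "\<Omega> \<in> sets \<mu>" using bo by simp
  have G2: "G \<epsilon> \<in> Lp (restrict_space \<mu> \<Omega>) 2" for \<epsilon>
    unfolding rs_L2_iff[OF bo] ind
  proof (rule Lp2_add)
    show "(\<lambda>x. indicator {x. \<phi> x = 0} x * (indicator \<Omega> x * G0 x)) \<in> Lp \<mu> 2"
      using G0(2) unfolding rs_L2_iff[OF bo] by (rule Lp2_bounded_mult[where C = 1]) (auto simp: indicator_def)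
    show "(\<lambda>x. indicator (\<Omega> \<inter> {x. \<phi> x \<noteq> 0}) x * g \<epsilon> x) \<in> Lp \<mu> 2"
      by (rule Lp2_bounded_mult[where C = 1, OF g2]) (auto simp: indicator_def)
  qed
  have "grad_inner_on \<mu> \<Omega> f \<phi> h"
    unfolding grad_inner_on_def
  proof (intro conjI exI[of _ G] allI)
    have "integrable \<mu> (\<lambda>x. indicator (\<Omega> \<inter> {x. \<phi> x \<noteq> 0}) x *\<^sub>R h0 x)" by (rule integrable_mult_indicator[OF _ h0int]) measurable
    moreover have "(\<lambda>x. indicator (\<Omega> \<inter> {x. \<phi> x \<noteq> 0}) x *\<^sub>R h0 x) = (\<lambda>x. indicator \<Omega> x * h x)"
      by (auto simp: h_def indicator_def)
    ultimately show "integrable (restrict_space \<mu> \<Omega>) h" by (simp add: rs_integrable[OF bo])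
    show "G \<epsilon> \<in> Lp (restrict_space \<mu> \<Omega>) 2" for \<epsilon> by (rule G2)
    show "min_gradient_on \<mu> \<Omega> (\<lambda>x. f x + \<epsilon> * \<phi> x) (G \<epsilon>)" for \<epsilon>
      unfolding min_gradient_on_def min_relaxed_gradient_iff
    proof (intro conjI ballI)
      show "G \<epsilon> \<in> borel_measurable (restrict_space \<mu> \<Omega>)" by (rule Lp2_measurable[OF G2])
      fix \<theta> assume \<theta>: "\<theta> \<in> Lip0 \<Omega>"
      obtain L0 where L0: "minimal_grad (\<lambda>x. \<theta> x * f x) L0" "AE x in \<mu>. x \<in> \<Omega> \<and> \<theta> x = 1 \<longrightarrow> G0 x = L0 x"
        using min_gradient_onD[OF G0(1) \<theta>] by blast
      have "upper_grad (\<lambda>x. \<theta> x * \<phi> x) (pt_Lip (\<lambda>x. \<theta> x * \<phi> x))"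
        by (rule upper_grad_Lip0[OF Lip0_mult[OF \<Omega> \<theta> Lip0_Lip_fun[OF \<phi>]]])
      from upper_grad_add[OF minimal_gradD[OF L0(1)] upper_grad_cmult[OF this, of \<epsilon>]]
      have "(\<lambda>x. \<theta> x * f x + \<epsilon> * (\<theta> x * \<phi> x)) \<in> Cheeger_dom \<mu>" by (rule upper_grad_Cheeger_dom)
      moreover have "(\<lambda>x. \<theta> x * f x + \<epsilon> * (\<theta> x * \<phi> x)) = (\<lambda>x. \<theta> x * (f x + \<epsilon> * \<phi> x))" by (auto simp: algebra_simps)
      ultimately obtain L where L: "minimal_grad (\<lambda>x. \<theta> x * (f x + \<epsilon> * \<phi> x)) L" using minimal_grad_exists by auto
      have "AE x in \<mu>. x \<in> \<Omega> \<and> \<theta> x = 1 \<longrightarrow> G \<epsilon> x = L x"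
        using L0(2) minimal_grad_local[OF L L0(1)] minimal_grad_local[OF L g[of \<epsilon>]]
      proof eventually_elim
        case (elim x)
        show ?case
        proof
          assume x: "x \<in> \<Omega> \<and> \<theta> x = 1"
          show "G \<epsilon> x = L x"
          proof (cases "\<phi> x = 0")
            case True then show ?thesis using elim(1,2) x by (simp add: G_def)
          next
            case False then show ?thesis using elim(3) x \<eta>(2)[OF False] by (simp add: G_def u_def)
          qed
        qed
      qed
      with L show "\<exists>G'. minimal_grad (\<lambda>x. \<theta> x * (f x + \<epsilon> * \<phi> x)) G' \<and> (AE x in \<mu>. x \<in> \<Omega> \<and> \<theta> x = 1 \<longrightarrow> G \<epsilon> x = G' x)"
        by blast
    qed
    show "((\<lambda>\<epsilon>. \<integral>x. \<bar>((G \<epsilon> x)\<^sup>2 - (G 0 x)\<^sup>2) / (2 * \<epsilon>) - h x\<bar> \<partial>restrict_space \<mu> \<Omega>) \<longlongrightarrow> 0) (at 0)"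
    proof (rule tendstoI)
      fix e :: real assume e: "e > 0"
      have "(\<lambda>n. \<gamma> / 2 * s n) \<longlonglongrightarrow> 0" by (rule tendsto_mult_right_zero[OF s0])
      from order_tendstoD(2)[OF this e] obtain n where n: "\<gamma> / 2 * s n < e" by (auto simp: eventually_sequentially)
      have "\<forall>\<^sub>F \<epsilon> in at 0. \<epsilon> \<noteq> 0 \<and> dist \<epsilon> 0 < s n" unfolding eventually_at using s[of n] by (intro exI[of _ "s n"]) auto
      then show "\<forall>\<^sub>F \<epsilon> in at 0. dist (\<integral>x. \<bar>((G \<epsilon> x)\<^sup>2 - (G 0 x)\<^sup>2) / (2 * \<epsilon>) - h x\<bar> \<partial>restrict_space \<mu> \<Omega>) 0 < e"
      proof eventually_elim
        case (elim \<epsilon>)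
        have pt: "indicator \<Omega> x * \<bar>((G \<epsilon> x)\<^sup>2 - (G 0 x)\<^sup>2) / (2 * \<epsilon>) - h x\<bar> \<le> \<bar>q \<epsilon> x - h0 x\<bar>" for x
          by (auto simp: G_def h_def q_def indicator_def)
        have "(\<integral>x. \<bar>((G \<epsilon> x)\<^sup>2 - (G 0 x)\<^sup>2) / (2 * \<epsilon>) - h x\<bar> \<partial>restrict_space \<mu> \<Omega>) \<le> (\<integral>x. \<bar>q \<epsilon> x - h0 x\<bar> \<partial>\<mu>)"
          unfolding rs_integral[OF bo] using pt qint h0int by (intro integral_mono') auto
        also have "\<dots> \<le> \<gamma> / 2 * s n" using elim by (intro squeeze) auto
        also have "\<dots> < e" by (rule n)
        finally show ?case by (simp add: abs_of_nonneg)
      qed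
    qed
  qed
  then show ?thesis by blast
qed

section \<open>The chain rule\<close>

lemma lip_le_sum:
  assumes "finite I" "\<And>i. i \<in> I \<Longrightarrow> lip_le (v i) x (L i)"
  shows "lip_le (\<lambda>y. \<Sum>i\<in>I. v i y) x (\<Sum>i\<in>I. L i)"
  using assms
proof (induction I rule: finite_induct)
  case empty
  then show ?case using lip_le_0[of 0 x] by simp
next
  case (insert i I)
  then show ?case using lip_le_add[of "v i" x "L i"] by simp
qed

lemma Lip0_sum:
  assumes "finite I" "\<And>i. i \<in> I \<Longrightarrow> v i \<in> Lip0 \<Omega>"
  shows "(\<lambda>x. \<Sum>i\<in>I. v i x) \<in> Lip0 \<Omega>"
  using assms
proof (induction I rule: finite_induct)
  case empty
  then show ?case using Lip0_zero by simp
next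
  case (insert i I)
  then show ?case using Lip0_add[of "v i"] by simp
qed

text \<open>
  The chain rule.  It suffices that at each point \<open>x\<close> the function \<open>\<phi>\<close> agrees to first order with a
  linear combination of the \<open>v i\<close>: comparing with the countably many rational combinations, whose
  coefficients are constant, gives the claim at almost every point.
\<close>

lemma grad_inner_chain:
  assumes \<Omega>: "open \<Omega>" and I: "finite I" and h: "grad_inner_on \<mu> \<Omega> f \<phi> h"
    and h': "\<And>i. i \<in> I \<Longrightarrow> grad_inner_on \<mu> \<Omega> f (v i) (h' i)"
    and G0: "min_gradient_on \<mu> \<Omega> f G0"
    and \<phi>: "\<phi> \<in> Lip0 \<Omega>" and v: "\<And>i. i \<in> I \<Longrightarrow> v i \<in> Lip0 \<Omega>"
    and first_order: "\<And>x. x \<in> \<Omega> \<Longrightarrow> lip_le (\<lambda>y. \<phi> y - (\<Sum>i\<in>I. a i x * v i y)) x 0"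
  shows "AE x in \<mu>. x \<in> \<Omega> \<longrightarrow> h x = (\<Sum>i\<in>I. a i x * h' i x)"
proof -
  define Q where "Q = (\<Pi>\<^sub>E i\<in>I. (\<rat> :: real set))"
  have Q: "countable Q" unfolding Q_def using I countable_rat by (intro countable_PiE)
  define R where "R q y = \<phi> y - (\<Sum>i\<in>I. q i * v i y)" for q y
  have R0: "R q \<in> Lip0 \<Omega>" for q
  proof -
    have "(\<lambda>y. \<phi> y + -1 * (\<Sum>i\<in>I. q i * v i y)) \<in> Lip0 \<Omega>" by (intro Lip0_add Lip0_cmult Lip0_sum[OF I] \<phi> v)
    then show ?thesis by (simp add: R_def[abs_def])
  qed
  have bo: "\<Omega> \<in> sets borel" using \<Omega> by auto
  have RL2: "pt_Lip (R q) \<in> Lp (restrict_space \<mu> \<Omega>) 2" for q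
    unfolding rs_L2_iff[OF bo] using bo
    by (intro Lp2_bounded_mult[where C = 1] Lip0_pt_Lip_L2[OF R0]) (auto simp: indicator_def)
  have key: "AE x in \<mu>. x \<in> \<Omega> \<longrightarrow> \<bar>h x - (\<Sum>i\<in>I. q i * h' i x)\<bar> \<le> G0 x * pt_Lip (R q) x" for q
  proof -
    have up: "upper_grad_on \<Omega> (R q) (pt_Lip (R q))" by (rule upper_grad_on_Lip0[OF \<Omega> Lip0_Lip_fun[OF R0]])
    have 1: "AE x in \<mu>. x \<in> \<Omega> \<longrightarrow> h x \<le> (\<Sum>i\<in>I. q i * h' i x) + G0 x * pt_Lip (R q) x"
      by (rule grad_inner_subadditive[OF \<Omega> \<Omega> order_refl I h grad_inner_on_scale[OF h'] G0 _ RL2])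
        (use up in \<open>simp_all add: R_def[abs_def]\<close>)
    have "upper_grad_on \<Omega> (\<lambda>x. -1 * R q x) (\<lambda>x. \<bar>-1\<bar> * pt_Lip (R q) x)" by (rule upper_grad_on_cmult[OF up])
    then have up': "upper_grad_on \<Omega> (\<lambda>x. -1 * \<phi> x - (\<Sum>i\<in>I. - q i * v i x)) (pt_Lip (R q))"
      by (simp add: R_def sum_negf)
    have 2: "AE x in \<mu>. x \<in> \<Omega> \<longrightarrow> -1 * h x \<le> (\<Sum>i\<in>I. - q i * h' i x) + G0 x * pt_Lip (R q) x"
      by (rule grad_inner_subadditive[OF \<Omega> \<Omega> order_refl I grad_inner_on_scale[OF h] grad_inner_on_scale[OF h'] G0 up' RL2])
    from 1 2 show ?thesis by eventually_elim (auto simp: sum_negf abs_le_iff)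
  qed
  have "AE x in \<mu>. \<forall>q\<in>Q. x \<in> \<Omega> \<longrightarrow> \<bar>h x - (\<Sum>i\<in>I. q i * h' i x)\<bar> \<le> G0 x * pt_Lip (R q) x"
    unfolding AE_ball_countable[OF Q] using key by blast
  with min_gradient_on_nonneg[OF \<Omega> G0] show ?thesis
  proof eventually_elim
    case (elim x)
    show ?case
    proof
      assume x: "x \<in> \<Omega>"
      then have G0x: "0 \<le> G0 x" using elim by blast
      have "\<exists>r\<in>\<rat>. \<bar>r - c\<bar> < 1 / real (Suc n)" for c :: real and n
        using Rats_dense_in_real[of c "c + 1 / real (Suc n)"] by force
      then have ex: "\<exists>r. r \<in> \<rat> \<and> \<bar>r - c\<bar> < 1 / real (Suc n)" for c :: real and n by blast
      define r where "r n c = (SOME r. r \<in> \<rat> \<and> \<bar>r - c\<bar> < 1 / real (Suc n))" for n and c :: real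
      have r: "r n c \<in> \<rat>" "\<bar>r n c - c\<bar> < 1 / real (Suc n)" for c n
        using someI_ex[OF ex[of c n]] unfolding r_def by blast+
      have rlim: "(\<lambda>n. r n c) \<longlonglongrightarrow> c" for c
      proof -
        have "(\<lambda>n. r n c - c) \<longlonglongrightarrow> 0"
          by (rule Lim_null_comparison[OF always_eventually LIMSEQ_Suc[OF lim_1_over_n]]) (use r(2) less_imp_le in auto)
        then show ?thesis by (simp add: LIM_zero_iff)
      qed
      define q where "q n = restrict (\<lambda>i. r n (a i x)) I" for n
      have qQ: "q n \<in> Q" for n using r(1) by (auto simp: q_def Q_def)
      have L: "\<exists>b. lip_le (v i) x b" if "i \<in> I" for i by (rule Lip_fun_lip_le[OF Lip0_Lip_fun[OF v[OF that]]])
      have Rle: "pt_Lip (R (q n)) x \<le> (\<Sum>i\<in>I. \<bar>a i x - r n (a i x)\<bar> * pt_Lip (v i) x)" for n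
      proof -
        have "lip_le (\<lambda>y. (\<phi> y - (\<Sum>i\<in>I. a i x * v i y)) + (\<Sum>i\<in>I. (a i x - r n (a i x)) * v i y)) x
            (0 + (\<Sum>i\<in>I. \<bar>a i x - r n (a i x)\<bar> * pt_Lip (v i) x))"
          using L lip_le_pt_Lip by (intro lip_le_add[OF first_order[OF x]] lip_le_sum[OF I] lip_le_cmult) blast
        moreover have "(\<lambda>y. (\<phi> y - (\<Sum>i\<in>I. a i x * v i y)) + (\<Sum>i\<in>I. (a i x - r n (a i x)) * v i y)) = R (q n)"
          by (auto simp: R_def q_def left_diff_distrib sum_subtractf)
        ultimately show ?thesis using pt_Lip_le(2) by fastforce
      qed
      have "\<bar>h x - (\<Sum>i\<in>I. a i x * h' i x)\<bar> \<le> G0 x * (\<Sum>i\<in>I. \<bar>a i x - a i x\<bar> * pt_Lip (v i) x)"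
      proof (rule LIMSEQ_le)
        show "(\<lambda>n. \<bar>h x - (\<Sum>i\<in>I. r n (a i x) * h' i x)\<bar>) \<longlonglongrightarrow> \<bar>h x - (\<Sum>i\<in>I. a i x * h' i x)\<bar>"
          by (intro tendsto_intros rlim)
        show "(\<lambda>n. G0 x * (\<Sum>i\<in>I. \<bar>a i x - r n (a i x)\<bar> * pt_Lip (v i) x)) \<longlonglongrightarrow> G0 x * (\<Sum>i\<in>I. \<bar>a i x - a i x\<bar> * pt_Lip (v i) x)"
          by (intro tendsto_intros rlim)
        show "\<exists>N. \<forall>n\<ge>N. \<bar>h x - (\<Sum>i\<in>I. r n (a i x) * h' i x)\<bar> \<le> G0 x * (\<Sum>i\<in>I. \<bar>a i x - r n (a i x)\<bar> * pt_Lip (v i) x)"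
        proof (intro exI allI impI)
          fix n
          have "\<bar>h x - (\<Sum>i\<in>I. q n i * h' i x)\<bar> \<le> G0 x * pt_Lip (R (q n)) x" using elim(2) qQ x by blast
          also have "\<dots> \<le> G0 x * (\<Sum>i\<in>I. \<bar>a i x - r n (a i x)\<bar> * pt_Lip (v i) x)" by (rule mult_left_mono[OF Rle G0x])
          finally show "\<bar>h x - (\<Sum>i\<in>I. r n (a i x) * h' i x)\<bar> \<le> G0 x * (\<Sum>i\<in>I. \<bar>a i x - r n (a i x)\<bar> * pt_Lip (v i) x)"
            by (simp add: q_def)
        qed
      qed
      then show "h x = (\<Sum>i\<in>I. a i x * h' i x)" by simp
    qed
  qed
qed

section \<open>Approximation of Sobolev functions by locally Lipschitz functions\<close>

lemma Lip_loc_diff: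
  assumes "p \<in> Lip_loc \<Omega>" "q \<in> Lip_loc \<Omega>"
  shows "(\<lambda>x. p x - q x) \<in> Lip_loc \<Omega>"
  unfolding Lip_loc_def
proof (intro CollectI ballI)
  fix x assume x: "x \<in> \<Omega>"
  obtain r C where 1: "r > 0" "C-lipschitz_on (ball x r \<inter> \<Omega>) p" using assms(1) x unfolding Lip_loc_def by blast
  obtain r' C' where 2: "r' > 0" "C'-lipschitz_on (ball x r' \<inter> \<Omega>) q" using assms(2) x unfolding Lip_loc_def by blast
  have "(C + C')-lipschitz_on (ball x (min r r') \<inter> \<Omega>) (\<lambda>x. p x - q x)"
    by (intro lipschitz_on_diff lipschitz_on_subset[OF 1(2)] lipschitz_on_subset[OF 2(2)]) auto
  then show "\<exists>r>0. \<exists>C. C-lipschitz_on (ball x r \<inter> \<Omega>) (\<lambda>x. p x - q x)"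
    using 1(1) 2(1) by (intro exI[of _ "min r r'"]) auto
qed

lemma Lip_loc_pt_Lip_measurable:
  assumes \<Omega>: "open \<Omega>" and p: "p \<in> Lip_loc \<Omega>"
  shows "pt_Lip p \<in> borel_measurable (restrict_space \<mu> \<Omega>)"
proof -
  obtain C where C: "countable C \<and> \<Union>C = \<Omega> \<and> (\<forall>W\<in>C. open W \<and> W \<subseteq> \<Omega> \<and>
      (\<exists>\<eta>\<in>Lip0 \<Omega>. (\<forall>x. 0 \<le> \<eta> x \<and> \<eta> x \<le> 1) \<and> (\<forall>x\<in>W. \<eta> x = 1)))"
    using countable_cutoff_cover[OF \<Omega>] ..
  show ?thesis
  proof (rule measurable_piecewise_restrict[OF C[THEN conjunct1]])
    show "space (restrict_space \<mu> \<Omega>) \<subseteq> \<Union>C" using C[THEN conjunct2, THEN conjunct1] by (simp add: space_restrict_space)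
    fix W assume "W \<in> C"
    with C have W: "open W" "W \<subseteq> \<Omega>" "\<exists>\<eta>\<in>Lip0 \<Omega>. (\<forall>x. 0 \<le> \<eta> x \<and> \<eta> x \<le> 1) \<and> (\<forall>x\<in>W. \<eta> x = 1)" by simp_all
    then obtain \<eta> where \<eta>: "\<eta> \<in> Lip0 \<Omega>" "\<forall>x\<in>W. \<eta> x = 1" by blast
    show "W \<inter> space (restrict_space \<mu> \<Omega>) \<in> sets (restrict_space \<mu> \<Omega>)"
      using W(1,2) \<Omega> by (auto simp: sets_restrict_space_iff space_restrict_space)
    have "pt_Lip (\<lambda>x. \<eta> x * p x) \<in> borel_measurable \<mu>"
      by (rule pt_Lip_measurable_mu[OF Lip0_Lip_fun[OF Lip0_mult_Lip_loc[OF \<Omega> \<eta>(1) p]]])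
    then have "pt_Lip (\<lambda>x. \<eta> x * p x) \<in> borel_measurable (restrict_space (restrict_space \<mu> \<Omega>) W)"
      by (intro measurable_restrict_space1)
    moreover have "pt_Lip (\<lambda>x. \<eta> x * p x) x = pt_Lip p x" if "x \<in> W" for x
    proof -
      obtain L where "lip_le p x L" using Lip_loc_lip_le[OF p \<Omega>] W(2) \<open>x \<in> W\<close> by blast
      then show ?thesis using W(1) that \<eta>(2) by (intro pt_Lip_local[of W x "\<lambda>x. \<eta> x * p x" p L]) auto
    qed
    ultimately show "pt_Lip p \<in> borel_measurable (restrict_space (restrict_space \<mu> \<Omega>) W)"
      by (subst measurable_cong[of _ _ "pt_Lip (\<lambda>x. \<eta> x * p x)"]) (auto simp: space_restrict_space)
  qed
qed

text \<open>
  For a function in \<open>H\<^sup>1(\<Omega>)\<close> the error of an approximation has a gradient that is small in \<open>L\<^sup>2\<close>,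
  namely the limit of the Lipschitz constants of the differences with the later approximations.
\<close>

lemma H1_approximation:
  assumes \<Omega>: "open \<Omega>" and f: "f \<in> H1 \<mu> \<Omega>"
  shows "\<exists>F g. (\<forall>n. F n \<in> Lip_loc \<Omega>) \<and> Lp_tendsto (restrict_space \<mu> \<Omega>) 2 F f \<and>
    (\<forall>n. g n \<in> Lp (restrict_space \<mu> \<Omega>) 2) \<and> (\<lambda>n. Lp_norm (restrict_space \<mu> \<Omega>) 2 (g n)) \<longlonglongrightarrow> 0 \<and>
    (\<forall>n V. open V \<longrightarrow> V \<subseteq> \<Omega> \<longrightarrow> upper_grad_on V (\<lambda>x. F n x - f x) (g n))"
proof -
  let ?M = "restrict_space \<mu> \<Omega>"
  have bo: "\<Omega> \<in> sets borel" using \<Omega> by auto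
  obtain F where F: "\<And>j. F j \<in> Lip_loc \<Omega>" "\<And>j. pt_Lip (F j) \<in> Lp ?M 2" "Lp_tendsto ?M 2 F f"
    "\<And>e. e > 0 \<Longrightarrow> \<exists>n0. \<forall>m\<ge>n0. \<forall>n\<ge>n0. W1p_norm \<mu> \<Omega> 2 (\<lambda>x. F m x - F n x) < e"
    using f unfolding W1p_def W1p_closure_def by blast
  \<comment> \<open>For fixed \<open>m\<close> the functions \<open>D m n\<close> converge in \<open>L\<^sup>2\<close>, because \<open>\<bar>D m n - D m n'\<bar> \<le> D n n'\<close>.\<close>
  define D where "D m n = pt_Lip (\<lambda>x. F m x - F n x)" for m n
  have lip: "\<exists>L. lip_le (F n) x L" if "x \<in> \<Omega>" for n x by (rule Lip_loc_lip_le[OF F(1) \<Omega> that])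
  have D0: "0 \<le> D m n x" if x: "x \<in> \<Omega>" for m n x
  proof -
    obtain a b where "lip_le (F m) x a" "lip_le (F n) x b" using lip[OF x] by metis
    from pt_Lip_le(1)[OF lip_le_diff[OF this]] show ?thesis by (simp add: D_def)
  qed
  have Dtri: "\<bar>D n m x - D n m' x\<bar> \<le> D m m' x" if x: "x \<in> \<Omega>" for n m m' x
  proof -
    obtain a b c where l: "lip_le (F n) x a" "lip_le (F m) x b" "lip_le (F m') x c" using lip[OF x] by metis
    have "\<bar>D n m x - D n m' x\<bar> \<le> pt_Lip (\<lambda>x. (F n x - F m x) - (F n x - F m' x)) x"
      unfolding D_def by (rule pt_Lip_diff_le[OF lip_le_diff[OF l(1,2)] lip_le_diff[OF l(1,3)]])
    also have "\<dots> = pt_Lip (\<lambda>x. F m' x - F m x) x" by simp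
    also have "\<dots> = D m m' x" unfolding D_def by (rule pt_Lip_minus_commute)
    finally show ?thesis .
  qed
  have D2: "D m n \<in> Lp ?M 2" for m n
  proof (rule Lp2_dominated[OF Lp2_add[OF F(2)[of m] F(2)[of n]]])
    show "D m n \<in> borel_measurable ?M" unfolding D_def by (rule Lip_loc_pt_Lip_measurable[OF \<Omega> Lip_loc_diff[OF F(1) F(1)]])
    have "\<bar>D m n x\<bar> \<le> \<bar>pt_Lip (F m) x + pt_Lip (F n) x\<bar>" if x: "x \<in> \<Omega>" for x
    proof -
      obtain a b where l: "lip_le (F m) x a" "lip_le (F n) x b" using lip[OF x] by metis
      have "D m n x \<le> pt_Lip (F m) x + pt_Lip (F n) x"
        unfolding D_def by (rule pt_Lip_le(2)[OF lip_le_diff[OF lip_le_pt_Lip[OF l(1)] lip_le_pt_Lip[OF l(2)]]])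
      then show ?thesis using D0[OF x, of m n] by simp
    qed
    then show "AE x in ?M. \<bar>D m n x\<bar> \<le> \<bar>pt_Lip (F m) x + pt_Lip (F n) x\<bar>" unfolding rs_AE[OF bo] by simp
  qed
  have Dsmall: "\<exists>n0. \<forall>m\<ge>n0. \<forall>n\<ge>n0. Lp_norm ?M 2 (D m n) < e" if e: "e > 0" for e
  proof -
    obtain n0 where n0: "\<forall>m\<ge>n0. \<forall>n\<ge>n0. W1p_norm \<mu> \<Omega> 2 (\<lambda>x. F m x - F n x) < e" using F(4)[OF e] by blast
    have "Lp_norm ?M 2 (D m n) \<le> W1p_norm \<mu> \<Omega> 2 (\<lambda>x. F m x - F n x)" for m n
      by (simp add: W1p_norm_def D_def)
    then show ?thesis using n0 by (meson le_less_trans)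
  qed
  have "\<exists>g. Lp_tendsto ?M 2 (D n) g" for n
  proof (rule Lp2_complete[OF D2])
    fix e :: real assume "e > 0"
    then obtain n0 where n0: "\<forall>m\<ge>n0. \<forall>m'\<ge>n0. Lp_norm ?M 2 (D m m') < e" using Dsmall by blast
    have "Lp_norm ?M 2 (\<lambda>x. D n m x - D n m' x) \<le> Lp_norm ?M 2 (D m m')" for m m'
    proof (rule Lp2_norm_mono[OF D2 Lp2_measurable[OF Lp2_diff[OF D2 D2]]])
      show "AE x in ?M. \<bar>D n m x - D n m' x\<bar> \<le> \<bar>D m m' x\<bar>"
        unfolding rs_AE[OF bo] using Dtri D0 by (intro AE_I2) (simp add: abs_of_nonneg)
    qed
    then show "\<exists>n0. \<forall>m\<ge>n0. \<forall>m'\<ge>n0. Lp_norm ?M 2 (\<lambda>x. D n m x - D n m' x) < e" using n0 by (meson le_less_trans)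
  qed
  then obtain g where g: "\<And>n. Lp_tendsto ?M 2 (D n) (g n)" by metis
  have g2: "g n \<in> Lp ?M 2" for n by (rule Lp2_tendstoD(2)[OF g])
  have small: "(\<lambda>n. Lp_norm ?M 2 (g n)) \<longlonglongrightarrow> 0"
  proof (rule LIMSEQ_I)
    fix e :: real assume "e > 0"
    then obtain n0 where n0: "\<forall>m\<ge>n0. \<forall>m'\<ge>n0. Lp_norm ?M 2 (D m m') < e / 2" using Dsmall[of "e / 2"] by auto
    have "Lp_norm ?M 2 (g n) \<le> e / 2" if "n \<ge> n0" for n
    proof (rule LIMSEQ_le_const2[OF Lp2_tendsto_norm[OF g]])
      show "\<exists>N. \<forall>m\<ge>N. Lp_norm ?M 2 (D n m) \<le> e / 2" using n0 that less_imp_le by blast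
    qed
    then show "\<exists>no. \<forall>n\<ge>no. norm (Lp_norm ?M 2 (g n) - 0) < e"
      using \<open>e > 0\<close> by (intro exI[of _ n0]) (fastforce intro: le_less_trans)
  qed
  have up: "upper_grad_on V (\<lambda>x. F n x - f x) (g n)" if V: "open V" "V \<subseteq> \<Omega>" for n V
    unfolding upper_grad_on_def
  proof
    fix \<eta> assume \<eta>: "\<eta> \<in> Lip0 V"
    have \<eta>\<Omega>: "\<eta> \<in> Lip0 \<Omega>" by (rule Lip0_mono[OF V(2) \<eta>])
    obtain B where B: "\<And>x. \<bar>\<eta> x\<bar> \<le> B" using Lip0_bounded[OF \<eta>] by blast
    obtain K where K: "\<And>x. \<bar>pt_Lip \<eta> x\<bar> \<le> K" using pt_Lip_Lip0_bounded[OF \<eta>] by blast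
    have m: "\<eta> \<in> borel_measurable \<mu>" "pt_Lip \<eta> \<in> borel_measurable \<mu>"
      using Lip_fun_measurable pt_Lip_measurable_mu Lip0_Lip_fun[OF \<eta>] by auto
    have FF: "Lp_tendsto \<mu> 2 (\<lambda>j x. indicator \<Omega> x * (F n x - F j x)) (\<lambda>x. indicator \<Omega> x * (F n x - f x))"
      by (rule rs_L2_tendsto[OF bo Lp2_tendsto_diff[OF Lp2_tendsto_const[OF Lp2_tendstoD(1)[OF F(3)]] F(3)]])
    have DD: "Lp_tendsto \<mu> 2 (\<lambda>j x. indicator \<Omega> x * D n j x) (\<lambda>x. indicator \<Omega> x * g n x)"
      by (rule rs_L2_tendsto[OF bo g])
    have FFabs: "Lp_tendsto \<mu> 2 (\<lambda>j x. \<bar>indicator \<Omega> x * (F n x - F j x)\<bar>) (\<lambda>x. \<bar>indicator \<Omega> x * (F n x - f x)\<bar>)"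
    proof (rule Lp2_tendstoI[OF _ _ Lp2_tendstoD(3)[OF FF]])
      show "(\<lambda>x. \<bar>indicator \<Omega> x * (F n x - F j x)\<bar>) \<in> Lp \<mu> 2" for j by (rule Lp2_abs[OF Lp2_tendstoD(1)[OF FF]])
      show "(\<lambda>x. \<bar>indicator \<Omega> x * (F n x - f x)\<bar>) \<in> Lp \<mu> 2" by (rule Lp2_abs[OF Lp2_tendstoD(2)[OF FF]])
      then show "Lp_norm \<mu> 2 (\<lambda>x. \<bar>indicator \<Omega> x * (F n x - F j x)\<bar> - \<bar>indicator \<Omega> x * (F n x - f x)\<bar>)
          \<le> Lp_norm \<mu> 2 (\<lambda>x. indicator \<Omega> x * (F n x - F j x) - indicator \<Omega> x * (F n x - f x))" for j
        using Lp2_abs[OF Lp2_tendstoD(1)[OF FF, of j]]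
        by (intro Lp2_norm_mono Lp2_diff Lp2_tendstoD[OF FF] Lp2_measurable AE_I2 abs_triangle_ineq3[THEN order_trans]) auto
    qed
    have H0: "Lp_tendsto \<mu> 2 (\<lambda>j x. \<eta> x * (indicator \<Omega> x * (F n x - F j x))) (\<lambda>x. \<eta> x * (indicator \<Omega> x * (F n x - f x)))"
      using B m by (intro Lp2_tendsto_mult_bounded[OF FF, where C = B]) auto
    have ind: "\<eta> x * (indicator \<Omega> x * c) = \<eta> x * c" for x c
      using Lip0_outside[OF \<eta>\<Omega>, of x] by (cases "x \<in> \<Omega>") auto
    have H: "Lp_tendsto \<mu> 2 (\<lambda>j x. \<eta> x * (F n x - F j x)) (\<lambda>x. \<eta> x * (F n x - f x))"
      using H0 unfolding ind .
    have G: "Lp_tendsto \<mu> 2 (\<lambda>j x. \<bar>\<eta> x\<bar> * (indicator \<Omega> x * D n j x) + pt_Lip \<eta> x * \<bar>indicator \<Omega> x * (F n x - F j x)\<bar>)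
       (\<lambda>x. \<bar>\<eta> x\<bar> * (indicator \<Omega> x * g n x) + pt_Lip \<eta> x * \<bar>indicator \<Omega> x * (F n x - f x)\<bar>)"
      using B K m by (intro Lp2_tendsto_add Lp2_tendsto_mult_bounded[OF DD, where C = B] Lp2_tendsto_mult_bounded[OF FFabs, where C = K]) auto
    have HL: "(\<lambda>x. \<eta> x * (F n x - F j x)) \<in> Lip0 \<Omega>" for j by (rule Lip0_mult_Lip_loc[OF \<Omega> \<eta>\<Omega> Lip_loc_diff[OF F(1) F(1)]])
    have le: "pt_Lip (\<lambda>x. \<eta> x * (F n x - F j x)) x \<le> \<bar>\<eta> x\<bar> * (indicator \<Omega> x * D n j x) + pt_Lip \<eta> x * \<bar>indicator \<Omega> x * (F n x - F j x)\<bar>" for j x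
    proof (cases "x \<in> \<Omega>")
      case True
      obtain a b c where l: "lip_le (F n) x a" "lip_le (F j) x b" "lip_le \<eta> x c"
        using lip[OF True] Lip_fun_lip_le[OF Lip0_Lip_fun[OF \<eta>]] by metis
      from pt_Lip_mult[OF l(3) lip_le_diff[OF l(1,2)]] True show ?thesis by (simp add: D_def mult.commute)
    next
      case False
      have "x \<notin> closure {x. \<eta> x * (F n x - F j x) \<noteq> 0}"
        using Lip0_support[OF HL[of j]] False by (auto simp: compactly_inside_def)
      from pt_Lip_outside[OF this] show ?thesis using False by simp
    qed
    have "upper_grad (\<lambda>x. \<eta> x * (F n x - f x))
       (\<lambda>x. \<bar>\<eta> x\<bar> * (indicator \<Omega> x * g n x) + pt_Lip \<eta> x * \<bar>indicator \<Omega> x * (F n x - f x)\<bar>)"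
      by (rule upper_gradI[OF Lip0_Lip_fun[OF HL] H G]) (simp add: le)
    moreover have "AE x in \<mu>. x \<in> W \<longrightarrow> \<bar>\<eta> x\<bar> * (indicator \<Omega> x * g n x) + pt_Lip \<eta> x * \<bar>indicator \<Omega> x * (F n x - f x)\<bar> \<le> g n x"
      if W: "open W \<and> (\<forall>x\<in>W. \<eta> x = 1)" for W
    proof (rule AE_I2, rule impI)
      fix x assume x: "x \<in> W"
      then have "\<eta> x = 1" using W by blast
      then have "x \<in> \<Omega>" using Lip0_outside[OF \<eta>\<Omega>] by force
      have "pt_Lip \<eta> x = pt_Lip (\<lambda>x. 1) x"
        using W x lip_le_0[of 1 x] by (intro pt_Lip_local[of W x \<eta> "\<lambda>x. 1" 0]) auto
      then show "\<bar>\<eta> x\<bar> * (indicator \<Omega> x * g n x) + pt_Lip \<eta> x * \<bar>indicator \<Omega> x * (F n x - f x)\<bar> \<le> g n x"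
        using \<open>\<eta> x = 1\<close> \<open>x \<in> \<Omega>\<close> by simp
    qed
    ultimately show "\<exists>g'. upper_grad (\<lambda>x. \<eta> x * (F n x - f x)) g' \<and>
        (\<forall>W. open W \<and> (\<forall>x\<in>W. \<eta> x = 1) \<longrightarrow> (AE x in \<mu>. x \<in> W \<longrightarrow> g' x \<le> g n x))" by blast
  qed
  show ?thesis
    by (rule exI[of _ F], rule exI[of _ g]) (intro conjI allI impI F g2 small up)
qed

text \<open>
  Subadditivity, applied to \<open>\<phi> - \<psi>\<close> and to \<open>\<psi> - \<phi>\<close>.  This is how approximations in the Sobolev norm pass to the
  inner product with \<open>\<nabla>f\<close>.
\<close>

lemma grad_inner_close:
  assumes \<Omega>: "open \<Omega>" and V: "open V" "V \<subseteq> \<Omega>"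
    and h: "grad_inner_on \<mu> \<Omega> f \<phi> h" "grad_inner_on \<mu> \<Omega> f \<psi> k" and G0: "min_gradient_on \<mu> \<Omega> f G0"
    and g: "upper_grad_on V (\<lambda>x. \<phi> x - \<psi> x) g" "g \<in> Lp (restrict_space \<mu> V) 2"
  shows "AE x in \<mu>. x \<in> V \<longrightarrow> \<bar>h x - k x\<bar> \<le> G0 x * g x"
proof -
  have 1: "AE x in \<mu>. x \<in> V \<longrightarrow> h x \<le> (\<Sum>i\<in>{()}. k x) + G0 x * g x"
    by (rule grad_inner_subadditive[OF \<Omega> V _ h(1) _ G0 _ g(2), of "{()}" "\<lambda>i. \<psi>" "\<lambda>i. k"]) (use h(2) g(1) in auto)
  have "upper_grad_on V (\<lambda>x. \<psi> x - \<phi> x) g"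
    using upper_grad_on_cmult[OF g(1), of "-1"] by simp
  then have 2: "AE x in \<mu>. x \<in> V \<longrightarrow> k x \<le> (\<Sum>i\<in>{()}. h x) + G0 x * g x"
    by (intro grad_inner_subadditive[OF \<Omega> V _ h(2) _ G0 _ g(2), of "{()}" "\<lambda>i. \<phi>" "\<lambda>i. h"]) (use h(1) in auto)
  from 1 2 show ?thesis by eventually_elim auto
qed

end

section \<open>Transport plans\<close>

lemma borel_prod_metric:
  "sets (borel :: ('a::second_countable_topology \<times> 'b::second_countable_topology) measure) = sets (borel \<Otimes>\<^sub>M borel)"
  by (rule arg_cong[OF borel_prod[symmetric]])

lemma small_borel_partition:
  fixes \<eta> :: real
  assumes "\<eta> > 0"
  shows "\<exists>C :: nat \<Rightarrow> 'a::{metric_space, second_countable_topology} set.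
    (\<forall>i. C i \<in> sets borel) \<and> disjoint_family C \<and> (\<Union>i. C i) = UNIV \<and> (\<forall>i. \<forall>x\<in>C i. \<forall>y\<in>C i. dist x y < \<eta>)"
proof -
  obtain D :: "'a set" where D: "countable D" "\<And>X. open X \<Longrightarrow> X \<noteq> {} \<Longrightarrow> \<exists>d\<in>D. d \<in> X"
    using countable_dense_setE by blast
  have "D \<noteq> {}" using D(2)[OF open_UNIV] by auto
  define B where "B i = ball (from_nat_into D i) (\<eta> / 2)" for i
  have cover: "(\<Union>i. B i) = UNIV"
  proof (intro set_eqI iffI UNIV_I)
    fix x :: 'a
    obtain d where "d \<in> D" "d \<in> ball x (\<eta> / 2)" using D(2)[of "ball x (\<eta> / 2)"] assms by auto
    moreover obtain i where "from_nat_into D i = d" using from_nat_into_surj[OF D(1) \<open>d \<in> D\<close>] by blast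
    ultimately show "x \<in> (\<Union>i. B i)" by (auto simp: B_def dist_commute)
  qed
  have sub: "disjointed B i \<subseteq> B i" for i by (rule disjointed_subset)
  have "dist x y < \<eta>" if "x \<in> disjointed B i" "y \<in> disjointed B i" for x y i
    using subsetD[OF sub that(1)] subsetD[OF sub that(2)] dist_triangle_half_r[of "from_nat_into D i" x \<eta> y]
    unfolding B_def by simp
  moreover have "range (disjointed B) \<subseteq> sets borel"
    by (rule sets.range_disjointed_sets) (auto simp: B_def)
  ultimately show ?thesis
    using disjoint_family_disjointed[of B] UN_disjointed_eq[of B] cover by (intro exI[of _ "disjointed B"]) auto
qed

lemma couplingsD:
  assumes "q \<in> couplings \<alpha> \<beta>"
  shows "sets q = sets borel" "distr q borel fst = \<alpha>" "distr q borel snd = \<beta>"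
  using assms by (auto simp: couplings_def)

lemma coupling_prob_space:
  assumes "q \<in> couplings \<alpha> \<beta>" "prob_space \<alpha>"
  shows "prob_space q"
proof -
  have s: "sets q = sets borel" by (rule couplingsD(1)[OF assms(1)])
  have "fst \<in> measurable q borel"
    unfolding measurable_cong_sets[OF s refl] by (intro borel_measurable_continuous_onI continuous_intros)
  moreover have "prob_space (distr q borel fst)" using assms(2) couplingsD(2)[OF assms(1)] by simp
  ultimately show ?thesis by (rule prob_space_distrD)
qed

text \<open>
  Gluing two plans along a common marginal.  An exact gluing would need disintegration; cutting the
  common space into small cells and coupling independently within each cell is elementary and loses
  only the diameter of the cells.
\<close>

lemma approximate_gluing:
  fixes \<alpha> \<beta> \<gamma> :: "'a::{metric_space, second_countable_topology} measure"
  assumes q1: "q1 \<in> couplings \<alpha> \<beta>" and q2: "q2 \<in> couplings \<beta> \<gamma>" and prob: "prob_space \<alpha>" "prob_space \<beta>"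
    and \<eta>: "\<eta> > 0"
  shows "\<exists>\<Gamma>. sets \<Gamma> = sets (q1 \<Otimes>\<^sub>M q2) \<and> distr \<Gamma> q1 fst = q1 \<and> distr \<Gamma> q2 snd = q2 \<and>
    (AE \<omega> in \<Gamma>. dist (snd (fst \<omega>)) (fst (snd \<omega>)) < \<eta>)"
proof -
  interpret q1: prob_space q1 by (rule coupling_prob_space[OF q1 prob(1)])
  interpret q2: prob_space q2 by (rule coupling_prob_space[OF q2 prob(2)])
  interpret b: prob_space \<beta> by (rule prob(2))
  interpret P: pair_prob_space q1 q2 ..
  have s1[measurable_cong]: "sets q1 = sets borel" and s2[measurable_cong]: "sets q2 = sets borel"
    using couplingsD(1) q1 q2 by blast+
  have m1[measurable]: "snd \<in> measurable q1 borel" "fst \<in> measurable q2 borel"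
    unfolding measurable_cong_sets[OF s1 refl] measurable_cong_sets[OF s2 refl]
    by (intro borel_measurable_continuous_onI continuous_intros)+
  obtain C :: "nat \<Rightarrow> 'a set" where C: "\<And>i. C i \<in> sets borel" "disjoint_family C" "(\<Union>i. C i) = UNIV"
    "\<And>i x y. x \<in> C i \<Longrightarrow> y \<in> C i \<Longrightarrow> dist x y < \<eta>"
    using small_borel_partition[OF \<eta>] by blast
  have [measurable]: "C i \<in> sets borel" for i by (rule C(1))
  have b1: "emeasure q1 (snd -` A \<inter> space q1) = emeasure \<beta> A" if "A \<in> sets borel" for A
    using emeasure_distr[OF m1(1) that] couplingsD(3)[OF q1] by simp
  have b2: "emeasure q2 (fst -` A \<inter> space q2) = emeasure \<beta> A" if "A \<in> sets borel" for A
    using emeasure_distr[OF m1(2) that] couplingsD(2)[OF q2] by simp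
  \<comment> \<open>The density \<open>h\<close> of the gluing with respect to the product: condition both plans on the same cell.\<close>
  define c where "c i = ennreal (1 / measure \<beta> (C i))" for i
  have c: "c i * emeasure \<beta> (C i) = 1" if "emeasure \<beta> (C i) \<noteq> 0" for i
    using that unfolding c_def b.emeasure_eq_measure by (subst ennreal_mult'[symmetric]) auto
  define h where "h z w = (\<Sum>i. c i * indicator (C i) (fst w) * indicator (C i) (snd z))" for z w :: "'a \<times> 'a"
  have [measurable]: "(\<lambda>\<omega>. h (fst \<omega>) (snd \<omega>)) \<in> borel_measurable (q1 \<Otimes>\<^sub>M q2)" unfolding h_def by measurable
  have cell: "\<exists>i. x \<in> C i" for x using C(3) by blast
  have nullcells: "AE z in M. emeasure \<beta> (C i) = 0 \<longrightarrow> p z \<notin> C i"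
    if "\<And>A. A \<in> sets borel \<Longrightarrow> emeasure M (p -` A \<inter> space M) = emeasure \<beta> A" "p \<in> measurable M borel" for M :: "('a \<times> 'a) measure" and p i
  proof (cases "emeasure \<beta> (C i) = 0")
    case True
    then have "p -` C i \<inter> space M \<in> null_sets M" using that by (auto simp: null_sets_def)
    then show ?thesis by (rule AE_I') auto
  qed simp
  have h1: "AE z in q1. (\<integral>\<^sup>+w. h z w \<partial>q2) = 1"
  proof -
    have "AE z in q1. \<forall>i. emeasure \<beta> (C i) = 0 \<longrightarrow> snd z \<notin> C i"
      unfolding AE_all_countable using nullcells[OF b1 m1(1)] by blast
    then show ?thesis
    proof eventually_elim
      case (elim z)
      obtain i where i: "snd z \<in> C i" using cell by blast
      have "h z w = c i * indicator (C i) (fst w)" for w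
        unfolding h_def by (rule suminf_cmult_indicator[OF C(2) i])
      then have "(\<integral>\<^sup>+w. h z w \<partial>q2) = (\<integral>\<^sup>+w. c i * indicator (fst -` C i \<inter> space q2) w \<partial>q2)"
        by (intro nn_integral_cong) (auto simp: indicator_def)
      also have "\<dots> = c i * emeasure \<beta> (C i)" by (simp add: nn_integral_cmult_indicator b2)
      also have "\<dots> = 1" using elim i by (intro c) auto
      finally show ?case .
    qed
  qed
  have h2: "AE w in q2. (\<integral>\<^sup>+z. h z w \<partial>q1) = 1"
  proof -
    have "AE w in q2. \<forall>i. emeasure \<beta> (C i) = 0 \<longrightarrow> fst w \<notin> C i"
      unfolding AE_all_countable using nullcells[OF b2 m1(2)] by blast
    then show ?thesis
    proof eventually_elim
      case (elim w)
      obtain i where i: "fst w \<in> C i" using cell by blast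
      have "h z w = c i * indicator (C i) (snd z)" for z
      proof -
        have "h z w = (\<Sum>n. (c n * indicator (C n) (snd z)) * indicator (C n) (fst w))" unfolding h_def by (simp add: ac_simps)
        also have "\<dots> = c i * indicator (C i) (snd z)" by (rule suminf_cmult_indicator[OF C(2) i])
        finally show ?thesis .
      qed
      then have "(\<integral>\<^sup>+z. h z w \<partial>q1) = (\<integral>\<^sup>+z. c i * indicator (snd -` C i \<inter> space q1) z \<partial>q1)"
        by (intro nn_integral_cong) (auto simp: indicator_def)
      also have "\<dots> = c i * emeasure \<beta> (C i)" by (simp add: nn_integral_cmult_indicator b1)
      also have "\<dots> = 1" using elim i by (intro c) auto
      finally show ?case .
    qed
  qed
  define \<Gamma> where "\<Gamma> = density (q1 \<Otimes>\<^sub>M q2) (\<lambda>\<omega>. h (fst \<omega>) (snd \<omega>))"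
  have sG[measurable_cong]: "sets \<Gamma> = sets (q1 \<Otimes>\<^sub>M q2)" by (simp add: \<Gamma>_def)
  have d1: "distr \<Gamma> q1 fst = q1"
  proof (rule measure_eqI)
    fix A assume "A \<in> sets (distr \<Gamma> q1 fst)"
    then have [measurable]: "A \<in> sets q1" by simp
    have "emeasure (distr \<Gamma> q1 fst) A = emeasure \<Gamma> (fst -` A \<inter> space \<Gamma>)" by (intro emeasure_distr) measurable
    also have "\<dots> = (\<integral>\<^sup>+\<omega>. h (fst \<omega>) (snd \<omega>) * indicator (fst -` A \<inter> space \<Gamma>) \<omega> \<partial>(q1 \<Otimes>\<^sub>M q2))"
      unfolding \<Gamma>_def by (intro emeasure_density) measurable
    also have "\<dots> = (\<integral>\<^sup>+\<omega>. h (fst \<omega>) (snd \<omega>) * indicator A (fst \<omega>) \<partial>(q1 \<Otimes>\<^sub>M q2))"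
      by (intro nn_integral_cong) (auto simp: \<Gamma>_def indicator_def)
    also have "\<dots> = (\<integral>\<^sup>+z. \<integral>\<^sup>+w. h z w * indicator A z \<partial>q2 \<partial>q1)"
      by (subst q2.nn_integral_fst[symmetric]) auto
    also have "\<dots> = (\<integral>\<^sup>+z. indicator A z \<partial>q1)"
    proof (rule nn_integral_cong_AE, use h1 in eventually_elim)
      case (elim z)
      have "(\<integral>\<^sup>+w. h z w * indicator A z \<partial>q2) = (\<integral>\<^sup>+w. h z w \<partial>q2) * indicator A z"
        by (intro nn_integral_multc) (auto simp: h_def)
      then show ?case using elim by simp
    qed
    finally show "emeasure (distr \<Gamma> q1 fst) A = emeasure q1 A" by simp
  qed simp
  have d2: "distr \<Gamma> q2 snd = q2"
  proof (rule measure_eqI)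
    fix A assume "A \<in> sets (distr \<Gamma> q2 snd)"
    then have [measurable]: "A \<in> sets q2" by simp
    have "emeasure (distr \<Gamma> q2 snd) A = emeasure \<Gamma> (snd -` A \<inter> space \<Gamma>)" by (intro emeasure_distr) measurable
    also have "\<dots> = (\<integral>\<^sup>+\<omega>. h (fst \<omega>) (snd \<omega>) * indicator (snd -` A \<inter> space \<Gamma>) \<omega> \<partial>(q1 \<Otimes>\<^sub>M q2))"
      unfolding \<Gamma>_def by (intro emeasure_density) measurable
    also have "\<dots> = (\<integral>\<^sup>+\<omega>. h (fst \<omega>) (snd \<omega>) * indicator A (snd \<omega>) \<partial>(q1 \<Otimes>\<^sub>M q2))"
      by (intro nn_integral_cong) (auto simp: \<Gamma>_def indicator_def)
    also have "\<dots> = (\<integral>\<^sup>+w. \<integral>\<^sup>+z. h z w * indicator A w \<partial>q1 \<partial>q2)"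
      by (subst P.nn_integral_snd[symmetric]) auto
    also have "\<dots> = (\<integral>\<^sup>+w. indicator A w \<partial>q2)"
    proof (rule nn_integral_cong_AE, use h2 in eventually_elim)
      case (elim w)
      have "(\<integral>\<^sup>+z. h z w * indicator A w \<partial>q1) = (\<integral>\<^sup>+z. h z w \<partial>q1) * indicator A w"
        by (intro nn_integral_multc) (auto simp: h_def)
      then show ?case using elim by simp
    qed
    finally show "emeasure (distr \<Gamma> q2 snd) A = emeasure q2 A" by simp
  qed simp
  have "AE \<omega> in q1 \<Otimes>\<^sub>M q2. 0 < h (fst \<omega>) (snd \<omega>) \<longrightarrow> dist (snd (fst \<omega>)) (fst (snd \<omega>)) < \<eta>"
  proof (rule AE_I2, rule impI)
    fix \<omega> :: "('a \<times> 'a) \<times> ('a \<times> 'a)" assume "0 < h (fst \<omega>) (snd \<omega>)"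
    then have "h (fst \<omega>) (snd \<omega>) \<noteq> 0" by simp
    then have "\<exists>i. c i * indicator (C i) (fst (snd \<omega>)) * indicator (C i) (snd (fst \<omega>)) \<noteq> 0"
    proof (rule contrapos_np)
      assume "\<not> (\<exists>i. c i * indicator (C i) (fst (snd \<omega>)) * indicator (C i) (snd (fst \<omega>)) \<noteq> 0)"
      then have "(\<lambda>i. c i * indicator (C i) (fst (snd \<omega>)) * indicator (C i) (snd (fst \<omega>))) = (\<lambda>i. 0)" by blast
      then show "h (fst \<omega>) (snd \<omega>) = 0" by (simp only: h_def suminf_zero)
    qed
    then obtain i where "snd (fst \<omega>) \<in> C i" "fst (snd \<omega>) \<in> C i" by (auto simp: indicator_def split: if_splits)
    then show "dist (snd (fst \<omega>)) (fst (snd \<omega>)) < \<eta>" by (rule C(4))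
  qed
  then have "AE \<omega> in \<Gamma>. dist (snd (fst \<omega>)) (fst (snd \<omega>)) < \<eta>"
    unfolding \<Gamma>_def by (subst AE_density) auto
  with sG d1 d2 show ?thesis by blast
qed

lemma coupling_finite_cost_exists:
  fixes \<alpha> \<beta> :: "'a::{metric_space, second_countable_topology} measure"
  assumes "\<alpha> \<in> P2" "\<beta> \<in> P2"
  shows "\<exists>q\<in>couplings \<alpha> \<beta>. transport_cost q < \<infinity>"
proof -
  obtain a where a: "(\<integral>\<^sup>+x. ennreal ((dist x a)\<^sup>2) \<partial>\<alpha>) < \<infinity>" using assms(1) by (auto simp: P2_def)
  obtain b where b: "(\<integral>\<^sup>+x. ennreal ((dist x b)\<^sup>2) \<partial>\<beta>) < \<infinity>" using assms(2) by (auto simp: P2_def)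
  interpret a: prob_space \<alpha> using assms(1) by (auto simp: P2_def)
  interpret b: prob_space \<beta> using assms(2) by (auto simp: P2_def)
  have sa[measurable_cong]: "sets \<alpha> = sets borel" and sb[measurable_cong]: "sets \<beta> = sets borel"
    using assms by (auto simp: P2_def)
  interpret P: pair_prob_space \<alpha> \<beta> ..
  define q where "q = \<alpha> \<Otimes>\<^sub>M \<beta>"
  have sq: "sets q = sets borel"
    unfolding q_def borel_prod_metric by (rule sets_pair_measure_cong[OF sa sb])
  have "distr q borel fst = distr q \<alpha> fst" by (intro distr_cong refl) (simp add: sa)
  also have "\<dots> = \<alpha>" unfolding q_def using b.distr_pair_fst[of \<alpha>] by simp
  finally have f: "distr q borel fst = \<alpha>" .
  have s: "distr q borel snd = \<beta>"
  proof (rule measure_eqI)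
    fix A assume "A \<in> sets (distr q borel snd)"
    then have A: "A \<in> sets borel" "A \<in> sets \<beta>" by (auto simp: sb)
    have "emeasure (distr q borel snd) A = emeasure q (snd -` A \<inter> space q)"
      using A unfolding q_def by (intro emeasure_distr) auto
    also have "snd -` A \<inter> space q = space \<alpha> \<times> A" using sets.sets_into_space[OF A(2)] by (auto simp: q_def space_pair_measure)
    also have "emeasure q \<dots> = emeasure \<beta> A" unfolding q_def using A by (subst b.emeasure_pair_measure_Times) (auto simp: a.emeasure_space_1)
    finally show "emeasure (distr q borel snd) A = emeasure \<beta> A" .
  qed (simp add: sb)
  have [measurable]: "(\<lambda>x. dist x y) \<in> borel_measurable borel" "(\<lambda>x. dist y x) \<in> borel_measurable borel" for y :: 'a
    by (intro borel_measurable_continuous_onI continuous_intros)+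
  have [measurable]: "(\<lambda>z. dist (fst z) (snd z)) \<in> borel_measurable (\<alpha> \<Otimes>\<^sub>M \<beta>)" by measurable
  have three: "(r + s + t)\<^sup>2 \<le> 3 * (r\<^sup>2 + s\<^sup>2 + t\<^sup>2)" for r s t :: real
    using sum_squares_bound[of r s] sum_squares_bound[of r t] sum_squares_bound[of s t]
    by (simp add: power2_eq_square algebra_simps)
  have pt: "ennreal ((dist (fst z) (snd z))\<^sup>2) \<le> 3 * ennreal ((dist (fst z) a)\<^sup>2) + (ennreal (3 * (dist a b)\<^sup>2) + 3 * ennreal ((dist (snd z) b)\<^sup>2))" for z
  proof -
    have "dist (fst z) (snd z) \<le> dist (fst z) a + dist a b + dist (snd z) b"
      using dist_triangle[of "fst z" "snd z" a] dist_triangle[of a "snd z" b] by (simp add: dist_commute)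
    then have "(dist (fst z) (snd z))\<^sup>2 \<le> (dist (fst z) a + dist a b + dist (snd z) b)\<^sup>2" by (intro power_mono) auto
    also have "\<dots> \<le> 3 * (dist (fst z) a)\<^sup>2 + (3 * (dist a b)\<^sup>2 + 3 * (dist (snd z) b)\<^sup>2)" using three[of "dist (fst z) a" "dist a b" "dist (snd z) b"] by simp
    finally have "ennreal ((dist (fst z) (snd z))\<^sup>2) \<le> ennreal (3 * (dist (fst z) a)\<^sup>2 + (3 * (dist a b)\<^sup>2 + 3 * (dist (snd z) b)\<^sup>2))"
      by (rule ennreal_leI)
    then show ?thesis by (simp add: ennreal_plus ennreal_mult)
  qed
  have "transport_cost q \<le> (\<integral>\<^sup>+z. 3 * ennreal ((dist (fst z) a)\<^sup>2) + (ennreal (3 * (dist a b)\<^sup>2) + 3 * ennreal ((dist (snd z) b)\<^sup>2)) \<partial>(\<alpha> \<Otimes>\<^sub>M \<beta>))"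
    unfolding transport_cost_def q_def by (intro nn_integral_mono pt)
  also have "\<dots> = 3 * (\<integral>\<^sup>+z. ennreal ((dist (fst z) a)\<^sup>2) \<partial>(\<alpha> \<Otimes>\<^sub>M \<beta>)) + (ennreal (3 * (dist a b)\<^sup>2) + 3 * (\<integral>\<^sup>+z. ennreal ((dist (snd z) b)\<^sup>2) \<partial>(\<alpha> \<Otimes>\<^sub>M \<beta>)))"
    by (simp add: nn_integral_add nn_integral_cmult P.emeasure_space_1)
  also have "(\<integral>\<^sup>+z. ennreal ((dist (fst z) a)\<^sup>2) \<partial>(\<alpha> \<Otimes>\<^sub>M \<beta>)) = (\<integral>\<^sup>+x. ennreal ((dist x a)\<^sup>2) \<partial>\<alpha>)"
    by (subst b.nn_integral_fst[symmetric]) (auto simp: b.emeasure_space_1)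
  also have "(\<integral>\<^sup>+z. ennreal ((dist (snd z) b)\<^sup>2) \<partial>(\<alpha> \<Otimes>\<^sub>M \<beta>)) = (\<integral>\<^sup>+x. ennreal ((dist x b)\<^sup>2) \<partial>\<beta>)"
    by (subst P.nn_integral_snd[symmetric]) (auto simp: a.emeasure_space_1)
  also have "3 * (\<integral>\<^sup>+x. ennreal ((dist x a)\<^sup>2) \<partial>\<alpha>) + (ennreal (3 * (dist a b)\<^sup>2) + 3 * (\<integral>\<^sup>+x. ennreal ((dist x b)\<^sup>2) \<partial>\<beta>)) < \<infinity>"
    using a b by (auto simp: ennreal_mult_less_top)
  finally have "transport_cost q < \<infinity>" .
  moreover have "q \<in> couplings \<alpha> \<beta>" using sq f s by (simp add: couplings_def)
  ultimately show ?thesis by blast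
qed

text \<open>
  The product plan has finite cost, so \<open>enn2real\<close> in the definition of the distance loses nothing.
\<close>

lemma W2_square:
  fixes \<alpha> \<beta> :: "'a::{metric_space, second_countable_topology} measure"
  assumes "\<alpha> \<in> P2" "\<beta> \<in> P2"
  shows "(INF q\<in>couplings \<alpha> \<beta>. transport_cost q) = ennreal ((W2 \<alpha> \<beta>)\<^sup>2)"
proof -
  obtain q where q: "q \<in> couplings \<alpha> \<beta>" "transport_cost q < \<infinity>" using coupling_finite_cost_exists[OF assms] by blast
  have "(INF q\<in>couplings \<alpha> \<beta>. transport_cost q) < \<infinity>" by (rule le_less_trans[OF INF_lower[where f = transport_cost, OF q(1)] q(2)])
  then show ?thesis by (simp add: W2_def)
qed

text \<open>
  Glue nearly optimal plans from \<open>\<alpha>\<close> to \<open>\<beta>\<close> and from \<open>\<beta>\<close> to \<open>\<gamma>\<close>, and let \<open>a\<close>, \<open>b\<close>, \<open>c\<close> be the distances of the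
  midpoint to the two endpoints and of the endpoints.  Since \<open>\<beta>\<close> is a Wasserstein midpoint, the mean of
  \<open>2 a\<^sup>2 + 2 b\<^sup>2 - c\<^sup>2\<close> is at most zero up to the errors, and \<open>c \<le> a + b\<close> makes this at least the mean of
  \<open>(a - b)\<^sup>2\<close>.  As \<open>c \<le> R\<close>, a midpoint with \<open>a > R / 2 + \<delta>\<close> would contribute at least \<open>\<delta>\<^sup>2\<close>.
\<close>

lemma midpoint_concentration:
  fixes \<alpha> \<beta> \<gamma> :: "'a::{metric_space, second_countable_topology} measure"
  assumes P: "\<alpha> \<in> P2" "\<beta> \<in> P2" "\<gamma> \<in> P2"
    and W: "W2 \<alpha> \<beta> = W2 \<alpha> \<gamma> / 2" "W2 \<beta> \<gamma> = W2 \<alpha> \<gamma> / 2"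
    and A: "AE x in \<alpha>. x \<in> A" and C: "AE y in \<gamma>. y \<in> C" and R: "\<And>x y. x \<in> A \<Longrightarrow> y \<in> C \<Longrightarrow> dist x y \<le> R" "R \<ge> 0"
    and Ax: "\<And>y. y \<in> A \<Longrightarrow> dist y x0 \<le> \<epsilon>" and \<delta>: "\<delta> > 0"
  shows "AE z in \<beta>. dist z x0 \<le> R / 2 + \<epsilon> + \<delta>"
proof -
  define w where "w = (W2 \<alpha> \<gamma>)\<^sup>2"
  have w0: "w \<ge> 0" by (simp add: w_def)
  have prob: "prob_space \<alpha>" "prob_space \<beta>" using P by (auto simp: P2_def)
  interpret b: prob_space \<beta> by (rule prob(2))
  have sb[measurable_cong]: "sets \<beta> = sets borel" using P by (auto simp: P2_def)
  have [measurable]: "(\<lambda>x. dist x y) \<in> borel_measurable borel" for y :: 'a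
    by (intro borel_measurable_continuous_onI continuous_intros)
  define B where "B = {z. R / 2 + \<epsilon> + \<delta> < dist z x0}"
  have Bm[measurable]: "B \<in> sets borel" unfolding B_def by measurable
  have small: "ennreal (\<delta>\<^sup>2) * emeasure \<beta> B \<le> ennreal ((4 + 2 * R) * \<eta>)" if \<eta>: "\<eta> > 0" for \<eta>
  proof -
    have cost: "\<exists>q\<in>couplings \<mu> \<nu>. transport_cost q < ennreal (w / 4 + \<eta>)" if "\<mu> \<in> P2" "\<nu> \<in> P2" "W2 \<mu> \<nu> = W2 \<alpha> \<gamma> / 2" for \<mu> \<nu> :: "'a measure"
    proof -
      have "(INF q\<in>couplings \<mu> \<nu>. transport_cost q) = ennreal (w / 4)"
        using W2_square[OF that(1,2)] that(3) by (simp add: w_def power_divide)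
      also have "\<dots> < ennreal (w / 4 + \<eta>)" using \<eta> w0 by (simp add: ennreal_less_iff)
      finally show ?thesis by (simp add: INF_less_iff)
    qed
    obtain q1 where q1: "q1 \<in> couplings \<alpha> \<beta>" "transport_cost q1 < ennreal (w / 4 + \<eta>)" using cost[OF P(1,2) W(1)] by blast
    obtain q2 where q2: "q2 \<in> couplings \<beta> \<gamma>" "transport_cost q2 < ennreal (w / 4 + \<eta>)" using cost[OF P(2,3) W(2)] by blast
    obtain \<Gamma> where G: "sets \<Gamma> = sets (q1 \<Otimes>\<^sub>M q2)" "distr \<Gamma> q1 fst = q1" "distr \<Gamma> q2 snd = q2"
      "AE \<omega> in \<Gamma>. dist (snd (fst \<omega>)) (fst (snd \<omega>)) < \<eta>"
      using approximate_gluing[OF q1(1) q2(1) prob \<eta>] by blast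
    note s1[measurable_cong] = couplingsD(1)[OF q1(1)] and s2[measurable_cong] = couplingsD(1)[OF q2(1)]
    have sG[measurable_cong]: "sets \<Gamma> = sets (q1 \<Otimes>\<^sub>M q2)" by (rule G(1))
    have mf[measurable]: "fst \<in> measurable \<Gamma> q1" "snd \<in> measurable \<Gamma> q2" by measurable
    have [measurable]: "fst \<in> measurable q1 borel" "snd \<in> measurable q1 borel" "fst \<in> measurable q2 borel" "snd \<in> measurable q2 borel"
      unfolding measurable_cong_sets[OF s1 refl] measurable_cong_sets[OF s2 refl]
      by (intro borel_measurable_continuous_onI continuous_intros)+
    have dm[measurable]: "(\<lambda>z. dist (fst z) (snd z)) \<in> borel_measurable q1" "(\<lambda>z. dist (fst z) (snd z)) \<in> borel_measurable q2"
      by measurable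
    define a b c where "a \<omega> = dist (fst (fst \<omega>)) (snd (fst \<omega>))" and "b \<omega> = dist (fst (snd \<omega>)) (snd (snd \<omega>))"
      and "c \<omega> = dist (fst (fst \<omega>)) (snd (snd \<omega>))" for \<omega> :: "('a \<times> 'a) \<times> ('a \<times> 'a)"
    have [measurable]: "a \<in> borel_measurable \<Gamma>" "b \<in> borel_measurable \<Gamma>" "c \<in> borel_measurable \<Gamma>"
      unfolding a_def b_def c_def by measurable
    have Ia: "(\<integral>\<^sup>+\<omega>. ennreal ((a \<omega>)\<^sup>2) \<partial>\<Gamma>) = transport_cost q1"
    proof -
      have "transport_cost q1 = (\<integral>\<^sup>+z. ennreal ((dist (fst z) (snd z))\<^sup>2) \<partial>distr \<Gamma> q1 fst)"
        unfolding G(2) transport_cost_def ..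
      also have "\<dots> = (\<integral>\<^sup>+\<omega>. ennreal ((a \<omega>)\<^sup>2) \<partial>\<Gamma>)"
        unfolding a_def by (rule nn_integral_distr) measurable
      finally show ?thesis by (rule sym)
    qed
    have Ib: "(\<integral>\<^sup>+\<omega>. ennreal ((b \<omega>)\<^sup>2) \<partial>\<Gamma>) = transport_cost q2"
    proof -
      have "transport_cost q2 = (\<integral>\<^sup>+z. ennreal ((dist (fst z) (snd z))\<^sup>2) \<partial>distr \<Gamma> q2 snd)"
        unfolding G(3) transport_cost_def ..
      also have "\<dots> = (\<integral>\<^sup>+\<omega>. ennreal ((b \<omega>)\<^sup>2) \<partial>\<Gamma>)"
        unfolding b_def by (rule nn_integral_distr) measurable
      finally show ?thesis by (rule sym)
    qed
    define p where "p \<omega> = (fst (fst \<omega>), snd (snd \<omega>))" for \<omega> :: "('a \<times> 'a) \<times> ('a \<times> 'a)"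
    have pm: "p \<in> measurable \<Gamma> borel" unfolding p_def borel_prod[symmetric] by measurable
    define q where "q = distr \<Gamma> borel p"
    have m2: "fst \<in> measurable borel borel" "snd \<in> measurable borel borel"
      by (intro borel_measurable_continuous_onI continuous_intros)+
    have qc: "q \<in> couplings \<alpha> \<gamma>"
    proof -
      have "distr q borel fst = distr \<Gamma> borel (\<lambda>\<omega>. fst (fst \<omega>))"
        unfolding q_def by (subst distr_distr[OF m2(1) pm]) (simp add: p_def o_def)
      also have "\<dots> = distr (distr \<Gamma> q1 fst) borel fst" by (subst distr_distr) (auto simp: o_def)
      also have "\<dots> = \<alpha>" unfolding G(2) by (rule couplingsD(2)[OF q1(1)])
      finally have 1: "distr q borel fst = \<alpha>" .
      have "distr q borel snd = distr \<Gamma> borel (\<lambda>\<omega>. snd (snd \<omega>))"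
        unfolding q_def by (subst distr_distr[OF m2(2) pm]) (simp add: p_def o_def)
      also have "\<dots> = distr (distr \<Gamma> q2 snd) borel snd" by (subst distr_distr) (auto simp: o_def)
      also have "\<dots> = \<gamma>" unfolding G(3) by (rule couplingsD(3)[OF q2(1)])
      finally show ?thesis using 1 by (simp add: couplings_def q_def)
    qed
    have Ic: "ennreal w \<le> (\<integral>\<^sup>+\<omega>. ennreal ((c \<omega>)\<^sup>2) \<partial>\<Gamma>)"
    proof -
      have "ennreal w \<le> transport_cost q" unfolding w_def W2_square[OF P(1,3), symmetric] by (rule INF_lower[OF qc])
      also have "\<dots> = (\<integral>\<^sup>+\<omega>. ennreal ((c \<omega>)\<^sup>2) \<partial>\<Gamma>)"
      proof -
        have "(\<lambda>z :: 'a \<times> 'a. ennreal ((dist (fst z) (snd z))\<^sup>2)) \<in> borel_measurable borel"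
          by (intro measurable_compose[OF _ measurable_ennreal] borel_measurable_continuous_onI continuous_intros)
        then show ?thesis unfolding transport_cost_def q_def by (subst nn_integral_distr[OF pm]) (auto simp: p_def c_def)
      qed
      finally show ?thesis .
    qed
    have pullA: "AE \<omega> in \<Gamma>. fst (fst \<omega>) \<in> A"
    proof -
      have "AE x in distr q1 borel fst. x \<in> A" using A by (simp only: couplingsD(2)[OF q1(1)])
      from AE_distrD[OF _ this] have "AE z in q1. fst z \<in> A" by simp
      then have "AE z in distr \<Gamma> q1 fst. fst z \<in> A" by (simp only: G(2))
      from AE_distrD[OF mf(1) this] show ?thesis .
    qed
    have pullC: "AE \<omega> in \<Gamma>. snd (snd \<omega>) \<in> C"
    proof -
      have "AE x in distr q2 borel snd. x \<in> C" using C by (simp only: couplingsD(3)[OF q2(1)])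
      from AE_distrD[OF _ this] have "AE z in q2. snd z \<in> C" by simp
      then have "AE z in distr \<Gamma> q2 snd. snd z \<in> C" by (simp only: G(3))
      from AE_distrD[OF mf(2) this] show ?thesis .
    qed
    define E where "E = {\<omega> \<in> space \<Gamma>. R / 2 + \<delta> < a \<omega>}"
    have Em[measurable]: "E \<in> sets \<Gamma>" unfolding E_def by measurable
    have "ennreal w + ennreal (\<delta>\<^sup>2) * emeasure \<Gamma> E \<le> (\<integral>\<^sup>+\<omega>. ennreal ((c \<omega>)\<^sup>2) + ennreal (\<delta>\<^sup>2) * indicator E \<omega> \<partial>\<Gamma>)"
      using Ic by (subst nn_integral_add) (auto simp: nn_integral_cmult_indicator intro: add_right_mono)
    also have "\<dots> \<le> (\<integral>\<^sup>+\<omega>. 2 * ennreal ((a \<omega>)\<^sup>2) + (2 * ennreal ((b \<omega>)\<^sup>2) + ennreal (2 * R * \<eta>)) \<partial>\<Gamma>)"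
    proof (rule nn_integral_mono_AE, use G(4) pullA pullC in eventually_elim)
      case (elim \<omega>)
      have c: "c \<omega> \<le> R" using R(1) elim by (simp add: c_def)
      have tri: "c \<omega> \<le> a \<omega> + b \<omega> + \<eta>"
        using dist_triangle[of "fst (fst \<omega>)" "snd (snd \<omega>)" "snd (fst \<omega>)"] dist_triangle[of "snd (fst \<omega>)" "snd (snd \<omega>)" "fst (snd \<omega>)"] elim(1)
        by (simp add: a_def b_def c_def)
      have nn: "a \<omega> \<ge> 0" "b \<omega> \<ge> 0" "c \<omega> \<ge> 0" by (simp_all add: a_def b_def c_def)
      have sq: "2 * (a \<omega>)\<^sup>2 + 2 * (b \<omega>)\<^sup>2 = (a \<omega> + b \<omega>)\<^sup>2 + (a \<omega> - b \<omega>)\<^sup>2" by (simp add: power2_sum power2_diff)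
      have low: "(c \<omega>)\<^sup>2 \<le> (a \<omega> + b \<omega>)\<^sup>2 + 2 * R * \<eta>"
      proof (cases "c \<omega> \<le> \<eta>")
        case True
        then have "(c \<omega>)\<^sup>2 \<le> R * \<eta>" using c nn unfolding power2_eq_square by (intro mult_mono) auto
        also have "\<dots> \<le> 2 * R * \<eta>" using R(2) \<eta> by simp
        finally show ?thesis by (simp add: add_increasing)
      next
        case False
        then have "(c \<omega> - \<eta>)\<^sup>2 \<le> (a \<omega> + b \<omega>)\<^sup>2" using tri by (intro power_mono) auto
        moreover have "(c \<omega> - \<eta>)\<^sup>2 = (c \<omega>)\<^sup>2 - 2 * (c \<omega> * \<eta>) + \<eta>\<^sup>2" by (simp add: power2_diff)
        moreover have "c \<omega> * \<eta> \<le> R * \<eta>" using c \<eta> by (intro mult_right_mono) auto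
        moreover have "0 \<le> \<eta>\<^sup>2" by simp
        ultimately show ?thesis by linarith
      qed
      have "(c \<omega>)\<^sup>2 + \<delta>\<^sup>2 * indicator E \<omega> \<le> 2 * (a \<omega>)\<^sup>2 + (2 * (b \<omega>)\<^sup>2 + 2 * R * \<eta>)"
      proof (cases "\<omega> \<in> E")
        case True
        then have aE: "R / 2 + \<delta> < a \<omega>" by (simp add: E_def)
        show ?thesis
        proof (cases "R / 2 \<le> b \<omega>")
          case True
          then have "(R + \<delta>)\<^sup>2 \<le> (a \<omega> + b \<omega>)\<^sup>2" using aE R(2) \<delta> by (intro power_mono) auto
          moreover have "(R + \<delta>)\<^sup>2 = R\<^sup>2 + \<delta>\<^sup>2 + 2 * R * \<delta>" by (simp add: power2_sum)
          moreover have "(c \<omega>)\<^sup>2 \<le> R\<^sup>2" using c nn by (intro power_mono) auto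
          moreover have "0 \<le> 2 * R * \<delta>" "0 \<le> 2 * R * \<eta>" "0 \<le> (a \<omega> - b \<omega>)\<^sup>2" using R(2) \<delta> \<eta> by auto
          ultimately have "(c \<omega>)\<^sup>2 + \<delta>\<^sup>2 \<le> 2 * (a \<omega>)\<^sup>2 + (2 * (b \<omega>)\<^sup>2 + 2 * R * \<eta>)" using sq by linarith
          then show ?thesis using \<open>\<omega> \<in> E\<close> by simp
        next
          case False
          then have "\<delta>\<^sup>2 \<le> (a \<omega> - b \<omega>)\<^sup>2" using aE \<delta> by (intro power_mono) auto
          then show ?thesis using low sq \<open>\<omega> \<in> E\<close> by simp
        qed
      next
        case False
        have "0 \<le> (a \<omega> - b \<omega>)\<^sup>2" by simp
        then have "(c \<omega>)\<^sup>2 \<le> 2 * (a \<omega>)\<^sup>2 + (2 * (b \<omega>)\<^sup>2 + 2 * R * \<eta>)" using low sq by linarith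
        then show ?thesis using False by simp
      qed
      then have "ennreal ((c \<omega>)\<^sup>2 + \<delta>\<^sup>2 * indicator E \<omega>) \<le> ennreal (2 * (a \<omega>)\<^sup>2 + (2 * (b \<omega>)\<^sup>2 + 2 * R * \<eta>))" by (rule ennreal_leI)
      moreover have "ennreal ((c \<omega>)\<^sup>2 + \<delta>\<^sup>2 * indicator E \<omega>) = ennreal ((c \<omega>)\<^sup>2) + ennreal (\<delta>\<^sup>2) * indicator E \<omega>"
        by (cases "\<omega> \<in> E") (simp_all add: ennreal_plus)
      moreover have "ennreal (2 * (a \<omega>)\<^sup>2 + (2 * (b \<omega>)\<^sup>2 + 2 * R * \<eta>)) = 2 * ennreal ((a \<omega>)\<^sup>2) + (2 * ennreal ((b \<omega>)\<^sup>2) + ennreal (2 * R * \<eta>))"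
        using R(2) \<eta> by (simp add: ennreal_plus ennreal_mult)
      ultimately show ?case by simp
    qed
    also have "\<dots> = 2 * transport_cost q1 + (2 * transport_cost q2 + ennreal (2 * R * \<eta>) * emeasure \<Gamma> (space \<Gamma>))"
      by (simp add: nn_integral_add nn_integral_cmult Ia Ib)
    also have "emeasure \<Gamma> (space \<Gamma>) = 1"
    proof -
      have "emeasure \<Gamma> (space \<Gamma>) = emeasure (distr \<Gamma> q1 fst) (space q1)"
        using measurable_space[OF mf(1)] by (subst emeasure_distr[OF mf(1)]) (auto intro!: arg_cong[where f = "emeasure \<Gamma>"])
      also have "\<dots> = 1" unfolding G(2) using coupling_prob_space[OF q1(1) prob(1)] by (rule prob_space.emeasure_space_1)
      finally show ?thesis .
    qed
    also have "2 * transport_cost q1 + (2 * transport_cost q2 + ennreal (2 * R * \<eta>) * 1)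
        \<le> 2 * ennreal (w / 4 + \<eta>) + (2 * ennreal (w / 4 + \<eta>) + ennreal (2 * R * \<eta>) * 1)"
      using q1(2) q2(2) by (intro add_mono mult_left_mono order_refl) auto
    also have "\<dots> = ennreal w + ennreal ((4 + 2 * R) * \<eta>)"
    proof -
      have two: "2 * ennreal (w / 4 + \<eta>) = ennreal (2 * (w / 4 + \<eta>))"
        using ennreal_mult'[of 2 "w / 4 + \<eta>"] by (simp only: ennreal_numeral)
      have "2 * ennreal (w / 4 + \<eta>) + (2 * ennreal (w / 4 + \<eta>) + ennreal (2 * R * \<eta>) * 1)
        = ennreal (2 * (w / 4 + \<eta>)) + ennreal (2 * (w / 4 + \<eta>) + 2 * R * \<eta>)"
        unfolding two mult_1_right using w0 R(2) \<eta> by (intro arg_cong2[where f = "(+)"] refl ennreal_plus[symmetric]) auto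
      also have "\<dots> = ennreal (2 * (w / 4 + \<eta>) + (2 * (w / 4 + \<eta>) + 2 * R * \<eta>))"
        using w0 R(2) \<eta> by (intro ennreal_plus[symmetric]) auto
      also have "2 * (w / 4 + \<eta>) + (2 * (w / 4 + \<eta>) + 2 * R * \<eta>) = w + (4 + 2 * R) * \<eta>" by (simp add: algebra_simps)
      also have "ennreal (w + (4 + 2 * R) * \<eta>) = ennreal w + ennreal ((4 + 2 * R) * \<eta>)"
        using w0 R(2) \<eta> by (intro ennreal_plus) auto
      finally show ?thesis .
    qed
    finally have "ennreal (\<delta>\<^sup>2) * emeasure \<Gamma> E \<le> ennreal ((4 + 2 * R) * \<eta>)"
      by (subst (asm) ennreal_add_left_cancel_le) auto
    moreover have "emeasure \<beta> B \<le> emeasure \<Gamma> E"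
    proof -
      have "emeasure \<beta> B = emeasure q1 (snd -` B \<inter> space q1)"
        by (subst couplingsD(3)[OF q1(1), symmetric], subst emeasure_distr) auto
      also have "\<dots> = emeasure \<Gamma> (fst -` (snd -` B \<inter> space q1) \<inter> space \<Gamma>)"
        by (subst G(2)[symmetric], subst emeasure_distr) auto
      also have "\<dots> \<le> emeasure \<Gamma> E"
      proof (rule emeasure_mono_AE)
        show "AE \<omega> in \<Gamma>. \<omega> \<in> fst -` (snd -` B \<inter> space q1) \<inter> space \<Gamma> \<longrightarrow> \<omega> \<in> E"
          using pullA
        proof eventually_elim
          case (elim \<omega>)
          have "dist (snd (fst \<omega>)) x0 \<le> a \<omega> + \<epsilon>"
            using dist_triangle[of "snd (fst \<omega>)" x0 "fst (fst \<omega>)"] Ax[OF elim] by (simp add: a_def dist_commute)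
          then show ?case by (auto simp: B_def E_def)
        qed
      qed measurable
      finally show ?thesis .
    qed
    ultimately show ?thesis by (meson mult_left_mono order_trans zero_le)
  qed
  have "ennreal (\<delta>\<^sup>2) * emeasure \<beta> B \<le> 0"
  proof (rule ennreal_le_epsilon)
    fix e :: real assume e: "e > 0"
    have "ennreal (\<delta>\<^sup>2) * emeasure \<beta> B \<le> ennreal ((4 + 2 * R) * (e / (4 + 2 * R)))" using e R(2) by (intro small) auto
    also have "(4 + 2 * R) * (e / (4 + 2 * R)) = e" using R(2) by simp
    finally show "ennreal (\<delta>\<^sup>2) * emeasure \<beta> B \<le> 0 + ennreal e" by simp
  qed
  then have "emeasure \<beta> B = 0" using \<delta> by auto
  then have "B \<in> null_sets \<beta>" by (simp add: null_sets_def)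
  then show ?thesis by (rule AE_I') (auto simp: B_def not_le)
qed

section \<open>Doubling from the curvature-dimension condition\<close>

text \<open>
  The double angle formulas give \<open>sin a \<le> 2 sin (a/2)\<close> and \<open>sinh a \<le> 4 sinh (a/2)\<close> for \<open>0 < a \<le> 1\<close>.  On small
  balls every coefficient is therefore bounded below by a constant, whatever the sign of the curvature.
\<close>

lemma sigma_coeff_half_ge:
  assumes "\<theta> \<ge> 0" "\<bar>k\<bar> * \<theta>\<^sup>2 \<le> 1"
  shows "ennreal (1/4) \<le> sigma_coeff k (1/2) \<theta>"
proof -
  have k1: "k * \<theta>\<^sup>2 \<le> 1" "- k * \<theta>\<^sup>2 \<le> 1"
    using assms(2) mult_right_mono[OF abs_ge_self[of k], of "\<theta>\<^sup>2"] mult_right_mono[OF abs_ge_minus_self[of k], of "\<theta>\<^sup>2"] by auto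
  have "1 < pi\<^sup>2" using pi_gt3 by (simp add: one_less_power)
  then have nb: "\<not> k * \<theta>\<^sup>2 \<ge> pi\<^sup>2" using k1 by linarith
  consider "k * \<theta>\<^sup>2 = 0" | "k * \<theta>\<^sup>2 > 0" | "k * \<theta>\<^sup>2 < 0" by linarith
  then show ?thesis
  proof cases
    case 1
    then have "sigma_coeff k (1/2) \<theta> = ennreal (1/2)"
      using nb unfolding sigma_coeff_def by (simp only: if_False if_True simp_thms)
    then show ?thesis by (simp only:) (rule ennreal_leI, simp)
  next
    case 2
    then have k: "k > 0" "\<theta> > 0" using assms(1) by (auto simp: zero_less_mult_iff)
    define a where "a = sqrt k * \<theta>"
    have a: "a > 0" using k by (simp add: a_def)
    have "a\<^sup>2 \<le> 1\<^sup>2" using k1 k by (simp add: a_def power_mult_distrib)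
    then have a1: "a \<le> 1" by (rule power2_le_imp_le) simp
    have s0: "sin a > 0" using a a1 pi_gt3 by (intro sin_gt_zero) auto
    have "sin a = 2 * sin (a/2) * cos (a/2)" using sin_double[of "a/2"] by simp
    also have "\<dots> \<le> 2 * sin (a/2) * 1"
      using a a1 pi_gt3 by (intro mult_left_mono) (auto intro!: sin_ge_zero)
    finally have "1/4 \<le> sin (a/2) / sin a" using s0 by (simp add: field_simps)
    moreover have "sigma_coeff k (1/2) \<theta> = ennreal (sin (a/2) / sin a)"
      using nb 2 k by (simp add: sigma_coeff_def a_def)
    ultimately show ?thesis by (simp only: ennreal_leI)
  next
    case 3
    then have k: "k < 0" "\<theta> > 0" using assms(1) by (auto simp: mult_less_0_iff)
    define a where "a = sqrt (- k) * \<theta>"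
    have a: "a > 0" using k by (simp add: a_def)
    have "a\<^sup>2 \<le> 1\<^sup>2" using k1 k by (simp add: a_def power_mult_distrib)
    then have a1: "a \<le> 1" by (rule power2_le_imp_le) simp
    have s0: "sinh a > 0" "sinh (a/2) > 0" using a by auto
    have "cosh (a/2) \<le> 2"
    proof -
      have "exp (- (a/2)) \<le> exp (a/2)" using a by simp
      then have "cosh (a/2) \<le> exp (a/2)" by (simp add: cosh_def)
      also have "\<dots> \<le> exp (1/2)" using a1 by simp
      also have "\<dots> \<le> 2" by (rule exp_half_le2)
      finally show ?thesis .
    qed
    have "sinh a = 2 * sinh (a/2) * cosh (a/2)" using sinh_double[of "a/2"] by simp
    also have "\<dots> \<le> 2 * sinh (a/2) * 2" using \<open>cosh (a/2) \<le> 2\<close> s0 by (intro mult_left_mono) auto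
    finally have "1/4 \<le> sinh (a/2) / sinh a" using s0 by (simp add: field_simps)
    moreover have "sigma_coeff k (1/2) \<theta> = ennreal (sinh (a/2) / sinh a)"
      using nb 3 k by (simp add: sigma_coeff_def a_def)
    ultimately show ?thesis by (simp only: ennreal_leI)
  qed
qed

context mm_space
begin

lemma measure_ball_pos: "r > 0 \<Longrightarrow> 0 < measure \<mu> (ball x r)"
  using emeasure_open_pos[of "ball x r" x] emeasure_bounded_finite[of "ball x r"]
  by (auto simp: measure_def enn2real_positive_iff)

lemma emeasure_bounded_eq: "bounded A \<Longrightarrow> emeasure \<mu> A = ennreal (measure \<mu> A)"
  using emeasure_bounded_finite[of A] by (simp add: emeasure_eq_ennreal_measure less_top)

lemma uniform_density_P_infty:
  fixes x :: 'a and s :: real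
  assumes s: "s > 0"
  defines "\<rho> \<equiv> (\<lambda>y. indicator (ball x s) y / measure \<mu> (ball x s))"
  shows "nonneg_density \<mu> \<rho>" "density \<mu> (ennreal \<circ> \<rho>) \<in> P_infty \<mu>" "AE y in density \<mu> (ennreal \<circ> \<rho>). y \<in> ball x s"
proof -
  define m where "m = measure \<mu> (ball x s)"
  have m: "m > 0" unfolding m_def by (rule measure_ball_pos[OF s])
  have \<rho>: "\<rho> = (\<lambda>y. indicator (ball x s) y / m)" by (simp add: \<rho>_def m_def)
  have \<rho>m[measurable]: "\<rho> \<in> borel_measurable \<mu>"
    unfolding \<rho> by (intro borel_measurable_divide borel_measurable_indicator borel_measurable_const) simp
  show "nonneg_density \<mu> \<rho>" using m \<rho>m unfolding nonneg_density_def by (simp add: \<rho>)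
  let ?\<nu> = "density \<mu> (ennreal \<circ> \<rho>)"
  have [measurable]: "ennreal \<circ> \<rho> \<in> borel_measurable \<mu>" unfolding o_def by measurable
  have e: "(ennreal \<circ> \<rho>) y = ennreal (1 / m) * indicator (ball x s) y" for y
    by (auto simp: \<rho> indicator_def)
  have tot: "(\<integral>\<^sup>+y. (ennreal \<circ> \<rho>) y \<partial>\<mu>) = 1"
  proof -
    have "(\<integral>\<^sup>+y. (ennreal \<circ> \<rho>) y \<partial>\<mu>) = ennreal (1 / m) * emeasure \<mu> (ball x s)"
      unfolding e by (rule nn_integral_cmult_indicator) simp
    also have "\<dots> = ennreal (1 / m * m)"
      unfolding emeasure_bounded_eq[OF bounded_ball] m_def[symmetric]
      using m by (intro ennreal_mult[symmetric]) auto
    finally show ?thesis using m by simp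
  qed
  show AE: "AE y in ?\<nu>. y \<in> ball x s"
    by (subst AE_density) (auto simp: \<rho> indicator_def)
  have prob: "prob_space ?\<nu>"
    by (rule prob_spaceI) (simp add: emeasure_density tot[unfolded o_def])
  have "(\<integral>\<^sup>+y. ennreal ((dist y x)\<^sup>2) \<partial>?\<nu>) \<le> (\<integral>\<^sup>+y. ennreal (s\<^sup>2) \<partial>?\<nu>)"
  proof (rule nn_integral_mono_AE, use AE in eventually_elim)
    case (elim y)
    then show ?case by (intro ennreal_leI power_mono) (auto simp: dist_commute)
  qed
  also have "\<dots> = ennreal (s\<^sup>2)" using prob_space.emeasure_space_1[OF prob] by simp
  finally have mom: "(\<integral>\<^sup>+y. ennreal ((dist y x)\<^sup>2) \<partial>?\<nu>) < \<infinity>" by (rule le_less_trans) simp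
  have "msupport ?\<nu> \<subseteq> cball x s"
  proof
    fix y assume y: "y \<in> msupport ?\<nu>"
    show "y \<in> cball x s"
    proof (rule ccontr)
      assume "y \<notin> cball x s"
      then have "emeasure ?\<nu> (- cball x s) > 0" using y unfolding msupport_def by (auto simp: open_Compl)
      moreover have "- cball x s \<in> null_sets ?\<nu>"
      proof -
        have "AE y in ?\<nu>. y \<notin> - cball x s" using AE by eventually_elim auto
        then show ?thesis by (subst (asm) AE_iff_null_sets[symmetric]) (auto simp: open_Compl)
      qed
      ultimately show False by (auto simp: null_sets_def)
    qed
  qed
  then have "bounded (msupport ?\<nu>)" using bounded_cball bounded_subset by blast
  moreover have "absolutely_continuous \<mu> ?\<nu>" by (rule absolutely_continuousI_density) measurable
  ultimately show "?\<nu> \<in> P_infty \<mu>" using prob mom by (auto simp: P_infty_def P2_def)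
qed

text \<open>
  The curvature-dimension inequality at the midpoint between the uniform distributions on a small
  ball and on \<open>ball x r\<close>.  The midpoint measure lives on a strictly smaller ball, and by concavity
  its entropy is largest when it is uniform there.
\<close>

lemma ball_shrink:
  assumes CD: "CD_star K N \<mu>" and N: "N \<ge> 1" and r: "r > 0" and rK: "\<bar>K / N\<bar> * (2 * r)\<^sup>2 \<le> 1"
  shows "measure \<mu> (ball x r) \<le> (4 powr N) * measure \<mu> (ball x (3/4 * r))"
proof -
  define \<epsilon> where "\<epsilon> = r / 16"
  have \<epsilon>: "\<epsilon> > 0" using r by (simp add: \<epsilon>_def)
  define mB where "mB = measure \<mu> (ball x r)"
  define M where "M = measure \<mu> (ball x (3/4 * r))"
  have mB: "mB > 0" unfolding mB_def by (rule measure_ball_pos[OF r])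
  have M: "M > 0" unfolding M_def by (rule measure_ball_pos) (use r in simp)
  define \<rho>0 \<rho>1 where "\<rho>0 y = indicator (ball x \<epsilon>) y / measure \<mu> (ball x \<epsilon>)" and "\<rho>1 y = indicator (ball x r) y / measure \<mu> (ball x r)" for y
  have \<rho>0: "nonneg_density \<mu> \<rho>0" "density \<mu> (ennreal \<circ> \<rho>0) \<in> P_infty \<mu>" "AE y in density \<mu> (ennreal \<circ> \<rho>0). y \<in> ball x \<epsilon>"
    unfolding \<rho>0_def[abs_def] by (rule uniform_density_P_infty[OF \<epsilon>])+
  have \<rho>1: "nonneg_density \<mu> \<rho>1" "density \<mu> (ennreal \<circ> \<rho>1) \<in> P_infty \<mu>" "AE y in density \<mu> (ennreal \<circ> \<rho>1). y \<in> ball x r"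
    unfolding \<rho>1_def[abs_def] by (rule uniform_density_P_infty[OF r])+
  define \<alpha> \<gamma> where "\<alpha> = density \<mu> (ennreal \<circ> \<rho>0)" and "\<gamma> = density \<mu> (ennreal \<circ> \<rho>1)"
  obtain q \<rho> where q: "optimal_coupling \<alpha> \<gamma> q"
    and \<rho>: "\<forall>t\<in>{0..1}. nonneg_density \<mu> (\<rho> t) \<and> density \<mu> (ennreal \<circ> \<rho> t) \<in> P_infty \<mu>"
    and geo: "wasserstein_geodesic (\<lambda>t. density \<mu> (ennreal \<circ> \<rho> t))"
    and ends: "density \<mu> (ennreal \<circ> \<rho> 0) = \<alpha>" "density \<mu> (ennreal \<circ> \<rho> 1) = \<gamma>"
    and ineq: "\<forall>t\<in>{0..1}. \<forall>N'\<ge>N. (\<integral>\<^sup>+x. ennreal (\<rho> t x powr (- 1 / N')) \<partial>density \<mu> (ennreal \<circ> \<rho> t)) \<ge>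
             (\<integral>\<^sup>+z. sigma_coeff (K / N') (1 - t) (dist (fst z) (snd z)) * ennreal (\<rho>0 (fst z) powr (- 1 / N'))
                  + sigma_coeff (K / N') t (dist (fst z) (snd z)) * ennreal (\<rho>1 (snd z) powr (- 1 / N')) \<partial>q)"
    using CD[unfolded CD_star_def, rule_format, OF conjI[OF \<rho>0(1) conjI[OF \<rho>1(1) conjI[OF \<rho>0(2) \<rho>1(2)]]]]
    unfolding \<alpha>_def[symmetric] \<gamma>_def[symmetric] by (elim exE conjE) (rule that)
  define b where "b = \<rho> (1/2)"
  define \<beta> where "\<beta> = density \<mu> (ennreal \<circ> b)"
  have b: "b \<in> borel_measurable \<mu>" "\<And>y. 0 \<le> b y" "\<beta> \<in> P_infty \<mu>"
    using \<rho>[rule_format, of "1/2"] by (auto simp: b_def \<beta>_def nonneg_density_def)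
  note [measurable] = b(1)
  have bm: "ennreal \<circ> b \<in> borel_measurable \<mu>" unfolding o_def by measurable
  have P: "\<alpha> \<in> P2" "\<beta> \<in> P2" "\<gamma> \<in> P2" using \<rho>0(2) \<rho>1(2) b(3) by (auto simp: \<alpha>_def \<gamma>_def P_infty_def)
  have W: "W2 \<alpha> \<beta> = W2 \<alpha> \<gamma> / 2" "W2 \<beta> \<gamma> = W2 \<alpha> \<gamma> / 2"
    using geo[unfolded wasserstein_geodesic_def, THEN conjunct2, THEN bspec[of _ _ 0], THEN bspec[of _ _ "1/2"]]
      geo[unfolded wasserstein_geodesic_def, THEN conjunct2, THEN bspec[of _ _ "1/2"], THEN bspec[of _ _ 1]]
    unfolding ends b_def[symmetric] \<beta>_def[symmetric] by simp_all
  have mid: "AE z in \<beta>. dist z x \<le> (r + \<epsilon>) / 2 + \<epsilon> + \<epsilon>"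
  proof (rule midpoint_concentration[OF P W])
    show "AE y in \<alpha>. y \<in> ball x \<epsilon>" unfolding \<alpha>_def by (rule \<rho>0(3))
    show "AE y in \<gamma>. y \<in> ball x r" unfolding \<gamma>_def by (rule \<rho>1(3))
    show "dist y z \<le> r + \<epsilon>" if "y \<in> ball x \<epsilon>" "z \<in> ball x r" for y z
      using that dist_triangle3[of y z x] by simp
  qed (use r \<epsilon> in \<open>auto simp: dist_commute\<close>)
  have supp: "AE z in \<mu>. 0 < b z \<longrightarrow> z \<in> ball x (3/4 * r)"
  proof -
    have "AE z in \<mu>. 0 < (ennreal \<circ> b) z \<longrightarrow> dist z x \<le> (r + \<epsilon>) / 2 + \<epsilon> + \<epsilon>"
      using mid unfolding \<beta>_def by (simp only: AE_density[OF bm])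
    then show ?thesis
    proof eventually_elim
      case (elim z)
      then show ?case using r by (auto simp: \<epsilon>_def dist_commute)
    qed
  qed
  have tot: "(\<integral>\<^sup>+z. ennreal (b z) \<partial>\<mu>) = 1"
  proof -
    have "prob_space \<beta>" using P by (auto simp: P2_def)
    then have "emeasure \<beta> (space \<beta>) = 1" by (rule prob_space.emeasure_space_1)
    then show ?thesis using emeasure_density[OF bm, of UNIV] by (simp add: \<beta>_def)
  qed
  define \<theta> where "\<theta> = 1 / N"
  have \<theta>: "0 < \<theta>" "\<theta> \<le> 1" using N by (auto simp: \<theta>_def)
  have upper: "(\<integral>\<^sup>+z. ennreal (b z powr (- 1 / N)) \<partial>\<beta>) \<le> ennreal (M powr \<theta>)"
  proof -
    have "(\<integral>\<^sup>+z. ennreal (b z powr (- 1 / N)) \<partial>\<beta>) = (\<integral>\<^sup>+z. (ennreal \<circ> b) z * ennreal (b z powr (- 1 / N)) \<partial>\<mu>)"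
      unfolding \<beta>_def by (rule nn_integral_density[OF bm]) measurable
    also have "\<dots> \<le> (\<integral>\<^sup>+z. ennreal ((1 - \<theta>) * M powr \<theta>) * ennreal (b z) + ennreal (\<theta> * M powr (\<theta> - 1)) * indicator (ball x (3/4 * r)) z \<partial>\<mu>)"
    proof (rule nn_integral_mono_AE, use supp in eventually_elim)
      case (elim z)
      show ?case
      proof (cases "b z = 0")
        case False
        then have bz: "b z > 0" using b(2)[of z] by simp
        have Y: "1 powr \<theta> * (b z * M) powr (1 - \<theta>) \<le> \<theta> * 1 + (1 - \<theta>) * (b z * M)"
          using \<theta> bz M by (intro Youngs_inequality_0) auto
        have "b z * b z powr (- 1 / N) = b z powr (1 - \<theta>)"
          using bz by (simp add: \<theta>_def powr_diff powr_minus_divide)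
        also have "\<dots> = M powr (\<theta> - 1) * (b z * M) powr (1 - \<theta>)"
          using bz M by (simp add: powr_mult powr_diff field_simps)
        also have "\<dots> \<le> M powr (\<theta> - 1) * (\<theta> + (1 - \<theta>) * (b z * M))" using Y by (intro mult_left_mono) auto
        also have "\<dots> = (1 - \<theta>) * M powr \<theta> * b z + \<theta> * M powr (\<theta> - 1)"
          using M by (simp add: powr_diff field_simps)
        finally have le: "b z * b z powr (- 1 / N) \<le> (1 - \<theta>) * M powr \<theta> * b z + \<theta> * M powr (\<theta> - 1)" .
        have "(ennreal \<circ> b) z * ennreal (b z powr (- 1 / N)) = ennreal (b z * b z powr (- 1 / N))"
          using bz by (simp add: ennreal_mult)
        also have "\<dots> \<le> ennreal ((1 - \<theta>) * M powr \<theta> * b z + \<theta> * M powr (\<theta> - 1))" by (rule ennreal_leI[OF le])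
        also have "\<dots> = ennreal ((1 - \<theta>) * M powr \<theta> * b z) + ennreal (\<theta> * M powr (\<theta> - 1))"
          using \<theta> bz by (intro ennreal_plus) auto
        also have "ennreal ((1 - \<theta>) * M powr \<theta> * b z) = ennreal ((1 - \<theta>) * M powr \<theta>) * ennreal (b z)"
          using \<theta> by (intro ennreal_mult') auto
        finally have fin: "(ennreal \<circ> b) z * ennreal (b z powr (- 1 / N))
            \<le> ennreal ((1 - \<theta>) * M powr \<theta>) * ennreal (b z) + ennreal (\<theta> * M powr (\<theta> - 1))" .
        have "z \<in> ball x (3/4 * r)" using elim bz by blast
        then have ind: "indicator (ball x (3/4 * r)) z = (1::ennreal)" by (rule indicator_simps(1))
        show ?thesis unfolding ind mult_1_right by (rule fin)
      next
        case True
        then have "(ennreal \<circ> b) z = 0" by (simp only: o_def ennreal_0)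
        then show ?thesis by (simp only: mult_zero_left zero_le)
      qed
    qed
    also have "\<dots> = ennreal (M powr \<theta>)"
    proof -
      have c0: "0 \<le> (1 - \<theta>) * M powr \<theta>" "0 \<le> \<theta> * M powr (\<theta> - 1)" using \<theta> by simp_all
      define c1 c2 where "c1 = ennreal ((1 - \<theta>) * M powr \<theta>)" and "c2 = ennreal (\<theta> * M powr (\<theta> - 1))"
      have b': "(\<lambda>z. ennreal (b z)) \<in> borel_measurable \<mu>" by measurable
      have ball: "ball x (3/4 * r) \<in> sets \<mu>" by simp
      have "(\<integral>\<^sup>+z. c1 * ennreal (b z) + c2 * indicator (ball x (3/4 * r)) z \<partial>\<mu>)
          = (\<integral>\<^sup>+z. c1 * ennreal (b z) \<partial>\<mu>) + (\<integral>\<^sup>+z. c2 * indicator (ball x (3/4 * r)) z \<partial>\<mu>)"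
        by (rule nn_integral_add) (intro borel_measurable_times_ennreal borel_measurable_const b' borel_measurable_indicator ball)+
      also have "\<dots> = c1 * 1 + c2 * ennreal M"
        unfolding nn_integral_cmult[OF b'] nn_integral_cmult_indicator[OF ball] tot emeasure_bounded_eq[OF bounded_ball] M_def ..
      also have "\<dots> = ennreal ((1 - \<theta>) * M powr \<theta> + \<theta> * M powr (\<theta> - 1) * M)"
        unfolding c1_def c2_def mult_1_right ennreal_mult'[OF c0(2), symmetric] using c0 M
        by (intro ennreal_plus[symmetric]) simp_all
      also have "(1 - \<theta>) * M powr \<theta> + \<theta> * M powr (\<theta> - 1) * M = M powr \<theta>"
        using M by (simp add: powr_diff field_simps)
      finally show ?thesis unfolding c1_def c2_def .
    qed
    finally show ?thesis .
  qed
  have qc: "q \<in> couplings \<alpha> \<gamma>" using q by (simp add: optimal_coupling_def)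
  have sq: "sets q = sets borel" by (rule couplingsD(1)[OF qc])
  interpret q: prob_space q by (rule coupling_prob_space[OF qc]) (use P in \<open>auto simp: P2_def\<close>)
  have mq: "fst \<in> measurable q borel" "snd \<in> measurable q borel"
    unfolding measurable_cong_sets[OF sq refl] by (intro borel_measurable_continuous_onI continuous_intros)+
  have q1: "AE z in q. fst z \<in> ball x \<epsilon>"
  proof (rule AE_distrD[OF mq(1)])
    show "AE y in distr q borel fst. y \<in> ball x \<epsilon>" using \<rho>0(3) by (simp only: couplingsD(2)[OF qc] \<alpha>_def)
  qed
  have q2: "AE z in q. snd z \<in> ball x r"
  proof (rule AE_distrD[OF mq(2)])
    show "AE y in distr q borel snd. y \<in> ball x r" using \<rho>1(3) by (simp only: couplingsD(3)[OF qc] \<gamma>_def)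
  qed
  have "ennreal (1/4 * mB powr \<theta>) = (\<integral>\<^sup>+z. ennreal (1/4 * mB powr \<theta>) \<partial>q)" by (simp add: q.emeasure_space_1)
  also have "\<dots> \<le> (\<integral>\<^sup>+z. sigma_coeff (K / N) (1 - 1/2) (dist (fst z) (snd z)) * ennreal (\<rho>0 (fst z) powr (- 1 / N))
                  + sigma_coeff (K / N) (1/2) (dist (fst z) (snd z)) * ennreal (\<rho>1 (snd z) powr (- 1 / N)) \<partial>q)"
  proof (rule nn_integral_mono_AE, use q1 q2 in eventually_elim)
    case (elim z)
    have "dist (fst z) (snd z) \<le> 2 * r"
      using elim dist_triangle3[of "fst z" "snd z" x] r by (simp add: \<epsilon>_def)
    then have "\<bar>K / N\<bar> * (dist (fst z) (snd z))\<^sup>2 \<le> \<bar>K / N\<bar> * (2 * r)\<^sup>2" by (intro mult_left_mono power_mono) auto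
    then have s: "ennreal (1/4) \<le> sigma_coeff (K / N) (1/2) (dist (fst z) (snd z))"
      using rK by (intro sigma_coeff_half_ge) auto
    have "\<rho>1 (snd z) powr (- 1 / N) = mB powr \<theta>"
      using elim mB by (simp add: \<rho>1_def mB_def[symmetric] \<theta>_def powr_divide powr_minus_divide)
    then have "ennreal (1/4 * mB powr \<theta>) = ennreal (1/4) * ennreal (\<rho>1 (snd z) powr (- 1 / N))"
      by (simp add: ennreal_mult'[symmetric])
    also have "\<dots> \<le> sigma_coeff (K / N) (1/2) (dist (fst z) (snd z)) * ennreal (\<rho>1 (snd z) powr (- 1 / N))"
      by (rule mult_right_mono[OF s]) simp
    finally show ?case by (simp add: add_increasing)
  qed
  also have "\<dots> \<le> (\<integral>\<^sup>+x. ennreal (b x powr (- 1 / N)) \<partial>\<beta>)"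
    using ineq[rule_format, of "1/2" N] by (simp add: b_def \<beta>_def)
  also note upper
  finally have "1/4 * mB powr \<theta> \<le> M powr \<theta>" by (subst (asm) ennreal_le_iff) auto
  then have "(mB powr \<theta>) powr N \<le> (4 * M powr \<theta>) powr N" using N by (intro powr_mono2) auto
  then have "mB \<le> 4 powr N * M" using N mB M by (simp add: powr_powr powr_mult \<theta>_def)
  then show ?thesis by (simp add: mB_def M_def)
qed

text \<open>
  Four steps of \<open>ball_shrink\<close> suffice, since \<open>3 (3/4)\<^sup>4 < 1\<close>.
\<close>

lemma locally_doubling:
  assumes CD: "CD_star K N \<mu>" and N: "N \<ge> 1"
  shows "\<exists>r0>0. \<exists>D>0. \<forall>x r. 0 < r \<and> r \<le> r0 \<longrightarrow> measure \<mu> (ball x (3 * r)) \<le> D * measure \<mu> (ball x r)"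
proof -
  \<comment> \<open>Up to this radius the curvature term is harmless.\<close>
  define s where "s = 1 / (2 * sqrt (\<bar>K / N\<bar> + 1))"
  have s: "s > 0" by (simp add: s_def add_nonneg_pos)
  have sK: "\<bar>K / N\<bar> * (2 * t)\<^sup>2 \<le> 1" if "0 < t" "t \<le> s" for t
  proof -
    have "\<bar>K / N\<bar> * (2 * t)\<^sup>2 \<le> \<bar>K / N\<bar> * (2 * s)\<^sup>2" using that by (intro mult_left_mono power_mono) auto
    also have "(2 * s)\<^sup>2 = 1 / (\<bar>K / N\<bar> + 1)" by (simp add: s_def power_divide)
    also have "\<bar>K / N\<bar> * (1 / (\<bar>K / N\<bar> + 1)) \<le> 1" by (simp add: field_simps)
    finally show ?thesis .
  qed
  define c where "c = 4 powr N"
  have c: "c > 0" by (simp add: c_def)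
  have step: "measure \<mu> (ball x t) \<le> c * measure \<mu> (ball x (3/4 * t))" if "0 < t" "t \<le> s" for x t
    unfolding c_def by (rule ball_shrink[OF CD N that(1) sK[OF that]])
  have iter: "measure \<mu> (ball x t) \<le> c ^ n * measure \<mu> (ball x ((3/4) ^ n * t))" if "0 < t" "t \<le> s" for x t n
  proof (induction n)
    case (Suc n)
    have "(3/4) ^ n * t \<le> 1 * s" using that by (intro mult_mono power_le_one) auto
    then have "measure \<mu> (ball x ((3/4) ^ n * t)) \<le> c * measure \<mu> (ball x (3/4 * ((3/4) ^ n * t)))" using that by (intro step) auto
    then have "c ^ n * measure \<mu> (ball x ((3/4) ^ n * t)) \<le> c ^ n * (c * measure \<mu> (ball x (3/4 * ((3/4) ^ n * t))))"
      using c by (intro mult_left_mono) auto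
    then show ?case using Suc by (simp add: ac_simps)
  qed simp
  have "measure \<mu> (ball x (3 * r)) \<le> c ^ 4 * measure \<mu> (ball x r)" if "0 < r \<and> r \<le> s / 3" for x r
  proof -
    have "measure \<mu> (ball x (3 * r)) \<le> c ^ 4 * measure \<mu> (ball x ((3/4) ^ 4 * (3 * r)))" using that by (intro iter) auto
    also have "\<dots> \<le> c ^ 4 * measure \<mu> (ball x r)"
    proof (intro mult_left_mono measure_mono_fmeasurable)
      show "ball x ((3/4) ^ 4 * (3 * r)) \<subseteq> ball x r" using that by (intro subset_ball) (simp add: power4_eq_xxxx)
      show "ball x r \<in> fmeasurable \<mu>" using emeasure_bounded_finite[of "ball x r"] by (simp add: fmeasurable_def)
    qed (use c in auto)
    finally show ?thesis .
  qed
  then have dbl: "\<forall>x r. 0 < r \<and> r \<le> s / 3 \<longrightarrow> measure \<mu> (ball x (3 * r)) \<le> c ^ 4 * measure \<mu> (ball x r)"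
    by (intro allI impI)
  have "s / 3 > 0" "c ^ 4 > 0" using s c by simp_all
  with dbl show ?thesis by meson
qed

section \<open>Lebesgue density\<close>

text \<open>
  Select a ball of largest radius, discard those that meet it, and repeat.
\<close>

lemma finite_Vitali_covering:
  fixes F :: "('b::metric_space \<times> real) set"
  assumes "finite F" "\<And>p. p \<in> F \<Longrightarrow> snd p > 0"
  shows "\<exists>D\<subseteq>F. disjoint_family_on (\<lambda>p. ball (fst p) (snd p)) D \<and>
    (\<Union>p\<in>F. ball (fst p) (snd p)) \<subseteq> (\<Union>p\<in>D. ball (fst p) (3 * snd p))"
  using assms
proof (induction "card F" arbitrary: F rule: less_induct)
  case less
  show ?case
  proof (cases "F = {}")
    case False
    define m where "m = Max (snd ` F)"
    have "m \<in> snd ` F" unfolding m_def using less.prems(1) False by (intro Max_in) auto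
    then obtain p where p: "p \<in> F" "snd p = m" by auto
    have max: "snd q \<le> snd p" if "q \<in> F" for q unfolding p(2) m_def using less.prems(1) that by (intro Max_ge) auto
    define F' where "F' = {q \<in> F. ball (fst q) (snd q) \<inter> ball (fst p) (snd p) = {}}"
    have "p \<notin> F'"
    proof
      assume "p \<in> F'"
      then have "ball (fst p) (snd p) = {}" unfolding F'_def by simp
      with less.prems(2)[OF p(1)] show False by simp
    qed
    moreover have "F' \<subseteq> F" by (auto simp: F'_def)
    ultimately have sub: "F' \<subset> F" using p(1) by blast
    have fF: "finite F'" using less.prems(1) by (auto simp: F'_def)
    obtain D where D: "D \<subseteq> F'" "disjoint_family_on (\<lambda>p. ball (fst p) (snd p)) D"
      "(\<Union>p\<in>F'. ball (fst p) (snd p)) \<subseteq> (\<Union>p\<in>D. ball (fst p) (3 * snd p))"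
      using less.hyps[OF psubset_card_mono[OF less.prems(1) sub] fF] less.prems(2) sub by blast
    show ?thesis
    proof (intro exI[of _ "insert p D"] conjI)
      show "insert p D \<subseteq> F" using D(1) sub p(1) by blast
      show "disjoint_family_on (\<lambda>p. ball (fst p) (snd p)) (insert p D)"
        using D(1,2) unfolding disjoint_family_on_def F'_def by blast
      show "(\<Union>p\<in>F. ball (fst p) (snd p)) \<subseteq> (\<Union>p\<in>insert p D. ball (fst p) (3 * snd p))"
      proof
        fix y assume "y \<in> (\<Union>p\<in>F. ball (fst p) (snd p))"
        then obtain q where q: "q \<in> F" "y \<in> ball (fst q) (snd q)" by blast
        show "y \<in> (\<Union>p\<in>insert p D. ball (fst p) (3 * snd p))"
        proof (cases "q \<in> F'")
          case True
          then show ?thesis using D(3) q(2) by blast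
        next
          case False
          then obtain z where z: "z \<in> ball (fst q) (snd q)" "z \<in> ball (fst p) (snd p)" using q(1) by (auto simp: F'_def)
          have "dist (fst p) y \<le> dist (fst p) z + (dist (fst q) z + dist (fst q) y)"
            using dist_triangle[of "fst p" y z] dist_triangle3[of z y "fst q"] by simp
          then have "dist (fst p) y < 3 * snd p" using z q(2) max[OF q(1)] by simp
          then show ?thesis by auto
        qed
      qed
    qed
  qed (auto simp: disjoint_family_on_def)
qed

lemma sigma_finite_mu: "sigma_finite_measure \<mu>"
proof
  fix a :: 'a
  have "(\<Union>n. ball a (real n)) = UNIV"
  proof (intro set_eqI iffI UNIV_I)
    fix x
    obtain n where "dist a x < real n" using reals_Archimedean2 by blast
    then show "x \<in> (\<Union>n. ball a (real n))" by auto
  qed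
  then show "\<exists>A. countable A \<and> A \<subseteq> sets \<mu> \<and> \<Union>A = space \<mu> \<and> (\<forall>a\<in>A. emeasure \<mu> a \<noteq> \<infinity>)"
    using emeasure_bounded_finite[OF bounded_ball[of a]]
    by (intro exI[of _ "range (\<lambda>n. ball a (real n))"]) (auto simp: less_top)
qed

lemma measure_ball_diff_measurable:
  assumes "F \<in> sets borel"
  shows "(\<lambda>x. measure \<mu> (ball x r \<inter> F)) \<in> borel_measurable borel"
proof -
  interpret sigma_finite_measure \<mu> by (rule sigma_finite_mu)
  have "{z :: 'a \<times> 'a. dist (fst z) (snd z) < r} \<in> sets borel"
    by (intro borel_open open_Collect_less continuous_intros)
  moreover have "{z :: 'a \<times> 'a. snd z \<in> F} \<in> sets borel"
  proof -
    have "snd \<in> borel_measurable (borel :: ('a \<times> 'a) measure)" by (intro borel_measurable_continuous_onI continuous_intros)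
    from measurable_sets[OF this assms] show ?thesis by (simp add: vimage_def)
  qed
  ultimately have "{z :: 'a \<times> 'a. dist (fst z) (snd z) < r} \<inter> {z. snd z \<in> F} \<in> sets borel" by (rule sets.Int)
  then have Q: "{z :: 'a \<times> 'a. dist (fst z) (snd z) < r} \<inter> {z. snd z \<in> F} \<in> sets (borel \<Otimes>\<^sub>M \<mu>)"
  proof -
    have "sets ((borel :: 'a measure) \<Otimes>\<^sub>M \<mu>) = sets ((borel :: 'a measure) \<Otimes>\<^sub>M (borel :: 'a measure))"
      by (rule sets_pair_measure_cong[OF refl sets_mu])
    also have "\<dots> = sets borel" by (simp only: borel_prod)
    finally show "{z :: 'a \<times> 'a. dist (fst z) (snd z) < r} \<inter> {z. snd z \<in> F} \<in> sets borel \<Longrightarrow> ?thesis" by simp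
  qed
  have "Pair x -` ({z :: 'a \<times> 'a. dist (fst z) (snd z) < r} \<inter> {z. snd z \<in> F}) = ball x r \<inter> F" for x by auto
  then have "(\<lambda>x. emeasure \<mu> (ball x r \<inter> F)) \<in> borel_measurable borel"
    using measurable_emeasure_Pair[OF Q] by simp
  then show ?thesis unfolding measure_def by measurable
qed

text \<open>
  The balls in which the complement of \<open>E\<close> has a fraction at least \<open>\<alpha>\<close> cover \<open>C\<close>, and they may be chosen
  inside any open \<open>V\<close> around \<open>C\<close>.  The Vitali lemma and doubling bound the measure of \<open>C\<close> by that of \<open>V - E\<close>
  up to a constant, and inner regularity of the complement of \<open>E\<close> makes \<open>V - E\<close> arbitrarily small.
\<close>

lemma bad_density_null:
  assumes dbl: "r0 > 0" "D > 0" "\<And>x r. 0 < r \<Longrightarrow> r \<le> r0 \<Longrightarrow> measure \<mu> (ball x (3 * r)) \<le> D * measure \<mu> (ball x r)"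
    and E: "E \<in> sets borel" and C: "compact C" "C \<subseteq> E" and \<alpha>: "\<alpha> > 0"
    and bad: "\<And>x s. x \<in> C \<Longrightarrow> s > 0 \<Longrightarrow> \<exists>r. 0 < r \<and> r < s \<and> \<alpha> * measure \<mu> (ball x r) \<le> measure \<mu> (ball x r - E)"
  shows "emeasure \<mu> C = 0"
proof -
  have bdC: "bounded C" by (rule compact_imp_bounded[OF C(1)])
  obtain a R where W0: "C \<subseteq> ball a R" using bounded_subset_ballD[OF bdC] by blast
  define W where "W = ball a R"
  have W: "open W" "bounded W" "C \<subseteq> W" using W0 by (auto simp: W_def)
  have fm: "A \<in> fmeasurable \<mu>" if "A \<in> sets borel" "bounded A" for A
    using emeasure_bounded_finite[OF that(2)] that(1) by (simp add: fmeasurable_def)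
  have Cm: "C \<in> sets borel" using C(1) by (rule borel_compact)
  have small: "measure \<mu> C \<le> D / \<alpha> * \<delta>" if \<delta>: "\<delta> > 0" for \<delta>
  proof -
    have WE: "W - E \<in> sets borel" "bounded (W - E)" using W E by (auto intro: bounded_subset)
    obtain K where K: "compact K" "K \<subseteq> W - E" "measure \<mu> (W - E) - \<delta> < measure \<mu> K"
    proof (cases "measure \<mu> (W - E) - \<delta> < 0")
      case True
      then show ?thesis using that[of "{}"] by simp
    next
      case False
      have "ennreal (measure \<mu> (W - E) - \<delta>) < emeasure \<mu> (W - E)"
        using \<delta> False unfolding emeasure_bounded_eq[OF WE(2)] by (intro ennreal_lessI) auto
      from compact_subset_pos[OF WE(1) this] obtain K where K: "compact K" "K \<subseteq> W - E" "ennreal (measure \<mu> (W - E) - \<delta>) < emeasure \<mu> K" by blast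
      have "measure \<mu> (W - E) - \<delta> < measure \<mu> K"
        using K(3) False unfolding emeasure_bounded_eq[OF compact_imp_bounded[OF K(1)]] by (simp add: ennreal_less_iff)
      then show ?thesis using K that by blast
    qed
    define V where "V = W - K"
    have V: "open V" "C \<subseteq> V" "bounded V"
      using W K(1,2) C(2) by (auto simp: V_def intro: open_Diff compact_imp_closed bounded_subset)
    have Vm: "V - E \<in> fmeasurable \<mu>" using V E by (intro fm) (auto intro: bounded_subset)
    have "V - E = (W - E) - K" by (auto simp: V_def)
    moreover have "measure \<mu> ((W - E) - K) = measure \<mu> (W - E) - measure \<mu> K"
      by (rule measure_Diff) (use WE emeasure_bounded_finite[OF WE(2)] borel_compact[OF K(1)] K(2) in auto)
    ultimately have VE: "measure \<mu> (V - E) \<le> \<delta>" using K(3) by simp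
    have ex: "\<exists>r. 0 < r \<and> r \<le> r0 \<and> ball x r \<subseteq> V \<and> \<alpha> * measure \<mu> (ball x r) \<le> measure \<mu> (ball x r - E)" if x: "x \<in> C" for x
    proof -
      obtain e where e: "e > 0" "ball x e \<subseteq> V" using V(1,2) x open_contains_ball by blast
      obtain r where r: "0 < r" "r < min e r0" "\<alpha> * measure \<mu> (ball x r) \<le> measure \<mu> (ball x r - E)"
        using bad[OF x, of "min e r0"] e(1) dbl(1) by auto
      have "ball x r \<subseteq> V" using r(2) e(2) by (meson min_less_iff_conj less_imp_le subset_ball order_trans)
      then show ?thesis using r by (intro exI[of _ r]) auto
    qed
    define \<rho> where "\<rho> x = (SOME r. 0 < r \<and> r \<le> r0 \<and> ball x r \<subseteq> V \<and> \<alpha> * measure \<mu> (ball x r) \<le> measure \<mu> (ball x r - E))" for x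
    have \<rho>: "0 < \<rho> x \<and> \<rho> x \<le> r0 \<and> ball x (\<rho> x) \<subseteq> V \<and> \<alpha> * measure \<mu> (ball x (\<rho> x)) \<le> measure \<mu> (ball x (\<rho> x) - E)" if "x \<in> C" for x
      unfolding \<rho>_def by (rule someI_ex[OF ex[OF that]])
    have self: "C \<subseteq> (\<Union>x\<in>C. ball x (\<rho> x))" using \<rho> by fastforce
    obtain C' where C': "C' \<subseteq> C" "finite C'" "C \<subseteq> (\<Union>x\<in>C'. ball x (\<rho> x))"
      by (rule compactE_image[OF C(1) open_ball self])
    define F where "F = (\<lambda>x. (x, \<rho> x)) ` C'"
    have F: "finite F" "\<And>p. p \<in> F \<Longrightarrow> snd p > 0" using C' \<rho> by (auto simp: F_def)
    obtain T where T: "T \<subseteq> F" "disjoint_family_on (\<lambda>p. ball (fst p) (snd p)) T"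
      "(\<Union>p\<in>F. ball (fst p) (snd p)) \<subseteq> (\<Union>p\<in>T. ball (fst p) (3 * snd p))"
      using finite_Vitali_covering[OF F] by blast
    have fT: "finite T" using T(1) F(1) finite_subset by blast
    have pT: "0 < snd p \<and> snd p \<le> r0 \<and> ball (fst p) (snd p) \<subseteq> V \<and> \<alpha> * measure \<mu> (ball (fst p) (snd p)) \<le> measure \<mu> (ball (fst p) (snd p) - E)" if pT: "p \<in> T" for p
    proof -
      obtain x where "x \<in> C'" "p = (x, \<rho> x)" using subsetD[OF T(1) pT] unfolding F_def by blast
      then show ?thesis using \<rho>[of x] C'(1) by auto
    qed
    have cov: "C \<subseteq> (\<Union>p\<in>T. ball (fst p) (3 * snd p))" using C'(3) T(3) by (force simp: F_def)
    have "measure \<mu> C \<le> measure \<mu> (\<Union>p\<in>T. ball (fst p) (3 * snd p))"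
      using fT by (intro measure_mono_fmeasurable[OF cov] fm bounded_UN) (auto simp: Cm)
    also have "\<dots> \<le> (\<Sum>p\<in>T. measure \<mu> (ball (fst p) (3 * snd p)))"
      using fT by (intro measure_UNION_le) auto
    also have "\<dots> \<le> (\<Sum>p\<in>T. D / \<alpha> * measure \<mu> (ball (fst p) (snd p) - E))"
    proof (rule sum_mono)
      fix p assume p: "p \<in> T"
      have "measure \<mu> (ball (fst p) (3 * snd p)) \<le> D * measure \<mu> (ball (fst p) (snd p))" using pT[OF p] by (intro dbl(3)) auto
      also have "\<dots> \<le> D * (measure \<mu> (ball (fst p) (snd p) - E) / \<alpha>)"
        using pT[OF p] dbl(2) \<alpha> by (intro mult_left_mono) (auto simp: field_simps)
      finally show "measure \<mu> (ball (fst p) (3 * snd p)) \<le> D / \<alpha> * measure \<mu> (ball (fst p) (snd p) - E)" by simp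
    qed
    also have "\<dots> = D / \<alpha> * (\<Sum>p\<in>T. measure \<mu> (ball (fst p) (snd p) - E))" by (simp add: sum_distrib_left)
    also have "(\<Sum>p\<in>T. measure \<mu> (ball (fst p) (snd p) - E)) = measure \<mu> (\<Union>p\<in>T. ball (fst p) (snd p) - E)"
    proof (rule measure_finite_Union[symmetric, OF fT])
      show "(\<lambda>p. ball (fst p) (snd p) - E) ` T \<subseteq> sets \<mu>" using E by auto
      show "disjoint_family_on (\<lambda>p. ball (fst p) (snd p) - E) T" using T(2) unfolding disjoint_family_on_def by blast
      show "emeasure \<mu> (ball (fst p) (snd p) - E) \<noteq> \<infinity>" for p
        using emeasure_bounded_finite[of "ball (fst p) (snd p) - E"] by (simp add: bounded_diff)
    qed
    also have "D / \<alpha> * measure \<mu> (\<Union>p\<in>T. ball (fst p) (snd p) - E) \<le> D / \<alpha> * \<delta>"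
    proof (rule mult_left_mono)
      have "measure \<mu> (\<Union>p\<in>T. ball (fst p) (snd p) - E) \<le> measure \<mu> (V - E)"
      proof (rule measure_mono_fmeasurable[OF _ _ Vm])
        show "(\<Union>p\<in>T. ball (fst p) (snd p) - E) \<subseteq> V - E" using pT by fast
        show "(\<Union>p\<in>T. ball (fst p) (snd p) - E) \<in> sets \<mu>" using fT E by (intro sets.finite_UN) auto
      qed
      then show "measure \<mu> (\<Union>p\<in>T. ball (fst p) (snd p) - E) \<le> \<delta>" using VE by simp
    qed (use dbl(2) \<alpha> in auto)
    finally show ?thesis .
  qed
  have "measure \<mu> C \<le> 0"
  proof (rule field_le_epsilon)
    fix e :: real assume e: "e > 0"
    show "measure \<mu> C \<le> 0 + e" using small[of "e * \<alpha> / D"] e dbl(2) \<alpha> by simp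
  qed
  then have "measure \<mu> C = 0" using measure_nonneg[of \<mu> C] by linarith
  then show ?thesis by (simp add: emeasure_bounded_eq[OF bdC])
qed

text \<open>
  The exceptional set is made Borel by restricting to rational radii; a compact subset of positive measure
  would contradict \<open>bad_density_null\<close>.
\<close>

lemma density_points:
  assumes dbl: "r0 > 0" "D > 0" "\<And>x r. 0 < r \<Longrightarrow> r \<le> r0 \<Longrightarrow> measure \<mu> (ball x (3 * r)) \<le> D * measure \<mu> (ball x r)"
    and E: "E \<in> sets borel" and \<alpha>: "\<alpha> > 0"
  shows "AE x in \<mu>. x \<in> E \<longrightarrow> (\<exists>s>0. \<forall>r. 0 < r \<and> r < s \<longrightarrow> measure \<mu> (ball x r - E) \<le> \<alpha> * measure \<mu> (ball x r))"
proof -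
  define B where "B q = {x. \<alpha> * measure \<mu> (ball x q) < measure \<mu> (ball x q - E)}" for q :: real
  define Z where "Z = E \<inter> (\<Inter>n. \<Union>q\<in>{q\<in>\<rat>. 0 < q \<and> q < 1 / real (Suc n)}. B q)"
  have Bm: "B q \<in> sets borel" for q
  proof -
    have [measurable]: "(\<lambda>x. measure \<mu> (ball x q)) \<in> borel_measurable borel"
      using measure_ball_diff_measurable[of UNIV q] by simp
    have [measurable]: "(\<lambda>x. measure \<mu> (ball x q - E)) \<in> borel_measurable borel"
      using measure_ball_diff_measurable[of "- E" q] E by (simp add: Diff_eq)
    have "{x \<in> space borel. \<alpha> * measure \<mu> (ball x q) < measure \<mu> (ball x q - E)} \<in> sets borel" by measurable
    then show ?thesis by (simp add: B_def)
  qed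
  have cq: "countable {q\<in>\<rat>. 0 < q \<and> q < 1 / real (Suc n)}" for n
    by (rule countable_subset[OF _ countable_rat]) auto
  have "(\<Union>q\<in>{q\<in>\<rat>. 0 < q \<and> q < 1 / real (Suc n)}. B q) \<in> sets borel" for n
    by (rule sets.countable_UN''[OF cq Bm])
  then have "(\<Inter>n. \<Union>q\<in>{q\<in>\<rat>. 0 < q \<and> q < 1 / real (Suc n)}. B q) \<in> sets borel"
    by (intro sets.countable_INT'') auto
  then have Zm: "Z \<in> sets borel" unfolding Z_def by (rule sets.Int[OF E])
  have "emeasure \<mu> Z = 0"
  proof (rule ccontr)
    assume "emeasure \<mu> Z \<noteq> 0"
    then have "emeasure \<mu> Z > 0" by (simp add: zero_less_iff_neq_zero)
    from compact_subset_pos[OF Zm this] obtain C where C: "compact C" "C \<subseteq> Z" "emeasure \<mu> C > 0" by blast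
    have "emeasure \<mu> C = 0"
    proof (rule bad_density_null[OF dbl E C(1) _ \<alpha>])
      show "C \<subseteq> E" using C(2) by (auto simp: Z_def)
      fix x and s :: real assume x: "x \<in> C" and s: "s > 0"
      obtain n where n: "1 / real (Suc n) < s" using s by (metis inverse_eq_divide reals_Archimedean)
      have "x \<in> (\<Union>q\<in>{q\<in>\<rat>. 0 < q \<and> q < 1 / real (Suc n)}. B q)" using C(2) x unfolding Z_def by blast
      then obtain q where "0 < q" "q < 1 / real (Suc n)" "x \<in> B q" by blast
      then show "\<exists>r. 0 < r \<and> r < s \<and> \<alpha> * measure \<mu> (ball x r) \<le> measure \<mu> (ball x r - E)"
        using n by (intro exI[of _ q]) (auto simp: B_def)
    qed
    then show False using C(3) by simp
  qed
  then have "Z \<in> null_sets \<mu>" using Zm by (simp add: null_sets_def)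
  then have "AE x in \<mu>. x \<notin> Z" by (rule AE_not_in)
  then show ?thesis
  proof eventually_elim
    case (elim x)
    show ?case
    proof
      assume xE: "x \<in> E"
      then obtain n where n: "\<And>q. q \<in> \<rat> \<Longrightarrow> 0 < q \<Longrightarrow> q < 1 / real (Suc n) \<Longrightarrow> x \<notin> B q" using elim unfolding Z_def by auto
      have "measure \<mu> (ball x r - E) \<le> \<alpha> * measure \<mu> (ball x r)" if r: "0 < r" "r < 1 / real (Suc n)" for r
      proof (rule ccontr)
        assume neg: "\<not> measure \<mu> (ball x r - E) \<le> \<alpha> * measure \<mu> (ball x r)"
        \<comment> \<open>Open balls are exhausted by smaller ones, so the radius may be taken rational.\<close>
        define t where "t k = r - r / real (Suc (Suc k))" for k
        have t: "0 < t k" "t k < r" for k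
          using r(1) mult_nonneg_nonneg[of r "real k"] by (auto simp: t_def field_simps intro: add_pos_nonneg)
        have tinc: "incseq t"
          unfolding incseq_def t_def using r(1) by (auto intro!: diff_left_mono divide_left_mono)
        have tlim: "t \<longlonglongrightarrow> r"
          unfolding t_def using tendsto_diff[OF tendsto_const LIMSEQ_Suc[OF LIMSEQ_Suc[OF lim_const_over_n]], of r r] by simp
        have "(\<lambda>k. measure \<mu> (ball x (t k) - E)) \<longlonglongrightarrow> measure \<mu> (\<Union>k. ball x (t k) - E)"
        proof (rule Lim_measure_incseq)
          show "range (\<lambda>k. ball x (t k) - E) \<subseteq> sets \<mu>" using E by auto
          show "incseq (\<lambda>k. ball x (t k) - E)" using tinc unfolding incseq_def by (meson Diff_mono order_refl subset_ball)
          have "bounded (\<Union>k. ball x (t k) - E)"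
          proof (rule bounded_subset[OF bounded_ball[of x r]], rule UN_least)
            fix k show "ball x (t k) - E \<subseteq> ball x r" using t(2)[of k] by auto
          qed
          from emeasure_bounded_finite[OF this] show "emeasure \<mu> (\<Union>k. ball x (t k) - E) \<noteq> \<infinity>" by simp
        qed
        moreover have "(\<Union>k. ball x (t k) - E) = ball x r - E"
        proof (intro set_eqI iffI)
          fix y assume "y \<in> ball x r - E"
          then have "dist x y < r" "y \<notin> E" by auto
          from order_tendstoD(1)[OF tlim this(1)] obtain k where "dist x y < t k" by (auto simp: eventually_sequentially)
          then show "y \<in> (\<Union>k. ball x (t k) - E)" using \<open>y \<notin> E\<close> by auto
        next
          fix y assume "y \<in> (\<Union>k. ball x (t k) - E)"
          then obtain k where "dist x y < t k" "y \<notin> E" by auto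
          then show "y \<in> ball x r - E" using t(2)[of k] by auto
        qed
        ultimately have "(\<lambda>k. measure \<mu> (ball x (t k) - E)) \<longlonglongrightarrow> measure \<mu> (ball x r - E)" by simp
        moreover have "\<alpha> * measure \<mu> (ball x r) < measure \<mu> (ball x r - E)" using neg by simp
        ultimately have "\<forall>\<^sub>F k in sequentially. \<alpha> * measure \<mu> (ball x r) < measure \<mu> (ball x (t k) - E)" by (rule order_tendstoD(1))
        then obtain k where k: "\<alpha> * measure \<mu> (ball x r) < measure \<mu> (ball x (t k) - E)" by (auto simp: eventually_sequentially)
        obtain q where q: "q \<in> \<rat>" "t k < q" "q < r" using Rats_dense_in_real[OF t(2)[of k]] by blast
        have fm: "ball x p - A \<in> fmeasurable \<mu>" if "A \<in> sets borel" for p A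
          using emeasure_bounded_finite[of "ball x p - A"] that by (simp add: fmeasurable_def bounded_diff)
        have "measure \<mu> (ball x (t k) - E) \<le> measure \<mu> (ball x q - E)"
          using q(2) E by (intro measure_mono_fmeasurable fm) (auto intro: less_trans)
        moreover have "measure \<mu> (ball x q) \<le> measure \<mu> (ball x r)"
          using q(3) fm[of "{}" r] by (intro measure_mono_fmeasurable) (auto intro: less_trans)
        then have "\<alpha> * measure \<mu> (ball x q) \<le> \<alpha> * measure \<mu> (ball x r)" using \<alpha> by (intro mult_left_mono) auto
        ultimately have "x \<in> B q" using k by (simp add: B_def)
        then show False using n[OF q(1)] q t(1)[of k] r(2) by auto
      qed
      then show "\<exists>s>0. \<forall>r. 0 < r \<and> r < s \<longrightarrow> measure \<mu> (ball x r - E) \<le> \<alpha> * measure \<mu> (ball x r)"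
        by (intro exI[of _ "1 / real (Suc n)"]) auto
    qed
  qed
qed

text \<open>
  If \<open>x\<close> is a density point of \<open>{a < g < b}\<close> for all rational \<open>a < g x < b\<close>, then \<open>g\<close> is approximately
  continuous at \<open>x\<close>; only countably many sets are involved.
\<close>

lemma AE_approx_continuity_point:
  assumes dbl: "r0 > 0" "D > 0" "\<And>x r. 0 < r \<Longrightarrow> r \<le> r0 \<Longrightarrow> measure \<mu> (ball x (3 * r)) \<le> D * measure \<mu> (ball x r)"
    and \<Omega>: "open \<Omega>" and g: "g \<in> borel_measurable (restrict_space \<mu> \<Omega>)"
  shows "AE x in \<mu>. x \<in> \<Omega> \<longrightarrow> approx_continuity_point \<mu> g x"
proof -
  define E where "E a b = {x \<in> \<Omega>. a < g x \<and> g x < b}" for a b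
  have Em: "E a b \<in> sets borel" for a b
  proof -
    have "{x \<in> space (restrict_space \<mu> \<Omega>). a < g x \<and> g x < b} \<in> sets (restrict_space \<mu> \<Omega>)" using g by measurable
    then show ?thesis using \<Omega> by (auto simp: E_def space_restrict_space sets_restrict_space_iff)
  qed
  have "AE x in \<mu>. \<forall>a\<in>\<rat>. \<forall>b\<in>\<rat>. \<forall>n::nat. x \<in> E a b \<longrightarrow>
      (\<exists>s>0. \<forall>r. 0 < r \<and> r < s \<longrightarrow> measure \<mu> (ball x r - E a b) \<le> (1 / real (Suc n)) * measure \<mu> (ball x r))"
    unfolding AE_ball_countable[OF countable_rat] AE_all_countable
    by (intro ballI allI density_points[OF dbl Em]) auto
  then show ?thesis
  proof eventually_elim
    case (elim x)
    show ?case
    proof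
      assume x: "x \<in> \<Omega>"
      show "approx_continuity_point \<mu> g x"
        unfolding approx_continuity_point_def
      proof (intro allI impI)
        fix \<epsilon> :: real assume \<epsilon>: "\<epsilon> > 0"
        obtain a where a: "a \<in> \<rat>" "g x - \<epsilon> < a" "a < g x" using Rats_dense_in_real[of "g x - \<epsilon>" "g x"] \<epsilon> by auto
        obtain b where b: "b \<in> \<rat>" "g x < b" "b < g x + \<epsilon>" using Rats_dense_in_real[of "g x" "g x + \<epsilon>"] \<epsilon> by auto
        have xE: "x \<in> E a b" using x a b by (simp add: E_def)
        obtain e where e: "e > 0" "ball x e \<subseteq> \<Omega>" using \<Omega> x open_contains_ball by blast
        have quot: "measure \<mu> (ball x r \<inter> {y. \<epsilon> < \<bar>g y - g x\<bar>}) / measure \<mu> (ball x r) \<le> c"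
          if r: "0 < r" "r < e" and c: "measure \<mu> (ball x r - E a b) \<le> c * measure \<mu> (ball x r)" for r c
        proof -
          have sub: "ball x r \<inter> {y. \<epsilon> < \<bar>g y - g x\<bar>} \<subseteq> ball x r - E a b"
            using a b r e by (auto simp: E_def)
          have "emeasure \<mu> (ball x r \<inter> {y. \<epsilon> < \<bar>g y - g x\<bar>}) \<le> emeasure \<mu> (ball x r - E a b)"
            using Em by (intro emeasure_mono sub) auto
          moreover have "emeasure \<mu> (ball x r - E a b) < \<top>"
            using emeasure_bounded_finite[of "ball x r - E a b"] by (simp add: bounded_diff)
          ultimately have "measure \<mu> (ball x r \<inter> {y. \<epsilon> < \<bar>g y - g x\<bar>}) \<le> measure \<mu> (ball x r - E a b)"
            unfolding measure_def by (rule enn2real_mono)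
          also note c
          finally show ?thesis using measure_ball_pos[OF r(1), of x] by (simp add: field_simps)
        qed
        show "((\<lambda>r. measure \<mu> (ball x r \<inter> {y. \<epsilon> < \<bar>g y - g x\<bar>}) / measure \<mu> (ball x r)) \<longlongrightarrow> 0) (at_right 0)"
        proof (rule tendstoI)
          fix c :: real assume c: "c > 0"
          obtain n where n: "1 / real (Suc n) < c" using c by (metis inverse_eq_divide reals_Archimedean)
          from elim[rule_format, OF a(1) b(1) xE, of n]
          obtain s where s: "s > 0" "\<forall>r. 0 < r \<and> r < s \<longrightarrow> measure \<mu> (ball x r - E a b) \<le> (1 / real (Suc n)) * measure \<mu> (ball x r)"
            by (elim exE conjE) (rule that)
          have "\<forall>\<^sub>F r in at_right 0. 0 < r \<and> r < min e s"
            unfolding eventually_at_right_field using e(1) s(1) by (intro exI[of _ "min e s"]) auto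
          then show "\<forall>\<^sub>F r in at_right 0. dist (measure \<mu> (ball x r \<inter> {y. \<epsilon> < \<bar>g y - g x\<bar>}) / measure \<mu> (ball x r)) 0 < c"
          proof eventually_elim
            case (elim r)
            then have "measure \<mu> (ball x r \<inter> {y. \<epsilon> < \<bar>g y - g x\<bar>}) / measure \<mu> (ball x r) \<le> 1 / real (Suc n)"
              by (intro quot s(2)[rule_format]) auto
            also note n
            finally show ?case by simp
          qed
        qed
      qed
    qed
  qed
qed

end

section \<open>Signed Radon measures against test functions\<close>

text \<open>
  An inequality between differences of measures, written without subtraction so that both sides make
  sense in \<open>[0, \<infinity>]\<close>; by approximation with simple functions it suffices to know it on sets.
\<close>

lemma nn_integral_add_mono_measure:
  assumes sets: "sets A1 = sets M" "sets A2 = sets M" "sets B1 = sets M" "sets B2 = sets M"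
    and le: "\<And>S. S \<in> sets M \<Longrightarrow> emeasure A1 S + emeasure A2 S \<le> emeasure B1 S + emeasure B2 S"
    and u: "u \<in> borel_measurable M"
  shows "(\<integral>\<^sup>+x. u x \<partial>A1) + (\<integral>\<^sup>+x. u x \<partial>A2) \<le> (\<integral>\<^sup>+x. u x \<partial>B1) + (\<integral>\<^sup>+x. u x \<partial>B2)"
  using u
proof induct
  case (cong f g)
  have "integral\<^sup>N D f = integral\<^sup>N D g" if "sets D = sets M" for D
    using cong(3) sets_eq_imp_space_eq[OF that] by (intro nn_integral_cong) simp
  then show ?case using cong(4) sets by simp
next
  case (set S)
  then show ?case using le sets by simp
next
  case (mult u c)
  have "(\<integral>\<^sup>+x. c * u x \<partial>D) = c * (\<integral>\<^sup>+x. u x \<partial>D)" if "sets D = sets M" for D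
    using mult(2) by (intro nn_integral_cmult) (simp add: measurable_cong_sets[OF that refl])
  then show ?case using mult_left_mono[OF mult(4), of c] sets by (simp add: distrib_left)
next
  case (add u v)
  have e: "(\<integral>\<^sup>+x. v x + u x \<partial>D) = (\<integral>\<^sup>+x. v x \<partial>D) + (\<integral>\<^sup>+x. u x \<partial>D)" if "sets D = sets M" for D
    using add(1,4) by (intro nn_integral_add) (simp_all add: measurable_cong_sets[OF that refl])
  show ?case unfolding e[OF sets(1)] e[OF sets(2)] e[OF sets(3)] e[OF sets(4)]
    using add_mono[OF add(3) add(7)] by (simp add: ac_simps)
next
  case (seq U)
  have lim: "(\<lambda>i. \<integral>\<^sup>+x. U i x \<partial>D) \<longlonglongrightarrow> (\<integral>\<^sup>+x. (SUP i. U i) x \<partial>D)" if "sets D = sets M" for D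
  proof (rule nn_integral_LIMSEQ[OF seq(4)])
    show "U i \<in> borel_measurable D" for i using seq(1) by (simp add: measurable_cong_sets[OF that refl])
    show "(\<lambda>i. U i x) \<longlonglongrightarrow> (SUP i. U i) x" for x
      unfolding SUP_apply using seq(4) by (intro LIMSEQ_SUP) (auto simp: incseq_def le_fun_def)
  qed
  show ?case
    by (rule LIMSEQ_le[OF tendsto_add[OF lim[OF sets(1)] lim[OF sets(2)]] tendsto_add[OF lim[OF sets(3)] lim[OF sets(4)]]])
      (use seq(3) in blast)
qed

context mm_space
begin

text \<open>
  On subsets of the compact support of \<open>\<phi>\<close>, positivity of the singular part says that \<open>\<nu>\<close> dominates \<open>g \<mu>\<close>.
  Moving the negative parts to the other side turns this into an inequality between sums of positive
  measures, which can be integrated.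
\<close>

lemma signed_integral_ge:
  assumes \<Omega>: "open \<Omega>" and \<phi>: "\<phi> \<in> Lip0 \<Omega>" "\<And>x. 0 \<le> \<phi> x"
    and \<nu>: "signed_radon_on \<Omega> \<nu>" and rn: "radon_nikodym_decomposition \<mu> \<Omega> \<nu> g \<sigma>" and \<sigma>: "signed_nonneg_on \<Omega> \<sigma>"
  shows "(\<integral>x. \<phi> x * g x \<partial>restrict_space \<mu> \<Omega>) \<le> signed_integral \<nu> \<phi>"
proof -
  define P N where "P = fst \<nu>" and "N = snd \<nu>"
  have sets: "sets P = sets (restrict_space borel \<Omega>)" "sets N = sets (restrict_space borel \<Omega>)"
    and fin: "\<And>C. compact C \<Longrightarrow> C \<subseteq> \<Omega> \<Longrightarrow> emeasure P C < \<infinity>" "\<And>C. compact C \<Longrightarrow> C \<subseteq> \<Omega> \<Longrightarrow> emeasure N C < \<infinity>"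
    using \<nu> unfolding signed_radon_on_def radon_on_def P_def N_def by auto
  have bo: "\<Omega> \<in> sets borel" using \<Omega> by auto
  define C where "C = closure {x. \<phi> x \<noteq> 0}"
  have C: "compact C" "C \<subseteq> \<Omega>" using Lip0_support[OF \<phi>(1)] by (auto simp: compactly_inside_def C_def)
  have Cb: "C \<in> sets borel" by (rule borel_compact[OF C(1)])
  have supp: "\<phi> x = 0" if "x \<notin> C" for x using that closure_subset[of "{x. \<phi> x \<noteq> 0}"] by (auto simp: C_def)
  have rc: "S \<in> rc_borel \<Omega>" if "S \<in> sets borel" "S \<subseteq> C" for S
    using that C compactly_inside_subset[OF that(2), of \<Omega>] by (simp add: rc_borel_def compactly_inside_def compact_imp_closed)
  define gp gm where "gp x = max 0 (g x)" and "gm x = max 0 (- g x)" for x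
  have gpm: "g x = gp x - gm x" "0 \<le> gp x" "0 \<le> gm x" for x by (auto simp: gp_def gm_def)
  define R where "R = restrict_space borel C"
  define m where "m = restrict_space \<mu> C"
  have mR: "sets m = sets R" unfolding m_def R_def by (rule sets_restrict_space_cong) simp
  have gC: "integrable m g"
    using rn rc[OF Cb order_refl] unfolding radon_nikodym_decomposition_def set_integrable_def m_def rs_integrable[OF Cb] by simp
  have gpC: "integrable m gp" and gmC: "integrable m gm" unfolding gp_def gm_def using gC by auto
  note [measurable] = borel_measurable_integrable[OF gpC] borel_measurable_integrable[OF gmC]
  have \<Omega>m: "C \<inter> space P \<in> sets P" "C \<inter> space N \<in> sets N"
    using sets C(2) Cb sets_eq_imp_space_eq[OF sets(1)] sets_eq_imp_space_eq[OF sets(2)] bo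
    by (auto simp: sets_restrict_space_iff space_restrict_space)
  have setsC: "sets (restrict_space D C) = sets R" if "sets D = sets (restrict_space borel \<Omega>)" for D
  proof -
    have "sets (restrict_space D C) = sets (restrict_space (restrict_space borel \<Omega>) C)" by (rule sets_restrict_space_cong[OF that])
    also have "\<dots> = sets R" unfolding sets_restrict_restrict_space R_def using C(2) by (simp add: Int_absorb1)
    finally show ?thesis .
  qed
  have finC: "emeasure D S = ennreal (measure D S)" if "D = P \<or> D = N" "S \<in> sets borel" "S \<subseteq> C" for D S
  proof -
    have "C \<in> sets D" using that(1) \<Omega>m C(2) sets_eq_imp_space_eq[OF sets(1)] sets_eq_imp_space_eq[OF sets(2)]
      by (auto simp: space_restrict_space Int_absorb2)
    then have "emeasure D S \<le> emeasure D C" by (rule emeasure_mono[OF that(3)])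
    also have "\<dots> < \<infinity>" using that(1) fin[OF C] by auto
    finally show ?thesis by (simp add: emeasure_eq_ennreal_measure less_top)
  qed
  have key: "(\<integral>\<^sup>+x. u x \<partial>restrict_space N C) + (\<integral>\<^sup>+x. u x \<partial>density m (\<lambda>x. ennreal (gp x)))
      \<le> (\<integral>\<^sup>+x. u x \<partial>restrict_space P C) + (\<integral>\<^sup>+x. u x \<partial>density m (\<lambda>x. ennreal (gm x)))"
    if u: "u \<in> borel_measurable R" for u
  proof (rule nn_integral_add_mono_measure[OF setsC[OF sets(2)] _ setsC[OF sets(1)] _ _ u])
    fix S assume S: "S \<in> sets R"
    then have S': "S \<in> sets borel" "S \<subseteq> C" using Cb by (auto simp: R_def sets_restrict_space_iff)
    have Sm: "S \<in> sets m" using S mR by simp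
    have e: "emeasure (density m (\<lambda>x. ennreal (q x))) S = ennreal (\<integral>x. indicator S x * q x \<partial>m)"
      if q: "integrable m q" "\<And>x. 0 \<le> q x" for q
    proof -
      have [measurable]: "q \<in> borel_measurable m" using q(1) by auto
      have "emeasure (density m (\<lambda>x. ennreal (q x))) S = (\<integral>\<^sup>+x. ennreal (q x) * indicator S x \<partial>m)"
        using Sm by (intro emeasure_density) auto
      also have "\<dots> = (\<integral>\<^sup>+x. ennreal (indicator S x * q x) \<partial>m)" by (intro nn_integral_cong) (auto simp: indicator_def)
      also have "\<dots> = ennreal (\<integral>x. indicator S x * q x \<partial>m)"
        using integrable_real_mult_indicator[OF Sm q(1)] q(2) by (intro nn_integral_eq_integral) (auto simp: mult.commute)
      finally show ?thesis .
    qed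
    have "measure P S - measure N S = (LINT x:S|\<mu>. g x) + signed_value \<sigma> S"
      using rn rc[OF S'] unfolding radon_nikodym_decomposition_def signed_value_def P_def N_def by auto
    moreover have "0 \<le> signed_value \<sigma> S" using \<sigma> rc[OF S'] by (simp add: signed_nonneg_on_def)
    moreover have "(LINT x:S|\<mu>. g x) = (\<integral>x. indicator S x * g x \<partial>m)"
      unfolding set_lebesgue_integral_def m_def rs_integral[OF Cb] using S'(2)
      by (intro Bochner_Integration.integral_cong) (auto simp: indicator_def)
    moreover have "(\<integral>x. indicator S x * g x \<partial>m) = (\<integral>x. indicator S x * gp x - indicator S x * gm x \<partial>m)"
      unfolding gpm(1) right_diff_distrib ..
    moreover have "\<dots> = (\<integral>x. indicator S x * gp x \<partial>m) - (\<integral>x. indicator S x * gm x \<partial>m)"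
      using integrable_real_mult_indicator[OF Sm gpC] integrable_real_mult_indicator[OF Sm gmC]
      by (intro Bochner_Integration.integral_diff) (simp_all add: mult.commute)
    ultimately have r: "measure N S + (\<integral>x. indicator S x * gp x \<partial>m) \<le> measure P S + (\<integral>x. indicator S x * gm x \<partial>m)" by linarith
    have nn: "0 \<le> (\<integral>x. indicator S x * gp x \<partial>m)" "0 \<le> (\<integral>x. indicator S x * gm x \<partial>m)"
      using gpm by (auto intro!: integral_nonneg)
    have rs: "emeasure (restrict_space N C) S = ennreal (measure N S)" "emeasure (restrict_space P C) S = ennreal (measure P S)"
      using emeasure_restrict_space[OF \<Omega>m(2) S'(2)] emeasure_restrict_space[OF \<Omega>m(1) S'(2)] finC S' by simp_all
    show "emeasure (restrict_space N C) S + emeasure (density m (\<lambda>x. ennreal (gp x))) S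
        \<le> emeasure (restrict_space P C) S + emeasure (density m (\<lambda>x. ennreal (gm x))) S"
      unfolding rs e[OF gpC gpm(2)] e[OF gmC gpm(3)] using r nn
      by (simp add: ennreal_plus[symmetric] ennreal_leI del: ennreal_plus)
  qed (simp_all add: mR)
  have \<phi>b: "\<phi> \<in> borel_measurable borel" by (rule borel_measurable_continuous_onI[OF Lip_fun_continuous[OF Lip0_Lip_fun[OF \<phi>(1)]]])
  have \<phi>R: "\<phi> \<in> borel_measurable R" unfolding R_def by (rule measurable_restrict_space1[OF \<phi>b])
  have \<phi>m[measurable]: "\<phi> \<in> borel_measurable m" using \<phi>R by (simp add: measurable_cong_sets[OF mR refl])
  obtain B where B: "B \<ge> 0" "\<And>x. \<bar>\<phi> x\<bar> \<le> B" using Lip0_bounded[OF \<phi>(1)] by blast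
  have meas: "(\<integral>\<^sup>+x. ennreal (\<phi> x) \<partial>restrict_space D C) = ennreal (\<integral>x. \<phi> x \<partial>D)" if D: "D = P \<or> D = N" for D
  proof -
    have sD: "sets D = sets (restrict_space borel \<Omega>)" and CD: "C \<inter> space D \<in> sets D" using D sets \<Omega>m by auto
    have \<phi>D: "\<phi> \<in> borel_measurable D"
      unfolding measurable_cong_sets[OF sD refl] by (rule measurable_restrict_space1[OF \<phi>b])
    have sp: "space D = \<Omega>" using sets_eq_imp_space_eq[OF sD] by (simp add: space_restrict_space)
    have CD': "C \<in> sets D" using CD C(2) by (simp add: sp Int_absorb2)
    have int: "integrable D \<phi>"
    proof (rule Bochner_Integration.integrable_bound)
      show "integrable D (\<lambda>x. B * indicator C x)"
        using CD' finC[OF D Cb order_refl] by (intro integrable_mult_right integrable_real_indicator) auto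
      show "AE x in D. norm (\<phi> x) \<le> norm (B * indicator C x)"
        using B supp by (intro AE_I2) (auto simp: indicator_def)
    qed (rule \<phi>D)
    have "(\<integral>\<^sup>+x. ennreal (\<phi> x) \<partial>restrict_space D C) = (\<integral>\<^sup>+x. ennreal (\<phi> x) * indicator C x \<partial>D)"
      by (rule nn_integral_restrict_space[OF CD])
    also have "\<dots> = (\<integral>\<^sup>+x. ennreal (\<phi> x) \<partial>D)" using supp by (intro nn_integral_cong) (auto simp: indicator_def)
    also have "\<dots> = ennreal (\<integral>x. \<phi> x \<partial>D)" using \<phi>(2) by (intro nn_integral_eq_integral[OF int]) auto
    finally show ?thesis .
  qed
  have int: "integrable m (\<lambda>x. \<phi> x * q x)" if q: "integrable m q" for q
  proof (rule Bochner_Integration.integrable_bound[OF integrable_mult_right[OF integrable_abs[OF q], of B]])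
    show "(\<lambda>x. \<phi> x * q x) \<in> borel_measurable m" using borel_measurable_integrable[OF q] by measurable
    show "AE x in m. norm (\<phi> x * q x) \<le> norm (B * \<bar>q x\<bar>)"
      using B by (intro AE_I2) (auto simp: abs_mult intro!: mult_right_mono)
  qed
  have dens: "(\<integral>\<^sup>+x. ennreal (\<phi> x) \<partial>density m (\<lambda>x. ennreal (q x))) = ennreal (\<integral>x. \<phi> x * q x \<partial>m)"
    if q: "integrable m q" "\<And>x. 0 \<le> q x" for q
  proof -
    have [measurable]: "q \<in> borel_measurable m" using q(1) by auto
    have "(\<integral>\<^sup>+x. ennreal (\<phi> x) \<partial>density m (\<lambda>x. ennreal (q x))) = (\<integral>\<^sup>+x. ennreal (q x) * ennreal (\<phi> x) \<partial>m)"
      by (rule nn_integral_density) measurable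
    also have "\<dots> = (\<integral>\<^sup>+x. ennreal (\<phi> x * q x) \<partial>m)"
      using q(2) \<phi>(2) by (intro nn_integral_cong) (simp add: ennreal_mult mult.commute)
    also have "\<dots> = ennreal (\<integral>x. \<phi> x * q x \<partial>m)"
      using q(2) \<phi>(2) by (intro nn_integral_eq_integral[OF int[OF q(1)]]) auto
    finally show ?thesis .
  qed
  have nn: "0 \<le> (\<integral>x. \<phi> x \<partial>D)" "0 \<le> (\<integral>x. \<phi> x * gp x \<partial>m)" "0 \<le> (\<integral>x. \<phi> x * gm x \<partial>m)" for D
    using \<phi>(2) gpm by (auto intro!: integral_nonneg)
  have "(\<lambda>x. ennreal (\<phi> x)) \<in> borel_measurable R" using \<phi>R by measurable
  from key[OF this] have "ennreal ((\<integral>x. \<phi> x \<partial>N) + (\<integral>x. \<phi> x * gp x \<partial>m)) \<le> ennreal ((\<integral>x. \<phi> x \<partial>P) + (\<integral>x. \<phi> x * gm x \<partial>m))"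
    using meas[of P] meas[of N] dens[OF gpC gpm(2)] dens[OF gmC gpm(3)] nn by simp
  then have "(\<integral>x. \<phi> x \<partial>N) + (\<integral>x. \<phi> x * gp x \<partial>m) \<le> (\<integral>x. \<phi> x \<partial>P) + (\<integral>x. \<phi> x * gm x \<partial>m)"
    by (subst (asm) ennreal_le_iff) (intro add_nonneg_nonneg nn)
  moreover have "(\<integral>x. \<phi> x * g x \<partial>restrict_space \<mu> \<Omega>) = (\<integral>x. \<phi> x * g x \<partial>m)"
    unfolding m_def rs_integral[OF Cb] rs_integral[OF bo] using supp C(2)
    by (intro Bochner_Integration.integral_cong) (auto simp: indicator_def)
  moreover have "(\<integral>x. \<phi> x * g x \<partial>m) = (\<integral>x. \<phi> x * gp x - \<phi> x * gm x \<partial>m)"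
    unfolding gpm(1) right_diff_distrib ..
  moreover have "\<dots> = (\<integral>x. \<phi> x * gp x \<partial>m) - (\<integral>x. \<phi> x * gm x \<partial>m)"
    by (rule Bochner_Integration.integral_diff[OF int[OF gpC] int[OF gmC]])
  ultimately show ?thesis by (simp add: signed_integral_def P_def N_def)
qed

lemma Lip0_test_function:
  assumes \<Omega>: "open \<Omega>" and \<phi>: "\<phi> \<in> Lip0 \<Omega>"
  shows "\<phi> \<in> H1_0 \<mu> \<Omega> \<inter> Linfty \<mu> \<Omega> \<inter> Cc \<Omega>"
proof -
  have bo: "\<Omega> \<in> sets borel" "UNIV \<in> sets (borel :: 'a measure)" using \<Omega> by auto
  have L2: "u \<in> Lp (restrict_space \<mu> \<Omega>) 2" if "u \<in> Lp \<mu> 2" for u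
    using Lp2_bounded_mult[OF that, of "indicator \<Omega>" 1] bo unfolding rs_L2_iff[OF bo(1)] by (simp add: indicator_def)
  have zero: "W1p_norm \<mu> \<Omega> 2 (\<lambda>x. \<phi> x - \<phi> x) = 0"
    by (simp add: W1p_norm_def Lp2_norm)
  have "\<phi> \<in> H1_0 \<mu> \<Omega>"
    unfolding W1p_0_def W1p_closure_def mem_Collect_eq
  proof (intro exI[of _ "\<lambda>j. \<phi>"] conjI allI impI)
    show "Lp_tendsto (restrict_space \<mu> \<Omega>) 2 (\<lambda>j. \<phi>) \<phi>" by (rule Lp2_tendsto_const[OF L2[OF Lip0_L2[OF \<phi>]]])
    show "pt_Lip \<phi> \<in> Lp (restrict_space \<mu> \<Omega>) 2" by (rule L2[OF Lip0_pt_Lip_L2[OF \<phi>]])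
    show "\<exists>n0. \<forall>m\<ge>n0. \<forall>n\<ge>n0. W1p_norm \<mu> \<Omega> 2 (\<lambda>x. \<phi> x - \<phi> x) < e" if "e > 0" for e
      using that unfolding zero by simp
  qed (rule \<phi>)
  moreover have "\<phi> \<in> Linfty \<mu> \<Omega>"
  proof -
    obtain B where "\<And>x. \<bar>\<phi> x\<bar> \<le> B" using Lip0_bounded[OF \<phi>] by blast
    then show ?thesis
      using measurable_restrict_space1[OF Lip_fun_measurable[OF Lip0_Lip_fun[OF \<phi>]]] by (auto simp: Linfty_def)
  qed
  moreover have "\<phi> \<in> Cc \<Omega>"
    using Lip_fun_continuous[OF Lip0_Lip_fun[OF \<phi>]] Lip0_support[OF \<phi>] by (simp add: Cc_def)
  ultimately show ?thesis by blast
qed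

text \<open>
  The only way in which the Laplacian of \<open>f\<close> enters: tested with \<open>\<phi> \<ge> 0\<close>, the functional dominates its
  absolutely continuous part.
\<close>

lemma weak_laplacian_test:
  assumes \<Omega>: "open \<Omega>" and quad: "quadratic_form_on (Cheeger_dom \<mu>) (\<lambda>f. enn2real (Cheeger \<mu> f))"
    and G0: "min_gradient_on \<mu> \<Omega> f G0" "G0 \<in> Lp (restrict_space \<mu> \<Omega>) 2"
    and \<nu>: "measure_laplacian \<mu> \<Omega> f \<nu>" and rn: "radon_nikodym_decomposition \<mu> \<Omega> \<nu> g \<sigma>" and \<sigma>: "signed_nonneg_on \<Omega> \<sigma>"
    and \<phi>: "\<phi> \<in> Lip0 \<Omega>" "\<And>x. 0 \<le> \<phi> x"
  shows "\<exists>h. grad_inner_on \<mu> \<Omega> f \<phi> h \<and> (\<integral>x. h x \<partial>restrict_space \<mu> \<Omega>) + (\<integral>x. \<phi> x * g x \<partial>restrict_space \<mu> \<Omega>) \<le> 0"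
proof -
  let ?h = "SOME h. grad_inner_on \<mu> \<Omega> f \<phi> h"
  have "grad_inner_on \<mu> \<Omega> f \<phi> ?h" by (rule someI_ex[OF grad_inner_on_exists[OF \<Omega> quad G0 \<phi>(1)]])
  moreover have "- (\<integral>x. ?h x \<partial>restrict_space \<mu> \<Omega>) = signed_integral \<nu> \<phi>"
    using \<nu> Lip0_test_function[OF \<Omega> \<phi>(1)] unfolding measure_laplacian_def weak_laplacian_def by blast
  moreover have "(\<integral>x. \<phi> x * g x \<partial>restrict_space \<mu> \<Omega>) \<le> signed_integral \<nu> \<phi>"
    using \<nu> unfolding measure_laplacian_def by (intro signed_integral_ge[OF \<Omega> \<phi> _ rn \<sigma>]) simp
  ultimately show ?thesis by (intro exI[of _ ?h]) simp
qed

end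

section \<open>Test functions\<close>

lemma DERIV_pos_part_square: "((\<lambda>s. (max 0 (s - c))\<^sup>2) has_real_derivative 2 * max 0 (s - c)) (at (s::real))"
proof (cases s c rule: linorder_cases)
  case less
  have "((\<lambda>s::real. 0) has_real_derivative 2 * max 0 (s - c)) (at s)" using less by simp
  then show ?thesis
    by (rule has_field_derivative_transform_within_open[where S = "{..<c}"]) (use less in auto)
next
  case greater
  have "((\<lambda>s. (s - c)\<^sup>2) has_real_derivative 2 * max 0 (s - c)) (at s)"
    using greater by (auto intro!: derivative_eq_intros)
  then show ?thesis
    by (rule has_field_derivative_transform_within_open[where S = "{c<..}"]) (use greater in auto)
next
  case equal
  have "isCont (\<lambda>z. max 0 (z - c)) c" by (intro continuous_intros)
  moreover have "(max 0 (z - c))\<^sup>2 - (max 0 (c - c))\<^sup>2 = max 0 (z - c) * (z - c)" for z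
    by (simp add: power2_eq_square max_def)
  ultimately show ?thesis unfolding equal DERIV_caratheodory_within by (intro exI[of _ "\<lambda>z. max 0 (z - c)"]) simp
qed

text \<open>
  A function of class \<open>C\<^sup>1\<close> with values in \<open>[0, 1]\<close> that is positive exactly above \<open>c\<close>, with a bounded
  nonnegative derivative: as a function of \<open>f\<close> it localises to the set where \<open>f\<close> is close to its maximum.
\<close>

definition bump :: "real \<Rightarrow> real \<Rightarrow> real" where
  "bump c s = 1 - exp (- (max 0 (s - c))\<^sup>2)"

definition bump' :: "real \<Rightarrow> real \<Rightarrow> real" where
  "bump' c s = 2 * max 0 (s - c) * exp (- (max 0 (s - c))\<^sup>2)"

lemma bump_DERIV: "(bump c has_real_derivative bump' c s) (at s)"
  unfolding bump_def[abs_def] bump'_def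
  by (rule derivative_eq_intros DERIV_pos_part_square refl | simp)+

lemma bump_bounds: "0 \<le> bump c s" "bump c s \<le> 1" "0 < bump c s \<longleftrightarrow> c < s"
  by (auto simp: bump_def max_def)

lemma bump'_bounds: "0 \<le> bump' c s" "bump' c s \<le> 1"
proof -
  define p where "p = max 0 (s - c)"
  have p: "p \<ge> 0" by (simp add: p_def)
  have "2 * p \<le> 1 + p\<^sup>2" using sum_squares_bound[of p 1] by (simp add: power2_eq_square)
  also have "\<dots> \<le> exp (p\<^sup>2)" by (rule exp_ge_add_one_self)
  finally have "2 * p * exp (- p\<^sup>2) \<le> 1" by (simp add: exp_minus field_simps)
  then show "bump' c s \<le> 1" by (simp add: bump'_def p_def)
  show "0 \<le> bump' c s" by (simp add: bump'_def)
qed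

text \<open>
  The exponential below \<open>M\<close>, bent so that it stays bounded with bounded derivative above \<open>M\<close>; this makes it
  applicable to approximations of \<open>w\<close> that do not share its bound.
\<close>

definition trunc_exp :: "real \<Rightarrow> real \<Rightarrow> real" where
  "trunc_exp M s = exp (s - (max 0 (s - M))\<^sup>2)"

definition trunc_exp' :: "real \<Rightarrow> real \<Rightarrow> real" where
  "trunc_exp' M s = (1 - 2 * max 0 (s - M)) * trunc_exp M s"

lemma trunc_exp_DERIV: "(trunc_exp M has_real_derivative trunc_exp' M s) (at s)"
  unfolding trunc_exp_def[abs_def] trunc_exp'_def
  by (rule derivative_eq_intros DERIV_pos_part_square refl | simp add: trunc_exp_def)+

lemma trunc_exp_eq: "s \<le> M \<Longrightarrow> trunc_exp M s = exp s" "s \<le> M \<Longrightarrow> trunc_exp' M s = exp s"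
  by (auto simp: trunc_exp_def trunc_exp'_def max_def)

lemma trunc_exp_bounds: "0 < trunc_exp M s" "trunc_exp M s \<le> 4 * exp M" "\<bar>trunc_exp' M s\<bar> \<le> 4 * exp M"
proof -
  define p where "p = max 0 (s - M)"
  have p: "p \<ge> 0" "s \<le> M + p" by (auto simp: p_def)
  have e: "trunc_exp M s = exp (s - p\<^sup>2)" "trunc_exp' M s = (1 - 2 * p) * exp (s - p\<^sup>2)"
    by (simp_all add: trunc_exp_def trunc_exp'_def p_def)
  show "0 < trunc_exp M s" by (simp add: e)
  have "1 + 2 * p \<le> 4 * (1 + (p\<^sup>2 - p))" using zero_le_power2[of "2 * p - 3/2"] by (simp add: power2_eq_square algebra_simps)
  also have "\<dots> \<le> 4 * exp (p\<^sup>2 - p)" by (intro mult_left_mono exp_ge_add_one_self) simp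
  finally have "1 + 2 * p \<le> 4 * exp (p\<^sup>2 - p)" .
  then have "(1 + 2 * p) * exp (s - p\<^sup>2) \<le> 4 * exp (p\<^sup>2 - p) * exp (s - p\<^sup>2)" by (intro mult_right_mono) auto
  also have "\<dots> = 4 * exp (s - p)" by (simp add: exp_diff field_simps)
  also have "\<dots> \<le> 4 * exp M" using p by simp
  finally have b: "(1 + 2 * p) * exp (s - p\<^sup>2) \<le> 4 * exp M" .
  have "1 * exp (s - p\<^sup>2) \<le> (1 + 2 * p) * exp (s - p\<^sup>2)" using p by (intro mult_right_mono) auto
  also note b
  finally show "trunc_exp M s \<le> 4 * exp M" by (simp add: e)
  have "\<bar>1 - 2 * p\<bar> * exp (s - p\<^sup>2) \<le> (1 + 2 * p) * exp (s - p\<^sup>2)" using p by (intro mult_right_mono) auto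
  also note b
  finally show "\<bar>trunc_exp' M s\<bar> \<le> 4 * exp M" by (simp add: e abs_mult)
qed

lemma test_function_continuous:
  "continuous_on UNIV (bump c)" "continuous_on UNIV (trunc_exp M)" "continuous_on UNIV (trunc_exp' M)"
  unfolding bump_def[abs_def] trunc_exp_def[abs_def] trunc_exp'_def[abs_def] by (intro continuous_intros)+

lemma Lip_fun_compose_bounded_derivative:
  assumes u: "u \<in> Lip_fun" and D: "\<And>s. (\<psi> has_real_derivative \<psi>' s) (at s)" and B: "\<And>s. \<bar>\<psi>' s\<bar> \<le> B"
  shows "(\<lambda>x. \<psi> (u x)) \<in> Lip_fun"
proof -
  obtain L where L: "L-lipschitz_on UNIV u" using u unfolding Lip_fun_def by blast
  have "0 \<le> B" using B[of 0] by simp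
  then have "B-lipschitz_on (u ` UNIV) \<psi>"
    using field_differentiable_bound[of UNIV \<psi> \<psi>' B] D B
    by (intro lipschitz_onI) (auto simp: dist_norm)
  from lipschitz_on_compose2[OF L this] show ?thesis unfolding Lip_fun_def by blast
qed

text \<open>
  The product and chain rules, in the pointwise form that \<open>grad_inner_chain\<close> takes as its input.
\<close>

lemma lip_le_product_expansion:
  assumes "lip_le \<eta> x a" "lip_le v x b" "lip_le w x d"
    and \<psi>: "(\<psi> has_real_derivative \<psi>') (at (v x))" and \<kappa>: "(\<kappa> has_real_derivative \<kappa>') (at (w x))"
  shows "lip_le (\<lambda>y. \<eta> y * (\<psi> (v y) * \<kappa> (w y)) -
    (\<eta> x * \<psi>' * \<kappa> (w x) * v y + \<eta> x * \<psi> (v x) * \<kappa>' * w y + \<psi> (v x) * \<kappa> (w x) * \<eta> y)) x 0"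
proof -
  have X0: "lip_le (\<lambda>y. \<psi> (v y) - \<psi>' * v y) x 0" and Y0: "lip_le (\<lambda>y. \<kappa> (w y) - \<kappa>' * w y) x 0"
    by (rule lip_le_compose_error[OF assms(2) \<psi>], rule lip_le_compose_error[OF assms(3) \<kappa>])
  have X: "lip_le (\<lambda>y. \<psi> (v y)) x (0 + \<bar>\<psi>'\<bar> * b)" using lip_le_add[OF X0 lip_le_cmult[OF assms(2), of \<psi>']] by simp
  have Y: "lip_le (\<lambda>y. \<kappa> (w y)) x (0 + \<bar>\<kappa>'\<bar> * d)" using lip_le_add[OF Y0 lip_le_cmult[OF assms(3), of \<kappa>']] by simp
  note 1 = lip_le_mult_error[OF assms(1) lip_le_mult[OF X Y]]
  note 2 = lip_le_cmult[OF lip_le_mult_error[OF X Y], of "\<eta> x"]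
  note 3 = lip_le_cmult[OF X0, of "\<eta> x * \<kappa> (w x)"]
  note 4 = lip_le_cmult[OF Y0, of "\<eta> x * \<psi> (v x)"]
  from lip_le_add[OF lip_le_add[OF 1 2] lip_le_add[OF 3 4]] show ?thesis
    by (simp add: algebra_simps)
qed

context mm_space
begin

lemma grad_inner_product_chain:
  assumes \<Omega>: "open \<Omega>" and G0: "min_gradient_on \<mu> \<Omega> f G0"
    and \<eta>: "\<eta> \<in> Lip0 \<Omega>" and v: "v \<in> Lip0 \<Omega>" and w: "w \<in> Lip0 \<Omega>"
    and \<psi>: "\<And>s. (\<psi> has_real_derivative \<psi>' s) (at s)" and \<kappa>: "\<And>s. (\<kappa> has_real_derivative \<kappa>' s) (at s)"
    and h: "grad_inner_on \<mu> \<Omega> f (\<lambda>y. \<eta> y * (\<psi> (v y) * \<kappa> (w y))) h" and \<phi>: "(\<lambda>y. \<eta> y * (\<psi> (v y) * \<kappa> (w y))) \<in> Lip0 \<Omega>"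
    and p: "grad_inner_on \<mu> \<Omega> f v p" and q: "grad_inner_on \<mu> \<Omega> f w q" and e: "grad_inner_on \<mu> \<Omega> f \<eta> e"
  shows "AE x in \<mu>. x \<in> \<Omega> \<longrightarrow> h x = \<eta> x * \<psi>' (v x) * \<kappa> (w x) * p x + \<eta> x * \<psi> (v x) * \<kappa>' (w x) * q x + \<psi> (v x) * \<kappa> (w x) * e x"
proof -
  define V H A where "V i = (if i = 0 then v else if i = 1 then w else \<eta>)"
    and "H i = (if i = 0 then p else if i = 1 then q else e)"
    and "A i x = (if i = 0 then \<eta> x * \<psi>' (v x) * \<kappa> (w x) else if i = 1 then \<eta> x * \<psi> (v x) * \<kappa>' (w x) else \<psi> (v x) * \<kappa> (w x))"
    for i :: nat and x
  have "AE x in \<mu>. x \<in> \<Omega> \<longrightarrow> h x = (\<Sum>i\<in>{0, 1, 2}. A i x * H i x)"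
  proof (rule grad_inner_chain[OF \<Omega> _ h _ G0 \<phi>])
    show "grad_inner_on \<mu> \<Omega> f (V i) (H i)" "V i \<in> Lip0 \<Omega>" for i using p q e v w \<eta> by (simp_all add: V_def H_def)
    fix x
    obtain a b d where L: "lip_le \<eta> x a" "lip_le v x b" "lip_le w x d"
      using Lip_fun_lip_le[OF Lip0_Lip_fun[OF \<eta>]] Lip_fun_lip_le[OF Lip0_Lip_fun[OF v]] Lip_fun_lip_le[OF Lip0_Lip_fun[OF w]] by blast
    show "lip_le (\<lambda>y. \<eta> y * (\<psi> (v y) * \<kappa> (w y)) - (\<Sum>i\<in>{0, 1, 2}. A i x * V i y)) x 0"
      using lip_le_product_expansion[OF L \<psi> \<kappa>] by (simp add: A_def V_def add.assoc)
  qed simp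
  then show ?thesis by eventually_elim (simp add: A_def H_def add.assoc)
qed

section \<open>Testing with functions of the maximum\<close>

lemma integrable_Lip0_mult:
  assumes \<Omega>: "open \<Omega>" and \<eta>: "\<eta> \<in> Lip0 \<Omega>"
    and L: "L \<in> borel_measurable (restrict_space \<mu> \<Omega>)" "\<And>C. compact C \<Longrightarrow> C \<subseteq> \<Omega> \<Longrightarrow> integrable (restrict_space \<mu> C) L"
  shows "integrable (restrict_space \<mu> \<Omega>) (\<lambda>x. \<eta> x * L x)"
proof -
  have bo: "\<Omega> \<in> sets borel" using \<Omega> by auto
  define C where "C = closure {x. \<eta> x \<noteq> 0}"
  have C: "compact C" "C \<subseteq> \<Omega>" using Lip0_support[OF \<eta>] by (auto simp: compactly_inside_def C_def)
  have supp: "\<eta> x = 0" if "x \<notin> C" for x using that closure_subset[of "{x. \<eta> x \<noteq> 0}"] by (auto simp: C_def)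
  obtain B where B: "B \<ge> 0" "\<And>x. \<bar>\<eta> x\<bar> \<le> B" using Lip0_bounded[OF \<eta>] by blast
  have i: "integrable \<mu> (\<lambda>x. indicator C x * L x)" using L(2)[OF C] unfolding rs_integrable[OF borel_compact[OF C(1)]] .
  have m: "(\<lambda>x. \<eta> x * L x) \<in> borel_measurable (restrict_space \<mu> \<Omega>)"
    by (intro borel_measurable_times L(1) measurable_restrict_space1 Lip_fun_measurable Lip0_Lip_fun[OF \<eta>])
  show ?thesis unfolding rs_integrable[OF bo]
  proof (rule Bochner_Integration.integrable_bound[OF integrable_mult_right[OF integrable_abs[OF i], of B]])
    show "(\<lambda>x. indicator \<Omega> x * (\<eta> x * L x)) \<in> borel_measurable \<mu>" using m unfolding rs_measurable[OF bo] .
    show "AE x in \<mu>. norm (indicator \<Omega> x * (\<eta> x * L x)) \<le> norm (B * \<bar>indicator C x * L x\<bar>)"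
    proof (intro AE_I2)
      fix x
      have "\<bar>\<eta> x\<bar> * \<bar>L x\<bar> \<le> B * \<bar>L x\<bar>" using B by (intro mult_right_mono) auto
      then show "norm (indicator \<Omega> x * (\<eta> x * L x)) \<le> norm (B * \<bar>indicator C x * L x\<bar>)"
        using supp[of x] B(1) by (auto simp: indicator_def abs_mult)
    qed
  qed
qed

text \<open>
  Test the Laplacian of \<open>f\<close> with \<open>\<phi> = \<eta> \<psi>(f) e\<^sup>w\<close>, where \<open>\<psi>\<close> is \<open>bump c\<close>.  By the chain rule \<open>\<langle>\<nabla>f, \<nabla>\<phi>\<rangle>\<close> is the sum of
  \<open>\<eta> \<psi>'(f) e\<^sup>w \<bar>\<nabla>f\<bar>\<^sup>2 \<ge> 0\<close>, of \<open>\<eta> \<psi>(f) e\<^sup>w \<langle>\<nabla>f, \<nabla>w\<rangle>\<close> and of \<open>\<psi>(f) e\<^sup>w \<langle>\<nabla>f, \<nabla>\<eta>\<rangle>\<close>, and the last term vanishes because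
  \<open>\<nabla>\<eta> = 0\<close> on \<open>U\<close> and \<open>\<psi>(f) = 0\<close> off \<open>U\<close>.  The factor \<open>e\<^sup>w\<close> thus produces the drift term.  The function \<open>\<phi>\<close> is not
  Lipschitz, so the argument is carried out for locally Lipschitz approximations of \<open>f\<close> and \<open>w\<close>; the
  errors are bounded by \<open>\<bar>\<nabla>f\<bar>\<close> times gradients that are small in \<open>L\<^sup>2\<close>.
\<close>

lemma weak_maximum_inequality:
  assumes \<Omega>: "open \<Omega>" and quad: "quadratic_form_on (Cheeger_dom \<mu>) (\<lambda>f. enn2real (Cheeger \<mu> f))"
    and f: "f \<in> H1 \<mu> \<Omega>" and w: "w \<in> H1 \<mu> \<Omega>" and k: "grad_inner_on \<mu> \<Omega> f w k"
    and G0: "min_gradient_on \<mu> \<Omega> f G0" "G0 \<in> Lp (restrict_space \<mu> \<Omega>) 2"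
    and L: "L \<in> borel_measurable (restrict_space \<mu> \<Omega>)" "\<And>C. compact C \<Longrightarrow> C \<subseteq> \<Omega> \<Longrightarrow> integrable (restrict_space \<mu> C) L"
    and weak: "\<And>\<phi>. \<phi> \<in> Lip0 \<Omega> \<Longrightarrow> (\<And>x. 0 \<le> \<phi> x) \<Longrightarrow>
      \<exists>h. grad_inner_on \<mu> \<Omega> f \<phi> h \<and> (\<integral>x. h x \<partial>restrict_space \<mu> \<Omega>) + (\<integral>x. \<phi> x * L x \<partial>restrict_space \<mu> \<Omega>) \<le> 0"
    and \<eta>: "\<eta> \<in> Lip0 \<Omega>" "\<And>x. 0 \<le> \<eta> x \<and> \<eta> x \<le> 1" and U: "open U" "\<And>x. x \<in> U \<Longrightarrow> \<eta> x = 1"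
    and fc: "AE x in \<mu>. x \<in> \<Omega> \<longrightarrow> x \<notin> U \<longrightarrow> f x \<le> c" and wM: "AE x in \<mu>. x \<in> \<Omega> \<longrightarrow> w x \<le> M"
  shows "integrable (restrict_space \<mu> \<Omega>) (\<lambda>x. \<eta> x * bump c (f x) * exp (w x) * (L x + k x))"
    and "(\<integral>x. \<eta> x * bump c (f x) * exp (w x) * (L x + k x) \<partial>restrict_space \<mu> \<Omega>) \<le> 0"
proof -
  let ?M = "restrict_space \<mu> \<Omega>"
  have bo: "\<Omega> \<in> sets borel" using \<Omega> by auto
  define C where "C = closure {x. \<eta> x \<noteq> 0}"
  have C: "compact C" "C \<subseteq> \<Omega>" using Lip0_support[OF \<eta>(1)] by (auto simp: compactly_inside_def C_def)
  have supp: "\<eta> x = 0" if "x \<notin> C" for x using that closure_subset[of "{x. \<eta> x \<noteq> 0}"] by (auto simp: C_def)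
  obtain \<xi> V where \<xi>: "\<xi> \<in> Lip0 \<Omega>" and V: "open V" "C \<subseteq> V" "V \<subseteq> \<Omega>" "\<And>x. x \<in> V \<Longrightarrow> \<xi> x = 1"
    using Lip0_cutoff[OF C(1) \<Omega> C(2)] by blast
  define B where "B = 4 * exp M"
  have B: "B \<ge> 0" by (simp add: B_def)
  \<comment> \<open>Approximating sequences that converge almost everywhere.\<close>
  obtain F a where F: "\<forall>n. F n \<in> Lip_loc \<Omega>" "Lp_tendsto ?M 2 F f"
    and a: "\<forall>n. a n \<in> Lp ?M 2" "(\<lambda>n. Lp_norm ?M 2 (a n)) \<longlonglongrightarrow> 0"
      "\<forall>n V. open V \<longrightarrow> V \<subseteq> \<Omega> \<longrightarrow> upper_grad_on V (\<lambda>x. F n x - f x) (a n)"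
    using H1_approximation[OF \<Omega> f] by (elim exE conjE) (rule that)
  obtain W b where W: "\<forall>n. W n \<in> Lip_loc \<Omega>" "Lp_tendsto ?M 2 W w"
    and b: "\<forall>n. b n \<in> Lp ?M 2" "(\<lambda>n. Lp_norm ?M 2 (b n)) \<longlonglongrightarrow> 0"
      "\<forall>n V. open V \<longrightarrow> V \<subseteq> \<Omega> \<longrightarrow> upper_grad_on V (\<lambda>x. W n x - w x) (b n)"
    using H1_approximation[OF \<Omega> w] by (elim exE conjE) (rule that)
  obtain r1 where r1: "strict_mono r1" "AE x in ?M. (\<lambda>n. F (r1 n) x) \<longlonglongrightarrow> f x"
    using Lp2_tendsto_AE_subseq[OF F(2)] by blast
  obtain r2 where r2: "strict_mono r2" "AE x in ?M. (\<lambda>n. W (r1 (r2 n)) x) \<longlonglongrightarrow> w x"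
    using Lp2_tendsto_AE_subseq[OF Lp2_tendsto_subseq[OF W(2) r1(1)]] by blast
  define r where "r n = r1 (r2 n)" for n
  have r: "strict_mono r" using strict_mono_o[OF r1(1) r2(1)] by (simp add: o_def r_def[abs_def])
  have Flim: "AE x in ?M. (\<lambda>n. F (r n) x) \<longlonglongrightarrow> f x"
    using r1(2)
  proof eventually_elim
    case (elim x)
    show ?case using LIMSEQ_subseq_LIMSEQ[OF elim r2(1)] by (simp add: o_def r_def)
  qed
  have Wlim: "AE x in ?M. (\<lambda>n. W (r n) x) \<longlonglongrightarrow> w x" using r2(2) unfolding r_def .
  have alim: "(\<lambda>n. Lp_norm ?M 2 (a (r n))) \<longlonglongrightarrow> 0" "(\<lambda>n. Lp_norm ?M 2 (b (r n))) \<longlonglongrightarrow> 0"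
    using LIMSEQ_subseq_LIMSEQ[OF a(2) r] LIMSEQ_subseq_LIMSEQ[OF b(2) r] by (simp_all add: o_def)
  define v z where "v n x = \<xi> x * F (r n) x" and "z n x = \<xi> x * W (r n) x" for n x
  have v: "v n \<in> Lip0 \<Omega>" and z: "z n \<in> Lip0 \<Omega>" for n
    unfolding v_def[abs_def] z_def[abs_def] by (rule Lip0_mult_Lip_loc[OF \<Omega> \<xi>], use F W in blast)+
  define \<phi> where "\<phi> n = (\<lambda>y. \<eta> y * (bump c (v n y) * trunc_exp M (z n y)))" for n
  have \<phi>: "\<phi> n \<in> Lip0 \<Omega>" "0 \<le> \<phi> n x" for n x
  proof -
    have 1: "(\<lambda>y. bump c (v n y)) \<in> Lip_fun"
      by (rule Lip_fun_compose_bounded_derivative[OF Lip0_Lip_fun[OF v] bump_DERIV, where B = 1]) (use bump'_bounds in auto)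
    have 2: "(\<lambda>y. trunc_exp M (z n y)) \<in> Lip_fun"
      by (rule Lip_fun_compose_bounded_derivative[OF Lip0_Lip_fun[OF z] trunc_exp_DERIV trunc_exp_bounds(3)])
    show "\<phi> n \<in> Lip0 \<Omega>" using Lip0_mult[OF \<Omega> Lip0_mult[OF \<Omega> \<eta>(1) 1] 2] by (simp add: \<phi>_def mult.assoc)
    show "0 \<le> \<phi> n x" unfolding \<phi>_def
      by (intro mult_nonneg_nonneg bump_bounds(1) order.strict_implies_order[OF trunc_exp_bounds(1)]) (use \<eta>(2) in blast)
  qed
  have "\<exists>h. grad_inner_on \<mu> \<Omega> f (\<phi> n) h \<and> integral\<^sup>L ?M h + (\<integral>x. \<phi> n x * L x \<partial>?M) \<le> 0" for n
    by (rule weak[OF \<phi>])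
  then obtain h where "\<forall>n. grad_inner_on \<mu> \<Omega> f (\<phi> n) (h n) \<and> integral\<^sup>L ?M (h n) + (\<integral>x. \<phi> n x * L x \<partial>?M) \<le> 0"
    by (rule exE[OF choice[OF allI]])
  then have h: "grad_inner_on \<mu> \<Omega> f (\<phi> n) (h n)" "integral\<^sup>L ?M (h n) + (\<integral>x. \<phi> n x * L x \<partial>?M) \<le> 0" for n
    by blast+
  obtain p where p': "\<forall>n. grad_inner_on \<mu> \<Omega> f (v n) (p n)"
    by (rule exE[OF choice[OF allI[OF grad_inner_on_exists[OF \<Omega> quad G0 v]]]])
  then have p: "grad_inner_on \<mu> \<Omega> f (v n) (p n)" for n by blast
  obtain q where q': "\<forall>n. grad_inner_on \<mu> \<Omega> f (z n) (q n)"
    by (rule exE[OF choice[OF allI[OF grad_inner_on_exists[OF \<Omega> quad G0 z]]]])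
  then have q: "grad_inner_on \<mu> \<Omega> f (z n) (q n)" for n by blast
  obtain e where e: "grad_inner_on \<mu> \<Omega> f \<eta> e" using grad_inner_on_exists[OF \<Omega> quad G0 \<eta>(1)] by blast
  have chain: "AE x in \<mu>. x \<in> \<Omega> \<longrightarrow> h n x = \<eta> x * bump' c (v n x) * trunc_exp M (z n x) * p n x
      + \<eta> x * bump c (v n x) * trunc_exp' M (z n x) * q n x + bump c (v n x) * trunc_exp M (z n x) * e x" for n
    by (rule grad_inner_product_chain[OF \<Omega> G0(1) \<eta>(1) v z bump_DERIV trunc_exp_DERIV h(1)[unfolded \<phi>_def] \<phi>(1)[unfolded \<phi>_def] p q e])
  have bV: "V \<in> sets borel" using V(1) by auto
  have pclose: "AE x in \<mu>. x \<in> V \<longrightarrow> \<bar>p n x - (G0 x)\<^sup>2\<bar> \<le> G0 x * a (r n) x" for n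
  proof (rule grad_inner_close[OF \<Omega> V(1,3) p grad_inner_on_self[OF \<Omega> G0] G0(1)])
    show "upper_grad_on V (\<lambda>x. v n x - f x) (a (r n))"
      by (rule upper_grad_on_cong[of V "\<lambda>x. F (r n) x - f x"]) (use a(3) V in \<open>auto simp: v_def\<close>)
    show "a (r n) \<in> Lp (restrict_space \<mu> V) 2" using a(1) by (intro rs_L2_subset[OF bo bV V(3)]) simp
  qed
  have qclose: "AE x in \<mu>. x \<in> V \<longrightarrow> \<bar>q n x - k x\<bar> \<le> G0 x * b (r n) x" for n
  proof (rule grad_inner_close[OF \<Omega> V(1,3) q k G0(1)])
    show "upper_grad_on V (\<lambda>x. z n x - w x) (b (r n))"
      by (rule upper_grad_on_cong[of V "\<lambda>x. W (r n) x - w x"]) (use b(3) V in \<open>auto simp: z_def\<close>)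
    show "b (r n) \<in> Lp (restrict_space \<mu> V) 2" using b(1) by (intro rs_L2_subset[OF bo bV V(3)]) simp
  qed
  \<comment> \<open>The inner product with \<open>\<nabla>\<eta>\<close> lives where \<open>\<eta>\<close> is not locally constant.\<close>
  have e0: "AE x in \<mu>. x \<in> \<Omega> \<longrightarrow> e x \<noteq> 0 \<longrightarrow> x \<in> V \<and> x \<notin> U"
  proof -
    have ug: "upper_grad_on \<Omega> (\<lambda>x. \<eta> x - 0) (pt_Lip \<eta>)"
      using upper_grad_on_Lip0[OF \<Omega> Lip0_Lip_fun[OF \<eta>(1)]] by simp
    have L2: "pt_Lip \<eta> \<in> Lp ?M 2"
      by (rule rs_L2_subset[OF _ bo subset_UNIV]) (use Lip0_pt_Lip_L2[OF \<eta>(1)] in \<open>simp_all add: rs_L2_iff\<close>)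
    have "AE x in \<mu>. x \<in> \<Omega> \<longrightarrow> \<bar>e x - 0\<bar> \<le> G0 x * pt_Lip \<eta> x"
      by (rule grad_inner_close[OF \<Omega> \<Omega> order_refl e grad_inner_on_zero[OF e] G0(1) ug L2])
    then show ?thesis
    proof eventually_elim
      case (elim x)
      show ?case
      proof (intro impI)
        assume x: "x \<in> \<Omega>" "e x \<noteq> 0"
        then have n0: "pt_Lip \<eta> x \<noteq> 0" using elim by auto
        have "x \<in> V" using n0 pt_Lip_outside[of x \<eta>] V(2) by (auto simp: C_def)
        moreover have "x \<notin> U"
        proof
          assume xU: "x \<in> U"
          have "pt_Lip \<eta> x = pt_Lip (\<lambda>x. 1) x" by (rule pt_Lip_local[OF U(1) xU U(2) lip_le_0])
          then show False using n0 by simp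
        qed
        ultimately show "x \<in> V \<and> x \<notin> U" by blast
      qed
    qed
  qed
  define T where "T n x = \<eta> x * bump c (v n x) * trunc_exp' M (z n x) * k x + bump c (v n x) * trunc_exp M (z n x) * e x + \<phi> n x * L x" for n x
  have abs_bound: "\<bar>\<eta> x * s * t * y\<bar> \<le> B * \<bar>y\<bar>" if "0 \<le> s" "s \<le> 1" "\<bar>t\<bar> \<le> B" for s t y x
  proof -
    have "\<bar>\<eta> x\<bar> * \<bar>s\<bar> * \<bar>t\<bar> \<le> 1 * 1 * B" using \<eta>(2)[of x] that by (intro mult_mono) auto
    then have "\<bar>\<eta> x\<bar> * \<bar>s\<bar> * \<bar>t\<bar> * \<bar>y\<bar> \<le> B * \<bar>y\<bar>" by (intro mult_right_mono) auto
    then show ?thesis by (simp add: abs_mult)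
  qed
  have tB: "\<bar>trunc_exp M s\<bar> \<le> B" "\<bar>trunc_exp' M s\<bar> \<le> B" for s
    using trunc_exp_bounds[of M s] by (simp_all add: B_def)
  \<comment> \<open>Here the term with \<open>\<bar>\<nabla>f\<bar>\<^sup>2\<close> is dropped.\<close>
  have lower: "AE x in ?M. T n x - \<phi> n x * L x - B * \<bar>G0 x * a (r n) x\<bar> - B * \<bar>G0 x * b (r n) x\<bar> \<le> h n x" for n
    unfolding rs_AE[OF bo]
    using chain[of n] pclose[of n] qclose[of n]
  proof eventually_elim
    case (elim x)
    show ?case
    proof
      assume x: "x \<in> \<Omega>"
      let ?s = "\<eta> x * bump' c (v n x) * trunc_exp M (z n x)" and ?t = "\<eta> x * bump c (v n x) * trunc_exp' M (z n x)"
      have "- (B * \<bar>G0 x * a (r n) x\<bar>) \<le> ?s * p n x \<and> ?t * k x - B * \<bar>G0 x * b (r n) x\<bar> \<le> ?t * q n x"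
      proof (cases "x \<in> V")
        case True
        have s0: "0 \<le> ?s"
          using \<eta>(2)[of x] bump'_bounds(1) trunc_exp_bounds(1)[of M "z n x"] by (intro mult_nonneg_nonneg) auto
        have "?s * (- \<bar>G0 x * a (r n) x\<bar>) \<le> ?s * p n x"
        proof (rule mult_left_mono[OF _ s0])
          show "- \<bar>G0 x * a (r n) x\<bar> \<le> p n x" using elim(2) True zero_le_power2[of "G0 x"] by linarith
        qed
        moreover have "\<bar>?s * \<bar>G0 x * a (r n) x\<bar>\<bar> \<le> B * \<bar>\<bar>G0 x * a (r n) x\<bar>\<bar>"
          by (rule abs_bound[OF bump'_bounds tB(1)])
        moreover have "\<bar>?t * (q n x - k x)\<bar> \<le> B * \<bar>q n x - k x\<bar>" by (rule abs_bound[OF bump_bounds(1,2) tB(2)])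
        moreover have "B * \<bar>q n x - k x\<bar> \<le> B * \<bar>G0 x * b (r n) x\<bar>"
          using elim(3) True by (intro mult_left_mono[OF _ B]) linarith
        ultimately show ?thesis unfolding right_diff_distrib mult_minus_right by linarith
      next
        case False
        then have "\<eta> x = 0" using supp V(2) by blast
        then show ?thesis using B by simp
      qed
      then show "T n x - \<phi> n x * L x - B * \<bar>G0 x * a (r n) x\<bar> - B * \<bar>G0 x * b (r n) x\<bar> \<le> h n x"
        using elim(1)[rule_format, OF x] unfolding T_def by linarith
    qed
  qed
  define T' where "T' x = \<eta> x * bump c (f x) * exp (w x) * (L x + k x)" for x
  define D where "D x = B * \<bar>k x\<bar> + B * \<bar>e x\<bar> + B * \<bar>\<eta> x * L x\<bar>" for x
  have ki: "integrable ?M k" and ei: "integrable ?M e" by (rule grad_inner_onD(2)[OF k], rule grad_inner_onD(2)[OF e])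
  have \<eta>L: "integrable ?M (\<lambda>x. \<eta> x * L x)" by (rule integrable_Lip0_mult[OF \<Omega> \<eta>(1) L])
  have \<phi>L: "integrable ?M (\<lambda>x. \<phi> n x * L x)" for n by (rule integrable_Lip0_mult[OF \<Omega> \<phi>(1) L])
  have Di: "integrable ?M D" unfolding D_def[abs_def]
    by (intro Bochner_Integration.integrable_add integrable_mult_right integrable_abs ki ei \<eta>L)
  note [measurable] = borel_measurable_continuous_onI[OF test_function_continuous(1)]
    borel_measurable_continuous_onI[OF test_function_continuous(2)] borel_measurable_continuous_onI[OF test_function_continuous(3)]
    borel_measurable_integrable[OF ki] borel_measurable_integrable[OF ei] L(1)
  have Lm: "u \<in> borel_measurable ?M" if "u \<in> Lip0 \<Omega>" for u
    by (rule measurable_restrict_space1[OF Lip_fun_measurable[OF Lip0_Lip_fun[OF that]]])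
  note [measurable] = Lm[OF v] Lm[OF z] Lm[OF \<eta>(1)] Lm[OF \<phi>(1)]
    Lp2_measurable[OF Lp2_tendstoD(2)[OF F(2)]] Lp2_measurable[OF Lp2_tendstoD(2)[OF W(2)]]
  have Tm: "T n \<in> borel_measurable ?M" for n unfolding T_def[abs_def] by measurable
  have T'm: "T' \<in> borel_measurable ?M" unfolding T'_def[abs_def] by measurable
  have Tlim: "AE x in ?M. (\<lambda>n. T n x) \<longlonglongrightarrow> T' x"
    using Flim Wlim e0 fc wM unfolding rs_AE[OF bo]
  proof eventually_elim
    case (elim x)
    show ?case
    proof
      assume x: "x \<in> \<Omega>"
      show "(\<lambda>n. T n x) \<longlonglongrightarrow> T' x"
      proof (cases "x \<in> V")
        case True
        have vl: "(\<lambda>n. v n x) \<longlonglongrightarrow> f x" and zl: "(\<lambda>n. z n x) \<longlonglongrightarrow> w x"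
          using elim(1,2) x V(4)[OF True] by (simp_all add: v_def z_def)
        have cont: "isCont (bump c) s" "isCont (trunc_exp M) s" "isCont (trunc_exp' M) s" for s
          using test_function_continuous by (simp_all add: continuous_on_eq_continuous_at)
        have lims: "(\<lambda>n. bump c (v n x)) \<longlonglongrightarrow> bump c (f x)" "(\<lambda>n. trunc_exp M (z n x)) \<longlonglongrightarrow> trunc_exp M (w x)"
          "(\<lambda>n. trunc_exp' M (z n x)) \<longlonglongrightarrow> trunc_exp' M (w x)"
          by (rule isCont_tendsto_compose[OF cont(1) vl], rule isCont_tendsto_compose[OF cont(2) zl],
              rule isCont_tendsto_compose[OF cont(3) zl])
        have "(\<lambda>n. T n x) \<longlonglongrightarrow> \<eta> x * bump c (f x) * trunc_exp' M (w x) * k x + bump c (f x) * trunc_exp M (w x) * e x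
            + \<eta> x * (bump c (f x) * trunc_exp M (w x)) * L x"
          unfolding T_def \<phi>_def by (intro tendsto_intros lims)
        moreover have "bump c (f x) * e x = 0"
        proof (cases "e x = 0")
          case False
          then have "f x \<le> c" using elim(3,4) x by blast
          then have "bump c (f x) = 0" using bump_bounds(1,3)[of c "f x"] by linarith
          then show ?thesis by simp
        qed simp
        then have "bump c (f x) * trunc_exp M (w x) * e x = 0" by auto
        moreover have "w x \<le> M" using elim(5) x by blast
        then have "T' x = \<eta> x * bump c (f x) * trunc_exp' M (w x) * k x + 0
            + \<eta> x * (bump c (f x) * trunc_exp M (w x)) * L x"
          by (simp add: T'_def trunc_exp_eq algebra_simps)
        ultimately show ?thesis by (simp only:)
      next
        case False
        then have "\<eta> x = 0" "e x = 0" using supp V(2) elim(3) x by blast+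
        then show ?thesis by (simp add: T_def T'_def \<phi>_def)
      qed
    qed
  qed
  have TD: "AE x in ?M. norm (T n x) \<le> D x" for n
  proof (intro AE_I2)
    fix x
    have 1: "\<bar>\<eta> x * bump c (v n x) * trunc_exp' M (z n x) * k x\<bar> \<le> B * \<bar>k x\<bar>"
      by (rule abs_bound[OF bump_bounds(1,2) tB(2)])
    have "\<bar>bump c (v n x)\<bar> * \<bar>trunc_exp M (z n x)\<bar> \<le> 1 * B" using bump_bounds[of c "v n x"] tB(1) by (intro mult_mono) auto
    then have m: "\<bar>bump c (v n x) * trunc_exp M (z n x)\<bar> \<le> B" by (simp add: abs_mult)
    have 2: "\<bar>bump c (v n x) * trunc_exp M (z n x) * e x\<bar> \<le> B * \<bar>e x\<bar>"
      unfolding abs_mult[of _ "e x"] by (rule mult_right_mono[OF m]) simp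
    have "\<bar>bump c (v n x) * trunc_exp M (z n x) * (\<eta> x * L x)\<bar> \<le> B * \<bar>\<eta> x * L x\<bar>"
      unfolding abs_mult[of _ "\<eta> x * L x"] by (rule mult_right_mono[OF m]) simp
    then have 3: "\<bar>\<phi> n x * L x\<bar> \<le> B * \<bar>\<eta> x * L x\<bar>" by (simp add: \<phi>_def ac_simps)
    show "norm (T n x) \<le> D x" unfolding T_def D_def real_norm_def using 1 2 3 by linarith
  qed
  have Ti: "integrable ?M (T n)" for n
    by (rule Bochner_Integration.integrable_bound[OF Di Tm]) (use TD[of n] in eventually_elim, simp)
  show "integrable ?M (\<lambda>x. \<eta> x * bump c (f x) * exp (w x) * (L x + k x))"
    using integrable_dominated_convergence[OF T'm Tm Di Tlim TD] by (simp add: T'_def[abs_def])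
  have lim: "(\<lambda>n. integral\<^sup>L ?M (T n)) \<longlonglongrightarrow> integral\<^sup>L ?M T'"
    by (rule integral_dominated_convergence[OF T'm Tm Di Tlim TD])
  define E where "E n = B * (Lp_norm ?M 2 G0 * Lp_norm ?M 2 (a (r n))) + B * (Lp_norm ?M 2 G0 * Lp_norm ?M 2 (b (r n)))" for n
  have "E \<longlonglongrightarrow> B * (Lp_norm ?M 2 G0 * 0) + B * (Lp_norm ?M 2 G0 * 0)"
    unfolding E_def[abs_def] by (intro tendsto_intros alim)
  then have Elim: "E \<longlonglongrightarrow> 0" by simp
  have TE: "integral\<^sup>L ?M (T n) \<le> E n" for n
  proof -
    have ai: "integrable ?M (\<lambda>x. G0 x * a (r n) x)" "integrable ?M (\<lambda>x. G0 x * b (r n) x)"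
      using a(1) b(1) by (auto intro!: Lp2_integrable_mult[OF G0(2)])
    have CS: "(\<integral>x. \<bar>G0 x * a (r n) x\<bar> \<partial>?M) \<le> Lp_norm ?M 2 G0 * Lp_norm ?M 2 (a (r n))"
      "(\<integral>x. \<bar>G0 x * b (r n) x\<bar> \<partial>?M) \<le> Lp_norm ?M 2 G0 * Lp_norm ?M 2 (b (r n))"
      using a(1) b(1) by (auto intro!: Lp2_Cauchy_Schwarz_abs[OF G0(2)])
    have "(\<integral>x. T n x - \<phi> n x * L x - B * \<bar>G0 x * a (r n) x\<bar> - B * \<bar>G0 x * b (r n) x\<bar> \<partial>?M) \<le> integral\<^sup>L ?M (h n)"
      by (intro integral_mono_AE[OF _ grad_inner_onD(2)[OF h(1)] lower]
          Bochner_Integration.integrable_diff integrable_mult_right integrable_abs Ti \<phi>L ai)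
    also have "(\<integral>x. T n x - \<phi> n x * L x - B * \<bar>G0 x * a (r n) x\<bar> - B * \<bar>G0 x * b (r n) x\<bar> \<partial>?M)
        = integral\<^sup>L ?M (T n) - (\<integral>x. \<phi> n x * L x \<partial>?M) - B * (\<integral>x. \<bar>G0 x * a (r n) x\<bar> \<partial>?M) - B * (\<integral>x. \<bar>G0 x * b (r n) x\<bar> \<partial>?M)"
      using Ti[of n] \<phi>L[of n] integrable_abs[OF ai(1)] integrable_abs[OF ai(2)] by simp
    finally show ?thesis
      using h(2)[of n] mult_left_mono[OF CS(1) B] mult_left_mono[OF CS(2) B] unfolding E_def by linarith
  qed
  have "integral\<^sup>L ?M T' \<le> 0" by (rule LIMSEQ_le[OF lim Elim]) (use TE in blast)
  then show "(\<integral>x. \<eta> x * bump c (f x) * exp (w x) * (L x + k x) \<partial>?M) \<le> 0" by (simp add: T'_def[abs_def])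
qed

end

section \<open>The maximum principle\<close>

text \<open>
  If no point of \<open>U\<close> were as required, then \<open>Lac + innerfw\<close> would be positive almost everywhere on
  \<open>{f > c}\<close> for a level \<open>c\<close> just below the maximum.  The integral in \<open>weak_maximum_inequality\<close> is then that of
  a nonnegative function and at most zero, so \<open>f \<le> c\<close> almost everywhere, against the choice of \<open>c\<close>.
\<close>

theorem theorem1p3:
  fixes \<mu> :: "'a::{heine_borel, second_countable_topology} measure"
    and K N :: real
    and \<Omega> U :: "'a set"
    and f w Lac innerfw :: "'a \<Rightarrow> real"
    and Lf Lsing :: "'a signed_measure"
  assumes "metric_measure_space \<mu>"
    and "N \<ge> 1"
    and "RCD_star K N \<mu>"
    and "open \<Omega>" and "connected \<Omega>" and "bounded \<Omega>"
    and "f \<in> H1 \<mu> \<Omega> \<inter> Linfty_loc \<mu> \<Omega>"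
    and "measure_laplacian \<mu> \<Omega> f Lf"
    and "radon_nikodym_decomposition \<mu> \<Omega> Lf Lac Lsing"
    and "signed_nonneg_on \<Omega> Lsing"
    and "open U" and "U \<subset>\<subset> \<Omega>"
    and "ess_sup_on \<mu> U f > ess_sup_on \<mu> (\<Omega> - U) f"
    and "w \<in> H1 \<mu> \<Omega> \<inter> Linfty \<mu> \<Omega>"
    and "grad_inner_on \<mu> \<Omega> f w innerfw"
  shows "\<exists>x :: nat \<Rightarrow> 'a. \<forall>j\<ge>1.
           x j \<in> U \<and>
           approx_continuity_point \<mu> Lac (x j) \<and>
           approx_continuity_point \<mu> innerfw (x j) \<and>
           ereal (f (x j)) \<ge> ess_sup_on \<mu> \<Omega> f - ereal (1 / real j) \<and>
           Lac (x j) + innerfw (x j) \<le> 1 / real j"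
proof -
  interpret mm_space \<mu> by unfold_locales fact
  let ?M = "restrict_space \<mu> \<Omega>"
  note \<Omega> = \<open>open \<Omega>\<close> and U = \<open>open U\<close> and rn = assms(9) and inner = assms(15)
  have CD: "CD_star K N \<mu>" and quad: "quadratic_form_on (Cheeger_dom \<mu>) (\<lambda>f. enn2real (Cheeger \<mu> f))"
    using assms(3) by (auto simp: RCD_star_def)
  have f: "f \<in> H1 \<mu> \<Omega>" and w: "w \<in> H1 \<mu> \<Omega>" using assms(7,14) by auto
  have clU: "compact (closure U)" "closure U \<subseteq> \<Omega>" using assms(12) by (auto simp: compactly_inside_def)
  then have U\<Omega>: "U \<subseteq> \<Omega>" using closure_subset[of U] by blast
  have b: "\<Omega> \<in> sets borel" "U \<in> sets borel" "\<Omega> - U \<in> sets borel" using \<Omega> U by auto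
  obtain G where G: "\<And>\<epsilon>. min_gradient_on \<mu> \<Omega> (\<lambda>x. f x + \<epsilon> * w x) (G \<epsilon>)" "\<And>\<epsilon>. G \<epsilon> \<in> Lp ?M 2"
    using grad_inner_onD(1)[OF inner] by blast
  have G0: "min_gradient_on \<mu> \<Omega> f (G 0)" using G(1)[of 0] by simp
  have Lm: "Lac \<in> borel_measurable ?M" using rn by (simp add: radon_nikodym_decomposition_def)
  have Li: "integrable (restrict_space \<mu> C) Lac" if "compact C" "C \<subseteq> \<Omega>" for C
  proof -
    have C: "C \<in> sets borel" by (rule borel_compact[OF that(1)])
    have "C \<in> rc_borel \<Omega>" using C that closure_closed[OF compact_imp_closed[OF that(1)]] by (simp add: rc_borel_def compactly_inside_def compact_imp_bounded)
    then show ?thesis using rn unfolding radon_nikodym_decomposition_def set_integrable_def rs_integrable[OF C] by simp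
  qed
  have weak: "\<exists>h. grad_inner_on \<mu> \<Omega> f \<phi> h \<and> integral\<^sup>L ?M h + (\<integral>x. \<phi> x * Lac x \<partial>?M) \<le> 0"
    if "\<phi> \<in> Lip0 \<Omega>" "\<And>x. 0 \<le> \<phi> x" for \<phi>
    by (rule weak_laplacian_test[OF \<Omega> quad G0 G(2) assms(8) rn assms(10) that])
  have fm: "f \<in> borel_measurable ?M" using f H1_approximation[OF \<Omega> f] Lp2_measurable[OF Lp2_tendstoD(2)] by blast
  have fmU: "(\<lambda>x. ereal (f x)) \<in> borel_measurable (restrict_space \<mu> A)" if "A \<subseteq> \<Omega>" for A
    using measurable_restrict_mono[OF fm that] by (rule borel_measurable_ereal)
  \<comment> \<open>The supremum over \<open>\<Omega>\<close> is the one over \<open>U\<close>, and it is finite.\<close>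
  have supU: "AE x in \<mu>. x \<in> U \<longrightarrow> ereal (f x) \<le> ess_sup_on \<mu> U f"
    and supR: "AE x in \<mu>. x \<in> \<Omega> - U \<longrightarrow> ereal (f x) \<le> ess_sup_on \<mu> (\<Omega> - U) f"
    unfolding ess_sup_on_def rs_AE[OF b(2), symmetric] rs_AE[OF b(3), symmetric] by (rule esssup_AE)+
  obtain s where s: "ess_sup_on \<mu> U f = ereal s"
  proof -
    have "f \<in> Linfty \<mu> (closure U)" using assms(7) clU by (auto simp: Linfty_loc_def)
    then obtain C where C: "AE x in \<mu>. x \<in> closure U \<longrightarrow> \<bar>f x\<bar> \<le> C" by (auto simp: Linfty_def)
    have "ess_sup_on \<mu> U f \<le> ereal C"
      unfolding ess_sup_on_def
    proof (rule esssup_I[OF fmU[OF U\<Omega>]])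
      show "AE x in restrict_space \<mu> U. ereal (f x) \<le> ereal C"
        unfolding rs_AE[OF b(2)] using C
      proof eventually_elim
        case (elim x)
        then show ?case using closure_subset[of U] by auto
      qed
    qed
    moreover have "- \<infinity> < ess_sup_on \<mu> U f" by (rule order.strict_trans1[OF _ assms(13)]) simp
    ultimately show ?thesis using that by (cases "ess_sup_on \<mu> U f") auto
  qed
  have sup\<Omega>: "ess_sup_on \<mu> \<Omega> f \<le> ereal s"
    unfolding ess_sup_on_def
  proof (rule esssup_I[OF fmU[OF order_refl]])
    show "AE x in ?M. ereal (f x) \<le> ereal s"
      unfolding rs_AE[OF b(1)] using supU supR
    proof eventually_elim
      case (elim x)
      show ?case
      proof
        assume x: "x \<in> \<Omega>"
        show "ereal (f x) \<le> ereal s"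
        proof (cases "x \<in> U")
          case True
          then show ?thesis using elim(1) s by simp
        next
          case False
          then have "ereal (f x) \<le> ess_sup_on \<mu> (\<Omega> - U) f" using elim(2) x by blast
          also have "\<dots> \<le> ereal s" using assms(13) s by simp
          finally show ?thesis .
        qed
      qed
    qed
  qed
  obtain M where M: "AE x in \<mu>. x \<in> \<Omega> \<longrightarrow> \<bar>w x\<bar> \<le> M" using assms(14) by (auto simp: Linfty_def)
  have wM: "AE x in \<mu>. x \<in> \<Omega> \<longrightarrow> w x \<le> M" using M by eventually_elim auto
  obtain r0 D where dbl: "0 < r0" "0 < D" "\<forall>x r. 0 < r \<and> r \<le> r0 \<longrightarrow> measure \<mu> (ball x (3 * r)) \<le> D * measure \<mu> (ball x r)"
    using locally_doubling[OF CD assms(2)] by blast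
  have dbl3: "measure \<mu> (ball x (3 * r)) \<le> D * measure \<mu> (ball x r)" if "0 < r" "r \<le> r0" for x r using dbl(3) that by blast
  have acL: "AE x in \<mu>. x \<in> \<Omega> \<longrightarrow> approx_continuity_point \<mu> Lac x"
    by (rule AE_approx_continuity_point[OF dbl(1,2) dbl3 \<Omega> Lm])
  have acI: "AE x in \<mu>. x \<in> \<Omega> \<longrightarrow> approx_continuity_point \<mu> innerfw x"
    by (rule AE_approx_continuity_point[OF dbl(1,2) dbl3 \<Omega> borel_measurable_integrable[OF grad_inner_onD(2)[OF inner]]])
  obtain \<eta> V where \<eta>: "\<eta> \<in> Lip0 \<Omega>" "\<And>x. 0 \<le> \<eta> x \<and> \<eta> x \<le> 1" and V: "open V" "closure U \<subseteq> V" "\<And>x. x \<in> V \<Longrightarrow> \<eta> x = 1"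
    using Lip0_cutoff[OF clU(1) \<Omega> clU(2)] by blast
  have UV: "U \<subseteq> V" using V(2) closure_subset[of U] by blast
  have "\<exists>x. x \<in> U \<and> approx_continuity_point \<mu> Lac x \<and> approx_continuity_point \<mu> innerfw x \<and>
      s - 1 / real j \<le> f x \<and> Lac x + innerfw x \<le> 1 / real j" if j: "j \<ge> 1" for j :: nat
  proof (rule ccontr)
    assume no: "\<not> ?thesis"
    have "max (ess_sup_on \<mu> (\<Omega> - U) f) (ereal (s - 1 / real j)) < ereal s" using assms(13) s j by simp
    \<comment> \<open>Above such a level \<open>c\<close> the function \<open>f\<close> is almost maximal, and the point lies in \<open>U\<close>.\<close>
    from ereal_dense2[OF this] obtain c where c: "ess_sup_on \<mu> (\<Omega> - U) f < ereal c" "s - 1 / real j < c" "c < s" by auto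
    have fc: "AE x in \<mu>. x \<in> \<Omega> \<longrightarrow> x \<notin> U \<longrightarrow> f x \<le> c"
      using supR
    proof eventually_elim
      case (elim x)
      show ?case
      proof (intro impI)
        assume "x \<in> \<Omega>" "x \<notin> U"
        then have "ereal (f x) \<le> ess_sup_on \<mu> (\<Omega> - U) f" using elim by blast
        also have "\<dots> < ereal c" by (rule c(1))
        finally show "f x \<le> c" by simp
      qed
    qed
    then have fcV: "AE x in \<mu>. x \<in> \<Omega> \<longrightarrow> x \<notin> V \<longrightarrow> f x \<le> c"
      by eventually_elim (use UV in blast)
    have pos: "AE x in \<mu>. x \<in> \<Omega> \<longrightarrow> c < f x \<longrightarrow> x \<in> U \<and> 0 < Lac x + innerfw x"
      using fc acL acI
    proof eventually_elim
      case (elim x)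
      show ?case
      proof (intro impI)
        assume x: "x \<in> \<Omega>" "c < f x"
        then have xU: "x \<in> U" using elim(1) by fastforce
        have "\<not> Lac x + innerfw x \<le> 1 / real j" using no elim(2,3) x xU c(2) by fastforce
        then have "1 / real j < Lac x + innerfw x" by simp
        moreover have "0 < 1 / real j" using j by simp
        ultimately have "0 < Lac x + innerfw x" by linarith
        then show "x \<in> U \<and> 0 < Lac x + innerfw x" using xU by blast
      qed
    qed
    let ?H = "\<lambda>x. \<eta> x * bump c (f x) * exp (w x) * (Lac x + innerfw x)"
    have Hi: "integrable ?M ?H" and H0: "(\<integral>x. ?H x \<partial>?M) \<le> 0"
      by (rule weak_maximum_inequality[OF \<Omega> quad f w inner G0 G(2) Lm Li weak \<eta> V(1,3) fcV wM], assumption+)+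
    have Hnn: "AE x in ?M. 0 \<le> ?H x"
      unfolding rs_AE[OF b(1)] using pos
    proof eventually_elim
      case (elim x)
      show ?case
      proof
        assume x: "x \<in> \<Omega>"
        show "0 \<le> ?H x"
        proof (cases "c < f x")
          case True
          then have "0 < Lac x + innerfw x" using elim x by blast
          then show ?thesis using \<eta>(2)[of x] bump_bounds(1)[of c "f x"] by (intro mult_nonneg_nonneg) auto
        next
          case False
          then have "bump c (f x) = 0" using bump_bounds(1,3)[of c "f x"] by linarith
          then show ?thesis by simp
        qed
      qed
    qed
    have "(\<integral>x. ?H x \<partial>?M) = 0" using H0 integral_nonneg_AE[OF Hnn] by linarith
    then have "AE x in ?M. ?H x = 0" using integral_nonneg_eq_0_iff_AE[OF Hi Hnn] by blast
    then have "AE x in \<mu>. x \<in> U \<longrightarrow> ereal (f x) \<le> ereal c"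
      using pos unfolding rs_AE[OF b(1)]
    proof eventually_elim
      case (elim x)
      show ?case
      proof
        assume xU: "x \<in> U"
        then have x\<Omega>: "x \<in> \<Omega>" using U\<Omega> by blast
        show "ereal (f x) \<le> ereal c"
        proof (rule ccontr)
          assume "\<not> ereal (f x) \<le> ereal c"
          then have "c < f x" by simp
          then have "0 < Lac x + innerfw x" "0 < bump c (f x)" "\<eta> x = 1"
            using elim(2) x\<Omega> xU UV V(3) bump_bounds(3)[of c "f x"] by blast+
          then have "0 < ?H x" by simp
          then show False using elim(1) x\<Omega> by simp
        qed
      qed
    qed
    then have "ess_sup_on \<mu> U f \<le> ereal c"
      unfolding ess_sup_on_def by (intro esssup_I[OF fmU[OF U\<Omega>]]) (simp only: rs_AE[OF b(2)])
    then show False using s c(3) by simp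
  qed
  then have "\<forall>j. \<exists>x. j \<ge> 1 \<longrightarrow> x \<in> U \<and> approx_continuity_point \<mu> Lac x \<and> approx_continuity_point \<mu> innerfw x \<and>
      s - 1 / real j \<le> f x \<and> Lac x + innerfw x \<le> 1 / real j" by blast
  then obtain x where x: "\<forall>j\<ge>1. x j \<in> U \<and> approx_continuity_point \<mu> Lac (x j) \<and> approx_continuity_point \<mu> innerfw (x j) \<and>
      s - 1 / real j \<le> f (x j) \<and> Lac (x j) + innerfw (x j) \<le> 1 / real j"
    by (rule exE[OF choice])
  have "ess_sup_on \<mu> \<Omega> f - ereal (1 / real j) \<le> ereal t" if "s - 1 / real j \<le> t" for j t
  proof -
    have "ess_sup_on \<mu> \<Omega> f - ereal (1 / real j) \<le> ereal s - ereal (1 / real j)" by (rule ereal_minus_mono[OF sup\<Omega> order_refl])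
    also have "\<dots> \<le> ereal t" using that by simp
    finally show ?thesis .
  qed
  with x show ?thesis by blast
qed

end
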